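(* Let $\pi:Y\to X$ be a smooth fiber bundle. The module $\mathfrak d\mathcal O^0_\infty$ of derivations of the $\mathbb R$-ring $\mathcal O^0_\infty$ is isomorphic to the $\mathcal O^0_\infty$-dual $(\mathcal O^1_\infty)^*=\mathrm{Hom}_{\mathcal O^0_\infty}(\mathcal O^1_\infty,\mathcal O^0_\infty)$ of the module $\mathcal O^1_\infty$ of one-forms.
   Context: Manifolds are smooth, real, finite-dimensional, Hausdorff, second-countable and connected. $J^rY$ is the $r$-order jet manifold of sections of $Y\to X$ ($J^0Y=Y$), and $\mathcal O^*_\infty$ is the direct limit of the graded differential algebras $\mathcal O^*_r$ of exterior forms on $J^rY$ with respect to pull-back monomorphisms, i.e. all exterior forms on finite order jet manifolds modulo pull-back identification. $\mathcal O^0_\infty$ is its ring of degree-zero elements (smooth real functions on finite order jet manifolds) and $\mathcal O^1_\infty$ its $\mathcal O^0_\infty$-module of one-forms. Derivations of the $\mathbb R$-ring $\mathcal O^0_\infty$ are $\mathbb R$-linear maps $\mathcal O^0_\infty\to\mathcal O^0_\infty$ obeying the Leibniz rule. *)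

theory Defs
  imports
    "HOL-Analysis.Analysis"
    "HOL-Algebra.Module"
    "HOL-Library.Multiset"
begin

section \<open>Smooth functions on open subsets of coordinate spaces\<close>

text \<open>
  The coordinate space with index set \<open>I\<close> (finite below) is the carrier \<open>I \<rightarrow>\<^sub>E UNIV\<close> of
  \<^term>\<open>powertop_real I\<close>; for \<open>I = {..<n}\<close> this is the space of real \<open>n\<close>-tuples. Arbitrary finite
  index sets are allowed so that the coordinates of products and of jet manifolds need not be
  renumbered.
\<close>

definition pderiv_at :: "'i \<Rightarrow> (('i \<Rightarrow> real) \<Rightarrow> real) \<Rightarrow> ('i \<Rightarrow> real) \<Rightarrow> real" where
  "pderiv_at i f x = deriv (\<lambda>t. f (x(i := t))) (x i)"

primrec iter_pderiv :: "'i list \<Rightarrow> (('i \<Rightarrow> real) \<Rightarrow> real) \<Rightarrow> ('i \<Rightarrow> real) \<Rightarrow> real" where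
  "iter_pderiv [] f = f"
| "iter_pderiv (i # is) f = pderiv_at i (iter_pderiv is f)"

definition smooth_on :: "'i set \<Rightarrow> ('i \<Rightarrow> real) set \<Rightarrow> (('i \<Rightarrow> real) \<Rightarrow> real) \<Rightarrow> bool" where
  "smooth_on I U f \<longleftrightarrow>
     (\<forall>is. set is \<subseteq> I \<longrightarrow>
        continuous_map (subtopology (powertop_real I) U) euclideanreal (iter_pderiv is f) \<and>
        (\<forall>x\<in>U. \<forall>i\<in>I. (\<lambda>t. iter_pderiv is f (x(i := t))) differentiable (at (x i))))"

text \<open>Only applied to smooth functions, for which the order of differentiation is irrelevant.\<close>

definition mset_pderiv :: "'i multiset \<Rightarrow> (('i \<Rightarrow> real) \<Rightarrow> real) \<Rightarrow> ('i \<Rightarrow> real) \<Rightarrow> real" where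
  "mset_pderiv \<Lambda> f = iter_pderiv (SOME is. mset is = \<Lambda>) f"


section \<open>Smooth manifolds\<close>

type_synonym ('a, 'i) chart = "'a set \<times> ('a \<Rightarrow> 'i \<Rightarrow> real)"

record ('a, 'i) manifold =
  mtop :: "'a topology"
  midx :: "'i set"
  matlas :: "('a, 'i) chart set"

abbreviation points :: "('a, 'i) manifold \<Rightarrow> 'a set" where
  "points M \<equiv> topspace (mtop M)"

definition second_countable_top :: "'a topology \<Rightarrow> bool" where
  "second_countable_top T \<longleftrightarrow>
     (\<exists>\<B>. countable \<B> \<and> (\<forall>B\<in>\<B>. openin T B) \<and>
          (\<forall>U x. openin T U \<and> x \<in> U \<longrightarrow> (\<exists>B\<in>\<B>. x \<in> B \<and> B \<subseteq> U)))"

definition top_chart :: "'a topology \<Rightarrow> 'i set \<Rightarrow> ('a, 'i) chart \<Rightarrow> bool" where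
  "top_chart T I = (\<lambda>(U, \<phi>).
     openin T U \<and> openin (powertop_real I) (\<phi> ` U) \<and>
     homeomorphic_map (subtopology T U) (subtopology (powertop_real I) (\<phi> ` U)) \<phi>)"

definition smooth_transition ::
  "'i set \<Rightarrow> 'j set \<Rightarrow> ('a, 'i) chart \<Rightarrow> ('a, 'j) chart \<Rightarrow> bool" where
  "smooth_transition I J = (\<lambda>(U, \<phi>) (U', \<phi>').
     \<forall>j\<in>J. smooth_on I (\<phi> ` (U \<inter> U')) (\<lambda>z. \<phi>' (inv_into U \<phi> z) j))"

definition smooth_manifold :: "('a, 'i) manifold \<Rightarrow> bool" where
  "smooth_manifold M \<longleftrightarrow>
     Hausdorff_space (mtop M) \<and> second_countable_top (mtop M) \<and> finite (midx M) \<and>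
     (\<forall>c\<in>matlas M. top_chart (mtop M) (midx M) c) \<and>
     (\<Union>c\<in>matlas M. fst c) = points M \<and>
     (\<forall>c\<in>matlas M. \<forall>c'\<in>matlas M. smooth_transition (midx M) (midx M) c c')"

text \<open>
  The charts of the maximal atlas, with coordinates labelled by an index set \<open>J\<close> that may differ
  from the one used by the given atlas.
\<close>

definition is_chart :: "('a, 'i) manifold \<Rightarrow> 'j set \<Rightarrow> ('a, 'j) chart \<Rightarrow> bool" where
  "is_chart M J c \<longleftrightarrow>
     top_chart (mtop M) J c \<and>
     (\<forall>c'\<in>matlas M. smooth_transition J (midx M) c c' \<and> smooth_transition (midx M) J c' c)"

definition smooth_map ::
  "('a, 'i) manifold \<Rightarrow> ('b, 'j) manifold \<Rightarrow> ('a \<Rightarrow> 'b) \<Rightarrow> bool" where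
  "smooth_map M N f \<longleftrightarrow>
     continuous_map (mtop M) (mtop N) f \<and>
     (\<forall>(U, \<phi>)\<in>matlas M. \<forall>(U', \<phi>')\<in>matlas N. \<forall>j\<in>midx N.
        smooth_on (midx M) (\<phi> ` {p \<in> U. f p \<in> U'}) (\<lambda>z. \<phi>' (f (inv_into U \<phi> z)) j))"

definition diffeomorphism ::
  "('a, 'i) manifold \<Rightarrow> ('b, 'j) manifold \<Rightarrow> ('a \<Rightarrow> 'b) \<Rightarrow> bool" where
  "diffeomorphism M N f \<longleftrightarrow>
     (\<exists>g. smooth_map M N f \<and> smooth_map N M g \<and>
          (\<forall>p\<in>points M. g (f p) = p) \<and> (\<forall>q\<in>points N. f (g q) = q))"

definition open_submanifold :: "('a, 'i) manifold \<Rightarrow> 'a set \<Rightarrow> ('a, 'i) manifold" where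
  "open_submanifold M W =
     \<lparr>mtop = subtopology (mtop M) W, midx = midx M,
      matlas = {(U \<inter> W, \<phi>) | U \<phi>. (U, \<phi>) \<in> matlas M}\<rparr>"

definition prod_manifold ::
  "('a, 'i) manifold \<Rightarrow> ('b, 'j) manifold \<Rightarrow> ('a \<times> 'b, 'i + 'j) manifold" where
  "prod_manifold M N =
     \<lparr>mtop = prod_topology (mtop M) (mtop N), midx = midx M <+> midx N,
      matlas = {(U \<times> U', \<lambda>(p, q). case_sum (\<phi> p) (\<phi>' q)) | U \<phi> U' \<phi>'.
                  (U, \<phi>) \<in> matlas M \<and> (U', \<phi>') \<in> matlas N}\<rparr>"


section \<open>Smooth functions and one-forms on a manifold\<close>

text \<open>
  Functions on a manifold are extensional, so that equality of elements of the rings and modules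
  below is equality on the manifold.
\<close>

definition smooth_functions :: "('a, 'i) manifold \<Rightarrow> ('a \<Rightarrow> real) set" where
  "smooth_functions M =
     {f \<in> extensional (points M). \<forall>(U, \<phi>)\<in>matlas M.
        smooth_on (midx M) (\<phi> ` U) (\<lambda>z. f (inv_into U \<phi> z))}"

text \<open>Tangent vectors are derivations at a point of the algebra of smooth functions.\<close>

definition tangent_space :: "('a, 'i) manifold \<Rightarrow> 'a \<Rightarrow> (('a \<Rightarrow> real) \<Rightarrow> real) set" where
  "tangent_space M p =
     {v \<in> extensional (smooth_functions M).
        (\<forall>f\<in>smooth_functions M. \<forall>g\<in>smooth_functions M.
           v (\<lambda>q\<in>points M. f q + g q) = v f + v g \<and>
           v (\<lambda>q\<in>points M. f q * g q) = f p * v g + g p * v f) \<and>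
        (\<forall>c. \<forall>f\<in>smooth_functions M. v (\<lambda>q\<in>points M. c * f q) = c * v f)}"

definition cotangent_space ::
  "('a, 'i) manifold \<Rightarrow> 'a \<Rightarrow> ((('a \<Rightarrow> real) \<Rightarrow> real) \<Rightarrow> real) set" where
  "cotangent_space M p =
     {\<alpha> \<in> extensional (tangent_space M p).
        (\<forall>u\<in>tangent_space M p. \<forall>v\<in>tangent_space M p.
           \<alpha> (\<lambda>f\<in>smooth_functions M. u f + v f) = \<alpha> u + \<alpha> v) \<and>
        (\<forall>c. \<forall>v\<in>tangent_space M p. \<alpha> (\<lambda>f\<in>smooth_functions M. c * v f) = c * \<alpha> v)}"

definition coord_vector ::
  "('a, 'i) manifold \<Rightarrow> ('a, 'i) chart \<Rightarrow> 'i \<Rightarrow> 'a \<Rightarrow> ('a \<Rightarrow> real) \<Rightarrow> real" where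
  "coord_vector M = (\<lambda>(U, \<phi>) i p. \<lambda>f\<in>smooth_functions M.
     pderiv_at i (\<lambda>z. f (inv_into U \<phi> z)) (\<phi> p))"

definition one_forms ::
  "('a, 'i) manifold \<Rightarrow> ('a \<Rightarrow> (('a \<Rightarrow> real) \<Rightarrow> real) \<Rightarrow> real) set" where
  "one_forms M =
     {\<omega> \<in> Pi\<^sub>E (points M) (cotangent_space M). \<forall>(U, \<phi>)\<in>matlas M. \<forall>i\<in>midx M.
        smooth_on (midx M) (\<phi> ` U)
          (\<lambda>z. let p = inv_into U \<phi> z in \<omega> p (coord_vector M (U, \<phi>) i p))}"

definition pullback_fun ::
  "('a, 'i) manifold \<Rightarrow> ('a \<Rightarrow> 'b) \<Rightarrow> ('b \<Rightarrow> real) \<Rightarrow> 'a \<Rightarrow> real" where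
  "pullback_fun M F f = (\<lambda>p\<in>points M. f (F p))"

definition pushforward ::
  "('a, 'i) manifold \<Rightarrow> ('b, 'j) manifold \<Rightarrow> ('a \<Rightarrow> 'b) \<Rightarrow>
   (('a \<Rightarrow> real) \<Rightarrow> real) \<Rightarrow> ('b \<Rightarrow> real) \<Rightarrow> real" where
  "pushforward M N F v = (\<lambda>g\<in>smooth_functions N. v (pullback_fun M F g))"

definition pullback_form ::
  "('a, 'i) manifold \<Rightarrow> ('b, 'j) manifold \<Rightarrow> ('a \<Rightarrow> 'b) \<Rightarrow>
   ('b \<Rightarrow> (('b \<Rightarrow> real) \<Rightarrow> real) \<Rightarrow> real) \<Rightarrow> 'a \<Rightarrow> (('a \<Rightarrow> real) \<Rightarrow> real) \<Rightarrow> real" where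
  "pullback_form M N F \<omega> =
     (\<lambda>p\<in>points M. \<lambda>v\<in>tangent_space M p. \<omega> (F p) (pushforward M N F v))"


section \<open>Smooth fiber bundles\<close>

record ('x, 'i, 'y, 'j, 'v, 'k) fbundle =
  base :: "('x, 'i) manifold"
  total :: "('y, 'j) manifold"
  fiber :: "('v, 'k) manifold"
  proj :: "'y \<Rightarrow> 'x"

text \<open>The typical fiber is not required to be connected.\<close>

definition smooth_fiber_bundle :: "('x, 'i, 'y, 'j, 'v, 'k) fbundle \<Rightarrow> bool" where
  "smooth_fiber_bundle B \<longleftrightarrow>
     smooth_manifold (base B) \<and> connected_space (mtop (base B)) \<and>
     smooth_manifold (total B) \<and> connected_space (mtop (total B)) \<and>
     smooth_manifold (fiber B) \<and>
     smooth_map (total B) (base B) (proj B) \<and>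
     proj B ` points (total B) = points (base B) \<and>
     (\<forall>x\<in>points (base B). \<exists>W \<psi>. openin (mtop (base B)) W \<and> x \<in> W \<and>
        diffeomorphism (open_submanifold (total B) {y \<in> points (total B). proj B y \<in> W})
          (prod_manifold (open_submanifold (base B) W) (fiber B)) \<psi> \<and>
        (\<forall>y\<in>points (total B). proj B y \<in> W \<longrightarrow> fst (\<psi> y) = proj B y))"

text \<open>
  A fibered chart consists of an open \<open>U\<close>, base coordinates \<open>\<phi>\<close> on \<open>\<pi>(U)\<close> and fiber coordinates
  \<open>\<eta>\<close> on \<open>U\<close> such that \<open>(\<phi> \<circ> \<pi>, \<eta>)\<close> is a chart of the total space.
\<close>

definition fibered_chart ::
  "('x, 'i, 'y, 'j, 'v, 'k) fbundle \<Rightarrow> 'y set \<Rightarrow> ('x \<Rightarrow> 'i \<Rightarrow> real) \<Rightarrow> ('y \<Rightarrow> 'k \<Rightarrow> real) \<Rightarrow> bool"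
  where
  "fibered_chart B U \<phi> \<eta> \<longleftrightarrow>
     is_chart (base B) (midx (base B)) (proj B ` U, \<phi>) \<and>
     is_chart (total B) (midx (base B) <+> midx (fiber B))
       (U, \<lambda>y. case_sum (\<phi> (proj B y)) (\<eta> y))"


section \<open>Jet manifolds\<close>

text \<open>
  A local section near \<open>x\<close> is represented by a total function of which only the restriction to a
  neighborhood of \<open>x\<close> matters.
\<close>

definition local_section :: "('x, 'i, 'y, 'j, 'v, 'k) fbundle \<Rightarrow> 'x \<Rightarrow> ('x \<Rightarrow> 'y) \<Rightarrow> bool" where
  "local_section B x s \<longleftrightarrow>
     (\<exists>W. openin (mtop (base B)) W \<and> x \<in> W \<and>
        smooth_map (open_submanifold (base B) W) (total B) s \<and> (\<forall>w\<in>W. proj B (s w) = w))"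

definition section_coord ::
  "('x, 'i, 'y, 'j, 'v, 'k) fbundle \<Rightarrow> 'y set \<Rightarrow> ('x \<Rightarrow> 'i \<Rightarrow> real) \<Rightarrow> ('y \<Rightarrow> 'k \<Rightarrow> real) \<Rightarrow>
   ('x \<Rightarrow> 'y) \<Rightarrow> 'k \<Rightarrow> ('i \<Rightarrow> real) \<Rightarrow> real" where
  "section_coord B U \<phi> \<eta> s k z = \<eta> (s (inv_into (proj B ` U) \<phi> z)) k"

text \<open>Equality of the Taylor coefficients up to order \<open>r\<close> at \<open>x\<close> in fibered coordinates.\<close>

definition same_jet ::
  "('x, 'i, 'y, 'j, 'v, 'k) fbundle \<Rightarrow> nat \<Rightarrow> 'x \<Rightarrow> ('x \<Rightarrow> 'y) \<Rightarrow> ('x \<Rightarrow> 'y) \<Rightarrow> bool" where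
  "same_jet B r x s s' \<longleftrightarrow>
     s x = s' x \<and>
     (\<forall>U \<phi> \<eta>. fibered_chart B U \<phi> \<eta> \<and> s x \<in> U \<longrightarrow>
        (\<forall>k\<in>midx (fiber B). \<forall>is. set is \<subseteq> midx (base B) \<and> length is \<le> r \<longrightarrow>
           iter_pderiv is (section_coord B U \<phi> \<eta> s k) (\<phi> x) =
           iter_pderiv is (section_coord B U \<phi> \<eta> s' k) (\<phi> x)))"

type_synonym ('x, 'y) jet = "'x \<times> ('x \<Rightarrow> 'y) set"

definition jet_of ::
  "('x, 'i, 'y, 'j, 'v, 'k) fbundle \<Rightarrow> nat \<Rightarrow> 'x \<Rightarrow> ('x \<Rightarrow> 'y) \<Rightarrow> ('x, 'y) jet" where
  "jet_of B r x s = (x, {s'. local_section B x s' \<and> same_jet B r x s s'})"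

definition jets :: "('x, 'i, 'y, 'j, 'v, 'k) fbundle \<Rightarrow> nat \<Rightarrow> ('x, 'y) jet set" where
  "jets B r = {jet_of B r x s | x s. x \<in> points (base B) \<and> local_section B x s}"

definition jet_rep :: "('x, 'y) jet \<Rightarrow> 'x \<Rightarrow> 'y" where
  "jet_rep j = (SOME s. s \<in> snd j)"

text \<open>
  The coordinates on the jet manifold of order \<open>r\<close>: base coordinates \<open>x\<^sup>i\<close>, and
  \<open>y\<^sup>k\<^sub>\<Lambda>\<close> for symmetric multi-indices \<open>\<Lambda>\<close> with at most \<open>r\<close> entries.
\<close>

definition jet_fiber_idx :: "('x, 'i, 'y, 'j, 'v, 'k) fbundle \<Rightarrow> nat \<Rightarrow> ('k \<times> 'i multiset) set"
  where
  "jet_fiber_idx B r =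
     midx (fiber B) \<times> {\<Lambda>. set_mset \<Lambda> \<subseteq> midx (base B) \<and> size \<Lambda> \<le> r}"

definition jet_chart ::
  "('x, 'i, 'y, 'j, 'v, 'k) fbundle \<Rightarrow> nat \<Rightarrow> 'y set \<Rightarrow> ('x \<Rightarrow> 'i \<Rightarrow> real) \<Rightarrow> ('y \<Rightarrow> 'k \<Rightarrow> real) \<Rightarrow>
   (('x, 'y) jet, 'i + 'k \<times> 'i multiset) chart" where
  "jet_chart B r U \<phi> \<eta> =
     ({j \<in> jets B r. jet_rep j (fst j) \<in> U},
      \<lambda>j. case_sum (\<phi> (fst j))
            (\<lambda>(k, \<Lambda>)\<in>jet_fiber_idx B r.
               mset_pderiv \<Lambda> (section_coord B U \<phi> \<eta> (jet_rep j) k) (\<phi> (fst j))))"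

definition jet_atlas ::
  "('x, 'i, 'y, 'j, 'v, 'k) fbundle \<Rightarrow> nat \<Rightarrow> (('x, 'y) jet, 'i + 'k \<times> 'i multiset) chart set" where
  "jet_atlas B r = {jet_chart B r U \<phi> \<eta> | U \<phi> \<eta>. fibered_chart B U \<phi> \<eta>}"

text \<open>
  The topology is generated by the preimages of open sets under the jet charts. The manifold of
  order \<open>0\<close> is the total space with each point \<open>y\<close> replaced by the pair of \<open>\<pi>(y)\<close> and the set of
  local sections through \<open>y\<close>.
\<close>

definition jet_manifold ::
  "('x, 'i, 'y, 'j, 'v, 'k) fbundle \<Rightarrow> nat \<Rightarrow> (('x, 'y) jet, 'i + 'k \<times> 'i multiset) manifold" where
  "jet_manifold B r =
     (let J = midx (base B) <+> jet_fiber_idx B r in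
      \<lparr>mtop = topology_generated_by
                {{j \<in> U. \<phi> j \<in> S} | U \<phi> S. (U, \<phi>) \<in> jet_atlas B r \<and> openin (powertop_real J) S},
       midx = J,
       matlas = jet_atlas B r\<rparr>)"

text \<open>The projection from order \<open>t\<close> to order \<open>r\<close>, for \<open>r \<le> t\<close>.\<close>

definition jet_proj ::
  "('x, 'i, 'y, 'j, 'v, 'k) fbundle \<Rightarrow> nat \<Rightarrow> nat \<Rightarrow> ('x, 'y) jet \<Rightarrow> ('x, 'y) jet" where
  "jet_proj B t r j = jet_of B r (fst j) (jet_rep j)"


section \<open>Direct limits of sequences\<close>

text \<open>
  \<open>A r\<close> is the \<open>r\<close>-th set of the system and \<open>\<iota> r t\<close> its transition map from \<open>A r\<close> to \<open>A t\<close>,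
  for \<open>r \<le> t\<close>.
\<close>

definition dl_class ::
  "(nat \<Rightarrow> 'a set) \<Rightarrow> (nat \<Rightarrow> nat \<Rightarrow> 'a \<Rightarrow> 'a) \<Rightarrow> nat \<Rightarrow> 'a \<Rightarrow> (nat \<times> 'a) set" where
  "dl_class A \<iota> r a = {(s, b). b \<in> A s \<and> (\<exists>t. r \<le> t \<and> s \<le> t \<and> \<iota> r t a = \<iota> s t b)}"

definition dl_carrier ::
  "(nat \<Rightarrow> 'a set) \<Rightarrow> (nat \<Rightarrow> nat \<Rightarrow> 'a \<Rightarrow> 'a) \<Rightarrow> (nat \<times> 'a) set set" where
  "dl_carrier A \<iota> = {dl_class A \<iota> r a | r a. a \<in> A r}"

text \<open>
  The operation on the limits of \<open>(A, \<iota>)\<close> and \<open>(C, \<kappa>)\<close> with values in the limit of \<open>(C, \<kappa>)\<close>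
  induced by operations \<open>f t\<close> from \<open>A t\<close> and \<open>C t\<close> to \<open>C t\<close>.
\<close>

definition dl_op ::
  "(nat \<Rightarrow> nat \<Rightarrow> 'a \<Rightarrow> 'a) \<Rightarrow> (nat \<Rightarrow> 'c set) \<Rightarrow> (nat \<Rightarrow> nat \<Rightarrow> 'c \<Rightarrow> 'c) \<Rightarrow>
   (nat \<Rightarrow> 'a \<Rightarrow> 'c \<Rightarrow> 'c) \<Rightarrow> (nat \<times> 'a) set \<Rightarrow> (nat \<times> 'c) set \<Rightarrow> (nat \<times> 'c) set" where
  "dl_op \<iota> C \<kappa> f P Q =
     (\<Union>(r, a)\<in>P. \<Union>(s, b)\<in>Q.
        let t = max r s in dl_class C \<kappa> t (f t (\<iota> r t a) (\<kappa> s t b)))"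


section \<open>The ring of smooth functions and the module of one-forms of finite jet order\<close>

type_synonym ('x, 'y) jet_fun = "('x, 'y) jet \<Rightarrow> real"
type_synonym ('x, 'y) jet_form = "('x, 'y) jet \<Rightarrow> (('x, 'y) jet_fun \<Rightarrow> real) \<Rightarrow> real"

definition fun_pull ::
  "('x, 'i, 'y, 'j, 'v, 'k) fbundle \<Rightarrow> nat \<Rightarrow> nat \<Rightarrow> ('x, 'y) jet_fun \<Rightarrow> ('x, 'y) jet_fun" where
  "fun_pull B r t = pullback_fun (jet_manifold B t) (jet_proj B t r)"

definition form_pull ::
  "('x, 'i, 'y, 'j, 'v, 'k) fbundle \<Rightarrow> nat \<Rightarrow> nat \<Rightarrow> ('x, 'y) jet_form \<Rightarrow> ('x, 'y) jet_form" where
  "form_pull B r t = pullback_form (jet_manifold B t) (jet_manifold B r) (jet_proj B t r)"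

abbreviation jet_funs :: "('x, 'i, 'y, 'j, 'v, 'k) fbundle \<Rightarrow> nat \<Rightarrow> ('x, 'y) jet_fun set" where
  "jet_funs B r \<equiv> smooth_functions (jet_manifold B r)"

abbreviation jet_forms :: "('x, 'i, 'y, 'j, 'v, 'k) fbundle \<Rightarrow> nat \<Rightarrow> ('x, 'y) jet_form set" where
  "jet_forms B r \<equiv> one_forms (jet_manifold B r)"

text \<open>The structure map of the real algebra of functions of finite jet order.\<close>

definition O0_const ::
  "('x, 'i, 'y, 'j, 'v, 'k) fbundle \<Rightarrow> real \<Rightarrow> (nat \<times> ('x, 'y) jet_fun) set" where
  "O0_const B c = dl_class (jet_funs B) (fun_pull B) 0 (\<lambda>p\<in>points (jet_manifold B 0). c)"

definition O0 :: "('x, 'i, 'y, 'j, 'v, 'k) fbundle \<Rightarrow> (nat \<times> ('x, 'y) jet_fun) set ring" where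
  "O0 B =
     \<lparr>carrier = dl_carrier (jet_funs B) (fun_pull B),
      mult = dl_op (fun_pull B) (jet_funs B) (fun_pull B)
               (\<lambda>t f g. \<lambda>p\<in>points (jet_manifold B t). f p * g p),
      one = O0_const B 1,
      zero = O0_const B 0,
      add = dl_op (fun_pull B) (jet_funs B) (fun_pull B)
              (\<lambda>t f g. \<lambda>p\<in>points (jet_manifold B t). f p + g p)\<rparr>"

text \<open>In module records the ring fields \<open>mult\<close> and \<open>one\<close> carry no meaning.\<close>

definition O1 ::
  "('x, 'i, 'y, 'j, 'v, 'k) fbundle \<Rightarrow>
   ((nat \<times> ('x, 'y) jet_fun) set, (nat \<times> ('x, 'y) jet_form) set) module" where
  "O1 B =
     \<lparr>carrier = dl_carrier (jet_forms B) (form_pull B),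
      mult = undefined,
      one = undefined,
      zero = dl_class (jet_forms B) (form_pull B) 0
               (\<lambda>p\<in>points (jet_manifold B 0). \<lambda>v\<in>tangent_space (jet_manifold B 0) p. 0),
      add = dl_op (form_pull B) (jet_forms B) (form_pull B)
              (\<lambda>t \<omega> \<sigma>. \<lambda>p\<in>points (jet_manifold B t). \<lambda>v\<in>tangent_space (jet_manifold B t) p.
                 \<omega> p v + \<sigma> p v),
      smult = dl_op (fun_pull B) (jet_forms B) (form_pull B)
              (\<lambda>t f \<omega>. \<lambda>p\<in>points (jet_manifold B t). \<lambda>v\<in>tangent_space (jet_manifold B t) p.
                 f p * \<omega> p v)\<rparr>"


section \<open>Derivations, duals and isomorphisms of modules\<close>

text \<open>Derivations of \<open>R\<close> as a real algebra with structure map \<open>c\<close>.\<close>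

definition derivation_module ::
  "('a, 'm) ring_scheme \<Rightarrow> (real \<Rightarrow> 'a) \<Rightarrow> ('a, 'a \<Rightarrow> 'a) module" where
  "derivation_module R c =
     \<lparr>carrier = {D \<in> carrier R \<rightarrow>\<^sub>E carrier R.
        (\<forall>f\<in>carrier R. \<forall>g\<in>carrier R.
           D (f \<oplus>\<^bsub>R\<^esub> g) = D f \<oplus>\<^bsub>R\<^esub> D g \<and>
           D (f \<otimes>\<^bsub>R\<^esub> g) = (D f \<otimes>\<^bsub>R\<^esub> g) \<oplus>\<^bsub>R\<^esub> (f \<otimes>\<^bsub>R\<^esub> D g)) \<and>
        (\<forall>a. \<forall>f\<in>carrier R. D (c a \<otimes>\<^bsub>R\<^esub> f) = c a \<otimes>\<^bsub>R\<^esub> D f)},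
      mult = undefined,
      one = undefined,
      zero = (\<lambda>f\<in>carrier R. \<zero>\<^bsub>R\<^esub>),
      add = (\<lambda>D E. \<lambda>f\<in>carrier R. D f \<oplus>\<^bsub>R\<^esub> E f),
      smult = (\<lambda>h D. \<lambda>f\<in>carrier R. h \<otimes>\<^bsub>R\<^esub> D f)\<rparr>"

definition dual_module ::
  "('a, 'm) ring_scheme \<Rightarrow> ('a, 'b, 'n) module_scheme \<Rightarrow> ('a, 'b \<Rightarrow> 'a) module" where
  "dual_module R M =
     \<lparr>carrier = {\<phi> \<in> carrier M \<rightarrow>\<^sub>E carrier R.
        (\<forall>u\<in>carrier M. \<forall>v\<in>carrier M. \<phi> (u \<oplus>\<^bsub>M\<^esub> v) = \<phi> u \<oplus>\<^bsub>R\<^esub> \<phi> v) \<and>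
        (\<forall>h\<in>carrier R. \<forall>u\<in>carrier M. \<phi> (h \<odot>\<^bsub>M\<^esub> u) = h \<otimes>\<^bsub>R\<^esub> \<phi> u)},
      mult = undefined,
      one = undefined,
      zero = (\<lambda>u\<in>carrier M. \<zero>\<^bsub>R\<^esub>),
      add = (\<lambda>\<phi> \<psi>. \<lambda>u\<in>carrier M. \<phi> u \<oplus>\<^bsub>R\<^esub> \<psi> u),
      smult = (\<lambda>h \<phi>. \<lambda>u\<in>carrier M. h \<otimes>\<^bsub>R\<^esub> \<phi> u)\<rparr>"

definition module_isomorphic ::
  "('a, 'm) ring_scheme \<Rightarrow> ('a, 'b, 'n) module_scheme \<Rightarrow> ('a, 'c, 'l) module_scheme \<Rightarrow> bool" where
  "module_isomorphic R M N \<longleftrightarrow>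
     Module.module R M \<and> Module.module R N \<and>
     (\<exists>h. bij_betw h (carrier M) (carrier N) \<and>
        (\<forall>u\<in>carrier M. \<forall>v\<in>carrier M. h (u \<oplus>\<^bsub>M\<^esub> v) = h u \<oplus>\<^bsub>N\<^esub> h v) \<and>
        (\<forall>a\<in>carrier R. \<forall>u\<in>carrier M. h (a \<odot>\<^bsub>M\<^esub> u) = a \<odot>\<^bsub>N\<^esub> h u))"

end

theory Submission
  imports Defs
begin

text \<open>
  Write \<open>J\<^sup>r\<close> for the jet manifold of order \<open>r\<close>. The germ \<open>\<sigma>\<close> of a local section has an \<open>r\<close>-jet
  for every \<open>r\<close>, so a function of finite jet order has a value at \<open>\<sigma>\<close>, and these values determine it
  (\<open>O0_eqI\<close>). Tangent vectors are derivations at a point. Therefore a derivation \<open>D\<close> of the ring of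
  functions of finite jet order yields, for each germ \<open>\<sigma>\<close> and each \<open>r\<close>, the tangent vector
  \<open>f \<mapsto> (D f)(\<sigma>)\<close> of \<open>J\<^sup>r\<close> at the \<open>r\<close>-jet of \<open>\<sigma>\<close> (\<open>der_vec_tangent\<close>), and the projections
  between jet manifolds respect these vectors (\<open>der_vec_push\<close>). Evaluating a one-form on them gives a
  function of \<open>\<sigma>\<close> that is linear in the form: the contraction of the form with \<open>D\<close>.

  The point of the proof is that this contraction again has finite jet order. Near a point of \<open>J\<^sup>r\<close>
  every one-form is a combination of the differentials of finitely many global functions \<open>x\<^sub>i\<close>
  (\<open>coframe\<close>), and each \<open>D x\<^sub>i\<close> has finite order, so the order is locally bounded. If it were not
  bounded on all of \<open>J\<^sup>r\<close>, then functions witnessing larger and larger orders could be cut off by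
  bump functions with disjoint supports along a sequence that leaves every compact set, and added up to
  a single smooth function \<open>f\<close> on \<open>J\<^sup>r\<close>. Since \<open>D\<close> only sees germs, \<open>D f\<close> would have
  infinite order, which is absurd (\<open>locally_bounded_imp_bounded\<close>, \<open>has_order_uniform\<close>,
  \<open>form_value_function\<close>).

  Conversely a linear form \<open>\<Phi>\<close> on one-forms gives the derivation \<open>\<Phi> \<circ> d\<close>. Contraction of \<open>df\<close> with
  \<open>D\<close> is \<open>D f\<close> (\<open>restrict_d_contraction\<close>). For the other composition let \<open>\<rho>\<close> be a bump function
  at \<open>p\<close>: the identity \<open>\<rho> \<omega> = \<Sum>\<^sub>i \<rho> a\<^sub>i dx\<^sub>i\<close> holds on all of \<open>J\<^sup>r\<close>, and linearity together with
  \<open>\<rho>(p) = 1\<close> shows that \<open>\<Phi> \<omega>\<close> at a germ over \<open>p\<close> is determined by the \<open>\<Phi>(dx\<^sub>i)\<close>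
  (\<open>contraction_restrict_d\<close>).

  Two geometric facts support the argument. The first is that \<open>\<partial>\<^sub>1, \<dots>, \<partial>\<^sub>n\<close> span the derivations at a
  point, by Hadamard's lemma (\<open>tangent_expansion\<close>); it yields \<open>coframe\<close>. The second is that the
  \<open>J\<^sup>r\<close> are Hausdorff second countable manifolds (\<open>jet_manifold_smooth\<close>). Every vector of jet
  coordinates over a chart is the jet of a section that is polynomial in this chart (\<open>jet_realize\<close>), and
  the new coordinates of a jet are the derivatives of the transformed polynomial, which depends smoothly
  on its coefficients and on the point together (\<open>jet_transition_smooth\<close>).
\<close>

section \<open>Calculus on coordinate spaces\<close>

subsection \<open>Topology\<close>

abbreviation coord_space :: "'i set \<Rightarrow> ('i \<Rightarrow> real) set" where
  "coord_space I \<equiv> I \<rightarrow>\<^sub>E UNIV"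

text \<open>
  On the function type the product topology is the library topology, so continuity with respect
  to \<open>powertop_real I\<close> becomes \<open>continuous_on\<close>.
\<close>

lemma powertop_real_eq: "powertop_real I = top_of_set (coord_space I)"
proof -
  have 1: "continuous_map (powertop_real I) (top_of_set (coord_space I)) id"
    unfolding continuous_map_in_subtopology
  proof
    have "continuous_map (powertop_real I) (euclideanreal) (\<lambda>x. x i)" for i
    proof (cases "i \<in> I")
      case True
      then show ?thesis by (rule continuous_map_product_projection)
    next
      case False
      have "continuous_map (powertop_real I) euclideanreal (\<lambda>x. undefined)" by simp
      then show ?thesis
        by (rule continuous_map_eq) (use False in \<open>auto simp: PiE_iff extensional_def\<close>)
    qed
    then show "continuous_map (powertop_real I) euclidean id"
      by (subst euclidean_product_topology[symmetric]) (auto simp: continuous_map_componentwise_UNIV)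
  qed auto
  have 2: "continuous_map (top_of_set (coord_space I)) (powertop_real I) id"
    by (auto simp: continuous_map_componentwise PiE_iff continuous_map_iff_continuous
        intro!: continuous_on_subset[OF continuous_on_product_coordinates])
  have ts: "topspace (powertop_real I) = topspace (top_of_set (coord_space I))" by simp
  show ?thesis
    using topology_finer_continuous_id[OF ts] topology_finer_continuous_id[OF ts[symmetric]] 1 2
    by (auto simp: topology_eq)
qed

lemma coord_openin_subset: "openin (powertop_real I) U \<Longrightarrow> U \<subseteq> coord_space I"
  using openin_subset by fastforce

lemma subtopology_powertop: "U \<subseteq> coord_space I \<Longrightarrow> subtopology (powertop_real I) U = top_of_set U"
  unfolding powertop_real_eq by (simp add: subtopology_subtopology Int_absorb1)

lemma coord_upd: "x \<in> coord_space I \<Longrightarrow> i \<in> I \<Longrightarrow> x(i := t) \<in> coord_space I"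
  by (auto simp: PiE_iff extensional_def)

lemma coord_box:
  assumes "openin (powertop_real I) U" "x \<in> U" "finite I"
  obtains e where "e > 0" "\<And>y. y \<in> coord_space I \<Longrightarrow> (\<And>i. i \<in> I \<Longrightarrow> \<bar>y i - x i\<bar> < e) \<Longrightarrow> y \<in> U"
proof -
  from assms obtain W where W: "\<And>i. i \<in> I \<Longrightarrow> open (W i)" "x \<in> Pi\<^sub>E I W" "Pi\<^sub>E I W \<subseteq> U"
    unfolding openin_product_topology_alt by (metis open_openin)
  have "\<forall>i\<in>I. \<exists>e>0. \<forall>t. \<bar>t - x i\<bar> < e \<longrightarrow> t \<in> W i"
    using W by (auto simp: open_dist PiE_iff dist_real_def)
  then obtain e where e: "\<And>i. i \<in> I \<Longrightarrow> e i > 0" "\<And>i t. i \<in> I \<Longrightarrow> \<bar>t - x i\<bar> < e i \<Longrightarrow> t \<in> W i"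
    by metis
  define d where "d = Min (insert 1 (e ` I))"
  have "d > 0" unfolding d_def using e(1) \<open>finite I\<close> by (subst Min_gr_iff) auto
  moreover have de: "i \<in> I \<Longrightarrow> d \<le> e i" for i unfolding d_def using \<open>finite I\<close> by auto
  ultimately show ?thesis
  proof (intro that[of d])
    fix y assume y: "y \<in> coord_space I" "\<And>i. i \<in> I \<Longrightarrow> \<bar>y i - x i\<bar> < d"
    have "y i \<in> W i" if "i \<in> I" for i
      using e(2)[OF that] y(2)[OF that] de[OF that] by simp
    then have "y \<in> Pi\<^sub>E I W" using y(1) by (auto simp: PiE_iff)
    then show "y \<in> U" using W(3) by blast
  qed
qed

lemma coord_open_box:
  assumes "finite I"
  shows "openin (powertop_real I) {y \<in> coord_space I. \<forall>i\<in>I. \<bar>y i - x i\<bar> < e}"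
proof -
  have "{y \<in> coord_space I. \<forall>i\<in>I. \<bar>y i - x i\<bar> < e} = Pi\<^sub>E I (\<lambda>i. {x i - e <..< x i + e})"
    by (auto simp: PiE_def Pi_iff abs_diff_less_iff)
  then show ?thesis using assms by (simp add: openin_PiE_gen)
qed

lemma coord_upd_eventually:
  assumes "openin (powertop_real I) U" "x \<in> U" "i \<in> I"
  shows "eventually (\<lambda>t. x(i := t) \<in> U) (nhds (x i))"
proof -
  obtain V where V: "open V" "U = coord_space I \<inter> V"
    using assms unfolding powertop_real_eq by (auto simp: openin_open)
  have "continuous_on UNIV (\<lambda>t. x(i := t))"
  proof (rule continuous_on_coordinatewise_then_product)
    fix k show "continuous_on UNIV (\<lambda>t. (x(i := t)) k)" by (cases "k = i") auto
  qed
  then have "open ((\<lambda>t. x(i := t)) -` V)" using V(1) by (simp add: continuous_on_open_vimage)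
  moreover have "x i \<in> (\<lambda>t. x(i := t)) -` V" using V assms by auto
  ultimately have "eventually (\<lambda>t. t \<in> (\<lambda>t. x(i := t)) -` V) (nhds (x i))"
    by (rule eventually_nhds_in_open)
  then show ?thesis
    by (rule eventually_mono) (use V assms in \<open>auto intro: coord_upd\<close>)
qed

subsection \<open>Partial derivatives\<close>

definition pdiff :: "'i \<Rightarrow> (('i \<Rightarrow> real) \<Rightarrow> real) \<Rightarrow> ('i \<Rightarrow> real) \<Rightarrow> bool" where
  "pdiff i f x \<longleftrightarrow> (\<lambda>t. f (x(i := t))) differentiable (at (x i))"

lemma pdiffD: "pdiff i f x \<Longrightarrow> ((\<lambda>t. f (x(i := t))) has_real_derivative pderiv_at i f x) (at (x i))"
  unfolding pdiff_def pderiv_at_def by (metis DERIV_imp_deriv real_differentiableE)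

lemma pdiffI:
  assumes "((\<lambda>t. f (x(i := t))) has_real_derivative D) (at (x i))"
  shows "pdiff i f x" "pderiv_at i f x = D"
  using assms unfolding pdiff_def pderiv_at_def
  by (auto simp: DERIV_imp_deriv real_differentiable_def)

lemma pdiff_upd:
  assumes "pdiff i f (x(i := t))"
  shows "((\<lambda>t. f (x(i := t))) has_real_derivative pderiv_at i f (x(i := t))) (at t)"
  using pdiffD[OF assms] by simp

context
  fixes I :: "'i set" and U :: "('i \<Rightarrow> real) set" and f g :: "('i \<Rightarrow> real) \<Rightarrow> real"
  assumes U: "openin (powertop_real I) U" and eq: "\<And>x. x \<in> U \<Longrightarrow> f x = g x"
begin

lemma pd_cong_ev: "x \<in> U \<Longrightarrow> i \<in> I \<Longrightarrow> eventually (\<lambda>t. f (x(i := t)) = g (x(i := t))) (nhds (x i))"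
  using coord_upd_eventually[OF U] by (rule eventually_mono) (auto simp: eq)

lemma pderiv_at_cong: "x \<in> U \<Longrightarrow> i \<in> I \<Longrightarrow> pderiv_at i f x = pderiv_at i g x"
  unfolding pderiv_at_def by (rule deriv_cong_ev[OF pd_cong_ev]) auto

lemma pdiff_cong: "x \<in> U \<Longrightarrow> i \<in> I \<Longrightarrow> pdiff i f x = pdiff i g x"
  unfolding pdiff_def real_differentiable_def
  using DERIV_cong_ev[OF refl pd_cong_ev refl] by blast

end

lemma iter_pderiv_append: "iter_pderiv (xs @ ys) f = iter_pderiv xs (iter_pderiv ys f)"
  by (induction xs) auto

lemma iter_pderiv_snoc: "iter_pderiv (xs @ [i]) f = iter_pderiv xs (pderiv_at i f)"
  by (simp add: iter_pderiv_append)

lemma iter_pderiv_cong: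
  assumes "openin (powertop_real I) U" "\<And>x. x \<in> U \<Longrightarrow> f x = g x" "x \<in> U" "set is \<subseteq> I"
  shows "iter_pderiv is f x = iter_pderiv is g x"
  using assms(3,4)
proof (induction "is" arbitrary: x)
  case (Cons i js)
  then show ?case
    using pderiv_at_cong[OF assms(1), of "iter_pderiv js f" "iter_pderiv js g" x i] by auto
qed (use assms in auto)

subsection \<open>Smoothness\<close>

lemma smooth_on_iff:
  assumes "U \<subseteq> coord_space I"
  shows "smooth_on I U f \<longleftrightarrow> (\<forall>is. set is \<subseteq> I \<longrightarrow> continuous_on U (iter_pderiv is f) \<and>
    (\<forall>x\<in>U. \<forall>i\<in>I. pdiff i (iter_pderiv is f) x))"
  unfolding smooth_on_def subtopology_powertop[OF assms] pdiff_def by simp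

text \<open>Smoothness unfolds like a coinductive predicate, one derivative at a time.\<close>

lemma smooth_on_unfold:
  assumes "U \<subseteq> coord_space I"
  shows "smooth_on I U f \<longleftrightarrow> continuous_on U f \<and>
    (\<forall>i\<in>I. (\<forall>x\<in>U. pdiff i f x) \<and> smooth_on I U (pderiv_at i f))" (is "?L \<longleftrightarrow> ?R")
proof
  assume L: ?L
  show ?R
  proof (intro conjI ballI)
    show "continuous_on U f" using L[unfolded smooth_on_iff[OF assms], rule_format, of "[]"] by simp
    fix i assume i: "i \<in> I"
    show "pdiff i f x" if "x \<in> U" for x
      using L[unfolded smooth_on_iff[OF assms], rule_format, of "[]"] i that by simp
    show "smooth_on I U (pderiv_at i f)"
      unfolding smooth_on_iff[OF assms]
    proof (intro allI impI)
      fix "is" assume "set is \<subseteq> I"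
      then show "continuous_on U (iter_pderiv is (pderiv_at i f)) \<and>
          (\<forall>x\<in>U. \<forall>j\<in>I. pdiff j (iter_pderiv is (pderiv_at i f)) x)"
        using L[unfolded smooth_on_iff[OF assms], rule_format, of "is @ [i]"] i
        by (simp add: iter_pderiv_snoc)
    qed
  qed
next
  assume R: ?R
  show ?L
    unfolding smooth_on_iff[OF assms]
  proof (intro allI impI)
    fix "is" :: "'a list" assume is_I: "set is \<subseteq> I"
    show "continuous_on U (iter_pderiv is f) \<and> (\<forall>x\<in>U. \<forall>i\<in>I. pdiff i (iter_pderiv is f) x)"
    proof (cases "is" rule: rev_cases)
      case (snoc js j)
      with is_I have j: "j \<in> I" "set js \<subseteq> I" by auto
      with R have "smooth_on I U (pderiv_at j f)" by blast
      with j show ?thesis unfolding smooth_on_iff[OF assms] snoc iter_pderiv_snoc by blast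
    qed (use R in auto)
  qed
qed

lemma smooth_on_continuous: "U \<subseteq> coord_space I \<Longrightarrow> smooth_on I U f \<Longrightarrow> continuous_on U f"
  using smooth_on_unfold by blast

lemma smooth_on_pdiff: "U \<subseteq> coord_space I \<Longrightarrow> smooth_on I U f \<Longrightarrow> i \<in> I \<Longrightarrow> x \<in> U \<Longrightarrow> pdiff i f x"
  using smooth_on_unfold by blast

lemma smooth_on_pderiv: "U \<subseteq> coord_space I \<Longrightarrow> smooth_on I U f \<Longrightarrow> i \<in> I \<Longrightarrow> smooth_on I U (pderiv_at i f)"
  using smooth_on_unfold by blast

lemma smooth_on_iter_pderiv:
  "U \<subseteq> coord_space I \<Longrightarrow> smooth_on I U f \<Longrightarrow> set is \<subseteq> I \<Longrightarrow> smooth_on I U (iter_pderiv is f)"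
  by (induction "is") (auto intro: smooth_on_pderiv)

lemma smooth_on_subset: "V \<subseteq> coord_space I \<Longrightarrow> U \<subseteq> V \<Longrightarrow> smooth_on I V f \<Longrightarrow> smooth_on I U f"
  using smooth_on_iff[of V I f] smooth_on_iff[of U I f] by (meson continuous_on_subset subset_iff subset_trans)

text \<open>
  Smoothness is local because the iterated derivatives are defined without reference to the
  domain.
\<close>

lemma smooth_on_local:
  assumes "U \<subseteq> coord_space I"
    and "\<And>x. x \<in> U \<Longrightarrow> \<exists>V. openin (powertop_real I) V \<and> x \<in> V \<and> smooth_on I (V \<inter> U) f"
  shows "smooth_on I U f"
  unfolding smooth_on_iff[OF assms(1)]
proof (intro allI impI conjI ballI)
  fix "is" :: "'a list" assume js: "set is \<subseteq> I"
  show "continuous_on U (iter_pderiv is f)"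
    unfolding continuous_on_def
  proof
    fix x assume x: "x \<in> U"
    obtain V where V: "openin (powertop_real I) V" "x \<in> V" "smooth_on I (V \<inter> U) f"
      using assms(2)[OF x] by blast
    then obtain T where T: "open T" "V = coord_space I \<inter> T"
      unfolding powertop_real_eq by (auto simp: openin_open)
    have VU: "V \<inter> U = U \<inter> T" using T assms(1) by auto
    have "V \<inter> U \<subseteq> coord_space I" using assms by auto
    from smooth_on_iff[OF this] V(3) have "continuous_on (V \<inter> U) (iter_pderiv is f)"
      using js by blast
    then have "(iter_pderiv is f \<longlongrightarrow> iter_pderiv is f x) (at x within (T \<inter> U))"
      unfolding continuous_on_def VU using x V T by (auto simp: Int_commute)
    moreover have "at x within (T \<inter> U) = at x within U"
      using at_within_nhd[of x T "T \<inter> U" U] T V by auto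
    ultimately show "(iter_pderiv is f \<longlongrightarrow> iter_pderiv is f x) (at x within U)" by simp
  qed
  fix x i assume x: "x \<in> U" and i: "i \<in> I"
  obtain V where V: "openin (powertop_real I) V" "x \<in> V" "smooth_on I (V \<inter> U) f"
    using assms(2)[OF x] by blast
  have "V \<inter> U \<subseteq> coord_space I" using assms by auto
  from smooth_on_iff[OF this] V show "pdiff i (iter_pderiv is f) x"
    using js x i by blast
qed

text \<open>
  The class \<open>C\<^sup>n\<close>. The derivative of a product or of a composition is a sum of products
  involving the original functions, so closure properties are proved by induction on \<open>n\<close> and
  then transferred to \<open>smooth_on\<close>.
\<close>

primrec Cn :: "'i set \<Rightarrow> ('i \<Rightarrow> real) set \<Rightarrow> nat \<Rightarrow> (('i \<Rightarrow> real) \<Rightarrow> real) \<Rightarrow> bool" where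
  "Cn I U 0 f = continuous_on U f"
| "Cn I U (Suc n) f = (continuous_on U f \<and>
     (\<forall>i\<in>I. (\<forall>x\<in>U. pdiff i f x) \<and> Cn I U n (pderiv_at i f)))"

lemma Cn_continuous: "Cn I U n f \<Longrightarrow> continuous_on U f" by (cases n) auto

lemma Cn_Suc: "Cn I U (Suc n) f \<Longrightarrow> Cn I U n f"
proof (induction n arbitrary: f)
  case (Suc n)
  have "Cn I U n (pderiv_at i f)" if "i \<in> I" for i
    by (rule Suc.IH) (use Suc.prems that in simp)
  with Suc.prems show ?case by simp
qed simp

lemma smooth_on_imp_Cn: "U \<subseteq> coord_space I \<Longrightarrow> smooth_on I U f \<Longrightarrow> Cn I U n f"
proof (induction n arbitrary: f)
  case (Suc n)
  then show ?case using smooth_on_unfold[of U I f] by auto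
qed (auto intro: smooth_on_continuous)

lemma Cn_imp_smooth_on:
  assumes "U \<subseteq> coord_space I" "\<And>n. Cn I U n f"
  shows "smooth_on I U f"
proof -
  have *: "Cn I U n (iter_pderiv is f)" if "set is \<subseteq> I" "Cn I U (length is + n) f" for "is" n f
    using that
  proof (induction "is" arbitrary: f rule: rev_induct)
    case (snoc i js)
    then have "Cn I U (length js + n) (pderiv_at i f)" by simp
    then show ?case using snoc by (auto simp: iter_pderiv_snoc)
  qed simp
  show ?thesis unfolding smooth_on_iff[OF assms(1)]
  proof (intro allI impI)
    fix "is" :: "'a list" assume "set is \<subseteq> I"
    then have "Cn I U (Suc 0) (iter_pderiv is f)" using *[of "is" "Suc 0" f] assms(2)[of "length is + Suc 0"] by blast
    then show "continuous_on U (iter_pderiv is f) \<and> (\<forall>x\<in>U. \<forall>i\<in>I. pdiff i (iter_pderiv is f) x)" by simp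
  qed
qed

lemma smooth_on_Cn: "U \<subseteq> coord_space I \<Longrightarrow> smooth_on I U f \<longleftrightarrow> (\<forall>n. Cn I U n f)"
  using Cn_imp_smooth_on[of U I f] smooth_on_imp_Cn[of U I f] by (intro iffI allI) auto

lemma Cn_cong:
  assumes "openin (powertop_real I) U" "\<And>x. x \<in> U \<Longrightarrow> f x = g x"
  shows "Cn I U n f \<longleftrightarrow> Cn I U n g"
  using assms(2)
proof (induction n arbitrary: f g)
  case 0
  then show ?case by (auto cong: continuous_on_cong)
next
  case (Suc n)
  have "continuous_on U f = continuous_on U g" using Suc by (auto cong: continuous_on_cong)
  moreover have "Cn I U n (pderiv_at i f) = Cn I U n (pderiv_at i g)" if "i \<in> I" for i
    by (rule Suc.IH) (rule pderiv_at_cong[OF assms(1) Suc.prems _ that], auto)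
  moreover have "pdiff i f x = pdiff i g x" if "i \<in> I" "x \<in> U" for i x
    by (rule pdiff_cong[OF assms(1) Suc.prems that(2,1)], auto)
  ultimately show ?case by auto
qed

lemma smooth_on_cong:
  assumes "openin (powertop_real I) U" "\<And>x. x \<in> U \<Longrightarrow> f x = g x"
  shows "smooth_on I U f \<longleftrightarrow> smooth_on I U g"
  using Cn_cong[OF assms] smooth_on_Cn[OF coord_openin_subset[OF assms(1)]] by simp

lemma pd_const: "pdiff i (\<lambda>x. c) x" "pderiv_at i (\<lambda>x. c) x = 0"
  by (rule pdiffI[where D=0], auto intro!: derivative_eq_intros)+

lemma pd_coord:
  "pdiff i (\<lambda>x. x j) x" "pderiv_at i (\<lambda>x. x j) x = (if i = j then 1 else 0)"
proof -
  have "((\<lambda>t. (x(i := t)) j) has_real_derivative (if i = j then 1 else 0)) (at (x i))"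
    by (cases "i = j") (auto intro!: derivative_eq_intros)
  then show "pdiff i (\<lambda>x. x j) x" "pderiv_at i (\<lambda>x. x j) x = (if i = j then 1 else 0)"
    by (rule pdiffI)+
qed

lemma pd_add:
  assumes "pdiff i f x" "pdiff i g x"
  shows "pdiff i (\<lambda>x. f x + g x) x" "pderiv_at i (\<lambda>x. f x + g x) x = pderiv_at i f x + pderiv_at i g x"
  by (rule pdiffI, rule DERIV_add[OF pdiffD pdiffD, OF assms])+

lemma pd_mult:
  assumes "pdiff i f x" "pdiff i g x"
  shows "pdiff i (\<lambda>x. f x * g x) x"
    "pderiv_at i (\<lambda>x. f x * g x) x = f x * pderiv_at i g x + g x * pderiv_at i f x"
proof -
  have "((\<lambda>t. f (x(i := t)) * g (x(i := t))) has_real_derivative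
     f x * pderiv_at i g x + g x * pderiv_at i f x) (at (x i))"
    using DERIV_mult[OF pdiffD pdiffD, OF assms] by (simp add: mult.commute add.commute)
  then show "pdiff i (\<lambda>x. f x * g x) x"
    "pderiv_at i (\<lambda>x. f x * g x) x = f x * pderiv_at i g x + g x * pderiv_at i f x"
    by (rule pdiffI)+
qed

lemma pd_compose1:
  assumes "pdiff i f x" "(h has_real_derivative D) (at (f x))"
  shows "pdiff i (\<lambda>x. h (f x)) x" "pderiv_at i (\<lambda>x. h (f x)) x = D * pderiv_at i f x"
  by (rule pdiffI, rule DERIV_chain2[OF _ pdiffD[OF assms(1)]], use assms in simp)+

lemma Cn_const: "Cn I U n (\<lambda>x. c)"
proof (induction n arbitrary: c)
  case (Suc n)
  have "pderiv_at i (\<lambda>x. c) = (\<lambda>x. 0)" for i :: 'a by (rule ext) (rule pd_const)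
  with Suc show ?case by (auto simp: pd_const)
qed simp

lemma Cn_coord: "Cn I U n (\<lambda>x. x j)"
proof (cases n)
  case (Suc n)
  have "pderiv_at i (\<lambda>x. x j) = (\<lambda>x. if i = j then 1 else 0)" for i :: 'a
    by (rule ext) (rule pd_coord)
  with Suc show ?thesis
    by (auto simp: pd_coord Cn_const intro!: continuous_on_subset[OF continuous_on_product_coordinates])
qed (auto intro!: continuous_on_subset[OF continuous_on_product_coordinates])

context
  fixes I :: "'i set" and U :: "('i \<Rightarrow> real) set"
  assumes U: "openin (powertop_real I) U"
begin

lemma Cn_add: "Cn I U n f \<Longrightarrow> Cn I U n g \<Longrightarrow> Cn I U n (\<lambda>x. f x + g x)"
proof (induction n arbitrary: f g)
  case (Suc n)
  have "Cn I U n (pderiv_at i (\<lambda>x. f x + g x))" if i: "i \<in> I" for i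
    by (subst Cn_cong[OF U, where g="\<lambda>x. pderiv_at i f x + pderiv_at i g x"])
       (use Suc i in \<open>auto intro: pd_add\<close>)
  with Suc.prems show ?case by (auto intro!: continuous_intros pd_add)
qed (auto intro: continuous_intros)

lemma Cn_mult: "Cn I U n f \<Longrightarrow> Cn I U n g \<Longrightarrow> Cn I U n (\<lambda>x. f x * g x)"
proof (induction n arbitrary: f g)
  case (Suc n)
  have fg: "Cn I U n f" "Cn I U n g" using Suc.prems by (blast dest: Cn_Suc)+
  have "Cn I U n (pderiv_at i (\<lambda>x. f x * g x))" if i: "i \<in> I" for i
    by (subst Cn_cong[OF U, where g="\<lambda>x. f x * pderiv_at i g x + g x * pderiv_at i f x"])
       (use Suc i fg in \<open>auto intro!: pd_mult Cn_add\<close>)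
  with Suc.prems show ?case by (auto intro!: continuous_intros pd_mult)
qed (auto intro: continuous_intros)

lemma Cn_sum: "(\<And>k. k \<in> K \<Longrightarrow> Cn I U n (f k)) \<Longrightarrow> Cn I U n (\<lambda>x. \<Sum>k\<in>K. f k x)"
  by (induction K rule: infinite_finite_induct) (auto simp: Cn_const intro: Cn_add)

lemma Cn_prod: "(\<And>k. k \<in> K \<Longrightarrow> Cn I U n (f k)) \<Longrightarrow> Cn I U n (\<lambda>x. \<Prod>k\<in>K. f k x)"
  by (induction K rule: infinite_finite_induct) (auto simp: Cn_const intro: Cn_mult)

end

lemmas smooth_on_lift = smooth_on_Cn[OF coord_openin_subset]

lemma smooth_on_const: "openin (powertop_real I) U \<Longrightarrow> smooth_on I U (\<lambda>x. c)"
  by (simp add: smooth_on_lift Cn_const)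

lemma smooth_on_coord: "openin (powertop_real I) U \<Longrightarrow> smooth_on I U (\<lambda>x. x j)"
  by (simp add: smooth_on_lift Cn_coord)

lemma smooth_on_add:
  "openin (powertop_real I) U \<Longrightarrow> smooth_on I U f \<Longrightarrow> smooth_on I U g \<Longrightarrow> smooth_on I U (\<lambda>x. f x + g x)"
  by (simp add: smooth_on_lift Cn_add)

lemma smooth_on_mult:
  "openin (powertop_real I) U \<Longrightarrow> smooth_on I U f \<Longrightarrow> smooth_on I U g \<Longrightarrow> smooth_on I U (\<lambda>x. f x * g x)"
  by (simp add: smooth_on_lift Cn_mult)

lemma smooth_on_minus:
  "openin (powertop_real I) U \<Longrightarrow> smooth_on I U f \<Longrightarrow> smooth_on I U g \<Longrightarrow> smooth_on I U (\<lambda>x. f x - g x)"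
  using smooth_on_add[of I U f "\<lambda>x. (-1) * g x"] smooth_on_mult[of I U "\<lambda>_. -1" g]
  by (simp add: smooth_on_const)

lemma smooth_on_sum:
  "openin (powertop_real I) U \<Longrightarrow> (\<And>k. k \<in> K \<Longrightarrow> smooth_on I U (f k)) \<Longrightarrow> smooth_on I U (\<lambda>x. \<Sum>k\<in>K. f k x)"
  by (simp add: smooth_on_lift Cn_sum)

lemma smooth_on_prod:
  "openin (powertop_real I) U \<Longrightarrow> (\<And>k. k \<in> K \<Longrightarrow> smooth_on I U (f k)) \<Longrightarrow> smooth_on I U (\<lambda>x. \<Prod>k\<in>K. f k x)"
  by (simp add: smooth_on_lift Cn_prod)

lemma smooth_on_power:
  "openin (powertop_real I) U \<Longrightarrow> smooth_on I U f \<Longrightarrow> smooth_on I U (\<lambda>x. f x ^ n)"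
  by (induction n) (auto intro: smooth_on_const smooth_on_mult)

subsection \<open>The chain rule\<close>

lemma mvt_segment:
  fixes g :: "real \<Rightarrow> real"
  assumes "\<And>t. min a b \<le> t \<Longrightarrow> t \<le> max a b \<Longrightarrow> (g has_real_derivative g' t) (at t)"
  obtains t where "min a b \<le> t" "t \<le> max a b" "g b - g a = g' t * (b - a)"
proof -
  consider "a < b" | "b < a" | "a = b" by linarith
  then show ?thesis
  proof cases
    case 1
    then obtain z where "z > a" "z < b" "g b - g a = (b - a) * g' z"
      using MVT2[of a b g g'] assms by auto
    then show ?thesis using 1 that[of z] by (simp add: mult.commute)
  next
    case 2
    then obtain z where "z > b" "z < a" "g a - g b = (a - b) * g' z"
      using MVT2[of b a g g'] assms by auto
    then show ?thesis using 2 that[of z] by (simp add: algebra_simps)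
  next
    case 3
    then show ?thesis using that[of a] by simp
  qed
qed

text \<open>
  The path from \<open>p\<close> to \<open>y\<close> that changes one coordinate at a time turns the increment of \<open>f\<close> into
  a sum of one-variable increments.
\<close>

lemma mvt_box:
  assumes fin: "finite J" and p: "p \<in> coord_space J"
    and pd: "\<And>y j. y \<in> coord_space J \<Longrightarrow> (\<And>k. k \<in> J \<Longrightarrow> \<bar>y k - p k\<bar> < e) \<Longrightarrow> j \<in> J \<Longrightarrow> pdiff j f y"
    and y: "y \<in> coord_space J" "\<And>k. k \<in> J \<Longrightarrow> \<bar>y k - p k\<bar> < e"
  shows "\<exists>\<xi>. (\<forall>j\<in>J. \<xi> j \<in> coord_space J \<and> (\<forall>k\<in>J. \<bar>\<xi> j k - p k\<bar> \<le> \<bar>y k - p k\<bar>)) \<and>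
     f y - f p = (\<Sum>j\<in>J. pderiv_at j f (\<xi> j) * (y j - p j))"
proof -
  have "\<exists>\<xi>. (\<forall>j\<in>S. \<xi> j \<in> coord_space J \<and> (\<forall>k\<in>J. \<bar>\<xi> j k - p k\<bar> \<le> \<bar>y k - p k\<bar>)) \<and>
     f y - f p = (\<Sum>j\<in>S. pderiv_at j f (\<xi> j) * (y j - p j))"
    if "finite S" "S \<subseteq> J" "y \<in> coord_space J" "\<forall>k\<in>J. \<bar>y k - p k\<bar> < e" "\<forall>k\<in>J - S. y k = p k" for S y
    using that
  proof (induction S arbitrary: y)
    case empty
    then have "y = p" using p by (auto simp: PiE_iff extensional_def fun_eq_iff)
    then show ?case by simp
  next
    case (insert j S)
    \<comment> \<open>Reset the coordinate \<open>j\<close> of \<open>y\<close> to that of \<open>p\<close>; the last step changes this coordinate only.\<close>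
    let ?y = "y(j := p j)"
    have j: "j \<in> J" "j \<notin> S" using insert by auto
    have e: "e > 0" using insert.prems j by force
    have "?y \<in> coord_space J" using insert.prems j by (auto intro: coord_upd)
    moreover have "\<forall>k\<in>J. \<bar>?y k - p k\<bar> < e" using insert.prems e by auto
    moreover have "\<forall>k\<in>J - S. ?y k = p k" using insert.prems by auto
    ultimately obtain \<xi> where \<xi>: "\<forall>i\<in>S. \<xi> i \<in> coord_space J \<and> (\<forall>k\<in>J. \<bar>\<xi> i k - p k\<bar> \<le> \<bar>?y k - p k\<bar>)"
      "f ?y - f p = (\<Sum>i\<in>S. pderiv_at i f (\<xi> i) * (?y i - p i))"
      using insert.IH[of ?y] insert.prems(1) by blast
    have "((\<lambda>t. f (y(j := t))) has_real_derivative pderiv_at j f (y(j := t))) (at t)"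
      if t: "min (p j) (y j) \<le> t" "t \<le> max (p j) (y j)" for t
    proof (rule pdiff_upd, rule pd)
      show "y(j := t) \<in> coord_space J" using insert.prems j by (auto intro: coord_upd)
      have "\<bar>y j - p j\<bar> < e" using insert.prems j by auto
      then show "\<bar>(y(j := t)) k - p k\<bar> < e" if "k \<in> J" for k
        using t that insert.prems by (cases "k = j") (auto simp: abs_if split: if_splits)
    qed (rule j)
    then obtain t where t: "min (p j) (y j) \<le> t" "t \<le> max (p j) (y j)"
      and eq: "f (y(j := y j)) - f (y(j := p j)) = pderiv_at j f (y(j := t)) * (y j - p j)"
      by (rule mvt_segment)
    define \<zeta> where "\<zeta> = \<xi>(j := y(j := t))"
    have "(\<Sum>i\<in>S. pderiv_at i f (\<xi> i) * (?y i - p i)) = (\<Sum>i\<in>S. pderiv_at i f (\<zeta> i) * (y i - p i))"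
      by (rule sum.cong) (use j in \<open>auto simp: \<zeta>_def\<close>)
    moreover have "pderiv_at j f (y(j := t)) = pderiv_at j f (\<zeta> j)" by (simp add: \<zeta>_def)
    ultimately have "f y - f p = (\<Sum>i\<in>insert j S. pderiv_at i f (\<zeta> i) * (y i - p i))"
      using eq \<xi>(2) insert.hyps by simp
    moreover have "\<zeta> i \<in> coord_space J \<and> (\<forall>k\<in>J. \<bar>\<zeta> i k - p k\<bar> \<le> \<bar>y k - p k\<bar>)" if "i \<in> insert j S" for i
    proof (cases "i = j")
      case True
      then show ?thesis using t insert.prems j by (auto simp: \<zeta>_def intro: coord_upd)
    next
      case False
      then have i: "i \<in> S" "\<zeta> i = \<xi> i" using that by (auto simp: \<zeta>_def)
      have "\<bar>\<xi> i k - p k\<bar> \<le> \<bar>y k - p k\<bar>" if "k \<in> J" for k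
        using \<xi>(1) i(1) that by (cases "k = j") force+
      then show ?thesis using \<xi>(1) i by auto
    qed
    ultimately show ?case by blast
  qed
  from this[of J y] show ?thesis using fin y by auto
qed

lemma cont_box:
  assumes J: "finite J" "openin (powertop_real J) V" "continuous_on V g" "p \<in> V" "0 < r"
  obtains d where "d > 0" "\<And>y. y \<in> coord_space J \<Longrightarrow> (\<And>k. k \<in> J \<Longrightarrow> \<bar>y k - p k\<bar> < d) \<Longrightarrow> y \<in> V \<and> \<bar>g y - g p\<bar> < (r::real)"
proof -
  have "openin (top_of_set V) (V \<inter> g -` {g p - r <..< g p + r})"
    using J(3) by (rule continuous_openin_preimage_gen) auto
  then have "openin (powertop_real J) (V \<inter> g -` {g p - r <..< g p + r})"
    using J(2) subtopology_powertop[OF coord_openin_subset[OF J(2)]] openin_trans_full by metis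
  moreover have "p \<in> V \<inter> g -` {g p - r <..< g p + r}" using J(4,5) by auto
  ultimately obtain d where d: "d > 0"
    "\<And>y. y \<in> coord_space J \<Longrightarrow> (\<And>k. k \<in> J \<Longrightarrow> \<bar>y k - p k\<bar> < d) \<Longrightarrow> y \<in> (V \<inter> g -` {g p - r <..< g p + r})"
    using coord_box[of J "V \<inter> g -` {g p - r <..< g p + r}" p thesis] J(1) by meson
  have "y \<in> V \<and> \<bar>g y - g p\<bar> < r" if "y \<in> coord_space J" "\<And>k. k \<in> J \<Longrightarrow> \<bar>y k - p k\<bar> < d" for y
    using d(2)[OF that] by (auto simp: abs_less_iff)
  with d(1) show ?thesis by (rule that)
qed

text \<open>
  By \<open>mvt_box\<close> a difference quotient is \<open>\<Sum>\<^sub>j (\<partial>\<^sub>j f)(\<xi>\<^sub>j) \<Delta>c\<^sub>j / \<Delta>t\<close>, and the \<open>\<xi>\<^sub>j\<close> converge to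
  the base point. The curve is passed by its components because points of coordinate spaces are
  extensional.
\<close>

lemma chain_rule:
  assumes J: "finite J" "openin (powertop_real J) V"
    and f: "\<And>j. j \<in> J \<Longrightarrow> continuous_on V (pderiv_at j f)" "\<And>j x. j \<in> J \<Longrightarrow> x \<in> V \<Longrightarrow> pdiff j f x"
    and c: "\<And>j. j \<in> J \<Longrightarrow> (c j has_real_derivative c' j) (at t0)"
    and V: "(\<lambda>j\<in>J. c j t0) \<in> V"
  shows "((\<lambda>t. f (\<lambda>j\<in>J. c j t)) has_real_derivative
     (\<Sum>j\<in>J. pderiv_at j f (\<lambda>j\<in>J. c j t0) * c' j)) (at t0)"
proof -
  define C where "C t = (\<lambda>j\<in>J. c j t)" for t
  define p where "p = C t0"
  have p: "p \<in> V" "p \<in> coord_space J" using V by (auto simp: p_def C_def)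
  have Cc: "C t \<in> coord_space J" for t by (simp add: C_def)
  obtain e where e: "e > 0" "\<And>y. y \<in> coord_space J \<Longrightarrow> (\<And>i. i \<in> J \<Longrightarrow> \<bar>y i - p i\<bar> < e) \<Longrightarrow> y \<in> V"
    using coord_box[OF J(2) p(1) J(1)] by metis
  have near: "eventually (\<lambda>t. \<forall>j\<in>J. \<bar>C t j - p j\<bar> < d) (at t0)" if "d > 0" for d
    unfolding eventually_ball_finite_distrib[OF J(1)]
  proof
    fix j assume j: "j \<in> J"
    have "isCont (c j) t0" using c[OF j] by (rule DERIV_isCont)
    then have "(c j \<longlongrightarrow> c j t0) (at t0)" by (simp add: isCont_def)
    then have "eventually (\<lambda>t. dist (c j t) (c j t0) < d) (at t0)" using that by (rule tendstoD)
    then show "eventually (\<lambda>t. \<bar>C t j - p j\<bar> < d) (at t0)"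
      by (simp add: C_def p_def dist_real_def j)
  qed
  define P where "P t \<xi> \<longleftrightarrow> (\<forall>j\<in>J. \<xi> j \<in> coord_space J \<and> (\<forall>k\<in>J. \<bar>\<xi> j k - p k\<bar> \<le> \<bar>C t k - p k\<bar>)) \<and>
     f (C t) - f p = (\<Sum>j\<in>J. pderiv_at j f (\<xi> j) * (C t j - p j))" for t \<xi>
  define \<xi> where "\<xi> t = (SOME \<xi>. P t \<xi>)" for t
  have P: "P t (\<xi> t)" if "\<forall>j\<in>J. \<bar>C t j - p j\<bar> < e" for t
  proof -
    have "\<exists>\<xi>. P t \<xi>" unfolding P_def
      by (rule mvt_box[where e=e]) (use J p Cc e f that in auto)
    then show ?thesis unfolding \<xi>_def by (rule someI_ex)
  qed
  have ev: "eventually (\<lambda>t. P t (\<xi> t)) (at t0)"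
    using near[OF e(1)] by (rule eventually_mono) (rule P)
  have lim\<xi>: "((\<lambda>t. pderiv_at j f (\<xi> t j)) \<longlongrightarrow> pderiv_at j f p) (at t0)" if j: "j \<in> J" for j
  proof (rule tendstoI)
    fix r :: real assume "r > 0"
    from cont_box[OF J f(1)[OF j] p(1) this] obtain d where d: "d > 0"
      "\<And>y. y \<in> coord_space J \<Longrightarrow> (\<And>k. k \<in> J \<Longrightarrow> \<bar>y k - p k\<bar> < d) \<Longrightarrow> y \<in> V \<and> \<bar>pderiv_at j f y - pderiv_at j f p\<bar> < r"
      by blast
    show "eventually (\<lambda>t. dist (pderiv_at j f (\<xi> t j)) (pderiv_at j f p) < r) (at t0)"
      using ev near[OF d(1)]
    proof eventually_elim
      case (elim t)
      then have "\<xi> t j \<in> coord_space J" "\<And>k. k \<in> J \<Longrightarrow> \<bar>\<xi> t j k - p k\<bar> < d"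
        using j unfolding P_def by (force intro: le_less_trans)+
      then show ?case using d(2) by (auto simp: dist_real_def)
    qed
  qed
  have "((\<lambda>t. \<Sum>j\<in>J. pderiv_at j f (\<xi> t j) * ((c j t - c j t0) / (t - t0))) \<longlongrightarrow> (\<Sum>j\<in>J. pderiv_at j f p * c' j)) (at t0)"
    by (intro tendsto_sum tendsto_mult lim\<xi>) (use c in \<open>auto simp: has_field_derivative_iff\<close>)
  moreover have "eventually (\<lambda>t. (\<Sum>j\<in>J. pderiv_at j f (\<xi> t j) * ((c j t - c j t0) / (t - t0))) = (f (C t) - f (C t0)) / (t - t0)) (at t0)"
    using ev by (rule eventually_mono) (auto simp: P_def C_def p_def sum_divide_distrib intro!: sum.cong)
  ultimately have "((\<lambda>t. (f (C t) - f (C t0)) / (t - t0)) \<longlongrightarrow> (\<Sum>j\<in>J. pderiv_at j f p * c' j)) (at t0)"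
    by (rule Lim_transform_eventually)
  then show ?thesis unfolding has_field_derivative_iff C_def p_def by simp
qed

context
  fixes I :: "'i set" and U :: "('i \<Rightarrow> real) set" and J :: "'j set" and V :: "('j \<Rightarrow> real) set"
    and a :: "'j \<Rightarrow> ('i \<Rightarrow> real) \<Rightarrow> real"
  assumes U: "openin (powertop_real I) U" and J: "finite J" and V: "openin (powertop_real J) V"
    and aV: "\<And>x. x \<in> U \<Longrightarrow> (\<lambda>j\<in>J. a j x) \<in> V"
begin

lemma pd_compose:
  assumes T: "smooth_on J V T" and i: "i \<in> I" and x: "x \<in> U" and a: "\<And>j. j \<in> J \<Longrightarrow> pdiff i (a j) x"
  shows "pdiff i (\<lambda>x. T (\<lambda>j\<in>J. a j x)) x"
    "pderiv_at i (\<lambda>x. T (\<lambda>j\<in>J. a j x)) x = (\<Sum>j\<in>J. pderiv_at j T (\<lambda>j\<in>J. a j x) * pderiv_at i (a j) x)"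
proof -
  note V' = coord_openin_subset[OF V]
  have "((\<lambda>t. T (\<lambda>j\<in>J. a j (x(i := t)))) has_real_derivative
     (\<Sum>j\<in>J. pderiv_at j T (\<lambda>j\<in>J. a j (x(i := x i))) * pderiv_at i (a j) x)) (at (x i))"
  proof (rule chain_rule[OF J V])
    show "continuous_on V (pderiv_at j T)" if "j \<in> J" for j
      using smooth_on_continuous[OF V' smooth_on_pderiv[OF V' T that]] .
    show "pdiff j T y" if "j \<in> J" "y \<in> V" for j y using smooth_on_pdiff[OF V' T that] .
    show "((\<lambda>t. a j (x(i := t))) has_real_derivative pderiv_at i (a j) x) (at (x i))" if "j \<in> J" for j
      using pdiffD[OF a[OF that]] .
    show "(\<lambda>j\<in>J. a j (x(i := x i))) \<in> V" using aV[OF x] by simp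
  qed
  then have *: "((\<lambda>t. T (\<lambda>j\<in>J. a j (x(i := t)))) has_real_derivative
     (\<Sum>j\<in>J. pderiv_at j T (\<lambda>j\<in>J. a j x) * pderiv_at i (a j) x)) (at (x i))" by simp
  show "pdiff i (\<lambda>x. T (\<lambda>j\<in>J. a j x)) x"
    "pderiv_at i (\<lambda>x. T (\<lambda>j\<in>J. a j x)) x = (\<Sum>j\<in>J. pderiv_at j T (\<lambda>j\<in>J. a j x) * pderiv_at i (a j) x)"
    by (rule pdiffI[OF *])+
qed

lemma continuous_on_family:
  assumes "\<And>j. j \<in> J \<Longrightarrow> continuous_on U (a j)"
  shows "continuous_on U (\<lambda>x. \<lambda>j\<in>J. a j x)"
proof (rule continuous_on_coordinatewise_then_product)
  fix j show "continuous_on U (\<lambda>x. (\<lambda>j\<in>J. a j x) j)" using assms by (cases "j \<in> J") auto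
qed

text \<open>
  The chain rule expresses the derivative through \<open>\<partial>\<^sub>j T\<close> composed with the same inner
  functions, so the induction hypothesis applies to every \<open>\<partial>\<^sub>j T\<close> at once.
\<close>

lemma Cn_compose:
  "smooth_on J V T \<Longrightarrow> (\<And>j. j \<in> J \<Longrightarrow> Cn I U n (a j)) \<Longrightarrow> Cn I U n (\<lambda>x. T (\<lambda>j\<in>J. a j x))"
proof (induction n arbitrary: T)
  case 0
  have "continuous_on U (\<lambda>x. \<lambda>j\<in>J. a j x)" by (rule continuous_on_family) (use 0 in auto)
  from continuous_on_compose2[OF smooth_on_continuous[OF coord_openin_subset[OF V] 0(1)] this] aV
  show ?case by (simp add: image_subset_iff)
next
  case (Suc n)
  have a: "Cn I U n (a j)" if "j \<in> J" for j using Suc.prems(2)[OF that] by (rule Cn_Suc)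
  have "continuous_on U (\<lambda>x. T (\<lambda>j\<in>J. a j x))"
    using Suc.IH[OF Suc.prems(1) a] by (rule Cn_continuous)
  moreover have pa: "pdiff i (a j) x" if "i \<in> I" "x \<in> U" "j \<in> J" for i j x
    using Suc.prems(2)[of j] that by simp
  moreover have "Cn I U n (pderiv_at i (\<lambda>x. T (\<lambda>j\<in>J. a j x)))" if i: "i \<in> I" for i
  proof (subst Cn_cong[OF U])
    show "pderiv_at i (\<lambda>x. T (\<lambda>j\<in>J. a j x)) x = (\<Sum>j\<in>J. pderiv_at j T (\<lambda>j\<in>J. a j x) * pderiv_at i (a j) x)"
      if "x \<in> U" for x using that i pa Suc.prems(1) by (intro pd_compose(2)) auto
    have 1: "Cn I U n (\<lambda>x. pderiv_at j T (\<lambda>j\<in>J. a j x))" if "j \<in> J" for j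
      by (rule Suc.IH[OF smooth_on_pderiv[OF coord_openin_subset[OF V]]]) (use that a Suc.prems(1) in auto)
    have 2: "Cn I U n (pderiv_at i (a j))" if "j \<in> J" for j
      using Suc.prems(2)[OF that] i by simp
    show "Cn I U n (\<lambda>x. \<Sum>j\<in>J. pderiv_at j T (\<lambda>j\<in>J. a j x) * pderiv_at i (a j) x)"
      by (intro Cn_sum[OF U] Cn_mult[OF U] 1 2)
  qed
  moreover have "pdiff i (\<lambda>x. T (\<lambda>j\<in>J. a j x)) x" if "i \<in> I" "x \<in> U" for i x
    by (rule pd_compose(1)) (use Suc.prems(1) pa that in auto)
  ultimately show ?case unfolding Cn.simps by blast
qed

lemma smooth_on_compose:
  "smooth_on J V T \<Longrightarrow> (\<And>j. j \<in> J \<Longrightarrow> smooth_on I U (a j)) \<Longrightarrow> smooth_on I U (\<lambda>x. T (\<lambda>j\<in>J. a j x))"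
  using Cn_compose by (simp add: smooth_on_lift[OF U])

end

subsection \<open>A smooth step\<close>

text \<open>
  A sequence of functions of one variable in which each member is the derivative of its
  predecessor plays the role of a smooth function of one variable.
\<close>

lemma smooth_on_compose1:
  fixes h :: "nat \<Rightarrow> real \<Rightarrow> real"
  assumes U: "openin (powertop_real I) U"
    and h: "\<And>n t. t \<in> A \<Longrightarrow> (h n has_real_derivative h (Suc n) t) (at t)"
    and f: "smooth_on I U f" "\<And>x. x \<in> U \<Longrightarrow> f x \<in> A"
  shows "smooth_on I U (\<lambda>x. h m (f x))"
proof -
  note fC = smooth_on_imp_Cn[OF coord_openin_subset[OF U] f(1)]
  have "Cn I U n (\<lambda>x. h m (f x))" for n
  proof (induction n arbitrary: m)
    case 0
    have "continuous_on A (h m)" using h by (meson DERIV_isCont continuous_at_imp_continuous_on)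
    then show ?case using fC[of 0] f(2) by (auto intro: continuous_on_compose2)
  next
    case (Suc n)
    have "pdiff i f x" if "i \<in> I" "x \<in> U" for i x using fC[of "Suc 0"] that by simp
    note pd = pd_compose1[OF this h[OF f(2)]]
    have "Cn I U n (pderiv_at i (\<lambda>x. h m (f x)))" if i: "i \<in> I" for i
      by (subst Cn_cong[OF U, where g="\<lambda>x. h (Suc m) (f x) * pderiv_at i f x"])
         (use i fC[of "Suc n"] Suc pd in \<open>auto intro: Cn_mult[OF U]\<close>)
    then show ?case using Cn_continuous[OF Suc[of m]] pd(1) by auto
  qed
  then show ?thesis by (simp add: smooth_on_lift[OF U])
qed

lemma smooth_on_divide:
  assumes U: "openin (powertop_real I) U" and "smooth_on I U f" "smooth_on I U g" "\<And>x. x \<in> U \<Longrightarrow> g x \<noteq> 0"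
  shows "smooth_on I U (\<lambda>x. f x / g x)"
proof -
  define h :: "nat \<Rightarrow> real \<Rightarrow> real" where "h n t = (-1) ^ n * fact n / t ^ Suc n" for n t
  have "(h n has_real_derivative h (Suc n) t) (at t)" if "t \<in> - {0}" for n t
  proof -
    have "((\<lambda>t. (-1) ^ n * fact n * inverse (t ^ Suc n)) has_real_derivative
        (-1) ^ n * fact n * (- (inverse (t ^ Suc n) * (real (Suc n) * t ^ n) * inverse (t ^ Suc n)))) (at t)"
      by (rule derivative_eq_intros refl | use that in simp)+
    also have "(-1) ^ n * fact n * (- (inverse (t ^ Suc n) * (real (Suc n) * t ^ n) * inverse (t ^ Suc n))) = h (Suc n) t"
      using that by (simp add: h_def field_simps)
    finally show ?thesis by (simp add: h_def[abs_def] divide_inverse)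
  qed
  then have "smooth_on I U (\<lambda>x. h 0 (g x))"
    by (rule smooth_on_compose1[where h=h and A="- {0}", OF U _ assms(3)]) (use assms(4) in auto)
  from smooth_on_mult[OF U assms(2) this] show ?thesis by (simp add: h_def)
qed

text \<open>
  The functions \<open>P(1/t) exp(-1/t)\<close>, continued by \<open>0\<close>. This class is closed under
  differentiation, which is why \<open>exp(-1/t)\<close> is smooth at \<open>0\<close>.
\<close>

definition flat :: "real poly \<Rightarrow> real \<Rightarrow> real" where
  "flat P t = (if t > 0 then poly P (1 / t) * exp (- 1 / t) else 0)"

lemma poly_exp_tendsto_0: "((\<lambda>u. poly P u * exp (- u)) \<longlongrightarrow> (0::real)) at_top"
proof -
  have "((\<lambda>u. \<Sum>i\<le>degree P. coeff P i * (u ^ i / exp u)) \<longlongrightarrow> (\<Sum>i\<le>degree P. coeff P i * 0)) at_top"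
    by (intro tendsto_sum tendsto_mult tendsto_const tendsto_power_div_exp_0)
  then show ?thesis by (simp add: poly_altdef exp_minus divide_inverse sum_distrib_right mult.assoc)
qed

text \<open>
  At \<open>0\<close> the difference quotient tends to \<open>0\<close> because in \<open>u = 1/t\<close> the exponential dominates
  every polynomial.
\<close>

lemma flat_deriv: "(flat P has_real_derivative flat ([:0, 0, 1:] * (P - pderiv P)) t) (at t)"
proof -
  consider "t > 0" | "t < 0" | "t = 0" by linarith
  then show ?thesis
  proof cases
    case 1
    have "((\<lambda>t. poly P (1 / t) * exp (- 1 / t)) has_real_derivative
      poly (pderiv P) (1 / t) * (- 1 / t ^ 2) * exp (- 1 / t) + poly P (1 / t) * (exp (- 1 / t) * (1 / t ^ 2))) (at t)"
      using 1 by (auto intro!: derivative_eq_intros poly_DERIV DERIV_chain2[where f="poly P"]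
          simp: power2_eq_square field_simps)
    also have "poly (pderiv P) (1 / t) * (- 1 / t ^ 2) * exp (- 1 / t) + poly P (1 / t) * (exp (- 1 / t) * (1 / t ^ 2))
       = flat ([:0, 0, 1:] * (P - pderiv P)) t"
      using 1 by (simp add: flat_def field_simps power2_eq_square)
    finally show ?thesis
      by (rule has_field_derivative_transform_within_open[where S="{0<..}"]) (use 1 in \<open>auto simp: flat_def\<close>)
  next
    case 2
    have "((\<lambda>t. 0) has_real_derivative 0) (at t)" by simp
    then have "(flat P has_real_derivative 0) (at t)"
      by (rule has_field_derivative_transform_within_open[where S="{..<0}"]) (use 2 in \<open>auto simp: flat_def\<close>)
    then show ?thesis using 2 by (simp add: flat_def)
  next
    case 3
    have "((\<lambda>h. poly ([:0, 1:] * P) (inverse h) * exp (- inverse h)) \<longlongrightarrow> 0) (at_right 0)"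
      by (rule filterlim_compose[OF poly_exp_tendsto_0 filterlim_inverse_at_top_right])
    then have r: "((\<lambda>h. (flat P h - flat P 0) / (h - 0)) \<longlongrightarrow> 0) (at_right 0)"
      by (rule Lim_transform_eventually)
        (auto simp: eventually_at_filter flat_def field_simps intro!: always_eventually)
    have "((\<lambda>h::real. 0::real) \<longlongrightarrow> 0) (at_left 0)" by simp
    then have l: "((\<lambda>h. (flat P h - flat P 0) / (h - 0)) \<longlongrightarrow> 0) (at_left 0)"
      by (rule Lim_transform_eventually)
        (auto simp: eventually_at_filter flat_def intro!: always_eventually)
    from filterlim_split_at[OF l r] show ?thesis
      unfolding has_field_derivative_iff 3 by (simp add: flat_def)
  qed
qed

lemma smooth_on_flat:
  assumes "openin (powertop_real I) U" "smooth_on I U f"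
  shows "smooth_on I U (\<lambda>x. flat P (f x))"
proof -
  define h where "h n = flat (((\<lambda>P. [:0, 0, 1:] * (P - pderiv P)) ^^ n) P)" for n
  have "(h n has_real_derivative h (Suc n) t) (at t)" for n t
    unfolding h_def using flat_deriv by simp
  from smooth_on_compose1[where h=h and m=0 and A=UNIV, OF assms(1) this assms(2)]
  show ?thesis by (simp add: h_def)
qed

definition step :: "real \<Rightarrow> real" where
  "step t = flat 1 t / (flat 1 t + flat 1 (1 - t))"

lemma step_denominator: "flat 1 t + flat 1 (1 - t) > 0"
  by (cases "t > 0") (auto simp: flat_def add_pos_pos)

lemma smooth_on_step:
  assumes "openin (powertop_real I) U" "smooth_on I U f"
  shows "smooth_on I U (\<lambda>x. step (f x))"
  unfolding step_def using step_denominator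
  by (intro smooth_on_divide smooth_on_add smooth_on_flat smooth_on_minus smooth_on_const assms) (auto simp: less_imp_neq[THEN not_sym])

lemma step_eq: "t \<ge> 1 \<Longrightarrow> step t = 1" "t \<le> 0 \<Longrightarrow> step t = 0"
  using step_denominator[of t] by (auto simp: step_def flat_def)

subsection \<open>Symmetry of the partial derivatives\<close>

lemma continuous_on_upd2:
  assumes "continuous_on U g" "\<And>u t. u \<in> A \<Longrightarrow> t \<in> B \<Longrightarrow> x(i := u, j := t) \<in> U"
  shows "continuous_on (B \<times> A) (\<lambda>(t, u). g (x(i := u, j := t)))"
proof -
  have "continuous_on (B \<times> A) (\<lambda>z. x(i := snd z, j := fst z))"
  proof (rule continuous_on_coordinatewise_then_product)
    fix k show "continuous_on (B \<times> A) (\<lambda>z. (x(i := snd z, j := fst z)) k)"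
      by (cases "k = j"; cases "k = i") (auto intro!: continuous_intros)
  qed
  moreover have "(\<lambda>z. x(i := snd z, j := fst z)) ` (B \<times> A) \<subseteq> U" using assms(2) by auto
  ultimately have "continuous_on (B \<times> A) (\<lambda>z. g (x(i := snd z, j := fst z)))"
    by (rule continuous_on_compose2[OF assms(1)])
  then show ?thesis unfolding case_prod_unfold .
qed

text \<open>
  Integrate \<open>\<partial>\<^sub>i f\<close> in the direction \<open>i\<close> and differentiate under the integral sign in the
  direction \<open>j\<close>: this gives \<open>\<partial>\<^sub>j f(s) - \<partial>\<^sub>j f(a) = \<integral>\<^sub>a\<^sup>s \<partial>\<^sub>j \<partial>\<^sub>i f\<close>. Differentiating in \<open>s\<close>
  exchanges the derivatives.
\<close>

lemma pderiv_at_commute: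
  assumes I: "finite I" and U: "openin (powertop_real I) U" and f: "smooth_on I U f"
    and x: "x \<in> U" and ij: "i \<in> I" "j \<in> I"
  shows "pderiv_at i (pderiv_at j f) x = pderiv_at j (pderiv_at i f) x"
proof (cases "i = j")
  case False
  note U' = coord_openin_subset[OF U]
  obtain e where e: "e > 0" "\<And>y. y \<in> coord_space I \<Longrightarrow> (\<And>k. k \<in> I \<Longrightarrow> \<bar>y k - x k\<bar> < e) \<Longrightarrow> y \<in> U"
    using coord_box[OF U x I] by metis
  define z where "z s t = x(i := s, j := t)" for s t
  have zU: "z s t \<in> U" if "\<bar>s - x i\<bar> < e" "\<bar>t - x j\<bar> < e" for s t
    unfolding z_def by (rule e(2)) (use x ij U' e(1) that in \<open>auto intro!: coord_upd\<close>)
  have z': "z s t = (z s t')(j := t)" "z s t = (z s' t)(i := s)" for s t s' t'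
    using False by (auto simp: z_def)
  note D = smooth_on_pderiv[OF U' f]
  have di: "((\<lambda>s. g (z s t)) has_real_derivative pderiv_at i g (z s t)) (at s)"
    if "smooth_on I U g" "\<bar>s - x i\<bar> < e" "\<bar>t - x j\<bar> < e" for g s t
  proof -
    have eq: "(z s t)(i := u) = z u t" for u by (rule z'(2)[symmetric])
    have "z s t i = s" using False by (simp add: z_def)
    then show ?thesis
      using pdiffD[OF smooth_on_pdiff[OF U' that(1) ij(1) zU[OF that(2,3)]]] unfolding eq by simp
  qed
  have dj: "((\<lambda>t. g (z s t)) has_real_derivative pderiv_at j g (z s t)) (at t)"
    if "smooth_on I U g" "\<bar>s - x i\<bar> < e" "\<bar>t - x j\<bar> < e" for g s t
  proof -
    have eq: "(z s t)(j := u) = z s u" for u by (rule z'(1)[symmetric])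
    have "z s t j = t" by (simp add: z_def)
    then show ?thesis
      using pdiffD[OF smooth_on_pdiff[OF U' that(1) ij(2) zU[OF that(2,3)]]] unfolding eq by simp
  qed
  \<comment> \<open>An interval around \<open>x\<^sub>i\<close> for the integration and an open interval around \<open>x\<^sub>j\<close> for the
    differentiation.\<close>
  define a b where "a = x i - e / 2" and "b = x i + e / 2"
  define T where "T = {x j - e / 2 <..< x j + e / 2}"
  have sb: "\<bar>s - x i\<bar> < e" if "s \<in> {a..b}" for s using that e(1) by (auto simp: a_def b_def abs_less_iff field_simps)
  have tb: "\<bar>t - x j\<bar> < e" if "t \<in> T" for t using that e(1) by (auto simp: T_def abs_less_iff field_simps)
  have cont: "continuous_on (T \<times> {a..b}) (\<lambda>(t, u). g (z u t))" if "smooth_on I U g" for g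
    unfolding z_def
    by (rule continuous_on_upd2[OF smooth_on_continuous[OF U' that]]) (use zU sb tb in \<open>auto simp: z_def\<close>)
  have contu: "continuous_on {a..b} (\<lambda>u. g (z u t))" if "smooth_on I U g" "t \<in> T" for g t
  proof -
    have "continuous_on {a..b} (Pair t)"
      by (rule continuous_on_Pair[OF continuous_on_const continuous_on_id])
    from continuous_on_compose2[OF cont[OF that(1)] this] that(2) show ?thesis by auto
  qed
  have 1: "integral {a..s} (\<lambda>u. pderiv_at i f (z u t)) = f (z s t) - f (z a t)" if "s \<in> {a..b}" "t \<in> T" for s t
  proof (rule integral_unique, rule fundamental_theorem_of_calculus)
    show "a \<le> s" using that by simp
    show "((\<lambda>s. f (z s t)) has_vector_derivative pderiv_at i f (z u t)) (at u within {a..s})" if "u \<in> {a..s}" for u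
      unfolding has_real_derivative_iff_has_vector_derivative[symmetric]
      by (rule has_field_derivative_at_within, rule di[OF f sb tb]) (use \<open>s \<in> {a..b}\<close> \<open>t \<in> T\<close> that in auto)
  qed
  have xT: "x j \<in> T" using e(1) by (simp add: T_def)
  have 2: "integral {a..s} (\<lambda>u. pderiv_at j (pderiv_at i f) (z u (x j))) = pderiv_at j f (z s (x j)) - pderiv_at j f (z a (x j))"
    if s: "s \<in> {a..b}" for s
  proof -
    have "((\<lambda>t. integral (cbox a s) (\<lambda>u. pderiv_at i f (z u t))) has_field_derivative
        integral (cbox a s) (\<lambda>u. pderiv_at j (pderiv_at i f) (z u (x j)))) (at (x j) within T)"
    proof (rule leibniz_rule_field_derivative)
      show "((\<lambda>t. pderiv_at i f (z u t)) has_real_derivative pderiv_at j (pderiv_at i f) (z u t)) (at t within T)"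
        if "t \<in> T" "u \<in> cbox a s" for t u
        by (rule has_field_derivative_at_within, rule dj[OF D sb tb]) (use that s ij in auto)
      show "(\<lambda>u. pderiv_at i f (z u t)) integrable_on cbox a s" if "t \<in> T" for t
        by (rule integrable_continuous, rule continuous_on_subset[OF contu[OF D]]) (use that s ij in auto)
      show "continuous_on (T \<times> cbox a s) (\<lambda>(t, u). pderiv_at j (pderiv_at i f) (z u t))"
        by (rule continuous_on_subset[OF cont[OF smooth_on_pderiv[OF U' D]]]) (use s ij in auto)
      show "x j \<in> T" by (rule xT)
      show "convex T" by (simp add: T_def)
    qed
    then have "((\<lambda>t. f (z s t) - f (z a t)) has_real_derivative
        integral (cbox a s) (\<lambda>u. pderiv_at j (pderiv_at i f) (z u (x j)))) (at (x j) within T)"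
      by (rule has_field_derivative_transform_within[where d=1]) (use 1[OF s] xT in auto)
    moreover have "at (x j) within T = at (x j)" by (rule at_within_open[OF xT]) (simp add: T_def)
    moreover have "((\<lambda>t. f (z s t) - f (z a t)) has_real_derivative
        pderiv_at j f (z s (x j)) - pderiv_at j f (z a (x j))) (at (x j))"
      by (intro DERIV_diff dj f sb) (use s e in auto)
    ultimately show ?thesis by (metis DERIV_unique box_real(2))
  qed
  have xab: "x i \<in> {a..b}" "x i \<in> {a<..<b}" using e(1) by (auto simp: a_def b_def)
  have "((\<lambda>s. integral {a..s} (\<lambda>u. pderiv_at j (pderiv_at i f) (z u (x j)))) has_real_derivative
      pderiv_at j (pderiv_at i f) (z (x i) (x j))) (at (x i) within {a..b})"
    by (rule integral_has_real_derivative[OF contu[OF smooth_on_pderiv[OF U' D]] xab(1)]) (use ij xT in auto)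
  then have "((\<lambda>s. pderiv_at j f (z s (x j)) - pderiv_at j f (z a (x j))) has_real_derivative
      pderiv_at j (pderiv_at i f) (z (x i) (x j))) (at (x i) within {a..b})"
    by (rule has_field_derivative_transform_within[where d=1]) (use 2 xab in auto)
  moreover have "at (x i) within {a..b} = at (x i)" using at_within_interior[of "x i" "{a..b}"] xab by simp
  moreover have "((\<lambda>s. pderiv_at j f (z s (x j)) - pderiv_at j f (z a (x j))) has_real_derivative
      pderiv_at i (pderiv_at j f) (z (x i) (x j)) - 0) (at (x i))"
    by (intro DERIV_diff DERIV_const di D ij) (use e in auto)
  ultimately have "pderiv_at j (pderiv_at i f) (z (x i) (x j)) = pderiv_at i (pderiv_at j f) (z (x i) (x j))"
    by (metis DERIV_unique diff_zero)
  then show ?thesis by (simp add: z_def)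
qed simp

lemma iter_pderiv_move:
  assumes "finite I" "openin (powertop_real I) U" "smooth_on I U f" "x \<in> U" "set (as @ i # bs) \<subseteq> I"
  shows "iter_pderiv (as @ i # bs) f x = iter_pderiv (i # as @ bs) f x"
  using assms(4,5)
proof (induction as arbitrary: x)
  case (Cons c cs)
  let ?g = "iter_pderiv (cs @ bs) f"
  have "iter_pderiv ((c # cs) @ i # bs) f x = pderiv_at c (pderiv_at i ?g) x"
    using pderiv_at_cong[OF assms(2), of "iter_pderiv (cs @ i # bs) f" "pderiv_at i ?g" x c] Cons by auto
  also have "\<dots> = pderiv_at i (pderiv_at c ?g) x"
    by (rule pderiv_at_commute[OF assms(1,2) smooth_on_iter_pderiv[OF coord_openin_subset[OF assms(2)] assms(3)]])
       (use Cons in auto)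
  finally show ?case by simp
qed simp

lemma iter_pderiv_perm:
  assumes I: "finite I" and U: "openin (powertop_real I) U" and f: "smooth_on I U f"
    and x: "x \<in> U" "set is \<subseteq> I" and eq: "mset is = mset js"
  shows "iter_pderiv is f x = iter_pderiv js f x"
  using x eq
proof (induction "is" arbitrary: js x)
  case (Cons i ks)
  then have "i \<in> set js" by (metis list.set_intros(1) mset_eq_setD)
  then obtain as bs where js: "js = as @ i # bs" by (meson split_list)
  have ms: "mset ks = mset (as @ bs)" using Cons.prems(3) by (simp add: js)
  have sub: "set js \<subseteq> I" using Cons.prems(2,3) by (metis mset_eq_setD)
  have "iter_pderiv js f x = iter_pderiv (i # as @ bs) f x"
    using iter_pderiv_move[OF I U f Cons.prems(1), of as i bs] sub by (simp add: js)
  also have "\<dots> = iter_pderiv (i # ks) f x"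
    using pderiv_at_cong[OF U, of "iter_pderiv (as @ bs) f" "iter_pderiv ks f" x i] Cons.IH[OF _ _ ms] Cons.prems by auto
  finally show ?case by simp
qed simp

text \<open>
  Hence the enumeration of the multi-index that \<open>mset_pderiv\<close> selects is irrelevant for smooth
  functions.
\<close>

lemma mset_pderiv_eq:
  assumes "finite I" "openin (powertop_real I) U" "smooth_on I U f" "x \<in> U" "set is \<subseteq> I"
  shows "mset_pderiv (mset is) f x = iter_pderiv is f x"
proof -
  have "mset (SOME js. mset js = mset is) = mset is" by (rule someI[of _ "is"]) simp
  then show ?thesis
    unfolding mset_pderiv_def using iter_pderiv_perm[OF assms, of "SOME js. mset js = mset is"] by simp
qed

lemma mset_pderiv_list:
  obtains js where "mset js = \<Lambda>" "\<And>f x. mset_pderiv \<Lambda> f x = iter_pderiv js f x"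
proof (rule that)
  show "mset (SOME js. mset js = \<Lambda>) = \<Lambda>" by (rule someI_ex) (rule ex_mset)
qed (simp add: mset_pderiv_def)

subsection \<open>Hadamard's lemma\<close>

definition seg :: "'i set \<Rightarrow> ('i \<Rightarrow> real) \<Rightarrow> real \<Rightarrow> ('i \<Rightarrow> real) \<Rightarrow> 'i \<Rightarrow> real" where
  "seg I p s y = (\<lambda>i\<in>I. p i + s * (y i - p i))"

text \<open>
  The integral over \<open>s\<close> in the unit interval of \<open>s\<^sup>a h(p + s (y - p))\<close>. Hadamard coefficients
  are the case \<open>a = 0\<close>; each differentiation in \<open>y\<close> produces one more factor \<open>s\<close>, so the weight
  makes the family closed under derivatives.
\<close>

definition seg_int :: "'i set \<Rightarrow> ('i \<Rightarrow> real) \<Rightarrow> nat \<Rightarrow> (('i \<Rightarrow> real) \<Rightarrow> real) \<Rightarrow> ('i \<Rightarrow> real) \<Rightarrow> real" where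
  "seg_int I p a h y = integral (cbox 0 1) (\<lambda>s. s ^ a * h (seg I p s y))"

context
  fixes I :: "'i set" and p :: "'i \<Rightarrow> real" and e :: real and Bx
  assumes I: "finite I" and p: "p \<in> coord_space I" and e: "e > 0"
  defines "Bx \<equiv> {y \<in> coord_space I. \<forall>i\<in>I. \<bar>y i - p i\<bar> < e}"
begin

lemma Bx_open: "openin (powertop_real I) Bx"
  unfolding Bx_def by (rule coord_open_box[OF I])

lemma Bx_subset: "Bx \<subseteq> coord_space I" by (auto simp: Bx_def)

lemma seg_Bx: "y \<in> Bx \<Longrightarrow> s \<in> cbox 0 1 \<Longrightarrow> seg I p s y \<in> Bx"
proof -
  assume y: "y \<in> Bx" and s: "s \<in> cbox 0 (1::real)"
  have "\<bar>s * (y i - p i)\<bar> < e" if "i \<in> I" for i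
  proof -
    have "\<bar>s * (y i - p i)\<bar> \<le> 1 * \<bar>y i - p i\<bar>" unfolding abs_mult
      by (rule mult_right_mono) (use s in auto)
    then show ?thesis using y that by (auto simp: Bx_def)
  qed
  then show ?thesis by (auto simp: seg_def Bx_def)
qed

lemma seg_cont:
  assumes "continuous_on Bx h"
  shows "continuous_on (Bx \<times> cbox 0 1) (\<lambda>z. h (seg I p (snd z) (fst z)))"
proof (rule continuous_on_compose2[OF assms])
  show "continuous_on (Bx \<times> cbox 0 1) (\<lambda>z. seg I p (snd z) (fst z))"
  proof (rule continuous_on_coordinatewise_then_product)
    fix k
    have *: "continuous_on A (\<lambda>z. fst z k)" for A :: "(('i \<Rightarrow> real) \<times> real) set"
      by (rule continuous_on_product_then_coordinatewise) (intro continuous_intros)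
    show "continuous_on (Bx \<times> cbox 0 1) (\<lambda>z. seg I p (snd z) (fst z) k)"
      by (cases "k \<in> I") (auto simp: seg_def intro!: continuous_intros *)
  qed
qed (auto intro: seg_Bx)

lemma seg_deriv:
  assumes h: "smooth_on I Bx h" and c: "\<And>j. j \<in> I \<Longrightarrow> (c j has_real_derivative c' j) (at t)"
    and Bx: "(\<lambda>j\<in>I. c j t) \<in> Bx"
  shows "((\<lambda>t. h (\<lambda>j\<in>I. c j t)) has_real_derivative (\<Sum>j\<in>I. pderiv_at j h (\<lambda>j\<in>I. c j t) * c' j)) (at t)"
  by (rule chain_rule[OF I Bx_open])
     (use assms in \<open>auto intro: smooth_on_continuous[OF Bx_subset] smooth_on_pderiv[OF Bx_subset] smooth_on_pdiff[OF Bx_subset]\<close>)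

lemma seg_int_cont:
  assumes "smooth_on I Bx h" shows "continuous_on Bx (seg_int I p a h)"
proof -
  have "continuous_on (Bx \<times> cbox 0 1) (\<lambda>(y, s). s ^ a * h (seg I p s y))"
    unfolding case_prod_unfold
    by (intro continuous_intros seg_cont smooth_on_continuous[OF Bx_subset assms])
  then show ?thesis unfolding seg_int_def[abs_def] by (rule integral_continuous_on_param)
qed

lemma seg_int_deriv:
  assumes h: "smooth_on I Bx h" and y: "y \<in> Bx" and i: "i \<in> I"
  shows "pdiff i (seg_int I p a h) y" "pderiv_at i (seg_int I p a h) y = seg_int I p (Suc a) (pderiv_at i h) y"
proof -
  define T where "T = {p i - e <..< p i + e}"
  have yt: "y(i := t) \<in> Bx" if "t \<in> T" for t
    using y i that coord_upd[of y I i t] by (auto simp: Bx_def T_def abs_less_iff)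
  have yT: "y i \<in> T" using y i by (auto simp: T_def Bx_def abs_less_iff)
  have cont: "continuous_on (T \<times> cbox 0 1) (\<lambda>(t, s). s ^ b * g (seg I p s (y(i := t))))" if g: "smooth_on I Bx g" for b g
  proof -
    have "continuous_on (T \<times> cbox 0 1) (\<lambda>z. (y(i := fst z), snd z))"
    proof (intro continuous_intros continuous_on_coordinatewise_then_product)
      show "continuous_on (T \<times> cbox 0 1) (\<lambda>z. (y(i := fst z)) k)" for k
        by (cases "k = i") (auto intro!: continuous_intros)
    qed
    moreover have "(\<lambda>z. (y(i := fst z), snd z)) ` (T \<times> cbox 0 1) \<subseteq> Bx \<times> cbox 0 1" using yt by auto
    ultimately have "continuous_on (T \<times> cbox 0 1) (\<lambda>z. g (seg I p (snd (y(i := fst z), snd z)) (fst (y(i := fst z), snd z))))"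
      by (rule continuous_on_compose2[OF seg_cont[OF smooth_on_continuous[OF Bx_subset g]]])
    then show ?thesis unfolding case_prod_unfold fst_conv snd_conv by (intro continuous_intros)
  qed
  have "((\<lambda>t. integral (cbox 0 1) (\<lambda>s. s ^ a * h (seg I p s (y(i := t))))) has_field_derivative
      integral (cbox 0 1) (\<lambda>s. s ^ Suc a * pderiv_at i h (seg I p s (y(i := y i))))) (at (y i) within T)"
  proof (rule leibniz_rule_field_derivative[OF _ _ _ yT])
    fix t s :: real assume ts: "t \<in> T" "s \<in> cbox 0 1"
    have "((\<lambda>t. h (\<lambda>j\<in>I. p j + s * ((y(i := t)) j - p j))) has_real_derivative
        (\<Sum>j\<in>I. pderiv_at j h (\<lambda>j\<in>I. p j + s * ((y(i := t)) j - p j)) * (if j = i then s else 0))) (at t)"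
    proof (rule seg_deriv[OF h])
      show "((\<lambda>t. p j + s * ((y(i := t)) j - p j)) has_real_derivative (if j = i then s else 0)) (at t)" for j
        by (cases "j = i") (auto intro!: derivative_eq_intros)
      show "(\<lambda>j\<in>I. p j + s * ((y(i := t)) j - p j)) \<in> Bx"
        using seg_Bx[OF yt[OF ts(1)] ts(2)] unfolding seg_def .
    qed
    also have "(\<Sum>j\<in>I. pderiv_at j h (\<lambda>j\<in>I. p j + s * ((y(i := t)) j - p j)) * (if j = i then s else 0))
       = pderiv_at i h (seg I p s (y(i := t))) * s"
      using i I by (simp add: seg_def if_distrib[of "\<lambda>x. _ * x"] cong: if_cong)
    finally have "((\<lambda>t. h (seg I p s (y(i := t)))) has_real_derivative pderiv_at i h (seg I p s (y(i := t))) * s) (at t)"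
      unfolding seg_def .
    from DERIV_cmult[OF this, of "s ^ a"]
    show "((\<lambda>t. s ^ a * h (seg I p s (y(i := t)))) has_field_derivative s ^ Suc a * pderiv_at i h (seg I p s (y(i := t)))) (at t within T)"
      by (simp add: has_field_derivative_at_within mult_ac)
  next
    fix t assume t: "t \<in> T"
    have "continuous_on (cbox 0 1) (Pair t)"
      by (rule continuous_on_Pair[OF continuous_on_const continuous_on_id])
    moreover have "Pair t ` cbox 0 1 \<subseteq> T \<times> cbox 0 1" using t by auto
    ultimately have "continuous_on (cbox 0 1) (\<lambda>s. case (t, s) of (t, s) \<Rightarrow> s ^ a * h (seg I p s (y(i := t))))"
      by (rule continuous_on_compose2[OF cont[OF h]])
    then show "(\<lambda>s. s ^ a * h (seg I p s (y(i := t)))) integrable_on cbox 0 1"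
      unfolding case_prod_conv by (rule integrable_continuous)
  next
    show "continuous_on (T \<times> cbox 0 1) (\<lambda>(t, s). s ^ Suc a * pderiv_at i h (seg I p s (y(i := t))))"
      by (rule cont[OF smooth_on_pderiv[OF Bx_subset h i]])
  qed (simp add: T_def)
  moreover have "at (y i) within T = at (y i)" by (rule at_within_open[OF yT]) (simp add: T_def)
  ultimately have *: "((\<lambda>t. seg_int I p a h (y(i := t))) has_real_derivative seg_int I p (Suc a) (pderiv_at i h) y) (at (y i))"
    by (simp only: seg_int_def fun_upd_triv)
  show "pdiff i (seg_int I p a h) y" "pderiv_at i (seg_int I p a h) y = seg_int I p (Suc a) (pderiv_at i h) y"
    by (rule pdiffI[OF *])+
qed

text \<open>
  Induction over the differentiability class, for all weights and all integrands at the same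
  time.
\<close>

lemma smooth_on_seg_int:
  assumes "smooth_on I Bx h" shows "smooth_on I Bx (seg_int I p a h)"
proof -
  have "Cn I Bx n (seg_int I p a h)" if "smooth_on I Bx h" for n a h
    using that
  proof (induction n arbitrary: a h)
    case (Suc n)
    have "Cn I Bx n (pderiv_at i (seg_int I p a h))" if i: "i \<in> I" for i
      using Cn_cong[OF Bx_open, of "pderiv_at i (seg_int I p a h)" "seg_int I p (Suc a) (pderiv_at i h)" n]
        seg_int_deriv(2)[OF Suc.prems _ i] Suc.IH[OF smooth_on_pderiv[OF Bx_subset Suc.prems i]] by blast
    then show ?case using seg_int_cont seg_int_deriv(1) Suc.prems by auto
  qed (auto intro: seg_int_cont)
  then show ?thesis using assms by (simp add: smooth_on_lift[OF Bx_open])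
qed

text \<open>
  Integrate the derivative of \<open>h\<close> along the segment from \<open>p\<close> to \<open>y\<close>. The coefficients are smooth
  by \<open>smooth_on_seg_int\<close>.
\<close>

lemma hadamard:
  assumes h: "smooth_on I Bx h" and y: "y \<in> Bx"
  shows "h y = h p + (\<Sum>i\<in>I. (y i - p i) * seg_int I p 0 (pderiv_at i h) y)"
    and "i \<in> I \<Longrightarrow> seg_int I p 0 (pderiv_at i h) p = pderiv_at i h p"
proof -
  \<comment> \<open>The segment starts at \<open>p\<close>, ends at \<open>y\<close>, and is constant if \<open>y = p\<close>.\<close>
  have seg0: "seg I p 0 y = p" and seg1: "seg I p 1 y = y" and segp: "seg I p s p = p" for s
    using p y by (auto simp: seg_def Bx_def PiE_iff extensional_def fun_eq_iff)
  have cont: "continuous_on (cbox 0 1) (\<lambda>s. pderiv_at j h (seg I p s y))" if j: "j \<in> I" for j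
  proof -
    have "continuous_on (cbox 0 (1::real)) (\<lambda>s. (y, s))"
      by (intro continuous_intros)
    moreover have "(\<lambda>s. (y, s)) ` cbox 0 1 \<subseteq> Bx \<times> cbox 0 1" using y by auto
    ultimately have "continuous_on (cbox 0 1) (\<lambda>s. pderiv_at j h (seg I p (snd (y, s)) (fst (y, s))))"
      by (rule continuous_on_compose2[OF seg_cont[OF smooth_on_continuous[OF Bx_subset smooth_on_pderiv[OF Bx_subset h j]]]])
    then show ?thesis by simp
  qed
  have "((\<lambda>s. \<Sum>j\<in>I. pderiv_at j h (seg I p s y) * (y j - p j)) has_integral h (seg I p 1 y) - h (seg I p 0 y)) {0..1}"
  proof (rule fundamental_theorem_of_calculus)
    fix s :: real assume s: "s \<in> {0..1}"
    have "((\<lambda>s. h (\<lambda>j\<in>I. p j + s * (y j - p j))) has_real_derivative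
        (\<Sum>j\<in>I. pderiv_at j h (\<lambda>j\<in>I. p j + s * (y j - p j)) * (y j - p j))) (at s)"
    proof (rule seg_deriv[OF h])
      show "((\<lambda>s. p j + s * (y j - p j)) has_real_derivative (y j - p j)) (at s)" for j
        by (auto intro!: derivative_eq_intros)
      show "(\<lambda>j\<in>I. p j + s * (y j - p j)) \<in> Bx"
        using seg_Bx[OF y] s unfolding seg_def by simp
    qed
    then show "((\<lambda>s. h (seg I p s y)) has_vector_derivative (\<Sum>j\<in>I. pderiv_at j h (seg I p s y) * (y j - p j))) (at s within {0..1})"
      unfolding seg_def by (simp add: has_field_derivative_at_within flip: has_real_derivative_iff_has_vector_derivative)
  qed simp
  then have "h y - h p = integral (cbox 0 1) (\<lambda>s. \<Sum>j\<in>I. pderiv_at j h (seg I p s y) * (y j - p j))"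
    unfolding seg0 seg1 by (simp add: integral_unique)
  also have "\<dots> = (\<Sum>j\<in>I. integral (cbox 0 1) (\<lambda>s. pderiv_at j h (seg I p s y) * (y j - p j)))"
    by (rule integral_sum[OF I]) (intro integrable_continuous continuous_intros cont)
  also have "\<dots> = (\<Sum>i\<in>I. (y i - p i) * seg_int I p 0 (pderiv_at i h) y)"
    by (simp add: seg_int_def mult.commute)
  finally show "h y = h p + (\<Sum>i\<in>I. (y i - p i) * seg_int I p 0 (pderiv_at i h) y)" by simp
  show "seg_int I p 0 (pderiv_at i h) p = pderiv_at i h p" if "i \<in> I"
    by (simp add: seg_int_def segp)
qed

end

subsection \<open>Taylor polynomials\<close>

text \<open>
  The monomial \<open>(z - p)\<^sup>\<Lambda> / \<Lambda>!\<close>, normalised so that its partial derivatives are again such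
  monomials with coefficient \<open>1\<close>.
\<close>

definition taylor_mono :: "'i set \<Rightarrow> ('i \<Rightarrow> real) \<Rightarrow> 'i multiset \<Rightarrow> ('i \<Rightarrow> real) \<Rightarrow> real" where
  "taylor_mono I p \<Lambda> z = (\<Prod>i\<in>I. (z i - p i) ^ count \<Lambda> i / fact (count \<Lambda> i))"

lemma smooth_on_taylor_mono:
  assumes "openin (powertop_real J) U" "\<And>i. i \<in> I \<Longrightarrow> smooth_on J U (\<lambda>x. a x i)" "\<And>i. i \<in> I \<Longrightarrow> smooth_on J U (\<lambda>x. b x i)"
  shows "smooth_on J U (\<lambda>x. taylor_mono I (b x) \<Lambda> (a x))"
  unfolding taylor_mono_def
  by (intro smooth_on_prod smooth_on_divide smooth_on_power smooth_on_minus smooth_on_const assms) auto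

lemma pderiv_taylor_mono:
  assumes I: "finite I" and j: "j \<in> I"
  shows "pderiv_at j (taylor_mono I p \<Lambda>) = (if j \<in># \<Lambda> then taylor_mono I p (\<Lambda> - {#j#}) else (\<lambda>_. 0))"
proof
  fix z
  define c where "c = count \<Lambda> j"
  define R where "R = (\<Prod>i\<in>I - {j}. (z i - p i) ^ count \<Lambda> i / fact (count \<Lambda> i))"
  have eq: "taylor_mono I p \<Lambda>' (z(j := t)) = (t - p j) ^ count \<Lambda>' j / fact (count \<Lambda>' j) * R"
    if "\<And>i. i \<noteq> j \<Longrightarrow> count \<Lambda>' i = count \<Lambda> i" for t \<Lambda>'
    unfolding taylor_mono_def R_def prod.remove[OF I j] using that by (auto intro!: prod.cong)
  have "((\<lambda>t. (t - p j) ^ c / fact c * R) has_real_derivative real c * (z j - p j) ^ (c - 1) / fact c * R) (at (z j))"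
    by (auto intro!: derivative_eq_intros)
  then have D: "pderiv_at j (taylor_mono I p \<Lambda>) z = real c * (z j - p j) ^ (c - 1) / fact c * R"
    by (intro pdiffI(2)) (simp add: eq c_def)
  show "pderiv_at j (taylor_mono I p \<Lambda>) z = (if j \<in># \<Lambda> then taylor_mono I p (\<Lambda> - {#j#}) else (\<lambda>_. 0)) z"
  proof (cases "j \<in># \<Lambda>")
    case True
    then obtain m where m: "c = Suc m" unfolding c_def by (metis count_greater_zero_iff gr0_conv_Suc)
    have "taylor_mono I p (\<Lambda> - {#j#}) z = (z j - p j) ^ m / fact m * R"
      using eq[of "\<Lambda> - {#j#}" "z j"] m by (simp add: c_def)
    moreover have "real (Suc m) * X / fact (Suc m) = X / fact m" for X
      unfolding fact_Suc by (simp del: of_nat_Suc)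
    ultimately show ?thesis using D True m by simp
  next
    case False
    then have "c = 0" by (simp add: c_def not_in_iff)
    then show ?thesis using D False by simp
  qed
qed

lemma iter_pderiv_taylor_mono:
  assumes "finite I" "set is \<subseteq> I"
  shows "iter_pderiv is (taylor_mono I p \<Lambda>) = (if mset is \<subseteq># \<Lambda> then taylor_mono I p (\<Lambda> - mset is) else (\<lambda>_. 0))"
  using assms(2)
proof (induction "is")
  case (Cons j js)
  have z: "pderiv_at j (\<lambda>_. 0) = (\<lambda>_. 0)" by (rule ext) (rule pd_const)
  have "add_mset j (mset js) \<subseteq># \<Lambda> \<longleftrightarrow> mset js \<subseteq># \<Lambda> \<and> j \<in># \<Lambda> - mset js"
  proof safe
    assume a: "add_mset j (mset js) \<subseteq># \<Lambda>"
    then show "mset js \<subseteq># \<Lambda>" by (meson mset_subset_eq_insertD subset_mset.less_imp_le)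
    have "Suc (count (mset js) j) \<le> count \<Lambda> j" using mset_subset_eq_count[OF a, of j] by simp
    then show "j \<in># \<Lambda> - mset js" by (simp add: in_diff_count)
  next
    assume "mset js \<subseteq># \<Lambda>" "j \<in># \<Lambda> - mset js"
    then show "add_mset j (mset js) \<subseteq># \<Lambda>"
      by (auto simp: subseteq_mset_def in_diff_count)
  qed
  then show ?case using Cons pderiv_taylor_mono[OF assms(1), of j] z by (auto simp: diff_diff_add_mset)
qed simp

lemma taylor_mono_center:
  assumes "finite I" "set_mset \<Lambda> \<subseteq> I"
  shows "taylor_mono I p \<Lambda> p = (if \<Lambda> = {#} then 1 else 0)"
proof (cases "\<Lambda> = {#}")
  case False
  then obtain i where "i \<in># \<Lambda>" by auto
  then show ?thesis unfolding taylor_mono_def using assms False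
    by (intro trans[OF prod_zero[OF assms(1) bexI[of _ i]]]) auto
qed (simp add: taylor_mono_def)

lemma iter_pderiv_sum_scaled:
  assumes U: "openin (powertop_real I) U" and f: "\<And>k. k \<in> F \<Longrightarrow> smooth_on I U (f k)"
    and x: "x \<in> U" "set is \<subseteq> I"
  shows "iter_pderiv is (\<lambda>x. \<Sum>k\<in>F. c k * f k x) x = (\<Sum>k\<in>F. c k * iter_pderiv is (f k) x)"
  using x
proof (induction "is" arbitrary: x)
  case (Cons i js)
  note U' = coord_openin_subset[OF U]
  have "iter_pderiv (i # js) (\<lambda>x. \<Sum>k\<in>F. c k * f k x) x = pderiv_at i (\<lambda>x. \<Sum>k\<in>F. c k * iter_pderiv js (f k) x) x"
    using pderiv_at_cong[OF U, of "iter_pderiv js (\<lambda>x. \<Sum>k\<in>F. c k * f k x)" "\<lambda>x. \<Sum>k\<in>F. c k * iter_pderiv js (f k) x" x i] Cons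
    by auto
  also have "\<dots> = (\<Sum>k\<in>F. c k * pderiv_at i (iter_pderiv js (f k)) x)"
  proof (rule pdiffI(2), rule DERIV_sum, rule DERIV_cmult, rule pdiffD)
    show "pdiff i (iter_pderiv js (f k)) x" if "k \<in> F" for k
      by (rule smooth_on_pdiff[OF U' smooth_on_iter_pderiv[OF U' f[OF that]]]) (use Cons.prems in auto)
  qed
  finally show ?case by simp
qed simp

text \<open>
  At the centre all monomials vanish except the constant one, so differentiating along an index
  extracts exactly its coefficient.
\<close>

lemma iter_pderiv_taylor_poly:
  assumes I: "finite I" and F: "finite F" "\<And>\<Lambda>. \<Lambda> \<in> F \<Longrightarrow> set_mset \<Lambda> \<subseteq> I" and p: "p \<in> coord_space I"
    and js: "set is \<subseteq> I" "mset is \<in> F"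
  shows "iter_pderiv is (\<lambda>z. \<Sum>\<Lambda>\<in>F. c \<Lambda> * taylor_mono I p \<Lambda> z) p = c (mset is)"
proof -
  have U: "openin (powertop_real I) (coord_space I)" by (simp add: powertop_real_eq)
  have "iter_pderiv is (\<lambda>z. \<Sum>\<Lambda>\<in>F. c \<Lambda> * taylor_mono I p \<Lambda> z) p = (\<Sum>\<Lambda>\<in>F. c \<Lambda> * iter_pderiv is (taylor_mono I p \<Lambda>) p)"
    by (rule iter_pderiv_sum_scaled[OF U])
       (use p js in \<open>auto intro!: smooth_on_taylor_mono smooth_on_const smooth_on_coord U\<close>)
  also have "\<dots> = (\<Sum>\<Lambda>\<in>F. if \<Lambda> = mset is then c \<Lambda> else 0)"
  proof (rule sum.cong[OF refl])
    fix \<Lambda> assume \<Lambda>: "\<Lambda> \<in> F"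
    have "set_mset (\<Lambda> - mset is) \<subseteq> I" using F(2)[OF \<Lambda>] in_diffD by fastforce
    moreover have "mset is \<subseteq># \<Lambda> \<Longrightarrow> \<Lambda> - mset is = {#} \<longleftrightarrow> \<Lambda> = mset is"
      by (metis Diff_eq_empty_iff_mset subset_mset.antisym subset_mset.order_refl)
    ultimately show "c \<Lambda> * iter_pderiv is (taylor_mono I p \<Lambda>) p = (if \<Lambda> = mset is then c \<Lambda> else 0)"
      unfolding iter_pderiv_taylor_mono[OF I js(1)] by (auto simp: taylor_mono_center[OF I])
  qed
  also have "\<dots> = c (mset is)" using js F by simp
  finally show ?thesis .
qed

subsection \<open>Jets of functions\<close>

text \<open>
  Equality of the \<open>n\<close>-jets at \<open>x\<close> of two functions. Lists of derivatives instead of multisets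
  allow inductions that peel off the innermost derivative.
\<close>

definition jet_eq :: "'i set \<Rightarrow> nat \<Rightarrow> ('i \<Rightarrow> real) \<Rightarrow> (('i \<Rightarrow> real) \<Rightarrow> real) \<Rightarrow> (('i \<Rightarrow> real) \<Rightarrow> real) \<Rightarrow> bool" where
  "jet_eq I n x f g \<longleftrightarrow> (\<forall>is. set is \<subseteq> I \<and> length is \<le> n \<longrightarrow> iter_pderiv is f x = iter_pderiv is g x)"

lemma jet_eq_0: "jet_eq I 0 x f g \<longleftrightarrow> f x = g x"
  by (auto simp: jet_eq_def)

lemma jet_eq_Suc:
  "jet_eq I (Suc n) x f g \<longleftrightarrow> f x = g x \<and> (\<forall>i\<in>I. jet_eq I n x (pderiv_at i f) (pderiv_at i g))" (is "?L \<longleftrightarrow> ?R")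
proof
  assume L: ?L
  show ?R unfolding jet_eq_def
  proof (intro conjI ballI allI impI)
    show "f x = g x" using L[unfolded jet_eq_def, rule_format, of "[]"] by simp
    show "iter_pderiv is (pderiv_at i f) x = iter_pderiv is (pderiv_at i g) x" if "i \<in> I" "set is \<subseteq> I \<and> length is \<le> n" for i "is"
      using L[unfolded jet_eq_def, rule_format, of "is @ [i]"] that by (simp add: iter_pderiv_snoc)
  qed
next
  assume R: ?R
  show ?L unfolding jet_eq_def
  proof (intro allI impI)
    fix "is" assume js: "set is \<subseteq> I \<and> length is \<le> Suc n"
    show "iter_pderiv is f x = iter_pderiv is g x"
    proof (cases "is" rule: rev_cases)
      case (snoc ks k)
      then show ?thesis using R js by (auto simp: jet_eq_def iter_pderiv_snoc)
    qed (use R in simp)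
  qed
qed

lemma jet_eq_value: "jet_eq I n x f g \<Longrightarrow> f x = g x"
  by (cases n) (auto simp: jet_eq_0 jet_eq_Suc)

lemma jet_eq_mono: "jet_eq I n x f g \<Longrightarrow> m \<le> n \<Longrightarrow> jet_eq I m x f g"
  by (auto simp: jet_eq_def)

lemma jet_eq_cong:
  assumes "openin (powertop_real I) U" "\<And>x. x \<in> U \<Longrightarrow> f x = f' x" "\<And>x. x \<in> U \<Longrightarrow> g x = g' x" "x \<in> U"
  shows "jet_eq I n x f g \<longleftrightarrow> jet_eq I n x f' g'"
  unfolding jet_eq_def
  using iter_pderiv_cong[OF assms(1), of f f' x] iter_pderiv_cong[OF assms(1), of g g' x] assms(2-4) by auto

context
  fixes I :: "'i set" and U x
  assumes U: "openin (powertop_real I) U" and x: "x \<in> U"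
begin

lemma jet_eq_add:
  assumes "smooth_on I U f" "smooth_on I U f'" "smooth_on I U g" "smooth_on I U g'"
    "jet_eq I n x f f'" "jet_eq I n x g g'"
  shows "jet_eq I n x (\<lambda>x. f x + g x) (\<lambda>x. f' x + g' x)"
  using assms
proof (induction n arbitrary: f f' g g')
  case (Suc n)
  note U' = coord_openin_subset[OF U]
  note D = smooth_on_pderiv[OF U'] and pd = smooth_on_pdiff[OF U']
  have "jet_eq I n x (pderiv_at i (\<lambda>x. f x + g x)) (pderiv_at i (\<lambda>x. f' x + g' x))" if i: "i \<in> I" for i
  proof (subst jet_eq_cong[OF U _ _ x])
    show "jet_eq I n x (\<lambda>x. pderiv_at i f x + pderiv_at i g x) (\<lambda>x. pderiv_at i f' x + pderiv_at i g' x)"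
      by (rule Suc.IH) (use Suc.prems i in \<open>auto simp: jet_eq_Suc intro: D\<close>)
  qed (use Suc.prems i in \<open>auto intro!: pd_add pd\<close>)
  with Suc.prems show ?case by (auto simp: jet_eq_Suc)
qed (auto simp: jet_eq_0)

lemma jet_eq_mult:
  assumes "smooth_on I U f" "smooth_on I U f'" "smooth_on I U g" "smooth_on I U g'"
    "jet_eq I n x f f'" "jet_eq I n x g g'"
  shows "jet_eq I n x (\<lambda>x. f x * g x) (\<lambda>x. f' x * g' x)"
  using assms
proof (induction n arbitrary: f f' g g')
  case (Suc n)
  note U' = coord_openin_subset[OF U]
  note D = smooth_on_pderiv[OF U'] and pd = smooth_on_pdiff[OF U']
  have m: "jet_eq I n x f f'" "jet_eq I n x g g'" using Suc.prems(5,6) by (auto intro: jet_eq_mono)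
  have "jet_eq I n x (pderiv_at i (\<lambda>x. f x * g x)) (pderiv_at i (\<lambda>x. f' x * g' x))" if i: "i \<in> I" for i
  proof (subst jet_eq_cong[OF U _ _ x])
    show "jet_eq I n x (\<lambda>x. f x * pderiv_at i g x + g x * pderiv_at i f x) (\<lambda>x. f' x * pderiv_at i g' x + g' x * pderiv_at i f' x)"
      by (intro jet_eq_add Suc.IH smooth_on_mult[OF U] D m i Suc.prems) (use Suc.prems i in \<open>auto simp: jet_eq_Suc\<close>)
  qed (use Suc.prems i in \<open>auto intro!: pd_mult pd\<close>)
  with Suc.prems show ?case by (auto simp: jet_eq_Suc)
qed (auto simp: jet_eq_0)

lemma jet_eq_sum:
  assumes "\<And>k. k \<in> K \<Longrightarrow> smooth_on I U (f k)" "\<And>k. k \<in> K \<Longrightarrow> smooth_on I U (g k)" "\<And>k. k \<in> K \<Longrightarrow> jet_eq I n x (f k) (g k)"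
  shows "jet_eq I n x (\<lambda>x. \<Sum>k\<in>K. f k x) (\<lambda>x. \<Sum>k\<in>K. g k x)"
  using assms
proof (induction K rule: infinite_finite_induct)
  case (insert k K)
  have "jet_eq I n x (\<lambda>x. f k x + (\<Sum>k\<in>K. f k x)) (\<lambda>x. g k x + (\<Sum>k\<in>K. g k x))"
    by (intro jet_eq_add insert smooth_on_sum[OF U]) (use insert in auto)
  then show ?case using insert by simp
qed (auto simp: jet_eq_def)

text \<open>
  The qualitative content of the formula of Faa di Bruno: the \<open>n\<close>-jet of a composition depends
  only on the \<open>n\<close>-jets of its constituents. In the induction the chain rule leaves sums of
  products of functions with equal jets of order one less.
\<close>

lemma jet_eq_compose:
  assumes J: "finite J" and V: "openin (powertop_real J) V"
    and aV: "\<And>x. x \<in> U \<Longrightarrow> (\<lambda>j\<in>J. a j x) \<in> V" "\<And>x. x \<in> U \<Longrightarrow> (\<lambda>j\<in>J. a' j x) \<in> V"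
    and a: "\<And>j. j \<in> J \<Longrightarrow> smooth_on I U (a j)" "\<And>j. j \<in> J \<Longrightarrow> smooth_on I U (a' j)"
      "\<And>j. j \<in> J \<Longrightarrow> jet_eq I n x (a j) (a' j)"
    and T: "smooth_on J V T" "smooth_on J V T'" "jet_eq J n (\<lambda>j\<in>J. a j x) T T'"
  shows "jet_eq I n x (\<lambda>x. T (\<lambda>j\<in>J. a j x)) (\<lambda>x. T' (\<lambda>j\<in>J. a' j x))"
  using a(3) T
proof (induction n arbitrary: T T')
  case 0
  have "(\<lambda>j\<in>J. a j x) = (\<lambda>j\<in>J. a' j x)" using jet_eq_value[OF 0(1)] by (auto simp: restrict_def)
  then show ?case using 0(4) by (simp only: jet_eq_0)
next
  case (Suc n)
  have "(\<lambda>j\<in>J. a j x) = (\<lambda>j\<in>J. a' j x)" using jet_eq_value[OF Suc.prems(1)] by (auto simp: restrict_def)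
  then have v: "T (\<lambda>j\<in>J. a j x) = T' (\<lambda>j\<in>J. a' j x)" using jet_eq_value[OF Suc.prems(4)] by (simp only:)
  note U' = coord_openin_subset[OF U] and V' = coord_openin_subset[OF V]
  have "jet_eq I n x (pderiv_at i (\<lambda>x. T (\<lambda>j\<in>J. a j x))) (pderiv_at i (\<lambda>x. T' (\<lambda>j\<in>J. a' j x)))" if i: "i \<in> I" for i
  proof (subst jet_eq_cong[OF U _ _ x])
    show "pderiv_at i (\<lambda>x. T (\<lambda>j\<in>J. a j x)) x = (\<Sum>j\<in>J. pderiv_at j T (\<lambda>j\<in>J. a j x) * pderiv_at i (a j) x)" if "x \<in> U" for x
      by (rule pd_compose(2)[OF U J V aV(1) Suc.prems(2) i that]) (use that i in \<open>auto intro: smooth_on_pdiff[OF U' a(1)]\<close>)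
    show "pderiv_at i (\<lambda>x. T' (\<lambda>j\<in>J. a' j x)) x = (\<Sum>j\<in>J. pderiv_at j T' (\<lambda>j\<in>J. a' j x) * pderiv_at i (a' j) x)" if "x \<in> U" for x
      by (rule pd_compose(2)[OF U J V aV(2) Suc.prems(3) i that]) (use that i in \<open>auto intro: smooth_on_pdiff[OF U' a(2)]\<close>)
    have DT: "smooth_on J V (pderiv_at j T)" "smooth_on J V (pderiv_at j T')" if "j \<in> J" for j
      using Suc.prems(2,3) smooth_on_pderiv[OF V'] that by auto
    have Da: "smooth_on I U (pderiv_at i (a j))" "smooth_on I U (pderiv_at i (a' j))" if "j \<in> J" for j
      using a(1,2) smooth_on_pderiv[OF U'] that i by auto
    note S1 = smooth_on_compose[OF U J V aV(1) DT(1) a(1)] and S2 = smooth_on_compose[OF U J V aV(2) DT(2) a(2)]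
    have "jet_eq I n x (\<lambda>x. pderiv_at j T (\<lambda>j\<in>J. a j x)) (\<lambda>x. pderiv_at j T' (\<lambda>j\<in>J. a' j x))" if "j \<in> J" for j
    proof (rule Suc.IH[OF _ DT[OF that]])
      show "jet_eq I n x (a k) (a' k)" if "k \<in> J" for k using Suc.prems(1)[OF that] by (rule jet_eq_mono) simp
      show "jet_eq J n (\<lambda>j\<in>J. a j x) (pderiv_at j T) (pderiv_at j T')"
        using Suc.prems(4) \<open>j \<in> J\<close> unfolding jet_eq_Suc by blast
    qed
    moreover have "jet_eq I n x (pderiv_at i (a j)) (pderiv_at i (a' j))" if "j \<in> J" for j
      using Suc.prems(1)[OF that] i by (auto simp: jet_eq_Suc)
    ultimately show "jet_eq I n x (\<lambda>x. \<Sum>j\<in>J. pderiv_at j T (\<lambda>j\<in>J. a j x) * pderiv_at i (a j) x)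
        (\<lambda>x. \<Sum>j\<in>J. pderiv_at j T' (\<lambda>j\<in>J. a' j x) * pderiv_at i (a' j) x)"
      by (intro jet_eq_sum jet_eq_mult smooth_on_mult[OF U] S1 S2 Da)
  qed
  then show ?case unfolding jet_eq_Suc using v by simp
qed

end

text \<open>Derivatives in the first block of variables treat the second block as parameters.\<close>

lemma iter_pderiv_map_Inl:
  "iter_pderiv (map Inl is) G (case_sum z w) = iter_pderiv is (\<lambda>z. G (case_sum z w)) z"
proof (induction "is" arbitrary: z)
  case (Cons i js)
  have "(case_sum z w)(Inl i := t) = case_sum (z(i := t)) w" for t
    by (auto simp: fun_eq_iff split: sum.split)
  then show ?case by (simp only: list.map iter_pderiv.simps pderiv_at_def Cons sum.case)
qed simp

section \<open>Smooth functions on manifolds\<close>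

subsection \<open>Charts\<close>

lemma top_chartD:
  assumes "top_chart T I (U, \<phi>)"
  shows "openin T U" "openin (powertop_real I) (\<phi> ` U)" "inj_on \<phi> U"
    "homeomorphic_map (subtopology T U) (subtopology (powertop_real I) (\<phi> ` U)) \<phi>" "U \<subseteq> topspace T"
proof -
  show *: "openin T U" "openin (powertop_real I) (\<phi> ` U)"
    "homeomorphic_map (subtopology T U) (subtopology (powertop_real I) (\<phi> ` U)) \<phi>"
    using assms by (auto simp: top_chart_def)
  show "U \<subseteq> topspace T" using *(1) by (rule openin_subset)
  then show "inj_on \<phi> U" using homeomorphic_imp_injective_map[OF *(3)] by (simp add: Int_absorb1)
qed

lemma chart_coord: "top_chart T I (U, \<phi>) \<Longrightarrow> p \<in> U \<Longrightarrow> \<phi> p \<in> coord_space I"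
  using coord_openin_subset[OF top_chartD(2)[of T I U \<phi>]] by auto

lemma chart_inv: "top_chart T I (U, \<phi>) \<Longrightarrow> p \<in> U \<Longrightarrow> inv_into U \<phi> (\<phi> p) = p"
  by (rule inv_into_f_f[OF top_chartD(3)])

lemma chart_image_open:
  assumes "top_chart T I (U, \<phi>)" "openin T W"
  shows "openin (powertop_real I) (\<phi> ` (U \<inter> W))"
proof -
  note c = top_chartD[OF assms(1)]
  have "openin (subtopology T U) (U \<inter> W)" using assms(2) by (simp add: openin_subtopology_Int2)
  then have "openin (subtopology (powertop_real I) (\<phi> ` U)) (\<phi> ` (U \<inter> W))"
    using homeomorphic_imp_open_map[OF c(4)] by (simp add: open_map_def)
  then show ?thesis using c(2) by (rule openin_trans_full)
qed

lemma chart_image_open_subset: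
  "top_chart T I (U, \<phi>) \<Longrightarrow> openin T W \<Longrightarrow> W \<subseteq> U \<Longrightarrow> openin (powertop_real I) (\<phi> ` W)"
  using chart_image_open[of T I U \<phi> W] by (simp add: Int_absorb1)

lemma chart_preimage_open:
  assumes "top_chart T I (U, \<phi>)" "openin (powertop_real I) S"
  shows "openin T {p \<in> U. \<phi> p \<in> S}"
proof -
  note c = top_chartD[OF assms(1)]
  have "openin (subtopology (powertop_real I) (\<phi> ` U)) (\<phi> ` U \<inter> S)"
    using assms(2) by (simp add: openin_subtopology_Int2)
  then have "openin (subtopology T U) {p \<in> topspace (subtopology T U). \<phi> p \<in> \<phi> ` U \<inter> S}"
    using homeomorphic_imp_continuous_map[OF c(4)] by (rule openin_continuous_map_preimage[rotated])
  moreover have "{p \<in> topspace (subtopology T U). \<phi> p \<in> \<phi> ` U \<inter> S} = {p \<in> U. \<phi> p \<in> S}" using c(5) by auto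
  ultimately have "openin (subtopology T U) {p \<in> U. \<phi> p \<in> S}" by simp
  then show ?thesis using c(1) by (rule openin_trans_full)
qed

text \<open>Read in \<open>\<phi>\<close>, the function is its reading in \<open>\<phi>'\<close> composed with the smooth transition.\<close>

lemma smooth_on_change_chart:
  assumes c: "top_chart T I (U, \<phi>)" and c': "top_chart T J (U', \<phi>')" and J: "finite J"
    and tr: "smooth_transition I J (U, \<phi>) (U', \<phi>')"
    and W: "openin T W" "W \<subseteq> U" "W \<subseteq> U'"
    and g: "smooth_on J (\<phi>' ` W) (\<lambda>z. g (inv_into U' \<phi>' z))"
  shows "smooth_on I (\<phi> ` W) (\<lambda>z. g (inv_into U \<phi> z))"
proof -
  have oW: "openin (powertop_real I) (\<phi> ` W)" and oW': "openin (powertop_real J) (\<phi>' ` W)"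
    using chart_image_open_subset[OF c W(1,2)] chart_image_open_subset[OF c' W(1,3)] by auto
  have ext: "(\<lambda>j\<in>J. \<phi>' p j) = \<phi>' p" if "p \<in> W" for p
    using chart_coord[OF c', of p] W that by (auto intro: extensional_restrict PiE_mem simp: PiE_def)
  have "smooth_on I (\<phi> ` W) (\<lambda>z. (\<lambda>y. g (inv_into U' \<phi>' y)) (\<lambda>j\<in>J. \<phi>' (inv_into U \<phi> z) j))"
  proof (rule smooth_on_compose[OF oW J oW' _ g])
    fix z assume "z \<in> \<phi> ` W"
    then obtain p where p: "p \<in> W" "z = \<phi> p" by blast
    then show "(\<lambda>j\<in>J. \<phi>' (inv_into U \<phi> z) j) \<in> \<phi>' ` W" using chart_inv[OF c, of p] W ext by auto
  next
    fix j assume "j \<in> J"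
    then have "smooth_on I (\<phi> ` (U \<inter> U')) (\<lambda>z. \<phi>' (inv_into U \<phi> z) j)"
      using tr by (auto simp: smooth_transition_def)
    moreover have "\<phi> ` (U \<inter> U') \<subseteq> coord_space I" using chart_coord[OF c] by auto
    moreover have "\<phi> ` W \<subseteq> \<phi> ` (U \<inter> U')" using W by auto
    ultimately show "smooth_on I (\<phi> ` W) (\<lambda>z. \<phi>' (inv_into U \<phi> z) j)"
      by (rule smooth_on_subset[rotated 2])
  qed
  moreover have "(\<lambda>y. g (inv_into U' \<phi>' y)) (\<lambda>j\<in>J. \<phi>' (inv_into U \<phi> z) j) = g (inv_into U \<phi> z)" if z: "z \<in> \<phi> ` W" for z
  proof -
    from z obtain p where p: "p \<in> W" "z = \<phi> p" by blast
    then show ?thesis using chart_inv[OF c, of p] chart_inv[OF c', of p] W ext[OF p(1)] by (simp add: subset_iff)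
  qed
  ultimately show ?thesis
    using smooth_on_cong[OF oW, of "\<lambda>z. (\<lambda>y. g (inv_into U' \<phi>' y)) (\<lambda>j\<in>J. \<phi>' (inv_into U \<phi> z) j)" "\<lambda>z. g (inv_into U \<phi> z)"]
    by simp
qed

subsection \<open>Local smoothness\<close>

text \<open>
  Smoothness on an open subset, for functions that need not be extensional: local constructions
  are made with \<open>smooth_fn\<close> and made extensional at the end.
\<close>

definition smooth_fn :: "('a, 'i) manifold \<Rightarrow> 'a set \<Rightarrow> ('a \<Rightarrow> real) \<Rightarrow> bool" where
  "smooth_fn M W g \<longleftrightarrow> (\<forall>(U, \<phi>)\<in>matlas M. smooth_on (midx M) (\<phi> ` (U \<inter> W)) (\<lambda>z. g (inv_into U \<phi> z)))"

lemma smooth_fnD: "smooth_fn M W g \<Longrightarrow> (U, \<phi>) \<in> matlas M \<Longrightarrow> smooth_on (midx M) (\<phi> ` (U \<inter> W)) (\<lambda>z. g (inv_into U \<phi> z))"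
  by (auto simp: smooth_fn_def)

context
  fixes M :: "('a, 'i) manifold"
  assumes M: "smooth_manifold M"
begin

lemma atlas_chart: "c \<in> matlas M \<Longrightarrow> top_chart (mtop M) (midx M) c"
  using M by (auto simp: smooth_manifold_def)

lemma atlas_is_chart: "c \<in> matlas M \<Longrightarrow> is_chart M (midx M) c"
  using M by (auto simp: smooth_manifold_def is_chart_def)

lemma midx_finite: "finite (midx M)" using M by (simp add: smooth_manifold_def)

lemma atlas_cover: "p \<in> points M \<Longrightarrow> \<exists>U \<phi>. (U, \<phi>) \<in> matlas M \<and> p \<in> U"
proof -
  assume "p \<in> points M"
  then have "p \<in> (\<Union>c\<in>matlas M. fst c)" using M by (simp add: smooth_manifold_def)
  then show ?thesis by force
qed

lemma smooth_fn_local: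
  assumes W: "W \<subseteq> points M" and loc: "\<And>p. p \<in> W \<Longrightarrow> \<exists>V. openin (mtop M) V \<and> p \<in> V \<and> smooth_fn M (W \<inter> V) g"
  shows "smooth_fn M W g"
  unfolding smooth_fn_def
proof safe
  fix U \<phi> assume c: "(U, \<phi>) \<in> matlas M"
  note tc = atlas_chart[OF c]
  show "smooth_on (midx M) (\<phi> ` (U \<inter> W)) (\<lambda>z. g (inv_into U \<phi> z))"
  proof (rule smooth_on_local)
    show "\<phi> ` (U \<inter> W) \<subseteq> coord_space (midx M)" using chart_coord[OF tc] by auto
    fix z assume "z \<in> \<phi> ` (U \<inter> W)"
    then obtain p where p: "p \<in> U" "p \<in> W" "z = \<phi> p" by blast
    then obtain V where V: "openin (mtop M) V" "p \<in> V" "smooth_fn M (W \<inter> V) g" using loc by blast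
    have "\<phi> ` (U \<inter> V) \<inter> \<phi> ` (U \<inter> W) = \<phi> ` (U \<inter> (W \<inter> V))"
      using inj_on_image_Int[OF top_chartD(3)[OF tc], of "U \<inter> V" "U \<inter> W"] by (simp add: Int_ac)
    then show "\<exists>Va. openin (powertop_real (midx M)) Va \<and> z \<in> Va \<and> smooth_on (midx M) (Va \<inter> \<phi> ` (U \<inter> W)) (\<lambda>z. g (inv_into U \<phi> z))"
      using chart_image_open[OF tc V(1)] p V smooth_fnD[OF V(3) c] by (intro exI[of _ "\<phi> ` (U \<inter> V)"]) auto
  qed
qed

lemma smooth_fn_subset: "smooth_fn M W g \<Longrightarrow> W' \<subseteq> W \<Longrightarrow> smooth_fn M W' g"
  unfolding smooth_fn_def
proof safe
  fix U \<phi> assume "W' \<subseteq> W" and c: "(U, \<phi>) \<in> matlas M" and "\<forall>(U, \<phi>)\<in>matlas M. smooth_on (midx M) (\<phi> ` (U \<inter> W)) (\<lambda>z. g (inv_into U \<phi> z))"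
  then have "smooth_on (midx M) (\<phi> ` (U \<inter> W)) (\<lambda>z. g (inv_into U \<phi> z))" "\<phi> ` (U \<inter> W') \<subseteq> \<phi> ` (U \<inter> W)" by auto
  moreover have "\<phi> ` (U \<inter> W) \<subseteq> coord_space (midx M)" using chart_coord[OF atlas_chart[OF c]] by auto
  ultimately show "smooth_on (midx M) (\<phi> ` (U \<inter> W')) (\<lambda>z. g (inv_into U \<phi> z))" using smooth_on_subset[of "\<phi> ` (U \<inter> W)" "midx M" "\<phi> ` (U \<inter> W')"] by simp
qed

context
  fixes W assumes W: "openin (mtop M) W"
begin

lemma W_img: "(U, \<phi>) \<in> matlas M \<Longrightarrow> openin (powertop_real (midx M)) (\<phi> ` (U \<inter> W))"
  using chart_image_open[OF atlas_chart W] .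

lemma smooth_fn_cong: "(\<And>p. p \<in> W \<Longrightarrow> f p = g p) \<Longrightarrow> smooth_fn M W f \<longleftrightarrow> smooth_fn M W g"
proof -
  assume eq: "\<And>p. p \<in> W \<Longrightarrow> f p = g p"
  have "smooth_on (midx M) (\<phi> ` (U \<inter> W)) (\<lambda>z. f (inv_into U \<phi> z)) = smooth_on (midx M) (\<phi> ` (U \<inter> W)) (\<lambda>z. g (inv_into U \<phi> z))"
    if c: "(U, \<phi>) \<in> matlas M" for U \<phi>
    by (rule smooth_on_cong[OF W_img[OF c]]) (use eq chart_inv[OF atlas_chart[OF c]] in auto)
  then show ?thesis by (fastforce simp: smooth_fn_def)
qed

lemma smooth_fn_const: "smooth_fn M W (\<lambda>p. c)"
  unfolding smooth_fn_def by (auto intro: smooth_on_const W_img)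

lemma smooth_fn_add: "smooth_fn M W f \<Longrightarrow> smooth_fn M W g \<Longrightarrow> smooth_fn M W (\<lambda>p. f p + g p)"
  unfolding smooth_fn_def by (fastforce intro: smooth_on_add W_img)

lemma smooth_fn_mult: "smooth_fn M W f \<Longrightarrow> smooth_fn M W g \<Longrightarrow> smooth_fn M W (\<lambda>p. f p * g p)"
  unfolding smooth_fn_def by (fastforce intro: smooth_on_mult W_img)

lemma smooth_fn_sum: "(\<And>k. k \<in> K \<Longrightarrow> smooth_fn M W (f k)) \<Longrightarrow> smooth_fn M W (\<lambda>p. \<Sum>k\<in>K. f k p)"
  by (induction K rule: infinite_finite_induct) (auto intro: smooth_fn_const smooth_fn_add)

lemma smooth_fn_compose:
  assumes "finite J" "openin (powertop_real J) V" "smooth_on J V T"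
    and "\<And>j. j \<in> J \<Longrightarrow> smooth_fn M W (a j)" "\<And>p. p \<in> W \<Longrightarrow> (\<lambda>j\<in>J. a j p) \<in> V"
  shows "smooth_fn M W (\<lambda>p. T (\<lambda>j\<in>J. a j p))"
  unfolding smooth_fn_def
proof safe
  fix U \<phi> assume c: "(U, \<phi>) \<in> matlas M"
  show "smooth_on (midx M) (\<phi> ` (U \<inter> W)) (\<lambda>z. T (\<lambda>j\<in>J. a j (inv_into U \<phi> z)))"
  proof (rule smooth_on_compose[OF W_img[OF c] assms(1,2) _ assms(3)])
    fix z assume "z \<in> \<phi> ` (U \<inter> W)"
    then show "(\<lambda>j\<in>J. a j (inv_into U \<phi> z)) \<in> V" using assms(5) chart_inv[OF atlas_chart[OF c]] by auto
  qed (use smooth_fnD[OF assms(4) c] in auto)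
qed

text \<open>A chart of the maximal atlas is compared locally with the charts of the given atlas.\<close>

lemma smooth_fn_chart:
  assumes g: "smooth_fn M W g" and c: "is_chart M J (U, \<phi>)"
  shows "smooth_on J (\<phi> ` (U \<inter> W)) (\<lambda>z. g (inv_into U \<phi> z))"
proof (rule smooth_on_local)
  have tc: "top_chart (mtop M) J (U, \<phi>)" using c by (simp add: is_chart_def)
  show "\<phi> ` (U \<inter> W) \<subseteq> coord_space J" using chart_coord[OF tc] by auto
  fix z assume "z \<in> \<phi> ` (U \<inter> W)"
  then obtain p where p: "p \<in> U" "p \<in> W" "z = \<phi> p" by blast
  then have "p \<in> points M" using W openin_subset by blast
  from atlas_cover[OF this] obtain A \<alpha> where A: "(A, \<alpha>) \<in> matlas M" "p \<in> A" by blast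
  note tA = atlas_chart[OF A(1)]
  let ?V = "U \<inter> W \<inter> A"
  have oV: "openin (mtop M) ?V" using top_chartD(1)[OF tc] W top_chartD(1)[OF tA] by auto
  have "smooth_on (midx M) (\<alpha> ` ?V) (\<lambda>z. g (inv_into A \<alpha> z))"
  proof -
    have "smooth_fn M ?V g" by (rule smooth_fn_subset[OF g]) auto
    from smooth_fnD[OF this A(1)] show ?thesis by (simp add: Int_absorb1)
  qed
  then have "smooth_on J (\<phi> ` ?V) (\<lambda>z. g (inv_into U \<phi> z))"
    by (intro smooth_on_change_chart[OF tc tA midx_finite _ oV])
       (use c A in \<open>auto simp: is_chart_def\<close>)
  moreover have "\<phi> ` ?V \<inter> \<phi> ` (U \<inter> W) = \<phi> ` ?V" by auto
  ultimately show "\<exists>V. openin (powertop_real J) V \<and> z \<in> V \<and> smooth_on J (V \<inter> \<phi> ` (U \<inter> W)) (\<lambda>z. g (inv_into U \<phi> z))"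
    using p A chart_image_open_subset[OF tc oV] by (intro exI[of _ "\<phi> ` ?V"]) auto
qed

end

text \<open>When \<open>W\<close> lies in one chart of the maximal atlas, smoothness need only be tested there.\<close>

lemma smooth_fn_of_chart:
  assumes c: "is_chart M J (U, \<phi>)" and J: "finite J" and W: "openin (mtop M) W" "W \<subseteq> U"
    and g: "smooth_on J (\<phi> ` W) (\<lambda>z. g (inv_into U \<phi> z))"
  shows "smooth_fn M W g"
  unfolding smooth_fn_def
proof safe
  fix A \<alpha> assume A: "(A, \<alpha>) \<in> matlas M"
  have tc: "top_chart (mtop M) J (U, \<phi>)" using c by (simp add: is_chart_def)
  note tA = atlas_chart[OF A(1)]
  have "smooth_on J (\<phi> ` (A \<inter> W)) (\<lambda>z. g (inv_into U \<phi> z))"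
  proof (rule smooth_on_subset[OF _ _ g])
    show "\<phi> ` W \<subseteq> coord_space J" using chart_coord[OF tc] W by auto
  qed auto
  then show "smooth_on (midx M) (\<alpha> ` (A \<inter> W)) (\<lambda>z. g (inv_into A \<alpha> z))"
    by (intro smooth_on_change_chart[OF tA tc J])
      (use c A W top_chartD(1)[OF tA] in \<open>auto simp: is_chart_def\<close>)
qed

lemma smooth_fn_coord:
  assumes c: "is_chart M J (U, \<phi>)" and J: "finite J"
  shows "smooth_fn M U (\<lambda>p. \<phi> p j)"
proof (rule smooth_fn_of_chart[OF c J])
  have tc: "top_chart (mtop M) J (U, \<phi>)" using c by (simp add: is_chart_def)
  show "openin (mtop M) U" by (rule top_chartD(1)[OF tc])
  show "smooth_on J (\<phi> ` U) (\<lambda>z. \<phi> (inv_into U \<phi> z) j)"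
    using smooth_on_cong[OF top_chartD(2)[OF tc], of "\<lambda>z. \<phi> (inv_into U \<phi> z) j" "\<lambda>z. z j"]
      smooth_on_coord[OF top_chartD(2)[OF tc]] by (simp add: f_inv_into_f)
qed simp

subsection \<open>The ring of smooth functions and bump functions\<close>

lemma points_open: "openin (mtop M) (points M)" by simp

lemma smooth_functions_iff: "f \<in> smooth_functions M \<longleftrightarrow> f \<in> extensional (points M) \<and> smooth_fn M (points M) f"
proof -
  have "\<phi> ` U = \<phi> ` (U \<inter> points M)" if "(U, \<phi>) \<in> matlas M" for U \<phi>
    using top_chartD(5)[OF atlas_chart[OF that]] by (simp add: Int_absorb2)
  then show ?thesis by (fastforce simp: smooth_functions_def smooth_fn_def)
qed

lemma smooth_functionsI: "smooth_fn M (points M) g \<Longrightarrow> (\<lambda>p\<in>points M. g p) \<in> smooth_functions M"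
  unfolding smooth_functions_iff using smooth_fn_cong[OF points_open, of "\<lambda>p\<in>points M. g p" g] by simp

lemma smooth_functionsD: "f \<in> smooth_functions M \<Longrightarrow> W \<subseteq> points M \<Longrightarrow> smooth_fn M W f"
  using smooth_fn_subset by (auto simp: smooth_functions_iff)

lemma sf_const: "(\<lambda>p\<in>points M. c) \<in> smooth_functions M"
  by (intro smooth_functionsI smooth_fn_const points_open)

lemma sf_add: "f \<in> smooth_functions M \<Longrightarrow> g \<in> smooth_functions M \<Longrightarrow> (\<lambda>p\<in>points M. f p + g p) \<in> smooth_functions M"
  by (intro smooth_functionsI smooth_fn_add points_open smooth_functionsD subset_refl)

lemma sf_mult: "f \<in> smooth_functions M \<Longrightarrow> g \<in> smooth_functions M \<Longrightarrow> (\<lambda>p\<in>points M. f p * g p) \<in> smooth_functions M"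
  by (intro smooth_functionsI smooth_fn_mult points_open smooth_functionsD subset_refl)

lemma sf_scale: "f \<in> smooth_functions M \<Longrightarrow> (\<lambda>p\<in>points M. c * f p) \<in> smooth_functions M"
  by (intro smooth_functionsI smooth_fn_mult smooth_fn_const points_open smooth_functionsD subset_refl)

lemma sf_sum: "(\<And>k. k \<in> K \<Longrightarrow> f k \<in> smooth_functions M) \<Longrightarrow> (\<lambda>p\<in>points M. \<Sum>k\<in>K. f k p) \<in> smooth_functions M"
  by (intro smooth_functionsI smooth_fn_sum points_open smooth_functionsD subset_refl)

text \<open>
  The product of one-dimensional steps in the squared coordinate differences, continued by zero.
  The Hausdorff property makes the compact cube \<open>K\<close> closed, hence the continuation is smooth off
  the chart.
\<close>

lemma chart_bump:
  assumes c: "(U, \<phi>) \<in> matlas M" and p: "p \<in> U" and W: "openin (mtop M) W" "p \<in> W"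
  obtains \<rho> N K where "\<rho> \<in> smooth_functions M" "openin (mtop M) N" "p \<in> N" "N \<subseteq> K" "K \<subseteq> U \<inter> W"
    "closedin (mtop M) K" "compactin (mtop M) K" "\<And>q. q \<in> N \<Longrightarrow> \<rho> q = 1" "\<And>q. q \<in> points M - K \<Longrightarrow> \<rho> q = 0"
proof -
  let ?I = "midx M"
  note tc = atlas_chart[OF c] and I = midx_finite
  have "\<phi> p \<in> \<phi> ` (U \<inter> W)" using p W by auto
  from coord_box[OF chart_image_open[OF tc W(1)] this I] obtain e' where e': "e' > 0"
    "\<And>y. y \<in> coord_space ?I \<Longrightarrow> (\<And>i. i \<in> ?I \<Longrightarrow> \<bar>y i - \<phi> p i\<bar> < e') \<Longrightarrow> y \<in> \<phi> ` (U \<inter> W)"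
    by metis
  \<comment> \<open>The closed cube of half-width \<open>2 e\<close> lies in the image of the chart.\<close>
  define e where "e = e' / 3"
  have e: "e > 0" using e' by (simp add: e_def)
  \<comment> \<open>A factor is \<open>1\<close> where the coordinate difference is at most \<open>e\<close> and \<open>0\<close> where its square is
    at least \<open>2 e\<^sup>2\<close>, in particular where it exceeds \<open>2 e\<close>.\<close>
  define \<beta> where "\<beta> z = (\<Prod>i\<in>?I. step (2 - (z i - \<phi> p i) ^ 2 / e ^ 2))" for z
  define C where "C = Pi\<^sub>E ?I (\<lambda>i. {\<phi> p i - 2 * e .. \<phi> p i + 2 * e})"
  define K where "K = {q \<in> U. \<phi> q \<in> C}"
  define N where "N = {q \<in> U. \<phi> q \<in> {y \<in> coord_space ?I. \<forall>i\<in>?I. \<bar>y i - \<phi> p i\<bar> < e}}"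
  define \<rho> where "\<rho> = (\<lambda>q\<in>points M. if q \<in> U then \<beta> (\<phi> q) else 0)"
  have CW: "C \<subseteq> \<phi> ` (U \<inter> W)"
  proof
    fix y assume y: "y \<in> C"
    have "\<bar>y i - \<phi> p i\<bar> < e'" if "i \<in> ?I" for i
    proof -
      have "\<bar>y i - \<phi> p i\<bar> \<le> 2 * e" using y that by (auto simp: C_def PiE_iff abs_le_iff algebra_simps)
      also have "2 * e < e'" using e'(1) by (simp add: e_def)
      finally show ?thesis .
    qed
    then show "y \<in> \<phi> ` (U \<inter> W)" using y by (intro e'(2)) (auto simp: C_def PiE_iff)
  qed
  have KW: "K \<subseteq> U \<inter> W"
    using CW inj_onD[OF top_chartD(3)[OF tc]] by (fastforce simp: K_def)
  have \<phi>K: "\<phi> ` K = C" using CW by (auto simp: K_def)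
  have "compactin (powertop_real ?I) C" unfolding C_def by (rule compactin_PiE[THEN iffD2]) auto
  then have "compactin (subtopology (powertop_real ?I) (\<phi> ` U)) (\<phi> ` K)"
    using CW \<phi>K by (auto simp: compactin_subtopology)
  moreover have KU: "K \<subseteq> topspace (subtopology (mtop M) U)" using KW top_chartD(5)[OF tc] by auto
  ultimately have "compactin (subtopology (mtop M) U) K"
    using homeomorphic_map_compactness_eq[OF top_chartD(4)[OF tc]] KU by blast
  then have Kc: "compactin (mtop M) K" by (simp add: compactin_subtopology)
  then have Kcl: "closedin (mtop M) K"
    using M compactin_imp_closedin by (auto simp: smooth_manifold_def)
  have N: "openin (mtop M) N" unfolding N_def
    by (rule chart_preimage_open[OF tc coord_open_box[OF I]])
  have pN: "p \<in> N" using p e chart_coord[OF tc p] by (auto simp: N_def)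
  have NK: "N \<subseteq> K"
  proof
    fix q assume q: "q \<in> N"
    have "\<phi> p i - 2 * e \<le> \<phi> q i \<and> \<phi> q i \<le> \<phi> p i + 2 * e" if "i \<in> ?I" for i
      using q that e by (fastforce simp: N_def abs_less_iff)
    then show "q \<in> K" using q by (auto simp: N_def K_def C_def PiE_iff)
  qed
  have U: "openin (mtop M) U" by (rule top_chartD(1)[OF tc])
  have \<rho>1: "\<rho> q = 1" if "q \<in> N" for q
  proof -
    have "step (2 - (\<phi> q i - \<phi> p i) ^ 2 / e ^ 2) = 1" if "i \<in> ?I" for i
    proof (rule step_eq(1))
      have "\<bar>\<phi> q i - \<phi> p i\<bar> < e" using \<open>q \<in> N\<close> that by (auto simp: N_def)
      then have "(\<phi> q i - \<phi> p i) ^ 2 \<le> e ^ 2" using e abs_le_square_iff[of "\<phi> q i - \<phi> p i" e] by simp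
      then show "1 \<le> 2 - (\<phi> q i - \<phi> p i) ^ 2 / e ^ 2" using e by (simp add: divide_le_eq)
    qed
    then show ?thesis using that top_chartD(5)[OF tc] by (auto simp: \<rho>_def \<beta>_def N_def)
  qed
  have \<rho>0: "\<rho> q = 0" if "q \<in> points M - K" for q
  proof (cases "q \<in> U")
    case True
    then have "\<phi> q \<notin> C" using that by (auto simp: K_def)
    then obtain i where i: "i \<in> ?I" "\<not> (\<phi> p i - 2 * e \<le> \<phi> q i \<and> \<phi> q i \<le> \<phi> p i + 2 * e)"
      using chart_coord[OF tc True] by (auto simp: C_def PiE_iff)
    have "2 * e \<le> \<bar>\<phi> q i - \<phi> p i\<bar>" using i(2) by linarith
    then have "(2 * e) ^ 2 \<le> (\<phi> q i - \<phi> p i) ^ 2" using e abs_le_square_iff[of "2 * e" "\<phi> q i - \<phi> p i"] by simp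
    then have "4 * e ^ 2 \<le> (\<phi> q i - \<phi> p i) ^ 2" by (simp add: power_mult_distrib)
    then have "2 * e ^ 2 \<le> (\<phi> q i - \<phi> p i) ^ 2" using zero_le_power2[of e] by linarith
    then have "2 \<le> (\<phi> q i - \<phi> p i) ^ 2 / e ^ 2" using e by (simp add: le_divide_eq)
    then have "step (2 - (\<phi> q i - \<phi> p i) ^ 2 / e ^ 2) = 0" by (intro step_eq(2)) simp
    then have "\<beta> (\<phi> q) = 0" unfolding \<beta>_def using I i(1) by (intro prod_zero) auto
    then show ?thesis using that by (simp add: \<rho>_def)
  qed (use that in \<open>auto simp: \<rho>_def\<close>)
  have sU: "smooth_fn M U (\<lambda>q. \<beta> (\<phi> q))"
  proof (rule smooth_fn_of_chart[OF atlas_is_chart[OF c] I U])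
    note o = top_chartD(2)[OF tc]
    have "smooth_on ?I (\<phi> ` U) \<beta>" unfolding \<beta>_def
      by (intro smooth_on_prod[OF o] smooth_on_step[OF o] smooth_on_minus[OF o] smooth_on_divide[OF o] smooth_on_power[OF o]
          smooth_on_const[OF o] smooth_on_coord[OF o]) (use e in auto)
    then show "smooth_on ?I (\<phi> ` U) (\<lambda>z. \<beta> (\<phi> (inv_into U \<phi> z)))"
      using smooth_on_cong[OF o, of "\<lambda>z. \<beta> (\<phi> (inv_into U \<phi> z))" \<beta>] by (simp add: f_inv_into_f)
  qed simp
  have "smooth_fn M (points M) (\<lambda>q. if q \<in> U then \<beta> (\<phi> q) else 0)"
  proof (rule smooth_fn_local)
    fix q assume q: "q \<in> points M"
    show "\<exists>V. openin (mtop M) V \<and> q \<in> V \<and> smooth_fn M (points M \<inter> V) (\<lambda>q. if q \<in> U then \<beta> (\<phi> q) else 0)"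
    proof (cases "q \<in> U")
      case True
      have "points M \<inter> U = U" using top_chartD(5)[OF tc] by auto
      then show ?thesis using True U sU smooth_fn_cong[OF U, of "\<lambda>q. if q \<in> U then \<beta> (\<phi> q) else 0" "\<lambda>q. \<beta> (\<phi> q)"]
        by (intro exI[of _ U]) auto
    next
      case False
      have o: "openin (mtop M) (points M - K)" using Kcl by blast
      have "smooth_fn M (points M - K) (\<lambda>q. if q \<in> U then \<beta> (\<phi> q) else 0)"
        using smooth_fn_cong[OF o, of "\<lambda>q. if q \<in> U then \<beta> (\<phi> q) else 0" "\<lambda>q. 0"] smooth_fn_const[OF o] \<rho>0
        by (auto simp: \<rho>_def split: if_splits)
      moreover have "points M \<inter> (points M - K) = points M - K" by auto
      ultimately show ?thesis using o q False KW by (intro exI[of _ "points M - K"]) auto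
    qed
  qed simp
  then have "\<rho> \<in> smooth_functions M" unfolding \<rho>_def by (rule smooth_functionsI)
  from that[OF this N pN NK KW Kcl Kc \<rho>1 \<rho>0] show thesis .
qed

lemma bump_extend:
  assumes W: "openin (mtop M) W" and g: "smooth_fn M W g" and \<rho>: "\<rho> \<in> smooth_functions M"
    and K: "closedin (mtop M) K" "K \<subseteq> W" "\<And>q. q \<in> points M - K \<Longrightarrow> \<rho> q = 0"
  shows "(\<lambda>q\<in>points M. if q \<in> W then \<rho> q * g q else 0) \<in> smooth_functions M"
proof (rule smooth_functionsI, rule smooth_fn_local)
  let ?f = "\<lambda>q. if q \<in> W then \<rho> q * g q else 0"
  fix q assume q: "q \<in> points M"
  have WM: "W \<subseteq> points M" using W openin_subset by blast
  show "\<exists>V. openin (mtop M) V \<and> q \<in> V \<and> smooth_fn M (points M \<inter> V) ?f"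
  proof (cases "q \<in> W")
    case True
    have "smooth_fn M W ?f"
      using smooth_fn_cong[OF W, of ?f "\<lambda>q. \<rho> q * g q"] smooth_fn_mult[OF W smooth_functionsD[OF \<rho> WM] g] by simp
    moreover have "points M \<inter> W = W" using WM by auto
    ultimately show ?thesis using W True by (intro exI[of _ W]) auto
  next
    case False
    have o: "openin (mtop M) (points M - K)" using K(1) by blast
    have "smooth_fn M (points M - K) ?f"
      using smooth_fn_cong[OF o, of ?f "\<lambda>q. 0"] smooth_fn_const[OF o] K(3) by auto
    moreover have "points M \<inter> (points M - K) = points M - K" by auto
    ultimately show ?thesis using o q False K by (intro exI[of _ "points M - K"]) auto
  qed
qed simp

text \<open>
  The operator \<open>E\<close> and the neighborhood \<open>N\<close> do not depend on the function that is extended, so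
  whole families of local functions can be extended with agreement on the same \<open>N\<close>.
\<close>

lemma chart_extend:
  assumes c: "(U, \<phi>) \<in> matlas M" and p: "p \<in> U" and W: "openin (mtop M) W" "p \<in> W" "W \<subseteq> U"
  obtains N E where "openin (mtop M) N" "p \<in> N" "N \<subseteq> W"
    "\<And>g. smooth_fn M W g \<Longrightarrow> E g \<in> smooth_functions M" "\<And>g q. q \<in> N \<Longrightarrow> E g q = g q"
proof -
  obtain \<rho> N K where *: "\<rho> \<in> smooth_functions M" "openin (mtop M) N" "p \<in> N" "N \<subseteq> K" "K \<subseteq> U \<inter> W"
    "closedin (mtop M) K" "\<And>q. q \<in> N \<Longrightarrow> \<rho> q = 1" "\<And>q. q \<in> points M - K \<Longrightarrow> \<rho> q = 0"
    using chart_bump[OF c p W(1,2)] by metis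
  define E where "E g = (\<lambda>q\<in>points M. if q \<in> W then \<rho> q * g q else 0)" for g
  show thesis
  proof (rule that[of N E])
    show "E g \<in> smooth_functions M" if "smooth_fn M W g" for g
      unfolding E_def by (rule bump_extend[OF W(1) that *(1,6)]) (use * in auto)
    show "E g q = g q" if "q \<in> N" for g q
    proof -
      have "q \<in> W" "q \<in> points M" using that * W(1) openin_subset[OF W(1)] by auto
      then show ?thesis using that * by (simp add: E_def)
    qed
  qed (use * in auto)
qed

end

section \<open>Tangent vectors and one-forms\<close>

context
  fixes M :: "('a, 'i) manifold"
  assumes M: "smooth_manifold M"
begin

subsection \<open>Tangent vectors\<close>

lemma tvD:
  assumes "v \<in> tangent_space M p" "f \<in> smooth_functions M" "g \<in> smooth_functions M"
  shows "v (\<lambda>q\<in>points M. f q + g q) = v f + v g"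
    "v (\<lambda>q\<in>points M. f q * g q) = f p * v g + g p * v f"
  using assms by (auto simp: tangent_space_def)

lemma tv_scale:
  "v \<in> tangent_space M p \<Longrightarrow> f \<in> smooth_functions M \<Longrightarrow> v (\<lambda>q\<in>points M. c * f q) = c * v f"
  by (auto simp: tangent_space_def)

lemma tv_zero:
  assumes v: "v \<in> tangent_space M p" shows "v (\<lambda>q\<in>points M. 0) = 0"
proof -
  have "(\<lambda>q\<in>points M. 0 * (\<lambda>q\<in>points M. 0) q) = (\<lambda>q\<in>points M. 0::real)" by (auto simp: restrict_def)
  then show ?thesis using tv_scale[OF v sf_const[OF M], of 0 0] by simp
qed

text \<open>The Leibniz rule for \<open>1 \<cdot> 1\<close> gives \<open>v(1) = 2 v(1)\<close>.\<close>

lemma tv_const: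
  assumes v: "v \<in> tangent_space M p" and p: "p \<in> points M" shows "v (\<lambda>q\<in>points M. c) = 0"
proof -
  let ?one = "\<lambda>q\<in>points M. 1::real"
  have one: "?one \<in> smooth_functions M" by (rule sf_const[OF M])
  have "(\<lambda>q\<in>points M. ?one q * ?one q) = ?one" by (auto simp: restrict_def)
  then have "v ?one = 0" using tvD(2)[OF v one one] p by simp
  moreover have "(\<lambda>q\<in>points M. c * ?one q) = (\<lambda>q\<in>points M. c)" by (auto simp: restrict_def)
  ultimately show ?thesis using tv_scale[OF v one, of c] by simp
qed

lemma tv_sum:
  assumes v: "v \<in> tangent_space M p" and f: "\<And>k. k \<in> S \<Longrightarrow> f k \<in> smooth_functions M"
  shows "v (\<lambda>q\<in>points M. \<Sum>k\<in>S. f k q) = (\<Sum>k\<in>S. v (f k))"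
  using f
proof (induction S rule: infinite_finite_induct)
  case (insert k S)
  let ?g = "\<lambda>q\<in>points M. \<Sum>k\<in>S. f k q"
  have "?g \<in> smooth_functions M" by (rule sf_sum[OF M]) (use insert in auto)
  moreover have "(\<lambda>q\<in>points M. \<Sum>k\<in>insert k S. f k q) = (\<lambda>q\<in>points M. f k q + ?g q)"
    by (rule restrict_ext) (use insert in auto)
  ultimately have "v (\<lambda>q\<in>points M. \<Sum>k\<in>insert k S. f k q) = v (f k) + v ?g"
    using tvD(1)[OF v, of "f k" ?g] insert.prems by (simp only: insertI1)
  also have "v ?g = (\<Sum>k\<in>S. v (f k))" by (rule insert.IH) (use insert.prems in auto)
  finally show ?case by (simp only: sum.insert[OF insert.hyps])
qed (auto simp: tv_zero[OF v])

text \<open>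
  A derivation only sees germs: the difference of \<open>f\<close> and \<open>g\<close> times a bump function at \<open>p\<close>
  supported in \<open>N\<close> is zero.
\<close>

lemma tv_local:
  assumes v: "v \<in> tangent_space M p" and f: "f \<in> smooth_functions M" and g: "g \<in> smooth_functions M"
    and N: "openin (mtop M) N" "p \<in> N" "\<And>q. q \<in> N \<Longrightarrow> f q = g q"
  shows "v f = v g"
proof -
  have p: "p \<in> points M" using N openin_subset by blast
  obtain U \<phi> where c: "(U, \<phi>) \<in> matlas M" "p \<in> U" using atlas_cover[OF M p] by blast
  obtain \<rho> N' K where \<rho>: "\<rho> \<in> smooth_functions M" "p \<in> N'" "N' \<subseteq> K" "K \<subseteq> U \<inter> N"
     "\<And>q. q \<in> N' \<Longrightarrow> \<rho> q = 1" "\<And>q. q \<in> points M - K \<Longrightarrow> \<rho> q = 0"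
    using chart_bump[OF M c N(1,2)] by metis
  let ?g = "\<lambda>q\<in>points M. - 1 * g q"
  let ?d = "\<lambda>q\<in>points M. f q + ?g q"
  have g': "?g \<in> smooth_functions M" by (rule sf_scale[OF M g])
  have d: "?d \<in> smooth_functions M" by (rule sf_add[OF M f g'])
  have "(\<lambda>q\<in>points M. \<rho> q * ?d q) = (\<lambda>q\<in>points M. 0)"
  proof (rule restrict_ext)
    fix q assume "q \<in> points M"
    then show "\<rho> q * ?d q = 0" using \<rho> N(3)[of q] by (cases "q \<in> K") auto
  qed
  then have "v (\<lambda>q\<in>points M. \<rho> q * ?d q) = 0" using tv_zero[OF v] by simp
  then have "v ?d = 0" using tvD(2)[OF v \<rho>(1) d] \<rho>(2,5) p N by auto
  moreover have "v ?d = v f - v g" using tvD(1)[OF v f g'] tv_scale[OF v g, of "- 1"] by simp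
  ultimately show ?thesis by simp
qed

text \<open>
  By the lemma of Hadamard \<open>f = f(p) + \<Sum>\<^sub>i (x\<^sub>i - x\<^sub>i(p)) g\<^sub>i\<close> near \<open>p\<close>. In the Leibniz rule
  only the terms \<open>g\<^sub>i(p) v(x\<^sub>i)\<close> survive, and \<open>g\<^sub>i(p)\<close> is the partial derivative.
\<close>

lemma tangent_expansion:
  assumes c: "(U, \<phi>) \<in> matlas M" and N: "openin (mtop M) N" "N \<subseteq> U" and pN: "p \<in> N"
    and x: "\<And>i. i \<in> midx M \<Longrightarrow> x i \<in> smooth_functions M" "\<And>i q. i \<in> midx M \<Longrightarrow> q \<in> N \<Longrightarrow> x i q = \<phi> q i"
    and v: "v \<in> tangent_space M p" and f: "f \<in> smooth_functions M"
  shows "v f = (\<Sum>i\<in>midx M. pderiv_at i (\<lambda>z. f (inv_into U \<phi> z)) (\<phi> p) * v (x i))"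
proof -
  let ?I = "midx M"
  note tc = atlas_chart[OF M c] and I = midx_finite[OF M]
  define h where "h z = f (inv_into U \<phi> z)" for z
  define p0 where "p0 = \<phi> p"
  have pU: "p \<in> U" and pM: "p \<in> points M" using pN N openin_subset[OF N(1)] by auto
  have NM: "N \<subseteq> points M" using openin_subset[OF N(1)] .
  have oN: "openin (powertop_real ?I) (\<phi> ` N)" using chart_image_open_subset[OF tc N] .
  have "p0 \<in> \<phi> ` N" using pN by (simp add: p0_def)
  from coord_box[OF oN this I] obtain e where e: "e > 0"
    "\<And>y. y \<in> coord_space ?I \<Longrightarrow> (\<And>i. i \<in> ?I \<Longrightarrow> \<bar>y i - p0 i\<bar> < e) \<Longrightarrow> y \<in> \<phi> ` N" by metis
  define Bx where "Bx = {y \<in> coord_space ?I. \<forall>i\<in>?I. \<bar>y i - p0 i\<bar> < e}"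
  have p0: "p0 \<in> coord_space ?I" using chart_coord[OF tc pU] by (simp add: p0_def)
  have oB: "openin (powertop_real ?I) Bx" unfolding Bx_def by (rule coord_open_box[OF I])
  have BN: "Bx \<subseteq> \<phi> ` N" using e(2) by (auto simp: Bx_def)
  have "smooth_on ?I (\<phi> ` (U \<inter> N)) h" unfolding h_def
    by (rule smooth_fnD[OF smooth_functionsD[OF M f NM] c])
  then have hB: "smooth_on ?I Bx h"
    using smooth_on_subset[OF _ BN] coord_openin_subset[OF oN] N(2) by (simp add: Int_absorb1)
  \<comment> \<open>The Hadamard coefficients of \<open>h\<close> at \<open>p0\<close>.\<close>
  define G where "G i = seg_int ?I p0 0 (pderiv_at i h)" for i
  have G: "smooth_on ?I Bx (G i)" if "i \<in> ?I" for i
    unfolding G_def using smooth_on_seg_int[OF I p0 e(1)] smooth_on_pderiv[OF coord_openin_subset[OF oB] hB that]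
    unfolding Bx_def by blast
  have had: "h y = h p0 + (\<Sum>i\<in>?I. (y i - p0 i) * G i y)" if "y \<in> Bx" for y
    unfolding G_def using hadamard(1)[OF I p0 e(1), of h y] hB that unfolding Bx_def by blast
  have Gp: "G i p0 = pderiv_at i h p0" if "i \<in> ?I" for i
    unfolding G_def using hadamard(2)[OF I p0 e(1), of h p0 i] hB that p0 e(1) unfolding Bx_def by auto
  define W where "W = {q \<in> U. \<phi> q \<in> Bx}"
  have W: "openin (mtop M) W" "W \<subseteq> U" unfolding W_def using chart_preimage_open[OF tc oB] by auto
  have pW: "p \<in> W" using pU p0 e by (auto simp: W_def Bx_def p0_def)
  have WN: "W \<subseteq> N"
  proof
    fix q assume q: "q \<in> W"
    then obtain q' where "q' \<in> N" "\<phi> q = \<phi> q'" using BN by (auto simp: W_def)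
    then show "q \<in> N" using inj_onD[OF top_chartD(3)[OF tc], of q q'] q N(2) W(2) by auto
  qed
  have GW: "smooth_fn M W (\<lambda>q. G i (\<phi> q))" if i: "i \<in> ?I" for i
  proof (rule smooth_fn_of_chart[OF M atlas_is_chart[OF M c] I W])
    have W': "openin (powertop_real ?I) (\<phi> ` W)" using chart_image_open_subset[OF tc W] .
    have "\<phi> ` W \<subseteq> Bx" by (auto simp: W_def)
    then have "smooth_on ?I (\<phi> ` W) (G i)" using smooth_on_subset[OF coord_openin_subset[OF oB] _ G[OF i]] by simp
    moreover have "\<phi> (inv_into U \<phi> z) = z" if "z \<in> \<phi> ` W" for z
      using that W(2) by (meson f_inv_into_f image_mono subsetD)
    ultimately show "smooth_on ?I (\<phi> ` W) (\<lambda>z. G i (\<phi> (inv_into U \<phi> z)))"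
      using smooth_on_cong[OF W', of "\<lambda>z. G i (\<phi> (inv_into U \<phi> z))" "G i"] by simp
  qed
  obtain N' E where E: "openin (mtop M) N'" "p \<in> N'" "N' \<subseteq> W"
    "\<And>g. smooth_fn M W g \<Longrightarrow> E g \<in> smooth_functions M" "\<And>g q. q \<in> N' \<Longrightarrow> E g q = g q"
    using chart_extend[OF M c pU W(1) pW W(2)] by metis
  \<comment> \<open>Global functions with the germs of the Hadamard coefficients.\<close>
  define g where "g i = E (\<lambda>q. G i (\<phi> q))" for i
  have g: "g i \<in> smooth_functions M" if "i \<in> ?I" for i unfolding g_def by (rule E(4)[OF GW[OF that]])
  \<comment> \<open>The coordinate functions shifted so that they vanish at \<open>p\<close>.\<close>
  define y where "y i = (\<lambda>q\<in>points M. x i q + (\<lambda>q\<in>points M. - p0 i) q)" for i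
  have y: "y i \<in> smooth_functions M" if "i \<in> ?I" for i unfolding y_def by (rule sf_add[OF M x(1)[OF that] sf_const[OF M]])
  have vy: "v (y i) = v (x i)" if "i \<in> ?I" for i
    unfolding y_def using tvD(1)[OF v x(1)[OF that] sf_const[OF M]] tv_const[OF v pM] by simp
  define s where "s = (\<lambda>q\<in>points M. \<Sum>i\<in>?I. (\<lambda>q\<in>points M. y i q * g i q) q)"
  have yg: "(\<lambda>q\<in>points M. y i q * g i q) \<in> smooth_functions M" if "i \<in> ?I" for i
    by (rule sf_mult[OF M y[OF that] g[OF that]])
  have s: "s \<in> smooth_functions M" unfolding s_def by (rule sf_sum[OF M yg])
  let ?r = "\<lambda>q\<in>points M. (\<lambda>q\<in>points M. f p) q + s q"
  have "v f = v ?r"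
  proof (rule tv_local[OF v f sf_add[OF M sf_const[OF M] s] E(1,2)])
    fix q assume q: "q \<in> N'"
    then have qq: "q \<in> W" "q \<in> N" "q \<in> U" "q \<in> points M" using E(3) WN N(2) NM by auto
    have "\<phi> q \<in> Bx" using qq by (simp add: W_def)
    from had[OF this] have "f q = f p + (\<Sum>i\<in>?I. (\<phi> q i - p0 i) * G i (\<phi> q))"
      using chart_inv[OF tc qq(3)] chart_inv[OF tc pU] by (simp add: h_def p0_def)
    also have "(\<Sum>i\<in>?I. (\<phi> q i - p0 i) * G i (\<phi> q)) = s q"
      unfolding s_def using qq(4) x(2)[OF _ qq(2)] E(5)[OF q] by (auto simp: y_def g_def intro!: sum.cong)
    finally show "f q = ?r q" using qq(4) by simp
  qed
  also have "v ?r = v s" using tvD(1)[OF v sf_const[OF M] s] tv_const[OF v pM] by simp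
  also have "v s = (\<Sum>i\<in>?I. v (\<lambda>q\<in>points M. y i q * g i q))" unfolding s_def by (rule tv_sum[OF v yg])
  also have "\<dots> = (\<Sum>i\<in>?I. pderiv_at i h p0 * v (x i))"
  proof (rule sum.cong[OF refl])
    fix i assume i: "i \<in> ?I"
    have "y i p = 0" using x(2)[OF i pN] pM by (simp add: y_def p0_def)
    moreover have "g i p = pderiv_at i h p0" using E(5)[OF E(2)] Gp[OF i] by (simp add: g_def p0_def)
    ultimately show "v (\<lambda>q\<in>points M. y i q * g i q) = pderiv_at i h p0 * v (x i)"
      using tvD(2)[OF v y[OF i] g[OF i]] vy[OF i] by simp
  qed
  finally show ?thesis by (simp add: h_def[abs_def] p0_def)
qed

lemma coord_vector_tangent:
  assumes c: "(U, \<phi>) \<in> matlas M" and i: "i \<in> midx M" and p: "p \<in> U"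
  shows "coord_vector M (U, \<phi>) i p \<in> tangent_space M p"
proof -
  note tc = atlas_chart[OF M c]
  note o = top_chartD(2)[OF tc] and UM = top_chartD(5)[OF tc]
  let ?h = "\<lambda>f z. f (inv_into U \<phi> z)"
  have h: "smooth_on (midx M) (\<phi> ` U) (?h f)" if "f \<in> smooth_functions M" for f
    using smooth_fnD[OF smooth_functionsD[OF M that UM] c] by simp
  have pd: "pdiff i (?h f) (\<phi> p)" if "f \<in> smooth_functions M" for f
    using smooth_on_pdiff[OF coord_openin_subset[OF o] h[OF that] i] p by simp
  have inv: "inv_into U \<phi> z \<in> points M" if "z \<in> \<phi> ` U" for z using that UM by (metis inv_into_into subsetD)
  have cg: "pderiv_at i (?h (\<lambda>q\<in>points M. F q)) (\<phi> p) = pderiv_at i (?h F) (\<phi> p)" for F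
    by (rule pderiv_at_cong[OF o _ _ i]) (use inv p in auto)
  have v: "coord_vector M (U, \<phi>) i p f = pderiv_at i (?h f) (\<phi> p)" if "f \<in> smooth_functions M" for f
    using that by (simp add: coord_vector_def)
  note pm = sf_add[OF M] sf_mult[OF M] sf_scale[OF M]
  have "coord_vector M (U, \<phi>) i p (\<lambda>q\<in>points M. f q + g q) = coord_vector M (U, \<phi>) i p f + coord_vector M (U, \<phi>) i p g"
    if fg: "f \<in> smooth_functions M" "g \<in> smooth_functions M" for f g
    unfolding v[OF pm(1)[OF fg]] v[OF fg(1)] v[OF fg(2)] cg by (rule pd_add(2)[OF pd[OF fg(1)] pd[OF fg(2)]])
  moreover have "coord_vector M (U, \<phi>) i p (\<lambda>q\<in>points M. f q * g q) = f p * coord_vector M (U, \<phi>) i p g + g p * coord_vector M (U, \<phi>) i p f"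
    if fg: "f \<in> smooth_functions M" "g \<in> smooth_functions M" for f g
    unfolding v[OF pm(2)[OF fg]] v[OF fg(1)] v[OF fg(2)] cg using pd_mult(2)[OF pd[OF fg(1)] pd[OF fg(2)]]
    by (simp only: chart_inv[OF tc p])
  moreover have "coord_vector M (U, \<phi>) i p (\<lambda>q\<in>points M. a * f q) = a * coord_vector M (U, \<phi>) i p f"
    if f: "f \<in> smooth_functions M" for a f
    unfolding v[OF pm(3)[OF f]] v[OF f] cg using pd_mult(2)[OF pd_const(1) pd[OF f], of a] by (simp add: pd_const(2))
  moreover have "coord_vector M (U, \<phi>) i p \<in> extensional (smooth_functions M)" by (simp add: coord_vector_def)
  ultimately show ?thesis unfolding tangent_space_def by blast
qed

lemma tangent_add: "u \<in> tangent_space M p \<Longrightarrow> v \<in> tangent_space M p \<Longrightarrow> (\<lambda>f\<in>smooth_functions M. u f + v f) \<in> tangent_space M p"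
  unfolding tangent_space_def using sf_add[OF M] sf_mult[OF M] sf_scale[OF M] by (auto simp: algebra_simps)

lemma tangent_scale: "v \<in> tangent_space M p \<Longrightarrow> (\<lambda>f\<in>smooth_functions M. c * v f) \<in> tangent_space M p"
  unfolding tangent_space_def using sf_add[OF M] sf_mult[OF M] sf_scale[OF M] by (auto simp: algebra_simps)

lemma tangent_zero: "(\<lambda>f\<in>smooth_functions M. 0) \<in> tangent_space M p"
  unfolding tangent_space_def using sf_add[OF M] sf_mult[OF M] sf_scale[OF M] by auto

lemma tangent_ext: "u \<in> tangent_space M p \<Longrightarrow> v \<in> tangent_space M p \<Longrightarrow> (\<And>f. f \<in> smooth_functions M \<Longrightarrow> u f = v f) \<Longrightarrow> u = v"
  unfolding tangent_space_def by (auto intro: extensionalityI)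

subsection \<open>Cotangent vectors\<close>

lemma cotD:
  assumes "\<alpha> \<in> cotangent_space M p" "u \<in> tangent_space M p" "v \<in> tangent_space M p"
  shows "\<alpha> (\<lambda>f\<in>smooth_functions M. u f + v f) = \<alpha> u + \<alpha> v"
    "\<alpha> (\<lambda>f\<in>smooth_functions M. c * v f) = c * \<alpha> v"
  using assms by (auto simp: cotangent_space_def)

lemma cot_combination:
  assumes \<alpha>: "\<alpha> \<in> cotangent_space M p" and S: "finite S" and v: "\<And>k. k \<in> S \<Longrightarrow> v k \<in> tangent_space M p"
  shows "(\<lambda>f\<in>smooth_functions M. \<Sum>k\<in>S. c k * v k f) \<in> tangent_space M p \<and>
    \<alpha> (\<lambda>f\<in>smooth_functions M. \<Sum>k\<in>S. c k * v k f) = (\<Sum>k\<in>S. c k * \<alpha> (v k))"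
  using S v
proof (induction S)
  case empty
  have "(\<lambda>f\<in>smooth_functions M. 0 * (\<lambda>f\<in>smooth_functions M. 0) f) = (\<lambda>f\<in>smooth_functions M. 0::real)" by (auto simp: restrict_def)
  then have "\<alpha> (\<lambda>f\<in>smooth_functions M. 0) = 0" using cotD(2)[OF \<alpha> tangent_zero tangent_zero, of 0] by (simp only: mult_zero_left)
  then show ?case unfolding sum.empty using tangent_zero by (intro conjI)
next
  case (insert k S)
  let ?u = "\<lambda>f\<in>smooth_functions M. c k * v k f" and ?w = "\<lambda>f\<in>smooth_functions M. \<Sum>k\<in>S. c k * v k f"
  have u: "?u \<in> tangent_space M p" by (rule tangent_scale) (use insert in auto)
  have w: "?w \<in> tangent_space M p" "\<alpha> ?w = (\<Sum>k\<in>S. c k * \<alpha> (v k))"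
    using insert.IH[OF insert.prems[OF insertI2]] by blast+
  have eq: "(\<lambda>f\<in>smooth_functions M. \<Sum>k\<in>insert k S. c k * v k f) = (\<lambda>f\<in>smooth_functions M. ?u f + ?w f)"
    by (rule restrict_ext) (use insert in auto)
  have vk: "v k \<in> tangent_space M p" using insert.prems by auto
  have "\<alpha> (\<lambda>f\<in>smooth_functions M. ?u f + ?w f) = (\<Sum>k\<in>insert k S. c k * \<alpha> (v k))"
    unfolding cotD(1)[OF \<alpha> u w(1)] cotD(2)[OF \<alpha> vk vk] w(2) sum.insert[OF insert.hyps] ..
  then show ?case unfolding eq using tangent_add[OF u w(1)] by (intro conjI)
qed

text \<open>
  Dual form of \<open>tangent_expansion\<close>: the vector is the combination of the coordinate vectors with
  coefficients \<open>v(x\<^sub>i)\<close>.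
\<close>

lemma cot_expansion:
  assumes c: "(U, \<phi>) \<in> matlas M" and N: "openin (mtop M) N" "N \<subseteq> U" and pN: "p \<in> N"
    and x: "\<And>i. i \<in> midx M \<Longrightarrow> x i \<in> smooth_functions M" "\<And>i q. i \<in> midx M \<Longrightarrow> q \<in> N \<Longrightarrow> x i q = \<phi> q i"
    and \<alpha>: "\<alpha> \<in> cotangent_space M p" and v: "v \<in> tangent_space M p"
  shows "\<alpha> v = (\<Sum>i\<in>midx M. \<alpha> (coord_vector M (U, \<phi>) i p) * v (x i))"
proof -
  have cv: "coord_vector M (U, \<phi>) i p \<in> tangent_space M p" if "i \<in> midx M" for i
    by (rule coord_vector_tangent[OF c that]) (use N pN in auto)
  note cc = cot_combination[OF \<alpha> midx_finite[OF M], of "\<lambda>i. coord_vector M (U, \<phi>) i p" "\<lambda>i. v (x i)", OF cv]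
  have "v = (\<lambda>f\<in>smooth_functions M. \<Sum>i\<in>midx M. v (x i) * coord_vector M (U, \<phi>) i p f)"
  proof (rule tangent_ext[OF v])
    fix f assume f: "f \<in> smooth_functions M"
    show "v f = (\<lambda>f\<in>smooth_functions M. \<Sum>i\<in>midx M. v (x i) * coord_vector M (U, \<phi>) i p f) f"
      using tangent_expansion[OF c N pN x v f] f by (simp add: coord_vector_def mult.commute)
  qed (use cc in auto)
  then have "\<alpha> v = \<alpha> (\<lambda>f\<in>smooth_functions M. \<Sum>i\<in>midx M. v (x i) * coord_vector M (U, \<phi>) i p f)" by (rule arg_cong)
  also have "\<dots> = (\<Sum>i\<in>midx M. v (x i) * \<alpha> (coord_vector M (U, \<phi>) i p))" using cc by blast
  finally show ?thesis by (simp add: mult.commute)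
qed

subsection \<open>One-forms\<close>

lemma one_forms_iff: "\<omega> \<in> one_forms M \<longleftrightarrow> \<omega> \<in> Pi\<^sub>E (points M) (cotangent_space M) \<and>
   (\<forall>(U, \<phi>)\<in>matlas M. \<forall>i\<in>midx M. smooth_fn M U (\<lambda>p. \<omega> p (coord_vector M (U, \<phi>) i p)))"
proof -
  have "smooth_on (midx M) (\<phi> ` U) (\<lambda>z. let p = inv_into U \<phi> z in \<omega> p (coord_vector M (U, \<phi>) i p)) \<longleftrightarrow>
      smooth_fn M U (\<lambda>p. \<omega> p (coord_vector M (U, \<phi>) i p))" if c: "(U, \<phi>) \<in> matlas M" for U \<phi> i
  proof -
    note tc = atlas_chart[OF M c]
    show ?thesis
      using smooth_fn_of_chart[OF M atlas_is_chart[OF M c] midx_finite[OF M] top_chartD(1)[OF tc] subset_refl]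
        smooth_fnD[OF _ c, of U] unfolding Let_def Int_absorb by (intro iffI) auto
  qed
  then show ?thesis unfolding one_forms_def by auto
qed

lemma one_form_cot: "\<omega> \<in> one_forms M \<Longrightarrow> p \<in> points M \<Longrightarrow> \<omega> p \<in> cotangent_space M p"
  by (auto simp: one_forms_iff)

text \<open>
  The neighborhood and the functions \<open>x\<^sub>i\<close> are chosen before the form. A property of the
  differentials of these finitely many functions thereby carries over to all forms on the same
  neighborhood.
\<close>

lemma coframe:
  assumes p: "p \<in> points M"
  obtains N x where "openin (mtop M) N" "p \<in> N" "\<And>i. i \<in> midx M \<Longrightarrow> x i \<in> smooth_functions M"
    "\<And>\<omega>. \<omega> \<in> one_forms M \<Longrightarrow> \<exists>a. (\<forall>i\<in>midx M. a i \<in> smooth_functions M) \<and>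
      (\<forall>q\<in>N. \<forall>v\<in>tangent_space M q. \<omega> q v = (\<Sum>i\<in>midx M. a i q * v (x i)))"
proof -
  obtain U \<phi> where c: "(U, \<phi>) \<in> matlas M" "p \<in> U" using atlas_cover[OF M p] by blast
  note tc = atlas_chart[OF M c(1)]
  obtain N E where E: "openin (mtop M) N" "p \<in> N" "N \<subseteq> U"
    "\<And>g. smooth_fn M U g \<Longrightarrow> E g \<in> smooth_functions M" "\<And>g q. q \<in> N \<Longrightarrow> E g q = g q"
    using chart_extend[OF M c top_chartD(1)[OF tc] c(2) subset_refl] by metis
  define x where "x i = E (\<lambda>q. \<phi> q i)" for i
  have x: "x i \<in> smooth_functions M" "i \<in> midx M \<Longrightarrow> q \<in> N \<Longrightarrow> x i q = \<phi> q i" for i q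
    unfolding x_def using E(4)[OF smooth_fn_coord[OF M atlas_is_chart[OF M c(1)] midx_finite[OF M]]] E(5) by auto
  show thesis
  proof (rule that[OF E(1,2)])
    show "x i \<in> smooth_functions M" for i by (rule x)
    fix \<omega> assume \<omega>: "\<omega> \<in> one_forms M"
    define a where "a i = E (\<lambda>q. \<omega> q (coord_vector M (U, \<phi>) i q))" for i
    show "\<exists>a. (\<forall>i\<in>midx M. a i \<in> smooth_functions M) \<and>
      (\<forall>q\<in>N. \<forall>v\<in>tangent_space M q. \<omega> q v = (\<Sum>i\<in>midx M. a i q * v (x i)))"
    proof (intro exI conjI ballI)
      show "a i \<in> smooth_functions M" if "i \<in> midx M" for i
        unfolding a_def using \<omega> that c by (intro E(4)) (auto simp: one_forms_iff)
      fix q v assume q: "q \<in> N" and v: "v \<in> tangent_space M q"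
      have "\<omega> q \<in> cotangent_space M q" using one_form_cot[OF \<omega>] q openin_subset[OF E(1)] by auto
      then have "\<omega> q v = (\<Sum>i\<in>midx M. \<omega> q (coord_vector M (U, \<phi>) i q) * v (x i))"
        by (intro cot_expansion[OF c(1) E(1,3) q _ _ _ v] x) auto
      then show "\<omega> q v = (\<Sum>i\<in>midx M. a i q * v (x i))" using E(5)[OF q] by (simp add: a_def)
    qed
  qed
qed

text \<open>
  Such a local expression \<open>\<Sum>\<^sub>k a\<^sub>k dx\<^sub>k\<close> is smooth in every chart. The \<open>x\<^sub>k\<close> need not be
  coordinates and their number need not be the dimension, so sums, multiples and pull-backs of
  forms have local expressions of this kind.
\<close>

lemma one_formI:
  assumes \<omega>: "\<omega> \<in> Pi\<^sub>E (points M) (cotangent_space M)"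
    and loc: "\<And>p. p \<in> points M \<Longrightarrow> \<exists>N a x. openin (mtop M) N \<and> p \<in> N \<and>
       (\<forall>k\<in>S. a k \<in> smooth_functions M \<and> x k \<in> smooth_functions M) \<and>
       (\<forall>q\<in>N. \<forall>v\<in>tangent_space M q. \<omega> q v = (\<Sum>k\<in>S. a k q * v (x k)))"
  shows "\<omega> \<in> one_forms M"
  unfolding one_forms_iff
proof (intro conjI ballI, rule \<omega>, safe)
  fix U \<phi> i assume c: "(U, \<phi>) \<in> matlas M" and i: "i \<in> midx M"
  note tc = atlas_chart[OF M c]
  note U = top_chartD(1)[OF tc] and UM = top_chartD(5)[OF tc]
  show "smooth_fn M U (\<lambda>p. \<omega> p (coord_vector M (U, \<phi>) i p))"
  proof (rule smooth_fn_local[OF M UM])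
    fix p assume p: "p \<in> U"
    then have "p \<in> points M" using UM by blast
    from loc[OF this] obtain N a x where N: "openin (mtop M) N" "p \<in> N"
       and ax: "\<And>k. k \<in> S \<Longrightarrow> a k \<in> smooth_functions M" "\<And>k. k \<in> S \<Longrightarrow> x k \<in> smooth_functions M"
       and eq: "\<And>q v. q \<in> N \<Longrightarrow> v \<in> tangent_space M q \<Longrightarrow> \<omega> q v = (\<Sum>k\<in>S. a k q * v (x k))"
      by metis
    have UN: "openin (mtop M) (U \<inter> N)" using U N by blast
    have d: "smooth_fn M (U \<inter> N) (\<lambda>q. coord_vector M (U, \<phi>) i q f)" if f: "f \<in> smooth_functions M" for f
    proof (rule smooth_fn_of_chart[OF M atlas_is_chart[OF M c] midx_finite[OF M] UN])
      let ?V = "\<phi> ` (U \<inter> N)"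
      have oV: "openin (powertop_real (midx M)) ?V" by (rule chart_image_open[OF tc N(1)])
      have "smooth_on (midx M) (\<phi> ` (U \<inter> (U \<inter> N))) (\<lambda>z. f (inv_into U \<phi> z))"
        by (rule smooth_fnD[OF smooth_functionsD[OF M f] c]) (use UM in auto)
      then have "smooth_on (midx M) ?V (\<lambda>z. f (inv_into U \<phi> z))" by simp
      then have "smooth_on (midx M) ?V (pderiv_at i (\<lambda>z. f (inv_into U \<phi> z)))"
        using smooth_on_pderiv[OF coord_openin_subset[OF oV]] i by blast
      moreover have "coord_vector M (U, \<phi>) i (inv_into U \<phi> z) f = pderiv_at i (\<lambda>z. f (inv_into U \<phi> z)) z" if "z \<in> ?V" for z
      proof -
        have "z \<in> \<phi> ` U" using that by auto
        then have "\<phi> (inv_into U \<phi> z) = z" by (rule f_inv_into_f)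
        then show ?thesis using f by (simp add: coord_vector_def)
      qed
      ultimately show "smooth_on (midx M) ?V (\<lambda>z. coord_vector M (U, \<phi>) i (inv_into U \<phi> z) f)"
        using smooth_on_cong[OF oV, of "\<lambda>z. coord_vector M (U, \<phi>) i (inv_into U \<phi> z) f" "pderiv_at i (\<lambda>z. f (inv_into U \<phi> z))"] by simp
    qed simp
    have "smooth_fn M (U \<inter> N) (\<lambda>q. \<Sum>k\<in>S. a k q * coord_vector M (U, \<phi>) i q (x k))"
      by (intro smooth_fn_sum[OF M UN] smooth_fn_mult[OF M UN] d ax smooth_functionsD[OF M]) (use UM in auto)
    moreover have "\<omega> q (coord_vector M (U, \<phi>) i q) = (\<Sum>k\<in>S. a k q * coord_vector M (U, \<phi>) i q (x k))" if "q \<in> U \<inter> N" for q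
      by (rule eq) (use that coord_vector_tangent[OF c i] in auto)
    ultimately have "smooth_fn M (U \<inter> N) (\<lambda>p. \<omega> p (coord_vector M (U, \<phi>) i p))"
      using smooth_fn_cong[OF M UN, of "\<lambda>p. \<omega> p (coord_vector M (U, \<phi>) i p)" "\<lambda>q. \<Sum>k\<in>S. a k q * coord_vector M (U, \<phi>) i q (x k)"] by simp
    then show "\<exists>V. openin (mtop M) V \<and> p \<in> V \<and> smooth_fn M (U \<inter> V) (\<lambda>p. \<omega> p (coord_vector M (U, \<phi>) i p))"
      using N by blast
  qed
qed

text \<open>The form \<open>\<Sum>\<^sub>k a\<^sub>k dx\<^sub>k\<close>.\<close>

definition sum_form :: "'k set \<Rightarrow> ('k \<Rightarrow> 'a \<Rightarrow> real) \<Rightarrow> ('k \<Rightarrow> 'a \<Rightarrow> real) \<Rightarrow> 'a \<Rightarrow> (('a \<Rightarrow> real) \<Rightarrow> real) \<Rightarrow> real" where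
  "sum_form S a x = (\<lambda>p\<in>points M. \<lambda>v\<in>tangent_space M p. \<Sum>k\<in>S. a k p * v (x k))"

lemma sum_form_one_form:
  assumes a: "\<And>k. k \<in> S \<Longrightarrow> a k \<in> smooth_functions M" and x: "\<And>k. k \<in> S \<Longrightarrow> x k \<in> smooth_functions M"
  shows "sum_form S a x \<in> one_forms M"
proof (rule one_formI[where S=S])
  show "sum_form S a x \<in> Pi\<^sub>E (points M) (cotangent_space M)"
    unfolding sum_form_def
  proof (rule restrict_PiE_iff[THEN iffD2], rule ballI)
    fix p assume "p \<in> points M"
    show "(\<lambda>v\<in>tangent_space M p. \<Sum>k\<in>S. a k p * v (x k)) \<in> cotangent_space M p"
      unfolding cotangent_space_def
      using tangent_add[of _ p] tangent_scale[of _ p] x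
      by (auto simp: sum.distrib[symmetric] sum_distrib_left algebra_simps intro!: sum.cong)
  qed
  show "\<exists>N a' x'. openin (mtop M) N \<and> p \<in> N \<and> (\<forall>k\<in>S. a' k \<in> smooth_functions M \<and> x' k \<in> smooth_functions M) \<and>
       (\<forall>q\<in>N. \<forall>v\<in>tangent_space M q. sum_form S a x q v = (\<Sum>k\<in>S. a' k q * v (x' k)))" if "p \<in> points M" for p
    using that a x points_open by (intro exI[of _ "points M"] exI[of _ a] exI[of _ x]) (auto simp: sum_form_def)
qed

lemma one_form_add:
  assumes "\<omega> \<in> one_forms M" "\<sigma> \<in> one_forms M"
  shows "(\<lambda>p\<in>points M. \<lambda>v\<in>tangent_space M p. \<omega> p v + \<sigma> p v) \<in> one_forms M"
proof -
  have A: "(\<lambda>p\<in>points M. \<lambda>v\<in>tangent_space M p. \<omega> p v + \<sigma> p v) \<in> Pi\<^sub>E (points M) (cotangent_space M)"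
  proof (rule restrict_PiE_iff[THEN iffD2], rule ballI)
    fix p assume "p \<in> points M"
    then show "(\<lambda>v\<in>tangent_space M p. \<omega> p v + \<sigma> p v) \<in> cotangent_space M p"
      using one_form_cot[OF assms(1), of p] one_form_cot[OF assms(2), of p] tangent_add[of _ p] tangent_scale[of _ p]
      unfolding cotangent_space_def by (auto simp: algebra_simps)
  qed
  show ?thesis
    unfolding one_forms_iff
  proof (intro conjI ballI, rule A, safe)
  fix U \<phi> i assume c: "(U, \<phi>) \<in> matlas M" and i: "i \<in> midx M"
  note tc = atlas_chart[OF M c]
  note U = top_chartD(1)[OF tc] and UM = top_chartD(5)[OF tc]
  have "smooth_fn M U (\<lambda>p. \<omega> p (coord_vector M (U, \<phi>) i p) + \<sigma> p (coord_vector M (U, \<phi>) i p))"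
    using assms c i by (intro smooth_fn_add[OF M U]) (auto simp: one_forms_iff)
  then show "smooth_fn M U (\<lambda>p. (\<lambda>p\<in>points M. \<lambda>v\<in>tangent_space M p. \<omega> p v + \<sigma> p v) p (coord_vector M (U, \<phi>) i p))"
    by (subst smooth_fn_cong[OF M U, of _ "\<lambda>p. \<omega> p (coord_vector M (U, \<phi>) i p) + \<sigma> p (coord_vector M (U, \<phi>) i p)"])
       (use UM coord_vector_tangent[OF c i] in auto)
  qed
qed

lemma one_form_smult:
  assumes "f \<in> smooth_functions M" "\<omega> \<in> one_forms M"
  shows "(\<lambda>p\<in>points M. \<lambda>v\<in>tangent_space M p. f p * \<omega> p v) \<in> one_forms M"
proof -
  have A: "(\<lambda>p\<in>points M. \<lambda>v\<in>tangent_space M p. f p * \<omega> p v) \<in> Pi\<^sub>E (points M) (cotangent_space M)"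
  proof (rule restrict_PiE_iff[THEN iffD2], rule ballI)
    fix p assume "p \<in> points M"
    then show "(\<lambda>v\<in>tangent_space M p. f p * \<omega> p v) \<in> cotangent_space M p"
      using one_form_cot[OF assms(2), of p] tangent_add[of _ p] tangent_scale[of _ p]
      unfolding cotangent_space_def by (auto simp: algebra_simps)
  qed
  show ?thesis
    unfolding one_forms_iff
  proof (intro conjI ballI, rule A, safe)
  fix U \<phi> i assume c: "(U, \<phi>) \<in> matlas M" and i: "i \<in> midx M"
  note tc = atlas_chart[OF M c]
  note U = top_chartD(1)[OF tc] and UM = top_chartD(5)[OF tc]
  have "smooth_fn M U (\<lambda>p. f p * \<omega> p (coord_vector M (U, \<phi>) i p))"
    using assms c i by (intro smooth_fn_mult[OF M U] smooth_functionsD[OF M assms(1) UM]) (auto simp: one_forms_iff)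
  then show "smooth_fn M U (\<lambda>p. (\<lambda>p\<in>points M. \<lambda>v\<in>tangent_space M p. f p * \<omega> p v) p (coord_vector M (U, \<phi>) i p))"
    by (subst smooth_fn_cong[OF M U, of _ "\<lambda>p. f p * \<omega> p (coord_vector M (U, \<phi>) i p)"])
       (use UM coord_vector_tangent[OF c i] in auto)
  qed
qed

lemma one_form_ext:
  assumes "\<omega> \<in> one_forms M" "\<sigma> \<in> one_forms M"
    and "\<And>p v. p \<in> points M \<Longrightarrow> v \<in> tangent_space M p \<Longrightarrow> \<omega> p v = \<sigma> p v"
  shows "\<omega> = \<sigma>"
proof
  fix p show "\<omega> p = \<sigma> p"
  proof (cases "p \<in> points M")
    case True
    show ?thesis
      using one_form_cot[OF assms(1) True] one_form_cot[OF assms(2) True] assms(3)[OF True]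
      by (intro extensionalityI[of _ "tangent_space M p"]) (auto simp: cotangent_space_def)
  next
    case False
    then show ?thesis using assms(1,2) by (auto simp: one_forms_iff PiE_iff extensional_def)
  qed
qed

end

subsection \<open>Pull-back\<close>

context
  fixes M :: "('a, 'i) manifold" and N :: "('b, 'j) manifold" and F :: "'a \<Rightarrow> 'b"
  assumes M: "smooth_manifold M" and N: "smooth_manifold N"
    and F: "continuous_map (mtop M) (mtop N) F"
    and pull: "\<And>g. g \<in> smooth_functions N \<Longrightarrow> pullback_fun M F g \<in> smooth_functions M"
begin

lemma pushforward_tangent:
  assumes p: "p \<in> points M" and v: "v \<in> tangent_space M p"
  shows "pushforward M N F v \<in> tangent_space N (F p)"
proof -
  have FN: "F q \<in> points N" if "q \<in> points M" for q using F that by (auto simp: continuous_map_def)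
  have 1: "pullback_fun M F (\<lambda>q\<in>points N. f q + g q) = (\<lambda>q\<in>points M. pullback_fun M F f q + pullback_fun M F g q)"
    "pullback_fun M F (\<lambda>q\<in>points N. f q * g q) = (\<lambda>q\<in>points M. pullback_fun M F f q * pullback_fun M F g q)"
    "pullback_fun M F (\<lambda>q\<in>points N. c * f q) = (\<lambda>q\<in>points M. c * pullback_fun M F f q)" for f g c
    unfolding pullback_fun_def by (auto simp: FN intro!: restrict_ext)
  have 2: "pullback_fun M F f p = f (F p)" for f using p by (simp add: pullback_fun_def)
  have 3: "pushforward M N F v g = v (pullback_fun M F g)" if "g \<in> smooth_functions N" for g
    using that by (simp add: pushforward_def)
  show ?thesis
    unfolding tangent_space_def mem_Collect_eq
  proof (intro conjI ballI allI)
    fix f g assume f: "f \<in> smooth_functions N" and g: "g \<in> smooth_functions N"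
    show "pushforward M N F v (\<lambda>q\<in>points N. f q + g q) = pushforward M N F v f + pushforward M N F v g"
      unfolding 3[OF sf_add[OF N f g]] 3[OF f] 3[OF g] 1(1) by (rule tvD(1)[OF M v pull[OF f] pull[OF g]])
    show "pushforward M N F v (\<lambda>q\<in>points N. f q * g q) = f (F p) * pushforward M N F v g + g (F p) * pushforward M N F v f"
      unfolding 3[OF sf_mult[OF N f g]] 3[OF f] 3[OF g] 1(2) tvD(2)[OF M v pull[OF f] pull[OF g]] 2 ..
  next
    fix c f assume f: "f \<in> smooth_functions N"
    show "pushforward M N F v (\<lambda>q\<in>points N. c * f q) = c * pushforward M N F v f"
      unfolding 3[OF sf_scale[OF N f]] 3[OF f] 1(3) by (rule tv_scale[OF M v pull[OF f]])
  qed (simp add: pushforward_def)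
qed

text \<open>
  The pull-back of \<open>\<Sum>\<^sub>i a\<^sub>i dx\<^sub>i\<close> is \<open>\<Sum>\<^sub>i (a\<^sub>i \<circ> F) d(x\<^sub>i \<circ> F)\<close>. Smoothness of \<open>F\<close> enters as
  stability of the smooth functions under composition with \<open>F\<close>.
\<close>

lemma pullback_one_form:
  assumes \<omega>: "\<omega> \<in> one_forms N"
  shows "pullback_form M N F \<omega> \<in> one_forms M"
proof (rule one_formI[OF M, where S="midx N"])
  have FN: "F q \<in> points N" if "q \<in> points M" for q using F that by (auto simp: continuous_map_def)
  show "pullback_form M N F \<omega> \<in> Pi\<^sub>E (points M) (cotangent_space M)"
    unfolding pullback_form_def
  proof (rule restrict_PiE_iff[THEN iffD2], rule ballI)
    fix p assume p: "p \<in> points M"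
    note cot = cotD[OF N one_form_cot[OF N \<omega> FN[OF p]] pushforward_tangent[OF p] pushforward_tangent[OF p]]
    have 1: "pushforward M N F (\<lambda>f\<in>smooth_functions M. u f + v f) = (\<lambda>f\<in>smooth_functions N. pushforward M N F u f + pushforward M N F v f)"
      "pushforward M N F (\<lambda>f\<in>smooth_functions M. c * v f) = (\<lambda>f\<in>smooth_functions N. c * pushforward M N F v f)" for u v c
      unfolding pushforward_def by (auto simp: pull intro!: restrict_ext)
    show "(\<lambda>v\<in>tangent_space M p. \<omega> (F p) (pushforward M N F v)) \<in> cotangent_space M p"
      unfolding cotangent_space_def mem_Collect_eq
    proof (intro conjI ballI allI)
      fix u v assume u: "u \<in> tangent_space M p" and v: "v \<in> tangent_space M p"
      show "(\<lambda>v\<in>tangent_space M p. \<omega> (F p) (pushforward M N F v)) (\<lambda>f\<in>smooth_functions M. u f + v f) =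
          (\<lambda>v\<in>tangent_space M p. \<omega> (F p) (pushforward M N F v)) u + (\<lambda>v\<in>tangent_space M p. \<omega> (F p) (pushforward M N F v)) v"
        unfolding restrict_apply'[OF tangent_add[OF M u v]] restrict_apply'[OF u] restrict_apply'[OF v] 1(1) by (rule cot(1)[OF u v])
    next
      fix c v assume v: "v \<in> tangent_space M p"
      show "(\<lambda>v\<in>tangent_space M p. \<omega> (F p) (pushforward M N F v)) (\<lambda>f\<in>smooth_functions M. c * v f) =
          c * (\<lambda>v\<in>tangent_space M p. \<omega> (F p) (pushforward M N F v)) v"
        unfolding restrict_apply'[OF tangent_scale[OF M v]] restrict_apply'[OF v] 1(2) by (rule cot(2)[OF v v])
    qed simp
  qed
  fix p assume p: "p \<in> points M"
  obtain V x where Vx: "openin (mtop N) V" "F p \<in> V" "\<And>i. i \<in> midx N \<Longrightarrow> x i \<in> smooth_functions N"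
    "\<And>\<omega>. \<omega> \<in> one_forms N \<Longrightarrow> \<exists>a. (\<forall>i\<in>midx N. a i \<in> smooth_functions N) \<and>
      (\<forall>q\<in>V. \<forall>v\<in>tangent_space N q. \<omega> q v = (\<Sum>i\<in>midx N. a i q * v (x i)))"
    by (rule coframe[OF N FN[OF p]]) (rule that)
  from Vx(4)[OF \<omega>] obtain a where a: "(\<forall>i\<in>midx N. a i \<in> smooth_functions N) \<and>
      (\<forall>q\<in>V. \<forall>v\<in>tangent_space N q. \<omega> q v = (\<Sum>i\<in>midx N. a i q * v (x i)))" ..
  have V: "openin (mtop N) V" "F p \<in> V" "\<And>i. i \<in> midx N \<Longrightarrow> a i \<in> smooth_functions N"
    "\<And>i. i \<in> midx N \<Longrightarrow> x i \<in> smooth_functions N"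
    "\<And>q v. q \<in> V \<Longrightarrow> v \<in> tangent_space N q \<Longrightarrow> \<omega> q v = (\<Sum>i\<in>midx N. a i q * v (x i))"
    using Vx a by simp_all
  let ?W = "{q \<in> points M. F q \<in> V}"
  have W: "openin (mtop M) ?W" using openin_continuous_map_preimage[OF F V(1)] .
  have eq: "pullback_form M N F \<omega> q v = (\<Sum>i\<in>midx N. pullback_fun M F (a i) q * v (pullback_fun M F (x i)))"
    if q: "q \<in> ?W" and v: "v \<in> tangent_space M q" for q v
  proof -
    have qM: "q \<in> points M" "F q \<in> V" using q by auto
    have "pullback_form M N F \<omega> q v = \<omega> (F q) (pushforward M N F v)"
      using qM v by (simp add: pullback_form_def)
    also have "\<dots> = (\<Sum>i\<in>midx N. a i (F q) * pushforward M N F v (x i))"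
      by (rule V(5)[OF qM(2) pushforward_tangent[OF qM(1) v]])
    also have "\<dots> = (\<Sum>i\<in>midx N. pullback_fun M F (a i) q * v (pullback_fun M F (x i)))"
      by (rule sum.cong[OF refl]) (simp add: pushforward_def V(4), simp add: pullback_fun_def qM)
    finally show ?thesis .
  qed
  show "\<exists>W a' x'. openin (mtop M) W \<and> p \<in> W \<and>
       (\<forall>k\<in>midx N. a' k \<in> smooth_functions M \<and> x' k \<in> smooth_functions M) \<and>
       (\<forall>q\<in>W. \<forall>v\<in>tangent_space M q. pullback_form M N F \<omega> q v = (\<Sum>k\<in>midx N. a' k q * v (x' k)))"
  proof (intro exI conjI ballI)
    show "openin (mtop M) ?W" by (rule W)
    show "p \<in> ?W" using p V(2) by simp
    show "pullback_fun M F (a k) \<in> smooth_functions M" "pullback_fun M F (x k) \<in> smooth_functions M" if "k \<in> midx N" for k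
      using pull V(3,4) that by auto
    show "pullback_form M N F \<omega> q v = (\<Sum>k\<in>midx N. pullback_fun M F (a k) q * v (pullback_fun M F (x k)))"
      if "q \<in> ?W" "v \<in> tangent_space M q" for q v by (rule eq[OF that])
  qed
qed

end

text \<open>
  Values of extensional functions are rewritten only at arguments known to lie in the domain.
  The unconditional rule would introduce a case distinction at every application, and forms are
  nested restrictions.
\<close>

declare restrict_apply [simp del] restrict_apply' [simp]

section \<open>A diagonal argument on manifolds\<close>

lemma second_countable_top_eq: "second_countable_top T \<longleftrightarrow> second_countable T"
  by (simp add: second_countable_top_def second_countable_def)

lemma Lindelof_cover:
  assumes "second_countable X" and P: "\<And>p. p \<in> topspace X \<Longrightarrow> \<exists>N. openin X N \<and> p \<in> N \<and> P N" and ne: "topspace X \<noteq> {}"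
  obtains N :: "nat \<Rightarrow> 'a set" where "\<And>k. openin X (N k)" "\<And>k. P (N k)" "(\<Union>k. N k) = topspace X"
proof -
  have "Lindelof_space X" using assms(1) by (rule second_countable_imp_Lindelof_space)
  moreover have "\<Union>{N. openin X N \<and> P N} = topspace X" using P openin_subset by fastforce
  ultimately obtain \<V> where \<V>: "countable \<V>" "\<V> \<subseteq> {N. openin X N \<and> P N}" "\<Union>\<V> = topspace X"
    unfolding Lindelof_space_def by (metis (mono_tags, lifting) mem_Collect_eq)
  then have "\<V> \<noteq> {}" using ne by blast
  with \<V> have "range (from_nat_into \<V>) = \<V>" by (simp add: range_from_nat_into)
  then show thesis using that[of "from_nat_into \<V>"] \<V> by (metis (mono_tags, lifting) mem_Collect_eq rangeI subsetD)
qed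

lemma compactin_increasing:
  fixes V :: "nat \<Rightarrow> 'a set"
  assumes L: "compactin X L" and V: "\<And>k. openin X (V k)" "\<And>k m. k \<le> m \<Longrightarrow> V k \<subseteq> V m" "L \<subseteq> (\<Union>k. V k)"
  obtains k where "L \<subseteq> V k"
proof -
  obtain \<F> where \<F>: "finite \<F>" "\<F> \<subseteq> range V" "L \<subseteq> \<Union>\<F>"
    using compactinD[OF L, of "range V"] V(1,3) by auto
  then obtain S where S: "finite S" "\<F> = V ` S" by (meson finite_subset_image)
  have "\<Union>\<F> \<subseteq> V (Max (insert 0 S))"
  proof -
    have "V i \<subseteq> V (Max (insert 0 S))" if "i \<in> S" for i
      by (rule V(2), rule Max_ge) (use S that in simp_all)
    then show ?thesis unfolding S(2) by (rule UN_least)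
  qed
  with \<F>(3) have "L \<subseteq> V (Max (insert 0 S))" by (rule subset_trans)
  then show thesis by (rule that)
qed

context
  fixes M :: "('a, 'i) manifold"
  assumes M: "smooth_manifold M"
begin

text \<open>
  By the Lindelof property, countably many relatively compact neighborhoods cover the manifold;
  take finite unions.
\<close>

lemma exhaustion:
  assumes "points M \<noteq> {}"
  obtains V C :: "nat \<Rightarrow> 'a set" where "\<And>k. openin (mtop M) (V k)" "\<And>k m. k \<le> m \<Longrightarrow> V k \<subseteq> V m"
    "(\<Union>k. V k) = points M" "\<And>k. compactin (mtop M) (C k)" "\<And>k. V k \<subseteq> C k"
proof -
  have "\<exists>N. openin (mtop M) N \<and> p \<in> N \<and> (\<exists>K. compactin (mtop M) K \<and> N \<subseteq> K)" if "p \<in> points M" for p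
  proof -
    obtain U \<phi> where c: "(U, \<phi>) \<in> matlas M" "p \<in> U" using atlas_cover[OF M \<open>p \<in> points M\<close>] by blast
    show ?thesis by (rule chart_bump[OF M c points_open[OF M] that]) blast
  qed
  note cov = this
  have sc: "second_countable (mtop M)" using M by (simp add: smooth_manifold_def second_countable_top_eq)
  obtain N where N: "\<And>k::nat. openin (mtop M) (N k)" "\<And>k. \<exists>K. compactin (mtop M) K \<and> N k \<subseteq> K" "(\<Union>k. N k) = points M"
    by (rule Lindelof_cover[OF sc cov assms], assumption) (rule that)
  from N(2) obtain K where K: "\<And>k. compactin (mtop M) (K k)" "\<And>k. N k \<subseteq> K k" by metis
  show thesis
  proof (rule that[of "\<lambda>k. \<Union>i<k. N i" "\<lambda>k. \<Union>i<k. K i"])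
    show "openin (mtop M) (\<Union>i<k. N i)" for k using N(1) by blast
    show "(\<Union>i<k. N i) \<subseteq> (\<Union>i<m. N i)" if "k \<le> m" for k m by (rule UN_mono) (use that in auto)
    have "N k \<subseteq> (\<Union>i<Suc k. N i)" for k by auto
    then show "(\<Union>k. \<Union>i<k. N i) = points M" unfolding N(3)[symmetric] by blast
    show "compactin (mtop M) (\<Union>i<k. K i)" for k using K(1) by (auto intro!: compactin_Union)
    show "(\<Union>i<k. N i) \<subseteq> (\<Union>i<k. K i)" for k using K(2) by auto
  qed
qed

text \<open>
  A diagonal argument. On each compact set there is a bound by \<open>loc\<close>, so if no bound holds
  everywhere, the points at which it fails leave every compact set. There one finds functions
  \<open>F\<^sub>n\<close> with disjoint, locally finite supports such that \<open>F\<^sub>n\<close> violates the bound \<open>n\<close> at some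
  point \<open>P\<^sub>n\<close>. Their sum has the germ of \<open>F\<^sub>n\<close> at \<open>P\<^sub>n\<close> and contradicts \<open>each\<close>.
\<close>

lemma locally_bounded_imp_bounded:
  fixes Q :: "nat \<Rightarrow> 'a \<Rightarrow> ('a \<Rightarrow> real) \<Rightarrow> bool"
  assumes germ: "\<And>n p f g N. f \<in> smooth_functions M \<Longrightarrow> g \<in> smooth_functions M \<Longrightarrow> openin (mtop M) N \<Longrightarrow> p \<in> N \<Longrightarrow>
      (\<And>q. q \<in> N \<Longrightarrow> f q = g q) \<Longrightarrow> Q n p f \<Longrightarrow> Q n p g"
    and mono: "\<And>m n p f. m \<le> n \<Longrightarrow> p \<in> points M \<Longrightarrow> f \<in> smooth_functions M \<Longrightarrow> Q m p f \<Longrightarrow> Q n p f"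
    and loc: "\<And>p. p \<in> points M \<Longrightarrow> \<exists>n W. openin (mtop M) W \<and> p \<in> W \<and> (\<forall>q\<in>W. \<forall>f\<in>smooth_functions M. Q n q f)"
    and each: "\<And>f. f \<in> smooth_functions M \<Longrightarrow> \<exists>n. \<forall>p\<in>points M. Q n p f"
  shows "\<exists>n. \<forall>p\<in>points M. \<forall>f\<in>smooth_functions M. Q n p f"
proof (rule ccontr)
  let ?S = "smooth_functions M"
  assume "\<not> ?thesis"
  then have unb: "\<exists>p\<in>points M. \<exists>f\<in>?S. \<not> Q n p f" for n by blast
  then have "points M \<noteq> {}" by blast
  then obtain V C :: "nat \<Rightarrow> 'a set" where V: "\<And>k. openin (mtop M) (V k)" "\<And>k m. k \<le> m \<Longrightarrow> V k \<subseteq> V m"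
    "(\<Union>k. V k) = points M" and C: "\<And>k. compactin (mtop M) (C k)" "\<And>k. V k \<subseteq> C k"
    by (rule exhaustion) (rule that)
  have bounded: "\<exists>n. \<forall>q\<in>C k. \<forall>f\<in>?S. Q n q f" for k
  proof -
    define W where "W n = \<Union>{W. openin (mtop M) W \<and> (\<forall>q\<in>W. \<forall>f\<in>?S. Q n q f)}" for n
    obtain n where "C k \<subseteq> W n"
    proof (rule compactin_increasing[OF C(1), of W k])
      show "openin (mtop M) (W n)" for n unfolding W_def by blast
      show "W m \<subseteq> W n" if "m \<le> n" for m n
        unfolding W_def using mono[OF that] openin_subset by (intro Union_mono) blast
      show "C k \<subseteq> (\<Union>n. W n)"
        using loc compactin_subset_topspace[OF C(1)] unfolding W_def by fastforce
    qed
    then show ?thesis unfolding W_def by blast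
  qed
  \<comment> \<open>A violation of the bound \<open>n\<close> at \<open>p\<close> by a function supported in \<open>L\<close>, outside of \<open>V k\<close> and
    inside of \<open>V k'\<close>.\<close>
  define R where "R k n = (\<lambda>(p, f, L, N, k'). k < k' \<and> f \<in> ?S \<and> \<not> Q n p f \<and> openin (mtop M) N \<and> p \<in> N \<and> N \<subseteq> L \<and> L \<inter> V k = {} \<and>
      L \<subseteq> V k' \<and> (\<forall>q\<in>points M - L. f q = 0))" for k n :: nat
  have step: "\<exists>z. R k n z" for k n
  proof -
    obtain b where b: "\<And>q f. q \<in> C k \<Longrightarrow> f \<in> ?S \<Longrightarrow> Q b q f" using bounded by blast
    \<comment> \<open>Since \<open>b\<close> bounds on \<open>C k\<close>, a violation of a bound at least \<open>b\<close> lies outside of \<open>C k\<close>.\<close>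
    obtain p f where pf: "p \<in> points M" "f \<in> ?S" "\<not> Q (max n b) p f" using unb by blast
    then have "p \<notin> C k" using b mono[of b "max n b" p f] by auto
    moreover have "closedin (mtop M) (C k)"
      using M C(1) compactin_imp_closedin by (auto simp: smooth_manifold_def)
    ultimately have W: "openin (mtop M) (points M - C k)" "p \<in> points M - C k" using pf(1) by auto
    obtain U \<phi> where c: "(U, \<phi>) \<in> matlas M" "p \<in> U" using atlas_cover[OF M pf(1)] by blast
    obtain \<rho> N L where \<rho>: "\<rho> \<in> ?S" "openin (mtop M) N" "p \<in> N" "N \<subseteq> L" "L \<subseteq> U \<inter> (points M - C k)"
      "compactin (mtop M) L" "\<And>q. q \<in> N \<Longrightarrow> \<rho> q = 1" "\<And>q. q \<in> points M - L \<Longrightarrow> \<rho> q = 0"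
      by (rule chart_bump[OF M c W]) (rule that)
    define g where "g = (\<lambda>q\<in>points M. \<rho> q * f q)"
    have g: "g \<in> ?S" unfolding g_def by (rule sf_mult[OF M \<rho>(1) pf(2)])
    have NM: "N \<subseteq> points M" using \<rho>(2) by (rule openin_subset)
    have "\<not> Q n p g"
    proof
      assume "Q n p g"
      then have "Q n p f" by (rule germ[OF g pf(2) \<rho>(2,3), rotated]) (use \<rho>(7) NM in \<open>auto simp: g_def\<close>)
      then show False using mono[of n "max n b" p f] pf by auto
    qed
    moreover obtain k' where "L \<subseteq> V k'"
      by (rule compactin_increasing[OF \<rho>(6), of V]) (use V \<rho>(5) in auto)
    then have "L \<subseteq> V (max (Suc k) k')" using V(2)[of k' "max (Suc k) k'"] by auto
    moreover have "\<forall>q\<in>points M - L. g q = 0" using \<rho>(8) by (auto simp: g_def)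
    moreover have "L \<inter> V k = {}" using \<rho>(5) C(2) by blast
    ultimately have "R k n (p, g, L, N, max (Suc k) k')" using g \<rho>(2,3,4) by (simp add: R_def)
    then show ?thesis ..
  qed
  define z where "z k n = (SOME z. R k n z)" for k n
  define p f L N k' where "p k n = fst (z k n)" and "f k n = fst (snd (z k n))" and "L k n = fst (snd (snd (z k n)))"
    and "N k n = fst (snd (snd (snd (z k n))))" and "k' k n = snd (snd (snd (snd (z k n))))" for k n
  have "R k n (z k n)" for k n unfolding z_def using step by (rule someI_ex)
  then have "R k n (p k n, f k n, L k n, N k n, k' k n)" for k n
    by (simp add: p_def f_def L_def N_def k'_def)
  then have st: "\<And>k n. k < k' k n" "\<And>k n. f k n \<in> ?S" "\<And>k n. \<not> Q n (p k n) (f k n)"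
     "\<And>k n. openin (mtop M) (N k n)" "\<And>k n. p k n \<in> N k n" "\<And>k n. N k n \<subseteq> L k n" "\<And>k n. L k n \<inter> V k = {}"
     "\<And>k n. L k n \<subseteq> V (k' k n)" "\<And>k n q. q \<in> points M - L k n \<Longrightarrow> f k n q = 0"
    by (simp_all add: R_def)
  \<comment> \<open>The choice for \<open>n + 1\<close> starts beyond the support of the choice for \<open>n\<close>.\<close>
  define \<kappa> where "\<kappa> = rec_nat 0 (\<lambda>n k. k' k n)"
  have \<kappa>Suc: "\<kappa> (Suc n) = k' (\<kappa> n) n" for n by (simp add: \<kappa>_def)
  have \<kappa>mono: "strict_mono \<kappa>" using st(1) by (simp add: strict_mono_Suc_iff \<kappa>Suc)
  define P F A B where "P n = p (\<kappa> n) n" and "F n = f (\<kappa> n) n" and "A n = L (\<kappa> n) n" and "B n = N (\<kappa> n) n" for n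
  have AV: "A n \<inter> V j = {}" if "j \<le> \<kappa> n" for n j
    using st(7)[of "\<kappa> n" n] V(2)[OF that] by (auto simp: A_def)
  have AA: "A m \<inter> A n = {}" if "m < n" for m n
  proof -
    have "A m \<subseteq> V (\<kappa> (Suc m))" unfolding A_def \<kappa>Suc by (rule st(8))
    moreover have "\<kappa> (Suc m) \<le> \<kappa> n" using that \<kappa>mono by (simp add: strict_mono_less_eq)
    ultimately show ?thesis using AV[of "\<kappa> (Suc m)" n] by blast
  qed
  then have uniq: "m = n" if "q \<in> A m" "q \<in> A n" for q m n using that by (metis disjoint_iff linorder_neqE_nat)
  \<comment> \<open>The supports are disjoint, so at most one term is present at each point.\<close>
  define G where "G q = (\<Sum>n\<in>{n. q \<in> A n}. F n q)" for q
  have Gsmooth: "smooth_fn M (points M) G"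
  proof (rule smooth_fn_local[OF M subset_refl])
    fix q assume "q \<in> points M"
    then obtain j where j: "q \<in> V j" using V(3) by blast
    have VM: "V j \<subseteq> points M" using V(1) by (rule openin_subset)
    have "G x = (\<Sum>n<j. F n x)" if x: "x \<in> V j" for x
      unfolding G_def
    proof (rule sum.mono_neutral_left)
      show "{n. x \<in> A n} \<subseteq> {..<j}"
      proof
        fix n assume "n \<in> {n. x \<in> A n}"
        then have "\<not> j \<le> \<kappa> n" using AV x by blast
        then show "n \<in> {..<j}" using strict_mono_imp_increasing[OF \<kappa>mono, of n] by simp
      qed
      show "\<forall>i\<in>{..<j} - {n. x \<in> A n}. F i x = 0" using st(9) x VM by (auto simp: F_def A_def)
    qed simp
    moreover have "smooth_fn M (V j) (\<lambda>x. \<Sum>n<j. F n x)"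
      by (intro smooth_fn_sum[OF M V(1)] smooth_functionsD[OF M _ VM]) (simp add: F_def st(2))
    ultimately have "smooth_fn M (V j) G"
      using smooth_fn_cong[OF M V(1), of j G "\<lambda>x. \<Sum>n<j. F n x"] by simp
    then show "\<exists>V. openin (mtop M) V \<and> q \<in> V \<and> smooth_fn M (points M \<inter> V) G"
      using j V(1) VM by (intro exI[of _ "V j"]) (auto simp: Int_absorb1)
  qed
  define g where "g = (\<lambda>q\<in>points M. G q)"
  have g: "g \<in> ?S" unfolding g_def by (rule smooth_functionsI[OF M Gsmooth])
  obtain t where t: "\<And>p. p \<in> points M \<Longrightarrow> Q t p g" using each[OF g] by blast
  have B: "openin (mtop M) (B t)" "P t \<in> B t" "B t \<subseteq> A t" using st(4,5,6) by (simp_all add: B_def P_def A_def)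
  have BM: "B t \<subseteq> points M" using B(1) by (rule openin_subset)
  have "g q = F t q" if "q \<in> B t" for q
  proof -
    have "{n. q \<in> A n} = {t}" using that B(3) uniq by blast
    then show ?thesis using that BM by (auto simp: g_def G_def)
  qed
  then have "Q t (P t) (F t)"
    using germ[OF g _ B(1,2), of "F t" t] t[of "P t"] B(2) BM by (auto simp: F_def st(2))
  then show False using st(3) by (simp add: P_def F_def)
qed

end

section \<open>Manifolds from an atlas\<close>

lemma smooth_preimage_open:
  assumes U: "openin (powertop_real I) U" and V: "openin (powertop_real J) V"
    and a: "\<And>j. j \<in> J \<Longrightarrow> continuous_on U (a j)"
  shows "openin (powertop_real I) {x \<in> U. (\<lambda>j\<in>J. a j x) \<in> V}"
proof -
  obtain V' where V': "open V'" "V = coord_space J \<inter> V'"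
    using V unfolding powertop_real_eq by (auto simp: openin_open)
  have "continuous_on U (\<lambda>x. \<lambda>j\<in>J. a j x)"
  proof (rule continuous_on_coordinatewise_then_product)
    fix j show "continuous_on U (\<lambda>x. (\<lambda>j\<in>J. a j x) j)"
      using a by (cases "j \<in> J") (auto simp: restrict_def)
  qed
  then have "openin (top_of_set U) (U \<inter> (\<lambda>x. \<lambda>j\<in>J. a j x) -` V')"
    by (rule continuous_openin_preimage_gen) (rule V'(1))
  moreover have "top_of_set U = subtopology (powertop_real I) U"
    using subtopology_powertop[OF coord_openin_subset[OF U]] by simp
  ultimately have "openin (powertop_real I) (U \<inter> (\<lambda>x. \<lambda>j\<in>J. a j x) -` V')"
    using openin_trans_full[OF _ U] by simp
  moreover have "U \<inter> (\<lambda>x. \<lambda>j\<in>J. a j x) -` V' = {x \<in> U. (\<lambda>j\<in>J. a j x) \<in> V}" using V'(2) by auto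
  ultimately show ?thesis by simp
qed

text \<open>Boxes with rational end points.\<close>

lemma second_countable_powertop:
  assumes I: "finite I" shows "second_countable (powertop_real I)"
proof -
  define \<B> where "\<B> = (\<lambda>(a, b). Pi\<^sub>E I (\<lambda>i. {a i <..< b i :: real})) ` (Pi\<^sub>E I (\<lambda>_. \<rat>) \<times> Pi\<^sub>E I (\<lambda>_. \<rat>))"
  show ?thesis unfolding second_countable_def
  proof (intro exI[of _ \<B>] conjI ballI allI impI)
    show "countable \<B>" unfolding \<B>_def
      by (intro countable_image countable_SIGMA countable_PiE I countable_rat)
    show "openin (powertop_real I) V" if "V \<in> \<B>" for V
      using that I unfolding \<B>_def by (auto simp: openin_PiE_gen)
    fix U x assume U: "openin (powertop_real I) U \<and> x \<in> U"
    then obtain e where e: "e > 0" "\<And>y. y \<in> coord_space I \<Longrightarrow> (\<And>i. i \<in> I \<Longrightarrow> \<bar>y i - x i\<bar> < e) \<Longrightarrow> y \<in> U"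
      using coord_box[of I U x] I by metis
    have "\<exists>a\<in>\<rat>. x i - e < a \<and> a < x i" "\<exists>b\<in>\<rat>. x i < b \<and> b < x i + e" for i
      using Rats_dense_in_real[of "x i - e" "x i"] Rats_dense_in_real[of "x i" "x i + e"] e(1) by auto
    then obtain a b where ab: "\<And>i. a i \<in> \<rat>" "\<And>i. x i - e < a i \<and> a i < x i" "\<And>i. b i \<in> \<rat>" "\<And>i. x i < b i \<and> b i < x i + e"
      by metis
    let ?V = "Pi\<^sub>E I (\<lambda>i. {(\<lambda>i\<in>I. a i) i <..< (\<lambda>i\<in>I. b i) i})"
    have "?V \<in> \<B>" unfolding \<B>_def using ab by (intro image_eqI[of _ _ "(\<lambda>i\<in>I. a i, \<lambda>i\<in>I. b i)"]) auto
    moreover have "x \<in> ?V" using U ab coord_openin_subset[of I U] by (auto simp: PiE_iff)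
    moreover have "?V \<subseteq> U"
    proof
      fix y assume y: "y \<in> ?V"
      show "y \<in> U"
      proof (rule e(2))
        show "y \<in> coord_space I" using y by (auto simp: PiE_iff)
        fix i assume i: "i \<in> I"
        then have "a i < y i" "y i < b i" using y by (auto simp: PiE_iff)
        then show "\<bar>y i - x i\<bar> < e" using ab(2,4)[of i] by linarith
      qed
    qed
    ultimately show "\<exists>V\<in>\<B>. x \<in> V \<and> V \<subseteq> U" by blast
  qed
qed

context
  fixes \<A> :: "('a, 'i) chart set" and I :: "'i set" and T :: "'a topology"
  assumes I: "finite I"
    and inj: "\<And>U \<phi>. (U, \<phi>) \<in> \<A> \<Longrightarrow> inj_on \<phi> U"
    and img: "\<And>U \<phi>. (U, \<phi>) \<in> \<A> \<Longrightarrow> openin (powertop_real I) (\<phi> ` U)"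
    and overlap: "\<And>U \<phi> U' \<phi>'. (U, \<phi>) \<in> \<A> \<Longrightarrow> (U', \<phi>') \<in> \<A> \<Longrightarrow> openin (powertop_real I) (\<phi> ` (U \<inter> U'))"
    and trans: "\<And>c c'. c \<in> \<A> \<Longrightarrow> c' \<in> \<A> \<Longrightarrow> smooth_transition I I c c'"
  defines "T \<equiv> topology_generated_by {{j \<in> U. \<phi> j \<in> S} | U \<phi> S. (U, \<phi>) \<in> \<A> \<and> openin (powertop_real I) S}"
begin

lemma gen_open: "(U, \<phi>) \<in> \<A> \<Longrightarrow> openin (powertop_real I) S \<Longrightarrow> openin T {j \<in> U. \<phi> j \<in> S}"
  unfolding T_def by (rule topology_generated_by_Basis) blast

lemma gen_open_chart: "(U, \<phi>) \<in> \<A> \<Longrightarrow> openin T U"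
proof -
  assume c: "(U, \<phi>) \<in> \<A>"
  have "{j \<in> U. \<phi> j \<in> \<phi> ` U} = U" by auto
  then show ?thesis using gen_open[OF c img[OF c]] by simp
qed

lemma gen_topspace: "topspace T = (\<Union>c\<in>\<A>. fst c)"
proof
  show "topspace T \<subseteq> (\<Union>c\<in>\<A>. fst c)"
    unfolding T_def topology_generated_by_topspace by force
  show "(\<Union>c\<in>\<A>. fst c) \<subseteq> topspace T"
    using gen_open_chart openin_subset by force
qed

text \<open>
  Induction over the generated topology. The sets of the subbase are pulled back through a
  transition map, which is continuous with open domain.
\<close>

lemma gen_image_open:
  assumes c: "(U, \<phi>) \<in> \<A>" and W: "openin T W"
  shows "openin (powertop_real I) (\<phi> ` (U \<inter> W))"
proof -
  have "generate_topology_on {{j \<in> U. \<phi> j \<in> S} | U \<phi> S. (U, \<phi>) \<in> \<A> \<and> openin (powertop_real I) S} W"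
    using W unfolding T_def by (simp add: openin_topology_generated_by_iff)
  then show ?thesis
  proof induction
    case (Int a b)
    have "\<phi> ` (U \<inter> (a \<inter> b)) = \<phi> ` (U \<inter> a) \<inter> \<phi> ` (U \<inter> b)"
      using inj_on_image_Int[OF inj[OF c], of "U \<inter> a" "U \<inter> b"] by (simp add: Int_ac)
    then show ?case using Int by auto
  next
    case (UN K)
    have "\<phi> ` (U \<inter> \<Union>K) = \<Union>((\<lambda>a. \<phi> ` (U \<inter> a)) ` K)" by auto
    then show ?case using UN by auto
  next
    case (Basis s)
    then obtain U' \<phi>' S where s: "s = {j \<in> U'. \<phi>' j \<in> S}" "(U', \<phi>') \<in> \<A>" "openin (powertop_real I) S" by blast
    let ?O = "\<phi> ` (U \<inter> U')"
    note o = overlap[OF c s(2)]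
    have "smooth_on I ?O (\<lambda>z. \<phi>' (inv_into U \<phi> z) i)" if "i \<in> I" for i
      using trans[OF c s(2)] that by (auto simp: smooth_transition_def)
    then have "openin (powertop_real I) {z \<in> ?O. (\<lambda>i\<in>I. \<phi>' (inv_into U \<phi> z) i) \<in> S}"
      by (intro smooth_preimage_open[OF o s(3)] smooth_on_continuous[OF coord_openin_subset[OF o]])
    moreover have "{z \<in> ?O. (\<lambda>i\<in>I. \<phi>' (inv_into U \<phi> z) i) \<in> S} = \<phi> ` (U \<inter> s)"
    proof -
      have "(\<lambda>i\<in>I. \<phi>' (inv_into U \<phi> (\<phi> p)) i) = \<phi>' p" if "p \<in> U" "p \<in> U'" for p
      proof -
        have "\<phi>' p \<in> coord_space I" using coord_openin_subset[OF img[OF s(2)]] that by auto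
        then show ?thesis using inv_into_f_f[OF inj[OF c] that(1)] by (simp add: PiE_iff extensional_restrict)
      qed
      then show ?thesis using s(1) by auto
    qed
    ultimately show ?case by simp
  qed simp
qed

lemma gen_top_chart: assumes c: "(U, \<phi>) \<in> \<A>" shows "top_chart T I (U, \<phi>)"
  unfolding top_chart_def prod.case
proof (intro conjI)
  show U: "openin T U" by (rule gen_open_chart[OF c])
  show "openin (powertop_real I) (\<phi> ` U)" by (rule img[OF c])
  have ts: "topspace (subtopology T U) = U" using openin_subset[OF U] by auto
  have ts': "topspace (subtopology (powertop_real I) (\<phi> ` U)) = \<phi> ` U"
    using coord_openin_subset[OF img[OF c]] by auto
  show "homeomorphic_map (subtopology T U) (subtopology (powertop_real I) (\<phi> ` U)) \<phi>"
  proof (rule bijective_open_imp_homeomorphic_map)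
    show "continuous_map (subtopology T U) (subtopology (powertop_real I) (\<phi> ` U)) \<phi>"
      unfolding continuous_map_def ts ts'
    proof (intro conjI allI impI)
      fix S assume "openin (subtopology (powertop_real I) (\<phi> ` U)) S"
      then have "openin (powertop_real I) S" using img[OF c] by (rule openin_trans_full)
      from gen_open[OF c this] show "openin (subtopology T U) {x \<in> U. \<phi> x \<in> S}"
        unfolding openin_open_subtopology[OF U] by auto
    qed auto
    show "open_map (subtopology T U) (subtopology (powertop_real I) (\<phi> ` U)) \<phi>"
      unfolding open_map_def
    proof (intro allI impI)
      fix W assume "openin (subtopology T U) W"
      then have W: "openin T W" "W \<subseteq> U" using openin_open_subtopology[OF U] by auto
      then have "openin (powertop_real I) (\<phi> ` W)" using gen_image_open[OF c W(1)] by (simp add: Int_absorb1)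
      then show "openin (subtopology (powertop_real I) (\<phi> ` U)) (\<phi> ` W)"
        using W(2) openin_open_subtopology[OF img[OF c]] by blast
    qed
  qed (use inj[OF c] ts ts' in auto)
qed

text \<open>Preimages of a countable base under countably many charts that cover.\<close>

lemma gen_second_countable:
  assumes \<C>: "countable \<C>" "\<C> \<subseteq> \<A>" "(\<Union>c\<in>\<C>. fst c) = topspace T"
  shows "second_countable T"
proof -
  obtain \<B> where \<B>: "countable \<B>" "\<And>S. S \<in> \<B> \<Longrightarrow> openin (powertop_real I) S"
    "\<And>U x. openin (powertop_real I) U \<Longrightarrow> x \<in> U \<Longrightarrow> \<exists>S\<in>\<B>. x \<in> S \<and> S \<subseteq> U"
    using second_countable_powertop[OF I] unfolding second_countable_def by auto
  define \<D> where "\<D> = (\<lambda>(c, S). {j \<in> fst c. snd c j \<in> S}) ` (\<C> \<times> \<B>)"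
  show ?thesis unfolding second_countable_def
  proof (intro exI[of _ \<D>] conjI ballI allI impI)
    show "countable \<D>" unfolding \<D>_def using \<C> \<B> by auto
    show "openin T V" if "V \<in> \<D>" for V
      using that \<B>(2) \<C>(2) gen_open unfolding \<D>_def by auto
    fix W x assume W: "openin T W \<and> x \<in> W"
    then have "x \<in> (\<Union>c\<in>\<C>. fst c)" using \<C>(3) openin_subset by blast
    then obtain U \<phi> where c: "(U, \<phi>) \<in> \<C>" "x \<in> U" by auto
    then have c': "(U, \<phi>) \<in> \<A>" using \<C>(2) by auto
    have "\<phi> x \<in> \<phi> ` (U \<inter> W)" using c W by auto
    then obtain S where S: "S \<in> \<B>" "\<phi> x \<in> S" "S \<subseteq> \<phi> ` (U \<inter> W)"
      using \<B>(3)[OF gen_image_open[OF c']] W by blast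
    have "{j \<in> U. \<phi> j \<in> S} \<subseteq> W" using S(3) inj_onD[OF inj[OF c']] by fastforce
    moreover have "{j \<in> U. \<phi> j \<in> S} \<in> \<D>" unfolding \<D>_def
      by (rule image_eqI[of _ _ "((U, \<phi>), S)"]) (use c S in simp_all)
    moreover have "x \<in> {j \<in> U. \<phi> j \<in> S}" using c S by simp
    ultimately show "\<exists>V\<in>\<D>. x \<in> V \<and> V \<subseteq> W" by (intro bexI[of _ "{j \<in> U. \<phi> j \<in> S}"] conjI)
  qed
qed

end

subsection \<open>Maps into a chart\<close>

text \<open>Two charts of the maximal atlas are compared through the charts of the given atlas.\<close>

lemma is_chart_transition:
  assumes M: "smooth_manifold M" and c: "is_chart M J (U, \<phi>)" and c': "is_chart M J' (U', \<phi>')" "finite J'"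
  shows "smooth_transition J J' (U, \<phi>) (U', \<phi>')"
  unfolding smooth_transition_def prod.case
proof
  fix j
  have "openin (mtop M) U'" using c'(1) by (auto simp: is_chart_def intro: top_chartD(1))
  from smooth_fn_chart[OF M this smooth_fn_coord[OF M c'] c]
  show "smooth_on J (\<phi> ` (U \<inter> U')) (\<lambda>z. \<phi>' (inv_into U \<phi> z) j)" .
qed

lemma smooth_fn_change_target:
  assumes M: "smooth_manifold M" and V: "openin (mtop M) V" and J: "finite J"
    and c: "top_chart T J (U, \<Theta>)" and c': "top_chart T J' (U', \<Theta>')"
    and tr: "smooth_transition J J' (U, \<Theta>) (U', \<Theta>')"
    and s: "\<And>p. p \<in> V \<Longrightarrow> s p \<in> U \<inter> U'" "\<And>j. j \<in> J \<Longrightarrow> smooth_fn M V (\<lambda>p. \<Theta> (s p) j)"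
    and j': "j' \<in> J'"
  shows "smooth_fn M V (\<lambda>p. \<Theta>' (s p) j')"
proof -
  have r: "(\<lambda>j\<in>J. \<Theta> (s p) j) = \<Theta> (s p)" if "p \<in> V" for p
    using chart_coord[OF c, of "s p"] s(1)[OF that] by (simp add: PiE_iff extensional_restrict)
  have o: "openin (powertop_real J) (\<Theta> ` (U \<inter> U'))" by (rule chart_image_open[OF c top_chartD(1)[OF c']])
  have "smooth_fn M V (\<lambda>p. (\<lambda>u. \<Theta>' (inv_into U \<Theta> u) j') (\<lambda>j\<in>J. \<Theta> (s p) j))"
    by (rule smooth_fn_compose[OF M V J o _ s(2)])
       (use tr j' s(1) r in \<open>auto simp: smooth_transition_def\<close>)
  moreover have "(\<lambda>u. \<Theta>' (inv_into U \<Theta> u) j') (\<lambda>j\<in>J. \<Theta> (s p) j) = \<Theta>' (s p) j'" if "p \<in> V" for p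
    using r[OF that] s(1)[OF that] chart_inv[OF c, of "s p"] by simp
  ultimately show ?thesis
    using smooth_fn_cong[OF M V, of "\<lambda>p. (\<lambda>u. \<Theta>' (inv_into U \<Theta> u) j') (\<lambda>j\<in>J. \<Theta> (s p) j)" "\<lambda>p. \<Theta>' (s p) j'"] by simp
qed

text \<open>
  Reduces smoothness of a section on its domain to \<open>smooth_fn\<close> on the ambient manifold, without
  the charts of the open submanifold.
\<close>

lemma smooth_map_open_submanifold_iff:
  assumes M: "smooth_manifold M" and N: "smooth_manifold N" and W: "openin (mtop M) W"
  shows "smooth_map (open_submanifold M W) N s \<longleftrightarrow> continuous_map (subtopology (mtop M) W) (mtop N) s \<and>
    (\<forall>(C, \<gamma>)\<in>matlas N. \<forall>j\<in>midx N. smooth_fn M {p \<in> W. s p \<in> C} (\<lambda>p. \<gamma> (s p) j))"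
proof (cases "continuous_map (subtopology (mtop M) W) (mtop N) s")
  case cont: True
  have WM: "W \<subseteq> points M" using W by (rule openin_subset)
  have D: "openin (mtop M) {p \<in> W. s p \<in> C}" if "openin (mtop N) C" for C
  proof -
    have "openin (subtopology (mtop M) W) {p \<in> topspace (subtopology (mtop M) W). s p \<in> C}"
      by (rule openin_continuous_map_preimage[OF cont that])
    moreover have "{p \<in> topspace (subtopology (mtop M) W). s p \<in> C} = {p \<in> W. s p \<in> C}" using WM by auto
    ultimately show ?thesis using openin_trans_full[OF _ W] by simp
  qed
  have eq: "smooth_on (midx M) (\<phi> ` {p \<in> U \<inter> W. s p \<in> C}) (\<lambda>z. \<gamma> (s (inv_into (U \<inter> W) \<phi> z)) j) \<longleftrightarrow>
      smooth_on (midx M) (\<phi> ` (U \<inter> {p \<in> W. s p \<in> C})) (\<lambda>z. \<gamma> (s (inv_into U \<phi> z)) j)"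
    if c: "(U, \<phi>) \<in> matlas M" and C: "(C, \<gamma>) \<in> matlas N" for U \<phi> C \<gamma> j
  proof -
    note tc = atlas_chart[OF M c]
    have e: "{p \<in> U \<inter> W. s p \<in> C} = U \<inter> {p \<in> W. s p \<in> C}" by auto
    have o: "openin (powertop_real (midx M)) (\<phi> ` (U \<inter> {p \<in> W. s p \<in> C}))"
      by (rule chart_image_open[OF tc D[OF top_chartD(1)[OF atlas_chart[OF N C]]]])
    have inj: "inj_on \<phi> (U \<inter> W)" using top_chartD(3)[OF tc] by (rule inj_on_subset) auto
    show ?thesis unfolding e
      by (rule smooth_on_cong[OF o]) (auto simp: inv_into_f_f[OF inj] chart_inv[OF tc])
  qed
  show ?thesis
  proof
    assume L: "smooth_map (open_submanifold M W) N s"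
    have "smooth_fn M {p \<in> W. s p \<in> C} (\<lambda>p. \<gamma> (s p) j)" if C: "(C, \<gamma>) \<in> matlas N" and j: "j \<in> midx N" for C \<gamma> j
      unfolding smooth_fn_def
    proof safe
      fix U \<phi> assume c: "(U, \<phi>) \<in> matlas M"
      have "(U \<inter> W, \<phi>) \<in> matlas (open_submanifold M W)" using c by (auto simp: open_submanifold_def)
      then have "smooth_on (midx M) (\<phi> ` {p \<in> U \<inter> W. s p \<in> C}) (\<lambda>z. \<gamma> (s (inv_into (U \<inter> W) \<phi> z)) j)"
        using L C j unfolding smooth_map_def by (fastforce simp: open_submanifold_def)
      then show "smooth_on (midx M) (\<phi> ` (U \<inter> {p \<in> W. s p \<in> C})) (\<lambda>z. \<gamma> (s (inv_into U \<phi> z)) j)"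
        unfolding eq[OF c C] .
    qed
    then show "continuous_map (subtopology (mtop M) W) (mtop N) s \<and>
      (\<forall>(C, \<gamma>)\<in>matlas N. \<forall>j\<in>midx N. smooth_fn M {p \<in> W. s p \<in> C} (\<lambda>p. \<gamma> (s p) j))" using cont by blast
  next
    assume R: "continuous_map (subtopology (mtop M) W) (mtop N) s \<and>
      (\<forall>(C, \<gamma>)\<in>matlas N. \<forall>j\<in>midx N. smooth_fn M {p \<in> W. s p \<in> C} (\<lambda>p. \<gamma> (s p) j))"
    have "smooth_on (midx M) (\<phi> ` {p \<in> U \<inter> W. s p \<in> C}) (\<lambda>z. \<gamma> (s (inv_into (U \<inter> W) \<phi> z)) j)"
      if c: "(U, \<phi>) \<in> matlas M" and C: "(C, \<gamma>) \<in> matlas N" and j: "j \<in> midx N" for U \<phi> C \<gamma> j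
      unfolding eq[OF c C] by (rule smooth_fnD[OF _ c]) (use R C j in auto)
    then show "smooth_map (open_submanifold M W) N s"
      using cont unfolding smooth_map_def open_submanifold_def by auto
  qed
qed (simp add: smooth_map_def open_submanifold_def)

section \<open>Jets of sections in fibered coordinates\<close>

abbreviation bidx :: "('x, 'i, 'y, 'j, 'v, 'k) fbundle \<Rightarrow> 'i set" where "bidx B \<equiv> midx (base B)"
abbreviation fidx :: "('x, 'i, 'y, 'j, 'v, 'k) fbundle \<Rightarrow> 'k set" where "fidx B \<equiv> midx (fiber B)"
abbreviation tidx :: "('x, 'i, 'y, 'j, 'v, 'k) fbundle \<Rightarrow> ('i + 'k) set" where
  "tidx B \<equiv> midx (base B) <+> midx (fiber B)"
abbreviation jidx :: "('x, 'i, 'y, 'j, 'v, 'k) fbundle \<Rightarrow> nat \<Rightarrow> ('i + 'k \<times> 'i multiset) set" where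
  "jidx B r \<equiv> midx (base B) <+> jet_fiber_idx B r"

abbreviation tcoord :: "('x, 'i, 'y, 'j, 'v, 'k) fbundle \<Rightarrow> ('x \<Rightarrow> 'i \<Rightarrow> real) \<Rightarrow> ('y \<Rightarrow> 'k \<Rightarrow> real) \<Rightarrow> 'y \<Rightarrow> 'i + 'k \<Rightarrow> real" where
  "tcoord B \<phi> \<eta> \<equiv> \<lambda>y. case_sum (\<phi> (proj B y)) (\<eta> y)"

text \<open>
  The change of fibered coordinates for a section. If \<open>q\<close> gives the fiber coordinates \<open>\<eta>\<close> of a
  section as functions of the base coordinates \<open>\<phi>\<close>, then this gives the fiber coordinates \<open>\<eta>'\<close>
  as functions of \<open>\<phi>'\<close>. The argument \<open>q\<close> is arbitrary, so the formula also applies to Taylor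
  polynomials.
\<close>

definition section_change where
  "section_change B U \<phi> \<eta> U' \<phi>' \<eta>' q k' z' =
     \<eta>' (inv_into U (tcoord B \<phi> \<eta>)
       (\<lambda>m\<in>tidx B. case m of Inl i \<Rightarrow> \<phi> (inv_into (proj B ` U') \<phi>' z') i
          | Inr k \<Rightarrow> q k (\<lambda>i\<in>bidx B. \<phi> (inv_into (proj B ` U') \<phi>' z') i))) k'"

text \<open>
  The jet chart as a function of a representing section, as opposed to the representative chosen
  by \<open>jet_rep\<close>.
\<close>

definition jet_coords ::
  "('x, 'i, 'y, 'j, 'v, 'k) fbundle \<Rightarrow> nat \<Rightarrow> 'y set \<Rightarrow> ('x \<Rightarrow> 'i \<Rightarrow> real) \<Rightarrow> ('y \<Rightarrow> 'k \<Rightarrow> real) \<Rightarrow> 'x \<Rightarrow> ('x \<Rightarrow> 'y) \<Rightarrow>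
    'i + 'k \<times> 'i multiset \<Rightarrow> real" where
  "jet_coords B r U \<phi> \<eta> x s = case_sum (\<phi> x)
     (\<lambda>(k, \<Lambda>)\<in>jet_fiber_idx B r. mset_pderiv \<Lambda> (section_coord B U \<phi> \<eta> s k) (\<phi> x))"

definition mindices :: "('x, 'i, 'y, 'j, 'v, 'k) fbundle \<Rightarrow> nat \<Rightarrow> 'i multiset set" where
  "mindices B r = {\<Lambda>. set_mset \<Lambda> \<subseteq> bidx B \<and> size \<Lambda> \<le> r}"

text \<open>
  The fiber coordinates of the section that is polynomial in a fibered chart and whose jet has
  the coordinates \<open>w\<close>: its centre is the base point of the jet and its coefficients are the
  fiber components of \<open>w\<close>.
\<close>

definition poly_section :: "('x, 'i, 'y, 'j, 'v, 'k) fbundle \<Rightarrow> nat \<Rightarrow> ('i + 'k \<times> 'i multiset \<Rightarrow> real) \<Rightarrow> 'k \<Rightarrow> ('i \<Rightarrow> real) \<Rightarrow> real" where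
  "poly_section B r w k z = (\<Sum>\<Lambda>\<in>mindices B r. w (Inr (k, \<Lambda>)) * taylor_mono (bidx B) (\<lambda>i\<in>bidx B. w (Inl i)) \<Lambda> z)"

text \<open>The coordinates of the point of the total space below a jet, computed from jet coordinates.\<close>

definition order0 :: "('x, 'i, 'y, 'j, 'v, 'k) fbundle \<Rightarrow> ('i + 'k \<times> 'i multiset \<Rightarrow> real) \<Rightarrow> 'i + 'k \<Rightarrow> real" where
  "order0 B w = (\<lambda>m\<in>tidx B. case m of Inl i \<Rightarrow> w (Inl i) | Inr k \<Rightarrow> w (Inr (k, {#})))"

lemma jet_fiber_idx_iff: "(k, \<Lambda>) \<in> jet_fiber_idx B r \<longleftrightarrow> k \<in> fidx B \<and> \<Lambda> \<in> mindices B r"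
  by (simp add: jet_fiber_idx_def mindices_def)

lemma coord_ext: "u \<in> coord_space J \<Longrightarrow> (\<lambda>j\<in>J. u j) = u"
  by (auto simp: PiE_iff extensional_restrict)

context
  fixes B :: "('x, 'i, 'y, 'j, 'v, 'k) fbundle"
  assumes B: "smooth_fiber_bundle B"
begin

lemma base_mfd: "smooth_manifold (base B)" and total_mfd: "smooth_manifold (total B)"
  and fin_bidx: "finite (bidx B)" and fin_fidx: "finite (fidx B)"
  and proj_cont: "continuous_map (mtop (total B)) (mtop (base B)) (proj B)"
  using B by (auto simp: smooth_fiber_bundle_def smooth_manifold_def smooth_map_def)

lemma fin_tidx: "finite (tidx B)" using fin_bidx fin_fidx by simp

lemma fin_mindices: "finite (mindices B r)"
proof -
  have "mindices B r \<subseteq> mset ` {xs. set xs \<subseteq> bidx B \<and> length xs \<le> r}"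
  proof
    fix \<Lambda> assume "\<Lambda> \<in> mindices B r"
    moreover obtain xs where "mset xs = \<Lambda>" using ex_mset by blast
    ultimately show "\<Lambda> \<in> mset ` {xs. set xs \<subseteq> bidx B \<and> length xs \<le> r}"
      by (auto simp: mindices_def intro!: image_eqI[of _ _ xs])
  qed
  then show ?thesis using finite_lists_length_le[OF fin_bidx] finite_surj by blast
qed

lemma fin_jidx: "finite (jidx B r)"
proof -
  have "jet_fiber_idx B r = fidx B \<times> mindices B r" by (simp add: jet_fiber_idx_def mindices_def)
  then show ?thesis using fin_bidx fin_fidx fin_mindices by simp
qed

subsection \<open>Fibered charts and local sections\<close>

context
  fixes U \<phi> \<eta> assumes fc: "fibered_chart B U \<phi> \<eta>"
begin

lemma fc_base: "is_chart (base B) (bidx B) (proj B ` U, \<phi>)" and fc_total: "is_chart (total B) (tidx B) (U, tcoord B \<phi> \<eta>)"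
  using fc by (auto simp: fibered_chart_def)

lemma fc_base_top: "top_chart (mtop (base B)) (bidx B) (proj B ` U, \<phi>)"
  and fc_total_top: "top_chart (mtop (total B)) (tidx B) (U, tcoord B \<phi> \<eta>)"
  using fc_base fc_total by (auto simp: is_chart_def)

text \<open>
  A section through a point of a chart stays in the chart over a neighborhood, where its
  coordinate expression is smooth.
\<close>

lemma section_near:
  assumes s: "local_section B x s" "s x \<in> U"
  obtains D where "openin (mtop (base B)) D" "x \<in> D" "D \<subseteq> proj B ` U" "\<And>w. w \<in> D \<Longrightarrow> s w \<in> U \<and> proj B (s w) = w"
    "\<And>k. k \<in> fidx B \<Longrightarrow> smooth_on (bidx B) (\<phi> ` D) (section_coord B U \<phi> \<eta> s k)"
proof -
  let ?X = "base B" and ?Y = "total B"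
  obtain W where W: "openin (mtop ?X) W" "x \<in> W" "smooth_map (open_submanifold ?X W) ?Y s" "\<And>w. w \<in> W \<Longrightarrow> proj B (s w) = w"
    using s unfolding local_section_def by blast
  note sm = W(3)[unfolded smooth_map_open_submanifold_iff[OF base_mfd total_mfd W(1)]]
  have WX: "W \<subseteq> points ?X" using W(1) by (rule openin_subset)
  have pre: "openin (mtop ?X) {p \<in> W. s p \<in> C}" if "openin (mtop ?Y) C" for C
  proof -
    have "openin (subtopology (mtop ?X) W) {p \<in> topspace (subtopology (mtop ?X) W). s p \<in> C}"
      using sm that by (intro openin_continuous_map_preimage) auto
    moreover have "{p \<in> topspace (subtopology (mtop ?X) W). s p \<in> C} = {p \<in> W. s p \<in> C}" using WX by auto
    ultimately show ?thesis using openin_trans_full[OF _ W(1)] by simp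
  qed
  define D where "D = {w \<in> W. s w \<in> U}"
  have D: "openin (mtop ?X) D" unfolding D_def by (rule pre[OF top_chartD(1)[OF fc_total_top]])
  have DX: "D \<subseteq> points ?X" using D by (rule openin_subset)
  have ps: "proj B (s w) = w" if "w \<in> D" for w using W(4) that by (auto simp: D_def)
  have DU: "D \<subseteq> proj B ` U"
  proof
    fix w assume "w \<in> D"
    then show "w \<in> proj B ` U" using ps[of w] by (auto simp: D_def intro!: image_eqI[of _ _ "s w"])
  qed
  have sY: "s w \<in> points ?Y" if "w \<in> D" for w
    using that top_chartD(5)[OF fc_total_top] by (auto simp: D_def)
  have tc: "smooth_fn ?X D (\<lambda>w. tcoord B \<phi> \<eta> (s w) m)" if m: "m \<in> tidx B" for m
  proof (rule smooth_fn_local[OF base_mfd DX])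
    fix p assume p: "p \<in> D"
    obtain C \<gamma> where c: "(C, \<gamma>) \<in> matlas ?Y" "s p \<in> C" using atlas_cover[OF total_mfd sY[OF p]] by blast
    note tC = atlas_chart[OF total_mfd c(1)]
    let ?V = "{q \<in> W. s q \<in> C}"
    have V: "openin (mtop ?X) ?V" by (rule pre[OF top_chartD(1)[OF tC]])
    have DV: "openin (mtop ?X) (D \<inter> ?V)" using D V by blast
    have "smooth_fn ?X (D \<inter> ?V) (\<lambda>w. \<gamma> (s w) j)" if "j \<in> midx ?Y" for j
      by (rule smooth_fn_subset[OF base_mfd, of ?V]) (use sm c that in auto)
    then have "smooth_fn ?X (D \<inter> ?V) (\<lambda>w. tcoord B \<phi> \<eta> (s w) m)"
      by (intro smooth_fn_change_target[OF base_mfd DV midx_finite[OF total_mfd] tC fc_total_top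
            is_chart_transition[OF total_mfd atlas_is_chart[OF total_mfd c(1)] fc_total fin_tidx] _ _ m])
         (auto simp: D_def)
    then show "\<exists>V. openin (mtop ?X) V \<and> p \<in> V \<and> smooth_fn ?X (D \<inter> V) (\<lambda>w. tcoord B \<phi> \<eta> (s w) m)"
      using V p c by (intro exI[of _ ?V]) (auto simp: D_def)
  qed
  have "smooth_on (bidx B) (\<phi> ` D) (section_coord B U \<phi> \<eta> s k)" if k: "k \<in> fidx B" for k
  proof -
    have "smooth_fn ?X D (\<lambda>w. \<eta> (s w) k)" using tc[of "Inr k"] k by auto
    from smooth_fn_chart[OF base_mfd D this fc_base]
    have "smooth_on (bidx B) (\<phi> ` D) (\<lambda>z. \<eta> (s (inv_into (proj B ` U) \<phi> z)) k)"
      using DU by (simp add: Int_absorb1)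
    then show ?thesis by (simp add: section_coord_def[abs_def])
  qed
  with D DU ps W(2) s(2) show thesis by (intro that[of D]) (auto simp: D_def)
qed

lemma tcoord_ext: "y \<in> U \<Longrightarrow> (\<lambda>m\<in>tidx B. tcoord B \<phi> \<eta> y m) = tcoord B \<phi> \<eta> y"
  using chart_coord[OF fc_total_top] by (rule coord_ext)

lemma bcoord_ext: "x \<in> proj B ` U \<Longrightarrow> (\<lambda>i\<in>bidx B. \<phi> x i) = \<phi> x"
  using chart_coord[OF fc_base_top] by (rule coord_ext)

lemma section_coord_at: "x \<in> proj B ` U \<Longrightarrow> section_coord B U \<phi> \<eta> s k (\<phi> x) = \<eta> (s x) k"
  by (simp add: section_coord_def chart_inv[OF fc_base_top])

end

subsection \<open>Change of fibered coordinates\<close>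

context
  fixes U \<phi> \<eta> U' \<phi>' \<eta>'
  assumes c: "fibered_chart B U \<phi> \<eta>" and c': "fibered_chart B U' \<phi>' \<eta>'"
begin

abbreviation (input) "chg \<equiv> section_change B U \<phi> \<eta> U' \<phi>' \<eta>'"
abbreviation (input) "theta i z' \<equiv> \<phi> (inv_into (proj B ` U') \<phi>' z') i"

lemma section_change_section:
  assumes "x \<in> proj B ` U'" "s x \<in> U" "proj B (s x) = x"
  shows "section_coord B U' \<phi>' \<eta>' s k' (\<phi>' x) = chg (section_coord B U \<phi> \<eta> s) k' (\<phi>' x)"
proof -
  have x: "x \<in> proj B ` U" using assms(2,3) by force
  have "(\<lambda>m\<in>tidx B. case m of Inl i \<Rightarrow> \<phi> x i | Inr k \<Rightarrow> section_coord B U \<phi> \<eta> s k (\<lambda>i\<in>bidx B. \<phi> x i))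
     = (\<lambda>m\<in>tidx B. tcoord B \<phi> \<eta> (s x) m)"
    unfolding bcoord_ext[OF c x] section_coord_at[OF c x] assms(3) by (rule restrict_ext) (auto split: sum.split)
  also have "\<dots> = tcoord B \<phi> \<eta> (s x)" by (rule tcoord_ext[OF c assms(2)])
  finally show ?thesis
    unfolding section_change_def chart_inv[OF fc_base_top[OF c'] assms(1)] section_coord_at[OF c' assms(1)]
    using chart_inv[OF fc_total_top[OF c] assms(2)] by simp
qed

lemma overlap_base: "openin (powertop_real (bidx B)) (\<phi>' ` (proj B ` U' \<inter> proj B ` U))"
  by (rule chart_image_open[OF fc_base_top[OF c'] top_chartD(1)[OF fc_base_top[OF c]]])

lemma overlap_total: "openin (powertop_real (tidx B)) (tcoord B \<phi> \<eta> ` (U \<inter> U'))"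
  by (rule chart_image_open[OF fc_total_top[OF c] top_chartD(1)[OF fc_total_top[OF c']]])

lemma theta_smooth: "i \<in> bidx B \<Longrightarrow> smooth_on (bidx B) (\<phi>' ` (proj B ` U' \<inter> proj B ` U)) (theta i)"
  using is_chart_transition[OF base_mfd fc_base[OF c'] fc_base[OF c] fin_bidx] by (simp add: smooth_transition_def)

lemma eta_smooth: "k' \<in> fidx B \<Longrightarrow> smooth_on (tidx B) (tcoord B \<phi> \<eta> ` (U \<inter> U')) (\<lambda>u. \<eta>' (inv_into U (tcoord B \<phi> \<eta>) u) k')"
proof -
  assume k': "k' \<in> fidx B"
  then have "Inr k' \<in> tidx B" by blast
  with is_chart_transition[OF total_mfd fc_total[OF c] fc_total[OF c'] fin_tidx]
  have "smooth_on (tidx B) (tcoord B \<phi> \<eta> ` (U \<inter> U')) (\<lambda>u. tcoord B \<phi>' \<eta>' (inv_into U (tcoord B \<phi> \<eta>) u) (Inr k'))"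
    unfolding smooth_transition_def prod.case by (rule bspec)
  then show ?thesis by simp
qed

lemma theta_compose:
  assumes O: "openin (powertop_real J) E"
    and z: "\<And>i. i \<in> bidx B \<Longrightarrow> smooth_on J E (\<lambda>u. z u i)" "\<And>u. u \<in> E \<Longrightarrow> z u \<in> \<phi>' ` (proj B ` U' \<inter> proj B ` U)"
    and i: "i \<in> bidx B"
  shows "smooth_on J E (\<lambda>u. theta i (z u))"
proof -
  have ze: "(\<lambda>i\<in>bidx B. z u i) = z u" if "u \<in> E" for u
    using z(2)[OF that] coord_openin_subset[OF overlap_base] by (intro coord_ext) auto
  have "smooth_on J E (\<lambda>u. theta i (\<lambda>i\<in>bidx B. z u i))"
  proof (rule smooth_on_compose[OF O fin_bidx overlap_base _ theta_smooth[OF i]])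
    show "(\<lambda>i\<in>bidx B. z u i) \<in> \<phi>' ` (proj B ` U' \<inter> proj B ` U)" if "u \<in> E" for u using z(2)[OF that] ze[OF that] by simp
  qed (rule z(1))
  then show ?thesis
    using smooth_on_cong[OF O, of "\<lambda>u. theta i (\<lambda>i\<in>bidx B. z u i)" "\<lambda>u. theta i (z u)"] ze by simp
qed

text \<open>
  Joint smoothness in a parameter \<open>u\<close> on which both the section \<open>q u\<close> and the point \<open>z u\<close>
  depend.
\<close>

lemma section_change_smooth:
  assumes J: "finite J" and O: "openin (powertop_real J) E"
    and z: "\<And>i. i \<in> bidx B \<Longrightarrow> smooth_on J E (\<lambda>u. z u i)" "\<And>u. u \<in> E \<Longrightarrow> z u \<in> \<phi>' ` (proj B ` U' \<inter> proj B ` U)"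
    and q: "\<And>k. k \<in> fidx B \<Longrightarrow> smooth_on J E (\<lambda>u. q u k (\<lambda>i\<in>bidx B. theta i (z u)))"
    and U: "\<And>u. u \<in> E \<Longrightarrow> (\<lambda>m\<in>tidx B. case m of Inl i \<Rightarrow> theta i (z u) | Inr k \<Rightarrow> q u k (\<lambda>i\<in>bidx B. theta i (z u))) \<in> tcoord B \<phi> \<eta> ` (U \<inter> U')"
    and k': "k' \<in> fidx B"
  shows "smooth_on J E (\<lambda>u. chg (q u) k' (z u))"
  unfolding section_change_def
proof (rule smooth_on_compose[OF O fin_tidx overlap_total U eta_smooth[OF k']], assumption)
  fix m assume m: "m \<in> tidx B"
  show "smooth_on J E (\<lambda>u. case m of Inl i \<Rightarrow> theta i (z u) | Inr k \<Rightarrow> q u k (\<lambda>i\<in>bidx B. theta i (z u)))"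
  proof (cases m)
    case (Inl i)
    then have "smooth_on J E (\<lambda>u. theta i (z u))" using m by (intro theta_compose[OF O z]) auto
    then show ?thesis using Inl by simp
  next
    case (Inr k)
    then show ?thesis using q[of k] m by auto
  qed
qed

text \<open>
  Two applications of \<open>jet_eq_compose\<close>: the inner one for the change of base coordinates, the
  outer one for the change of total coordinates.
\<close>

lemma section_change_jet_eq:
  assumes x: "x \<in> proj B ` U" "x \<in> proj B ` U'"
    and E: "openin (powertop_real (bidx B)) E" "\<phi> x \<in> E"
    and q: "\<And>k. k \<in> fidx B \<Longrightarrow> smooth_on (bidx B) E (q k)" "\<And>k. k \<in> fidx B \<Longrightarrow> smooth_on (bidx B) E (q' k)"
      "\<And>k. k \<in> fidx B \<Longrightarrow> jet_eq (bidx B) r (\<phi> x) (q k) (q' k)"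
    and U: "(\<lambda>m\<in>tidx B. case m of Inl i \<Rightarrow> \<phi> x i | Inr k \<Rightarrow> q k (\<phi> x)) \<in> tcoord B \<phi> \<eta> ` (U \<inter> U')"
    and k': "k' \<in> fidx B"
  shows "jet_eq (bidx B) r (\<phi>' x) (chg q k') (chg q' k')"
proof -
  let ?I = "bidx B"
  let ?O = "{z \<in> \<phi>' ` (proj B ` U' \<inter> proj B ` U). (\<lambda>i\<in>?I. theta i z) \<in> E}"
  have oO: "openin (powertop_real ?I) ?O"
    by (rule smooth_preimage_open[OF overlap_base E(1)])
      (rule smooth_on_continuous[OF coord_openin_subset[OF overlap_base] theta_smooth])
  note O' = coord_openin_subset[OF oO]
  have th: "smooth_on ?I ?O (theta i)" if "i \<in> ?I" for i
    by (rule smooth_on_subset[OF coord_openin_subset[OF overlap_base] _ theta_smooth[OF that]]) auto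
  define a where "a p m z = (case m of Inl i \<Rightarrow> theta i z | Inr k \<Rightarrow> p k (\<lambda>i\<in>?I. theta i z))" for p :: "'k \<Rightarrow> ('i \<Rightarrow> real) \<Rightarrow> real" and m z
  have sa: "smooth_on ?I ?O (a p m)" if p: "\<And>k. k \<in> fidx B \<Longrightarrow> smooth_on ?I E (p k)" and m: "m \<in> tidx B" for p m
  proof (cases m)
    case (Inl i)
    then show ?thesis using th[of i] m by (auto simp: a_def[abs_def])
  next
    case (Inr k)
    then have "k \<in> fidx B" using m by auto
    then have "smooth_on ?I ?O (\<lambda>z. p k (\<lambda>i\<in>?I. theta i z))"
      by (intro smooth_on_compose[OF oO fin_bidx E(1) _ p] th) auto
    then show ?thesis using Inr by (simp add: a_def[abs_def])
  qed
  let ?V = "tcoord B \<phi> \<eta> ` (U \<inter> U')"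
  \<comment> \<open>The set on which both transformed functions are given by composition with smooth functions.\<close>
  let ?P = "{z \<in> ?O. (\<lambda>m\<in>tidx B. a q m z) \<in> ?V} \<inter> {z \<in> ?O. (\<lambda>m\<in>tidx B. a q' m z) \<in> ?V}"
  have oP: "openin (powertop_real ?I) ?P"
    by (intro openin_Int smooth_preimage_open[OF oO overlap_total] smooth_on_continuous[OF O' sa] q) auto
  have xth: "(\<lambda>i\<in>?I. theta i (\<phi>' x)) = \<phi> x"
    unfolding chart_inv[OF fc_base_top[OF c'] x(2)] by (rule bcoord_ext[OF c x(1)])
  have xO: "\<phi>' x \<in> ?O" using x E(2) xth by auto
  have ax: "(\<lambda>m\<in>tidx B. a p m (\<phi>' x)) = (\<lambda>m\<in>tidx B. case m of Inl i \<Rightarrow> \<phi> x i | Inr k \<Rightarrow> p k (\<phi> x))" for p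
    unfolding a_def chart_inv[OF fc_base_top[OF c'] x(2)] bcoord_ext[OF c x(1)] ..
  have "(\<lambda>m\<in>tidx B. case m of Inl i \<Rightarrow> \<phi> x i | Inr k \<Rightarrow> q k (\<phi> x)) = (\<lambda>m\<in>tidx B. case m of Inl i \<Rightarrow> \<phi> x i | Inr k \<Rightarrow> q' k (\<phi> x))"
    by (rule restrict_ext) (use jet_eq_value[OF q(3)] in \<open>auto split: sum.split\<close>)
  then have xP: "\<phi>' x \<in> ?P" using xO U ax by auto
  note P' = coord_openin_subset[OF oP]
  have sP: "smooth_on ?I ?P (a p m)" if "\<And>k. k \<in> fidx B \<Longrightarrow> smooth_on ?I E (p k)" "m \<in> tidx B" for p m
    by (rule smooth_on_subset[OF O' _ sa]) (use that in auto)
  have "jet_eq ?I r (\<phi>' x) (\<lambda>z. (\<lambda>u. \<eta>' (inv_into U (tcoord B \<phi> \<eta>) u) k') (\<lambda>m\<in>tidx B. a q m z))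
      (\<lambda>z. (\<lambda>u. \<eta>' (inv_into U (tcoord B \<phi> \<eta>) u) k') (\<lambda>m\<in>tidx B. a q' m z))"
  proof (rule jet_eq_compose[OF oP xP fin_tidx overlap_total _ _ _ _ _ eta_smooth[OF k'] eta_smooth[OF k']])
    show "jet_eq (tidx B) r (\<lambda>m\<in>tidx B. a q m (\<phi>' x)) (\<lambda>u. \<eta>' (inv_into U (tcoord B \<phi> \<eta>) u) k') (\<lambda>u. \<eta>' (inv_into U (tcoord B \<phi> \<eta>) u) k')"
      by (simp add: jet_eq_def)
    fix m assume m: "m \<in> tidx B"
    show "jet_eq ?I r (\<phi>' x) (a q m) (a q' m)"
    proof (cases m)
      case (Inl i)
      then show ?thesis by (simp add: a_def[abs_def] jet_eq_def)
    next
      case (Inr k)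
      then have k: "k \<in> fidx B" using m by auto
      have "jet_eq ?I r (\<phi>' x) (\<lambda>z. q k (\<lambda>i\<in>?I. theta i z)) (\<lambda>z. q' k (\<lambda>i\<in>?I. theta i z))"
      proof (rule jet_eq_compose[OF oO xO fin_bidx E(1) _ _ th th _ q(1)[OF k] q(2)[OF k]])
        show "jet_eq ?I r (\<lambda>i\<in>?I. theta i (\<phi>' x)) (q k) (q' k)" unfolding xth by (rule q(3)[OF k])
      qed (auto simp: jet_eq_def)
      then show ?thesis using Inr by (simp add: a_def[abs_def])
    qed
  qed (use sP q in auto)
  then show ?thesis by (simp add: section_change_def[abs_def] a_def)
qed

lemma section_jet_change:
  assumes s: "local_section B x s" and s': "local_section B x s'" and x: "s x \<in> U" "s x \<in> U'" "s' x = s x"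
    and j: "\<And>k. k \<in> fidx B \<Longrightarrow> jet_eq (bidx B) r (\<phi> x) (section_coord B U \<phi> \<eta> s k) (section_coord B U \<phi> \<eta> s' k)"
    and k': "k' \<in> fidx B"
  shows "jet_eq (bidx B) r (\<phi>' x) (section_coord B U' \<phi>' \<eta>' s k') (section_coord B U' \<phi>' \<eta>' s' k')"
proof -
  have x': "s' x \<in> U" "s' x \<in> U'" using x by auto
  obtain D1 where D1: "openin (mtop (base B)) D1" "x \<in> D1" "D1 \<subseteq> proj B ` U" "\<And>w. w \<in> D1 \<Longrightarrow> s w \<in> U \<and> proj B (s w) = w"
    "\<And>k. k \<in> fidx B \<Longrightarrow> smooth_on (bidx B) (\<phi> ` D1) (section_coord B U \<phi> \<eta> s k)"
    by (rule section_near[OF c s x(1)]) (rule that)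
  obtain D2 where D2: "openin (mtop (base B)) D2" "x \<in> D2" "D2 \<subseteq> proj B ` U" "\<And>w. w \<in> D2 \<Longrightarrow> s' w \<in> U \<and> proj B (s' w) = w"
    "\<And>k. k \<in> fidx B \<Longrightarrow> smooth_on (bidx B) (\<phi> ` D2) (section_coord B U \<phi> \<eta> s' k)"
    by (rule section_near[OF c s' x'(1)]) (rule that)
  obtain D3 where D3: "openin (mtop (base B)) D3" "x \<in> D3" "D3 \<subseteq> proj B ` U'"
    by (rule section_near[OF c' s x(2)]) (rule that)
  let ?D = "D1 \<inter> D2 \<inter> D3"
  have D: "openin (mtop (base B)) ?D" "x \<in> ?D" using D1 D2 D3 by auto
  have E: "openin (powertop_real (bidx B)) (\<phi> ` ?D)" "openin (powertop_real (bidx B)) (\<phi>' ` ?D)"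
    by (rule chart_image_open_subset[OF fc_base_top[OF c] D(1)], use D1(3) in blast)
      (rule chart_image_open_subset[OF fc_base_top[OF c'] D(1)], use D3(3) in blast)
  note o1 = chart_image_open_subset[OF fc_base_top[OF c] D1(1,3)] and o2 = chart_image_open_subset[OF fc_base_top[OF c] D2(1,3)]
  have xU: "x \<in> proj B ` U" "x \<in> proj B ` U'" using D1 D3 by auto
  have "jet_eq (bidx B) r (\<phi>' x) (chg (section_coord B U \<phi> \<eta> s) k') (chg (section_coord B U \<phi> \<eta> s') k')"
  proof (rule section_change_jet_eq[OF xU E(1) _ _ _ j _ k'])
    show "\<phi> x \<in> \<phi> ` ?D" using D(2) by blast
    show "smooth_on (bidx B) (\<phi> ` ?D) (section_coord B U \<phi> \<eta> s k)" if "k \<in> fidx B" for k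
      by (rule smooth_on_subset[OF coord_openin_subset[OF o1] _ D1(5)[OF that]]) auto
    show "smooth_on (bidx B) (\<phi> ` ?D) (section_coord B U \<phi> \<eta> s' k)" if "k \<in> fidx B" for k
      by (rule smooth_on_subset[OF coord_openin_subset[OF o2] _ D2(5)[OF that]]) auto
    have "(\<lambda>m\<in>tidx B. case m of Inl i \<Rightarrow> \<phi> x i | Inr k \<Rightarrow> section_coord B U \<phi> \<eta> s k (\<phi> x)) = (\<lambda>m\<in>tidx B. tcoord B \<phi> \<eta> (s x) m)"
      using D1(4)[OF D1(2)] by (intro restrict_ext) (auto simp: section_coord_at[OF c xU(1)] split: sum.split)
    then show "(\<lambda>m\<in>tidx B. case m of Inl i \<Rightarrow> \<phi> x i | Inr k \<Rightarrow> section_coord B U \<phi> \<eta> s k (\<phi> x)) \<in> tcoord B \<phi> \<eta> ` (U \<inter> U')"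
      using tcoord_ext[OF c x(1)] x by auto
  qed
  moreover have "section_coord B U' \<phi>' \<eta>' t k' z = chg (section_coord B U \<phi> \<eta> t) k' z"
    if "z \<in> \<phi>' ` ?D" "\<And>w. w \<in> ?D \<Longrightarrow> t w \<in> U \<and> proj B (t w) = w" for z t
  proof -
    obtain w where w: "w \<in> ?D" "z = \<phi>' w" using \<open>z \<in> \<phi>' ` ?D\<close> by blast
    then show ?thesis using section_change_section[of w t] that(2)[OF w(1)] D3(3) by auto
  qed
  ultimately show ?thesis
    using jet_eq_cong[OF E(2), of "section_coord B U' \<phi>' \<eta>' s k'" "chg (section_coord B U \<phi> \<eta> s) k'"
        "section_coord B U' \<phi>' \<eta>' s' k'" "chg (section_coord B U \<phi> \<eta> s') k'" "\<phi>' x" r] D(2) D1(4) D2(4) by auto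
qed

end

subsection \<open>Equality of jets\<close>

text \<open>
  Although \<open>same_jet\<close> speaks about all fibered charts, \<open>section_jet_change\<close> reduces it to a
  single one.
\<close>

lemma same_jetI:
  assumes c: "fibered_chart B U \<phi> \<eta>" and s: "local_section B x s" "local_section B x s'" "s x \<in> U" "s' x = s x"
    and j: "\<And>k. k \<in> fidx B \<Longrightarrow> jet_eq (bidx B) r (\<phi> x) (section_coord B U \<phi> \<eta> s k) (section_coord B U \<phi> \<eta> s' k)"
  shows "same_jet B r x s s'"
  unfolding same_jet_def
proof (intro conjI allI impI ballI)
  show "s x = s' x" using s by simp
  fix U' \<phi>' \<eta>' k "is" assume a: "fibered_chart B U' \<phi>' \<eta>' \<and> s x \<in> U'" and k: "k \<in> fidx B" and "is": "set is \<subseteq> bidx B \<and> length is \<le> r"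
  have c': "fibered_chart B U' \<phi>' \<eta>'" and U': "s x \<in> U'" using a by auto
  have "jet_eq (bidx B) r (\<phi>' x) (section_coord B U' \<phi>' \<eta>' s k) (section_coord B U' \<phi>' \<eta>' s' k)"
    by (rule section_jet_change[OF c c' s(1,2,3) U' s(4) j k])
  then show "iter_pderiv is (section_coord B U' \<phi>' \<eta>' s k) (\<phi>' x) = iter_pderiv is (section_coord B U' \<phi>' \<eta>' s' k) (\<phi>' x)"
    using "is" by (simp add: jet_eq_def)
qed

lemma same_jetD:
  "same_jet B r x s s' \<Longrightarrow> s x = s' x"
  "same_jet B r x s s' \<Longrightarrow> fibered_chart B U \<phi> \<eta> \<Longrightarrow> s x \<in> U \<Longrightarrow> k \<in> fidx B \<Longrightarrow>
     jet_eq (bidx B) r (\<phi> x) (section_coord B U \<phi> \<eta> s k) (section_coord B U \<phi> \<eta> s' k)"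
  by (auto simp: same_jet_def jet_eq_def)

lemma same_jet_refl: "same_jet B r x s s" by (simp add: same_jet_def)

lemma same_jet_sym: "same_jet B r x s s' \<Longrightarrow> same_jet B r x s' s" by (simp add: same_jet_def)

lemma same_jet_trans: "same_jet B r x s s' \<Longrightarrow> same_jet B r x s' s'' \<Longrightarrow> same_jet B r x s s''" by (simp add: same_jet_def)

lemma same_jet_mono: "same_jet B t x s s' \<Longrightarrow> r \<le> t \<Longrightarrow> same_jet B r x s s'"
  unfolding same_jet_def by (meson order.trans)

lemma jet_of_eq:
  assumes "local_section B x s" "local_section B x' s'"
  shows "jet_of B r x s = jet_of B r x' s' \<longleftrightarrow> x = x' \<and> same_jet B r x s s'"
proof
  assume eq: "jet_of B r x s = jet_of B r x' s'"
  then have x: "x = x'" by (simp add: jet_of_def)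
  have "s' \<in> snd (jet_of B r x' s')" using assms same_jet_refl by (simp add: jet_of_def)
  then have "s' \<in> snd (jet_of B r x s)" using eq by (simp only:)
  then show "x = x' \<and> same_jet B r x s s'" using x by (simp add: jet_of_def)
next
  assume a: "x = x' \<and> same_jet B r x s s'"
  then have "same_jet B r x s t \<longleftrightarrow> same_jet B r x s' t" for t
    using same_jet_sym same_jet_trans by blast
  then show "jet_of B r x s = jet_of B r x' s'" using a by (simp add: jet_of_def)
qed

lemma jet_rep_props:
  assumes "local_section B x s"
  shows "local_section B x (jet_rep (jet_of B r x s))" "same_jet B r x s (jet_rep (jet_of B r x s))" "fst (jet_of B r x s) = x"
proof -
  have "s \<in> snd (jet_of B r x s)" using assms same_jet_refl by (simp add: jet_of_def)
  then have "jet_rep (jet_of B r x s) \<in> snd (jet_of B r x s)" unfolding jet_rep_def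
    by (rule someI[of "\<lambda>t. t \<in> snd (jet_of B r x s)"])
  then show "local_section B x (jet_rep (jet_of B r x s))" "same_jet B r x s (jet_rep (jet_of B r x s))" "fst (jet_of B r x s) = x"
    by (auto simp: jet_of_def)
qed

lemma jet_rep_value: "local_section B x s \<Longrightarrow> jet_rep (jet_of B r x s) x = s x"
  using same_jetD(1)[OF jet_rep_props(2)] by simp

end

section \<open>The jet manifolds\<close>

definition jet_dom :: "('x, 'i, 'y, 'j, 'v, 'k) fbundle \<Rightarrow> nat \<Rightarrow> 'y set \<Rightarrow> ('x, 'y) jet set" where
  "jet_dom B r U = {j \<in> jets B r. jet_rep j (fst j) \<in> U}"

text \<open>
  The part of the coordinate space over \<open>V\<close>. It is the full image of a jet chart over \<open>V\<close>
  (\<open>jet_chart_image\<close>): the components of positive order are unrestricted.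
\<close>

definition jet_img ::
  "('x, 'i, 'y, 'j, 'v, 'k) fbundle \<Rightarrow> ('x \<Rightarrow> 'i \<Rightarrow> real) \<Rightarrow> ('y \<Rightarrow> 'k \<Rightarrow> real) \<Rightarrow> nat \<Rightarrow> 'y set \<Rightarrow>
   ('i + 'k \<times> 'i multiset \<Rightarrow> real) set" where
  "jet_img B \<phi> \<eta> r V = {w \<in> coord_space (jidx B r). order0 B w \<in> tcoord B \<phi> \<eta> ` V}"

context
  fixes B :: "('x, 'i, 'y, 'j, 'v, 'k) fbundle"
  assumes B: "smooth_fiber_bundle B"
begin

subsection \<open>Jet coordinates\<close>

lemma jets_cases:
  assumes "j \<in> jets B r"
  obtains x s where "x \<in> points (base B)" "local_section B x s" "j = jet_of B r x s"
  using assms by (auto simp: jets_def)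

lemma jet_of_dom_iff:
  "x \<in> points (base B) \<Longrightarrow> local_section B x s \<Longrightarrow> jet_of B r x s \<in> jet_dom B r U \<longleftrightarrow> s x \<in> U"
  using jet_rep_value[OF B] jet_rep_props(3)[OF B] by (auto simp: jet_dom_def jets_def)

lemma jet_dom_cases:
  assumes "j \<in> jet_dom B r U"
  obtains x s where "x \<in> points (base B)" "local_section B x s" "j = jet_of B r x s" "s x \<in> U"
proof -
  obtain x s where xs: "x \<in> points (base B)" "local_section B x s" "j = jet_of B r x s"
    using assms by (auto simp: jet_dom_def elim: jets_cases)
  then show thesis using that jet_of_dom_iff assms by blast
qed

context
  fixes U \<phi> \<eta> assumes fc: "fibered_chart B U \<phi> \<eta>"
begin

lemma jet_chart_eq: "jet_chart B r U \<phi> \<eta> = (jet_dom B r U, \<lambda>j. jet_coords B r U \<phi> \<eta> (fst j) (jet_rep j))"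
  by (simp add: jet_chart_def jet_dom_def jet_coords_def)

lemma section_base_point:
  assumes "local_section B x s" "s x \<in> U" shows "proj B (s x) = x" "x \<in> proj B ` U" "x \<in> points (base B)"
proof -
  obtain D where D: "openin (mtop (base B)) D" "x \<in> D" "D \<subseteq> proj B ` U" "\<And>w. w \<in> D \<Longrightarrow> s w \<in> U \<and> proj B (s w) = w"
    by (rule section_near[OF B fc assms]) (rule that)
  then show "proj B (s x) = x" "x \<in> proj B ` U" "x \<in> points (base B)" using openin_subset[OF D(1)] by auto
qed

lemma jet_coords_list:
  assumes s: "local_section B x s" "s x \<in> U" and k: "k \<in> fidx B" and js: "set is \<subseteq> bidx B" "length is \<le> r"
  shows "jet_coords B r U \<phi> \<eta> x s (Inr (k, mset is)) = iter_pderiv is (section_coord B U \<phi> \<eta> s k) (\<phi> x)"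
proof -
  obtain D where D: "openin (mtop (base B)) D" "x \<in> D" "D \<subseteq> proj B ` U"
    "\<And>k. k \<in> fidx B \<Longrightarrow> smooth_on (bidx B) (\<phi> ` D) (section_coord B U \<phi> \<eta> s k)"
    by (rule section_near[OF B fc s]) (rule that)
  have "(k, mset is) \<in> jet_fiber_idx B r" using k js by (simp add: jet_fiber_idx_iff mindices_def)
  then show ?thesis unfolding jet_coords_def
    using mset_pderiv_eq[OF fin_bidx[OF B] chart_image_open_subset[OF fc_base_top[OF B fc] D(1,3)] D(4)[OF k] _ js(1)] D(2) by auto
qed

lemma jet_coords_cong:
  assumes "same_jet B r x s s'" "s x \<in> U"
  shows "jet_coords B r U \<phi> \<eta> x s = jet_coords B r U \<phi> \<eta> x s'"
proof -
  have "mset_pderiv \<Lambda> (section_coord B U \<phi> \<eta> s k) (\<phi> x) = mset_pderiv \<Lambda> (section_coord B U \<phi> \<eta> s' k) (\<phi> x)"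
    if a: "(k, \<Lambda>) \<in> jet_fiber_idx B r" for k \<Lambda>
  proof -
    obtain js where js: "mset js = \<Lambda>" "\<And>f x. mset_pderiv \<Lambda> f x = iter_pderiv js f x" by (rule mset_pderiv_list) (rule that)
    have "k \<in> fidx B" "set js \<subseteq> bidx B" "length js \<le> r"
      using a js(1) by (auto simp: jet_fiber_idx_iff mindices_def)
    then show ?thesis unfolding js(2) using same_jetD(2)[OF B assms(1) fc assms(2)] by (simp add: jet_eq_def)
  qed
  then show ?thesis unfolding jet_coords_def by (intro arg_cong[of _ _ "case_sum (\<phi> x)"] restrict_ext) auto
qed

lemma jet_chart_jet:
  assumes "local_section B x s" "s x \<in> U"
  shows "jet_coords B r U \<phi> \<eta> (fst (jet_of B r x s)) (jet_rep (jet_of B r x s)) = jet_coords B r U \<phi> \<eta> x s"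
  using jet_coords_cong[OF jet_rep_props(2)[OF B assms(1)] assms(2)] jet_rep_props(3)[OF B assms(1)] by simp

lemma jet_coords_space:
  assumes "x \<in> proj B ` U" shows "jet_coords B r U \<phi> \<eta> x s \<in> coord_space (jidx B r)"
proof -
  have "\<phi> x \<in> coord_space (bidx B)" by (rule chart_coord[OF fc_base_top[OF B fc] assms])
  then show ?thesis by (auto simp: jet_coords_def PiE_iff extensional_def restrict_def split: sum.split)
qed

lemma order0_jet_coords:
  assumes "local_section B x s" "s x \<in> U"
  shows "order0 B (jet_coords B r U \<phi> \<eta> x s) = tcoord B \<phi> \<eta> (s x)"
proof -
  note x = section_base_point[OF assms]
  have "order0 B (jet_coords B r U \<phi> \<eta> x s) = (\<lambda>m\<in>tidx B. tcoord B \<phi> \<eta> (s x) m)"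
    unfolding order0_def
  proof (rule restrict_ext)
    fix m assume m: "m \<in> tidx B"
    show "(case m of Inl i \<Rightarrow> jet_coords B r U \<phi> \<eta> x s (Inl i) | Inr k \<Rightarrow> jet_coords B r U \<phi> \<eta> x s (Inr (k, {#}))) = tcoord B \<phi> \<eta> (s x) m"
    proof (cases m)
      case (Inl i)
      then show ?thesis using x(1) by (simp add: jet_coords_def)
    next
      case (Inr k)
      then have "k \<in> fidx B" using m by auto
      then show ?thesis
        using jet_coords_list[OF assms, of k "[]" r] section_coord_at[OF B fc x(2)] Inr by simp
    qed
  qed
  also have "\<dots> = tcoord B \<phi> \<eta> (s x)" by (rule tcoord_ext[OF B fc assms(2)])
  finally show ?thesis .
qed

lemma iter_pderiv_poly_section:
  assumes w: "k \<in> fidx B" and js: "set is \<subseteq> bidx B" "length is \<le> r"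
  shows "iter_pderiv is (poly_section B r w k) (\<lambda>i\<in>bidx B. w (Inl i)) = w (Inr (k, mset is))"
  unfolding poly_section_def[abs_def]
  by (rule iter_pderiv_taylor_poly[OF fin_bidx[OF B] fin_mindices[OF B] _ _ js(1), where c="\<lambda>\<Lambda>. w (Inr (k, \<Lambda>))"])
     (use js in \<open>auto simp: mindices_def\<close>)

lemma smooth_on_poly_section:
  assumes O: "openin (powertop_real J) E" and z: "\<And>i. i \<in> bidx B \<Longrightarrow> smooth_on J E (\<lambda>u. z u i)"
    and w: "\<And>m. m \<in> jidx B r \<Longrightarrow> smooth_on J E (\<lambda>u. w u m)" and k: "k \<in> fidx B"
  shows "smooth_on J E (\<lambda>u. poly_section B r (w u) k (z u))"
  unfolding poly_section_def
proof (intro smooth_on_sum[OF O] smooth_on_mult[OF O] smooth_on_taylor_mono[OF O] z)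
  show "smooth_on J E (\<lambda>u. w u (Inr (k, \<Lambda>)))" if "\<Lambda> \<in> mindices B r" for \<Lambda>
    by (rule w) (use that k in \<open>auto simp: jet_fiber_idx_iff\<close>)
  show "smooth_on J E (\<lambda>u. (\<lambda>i\<in>bidx B. w u (Inl i)) i)" if "i \<in> bidx B" for i
    using w[of "Inl i"] that by auto
qed

lemma coord_space_open: "openin (powertop_real J) (coord_space J)" by (simp add: powertop_real_eq)

text \<open>
  The polynomial with the coefficients \<open>w\<close> defines a section near the base point, because the
  chart of the total space has an open image.
\<close>

lemma jet_realize:
  assumes w: "w \<in> coord_space (jidx B r)" and y: "y \<in> U" "order0 B w = tcoord B \<phi> \<eta> y"
  obtains x s where "x \<in> points (base B)" "local_section B x s" "s x = y" "jet_coords B r U \<phi> \<eta> x s = w"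
proof -
  let ?I = "bidx B" and ?X = "base B" and ?T = "tcoord B \<phi> \<eta>"
  note tb = fc_base_top[OF B fc] and tt = fc_total_top[OF B fc]
  define x where "x = proj B y"
  have xU: "x \<in> proj B ` U" using y by (simp add: x_def)
  have xX: "x \<in> points ?X" using xU top_chartD(5)[OF tb] by auto
  have z0: "(\<lambda>i\<in>?I. w (Inl i)) = \<phi> x"
  proof -
    have "w (Inl i) = \<phi> x i" if "i \<in> ?I" for i
      using fun_cong[OF y(2), of "Inl i"] that by (simp add: order0_def x_def InlI)
    then have "(\<lambda>i\<in>?I. w (Inl i)) = (\<lambda>i\<in>?I. \<phi> x i)" by (rule restrict_ext)
    then show ?thesis using bcoord_ext[OF B fc xU] by simp
  qed
  define P where "P = poly_section B r w"
  have P0: "P k (\<phi> x) = \<eta> y k" if k: "k \<in> fidx B" for k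
    using iter_pderiv_poly_section[OF k, of "[]" r w] fun_cong[OF y(2), of "Inr k"] k
    by (simp add: z0 P_def order0_def InrI)
  define a where "a m z = (case m of Inl i \<Rightarrow> z i | Inr k \<Rightarrow> P k z)" for m and z :: "'i \<Rightarrow> real"
  have sP: "smooth_on ?I E (P k)" if "openin (powertop_real ?I) E" "k \<in> fidx B" for E k
    unfolding P_def using smooth_on_poly_section[OF that(1) smooth_on_coord[OF that(1)] smooth_on_const[OF that(1)] that(2)] .
  have sa: "smooth_on ?I E (a m)" if "openin (powertop_real ?I) E" "m \<in> tidx B" for E m
    using that sP[OF that(1)] smooth_on_coord[OF that(1)] by (cases m) (auto simp: a_def[abs_def])
  \<comment> \<open>The coordinates of the polynomial section at \<open>p\<close>.\<close>
  define b where "b p = (\<lambda>m\<in>tidx B. a m (\<phi> p))" for p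
  define s where "s p = inv_into U ?T (b p)" for p
  \<comment> \<open>The preimage under the polynomial section of an open set of the total space; with all points
    of the total space it is the domain of the section.\<close>
  define W where "W O' = {p \<in> proj B ` U. b p \<in> ?T ` (U \<inter> O')}" for O'
  have W: "openin (mtop ?X) (W O')" if "openin (mtop (total B)) O'" for O'
  proof -
    have "openin (powertop_real ?I) {z \<in> coord_space ?I. (\<lambda>m\<in>tidx B. a m z) \<in> ?T ` (U \<inter> O')}"
      by (rule smooth_preimage_open[OF coord_space_open chart_image_open[OF tt that]])
         (rule smooth_on_continuous[OF coord_openin_subset[OF coord_space_open] sa[OF coord_space_open]])
    from chart_preimage_open[OF tb this]
    have "openin (mtop ?X) {p \<in> proj B ` U. \<phi> p \<in> {z \<in> coord_space ?I. (\<lambda>m\<in>tidx B. a m z) \<in> ?T ` (U \<inter> O')}}" .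
    moreover have "{p \<in> proj B ` U. \<phi> p \<in> {z \<in> coord_space ?I. (\<lambda>m\<in>tidx B. a m z) \<in> ?T ` (U \<inter> O')}} = W O'"
      using chart_coord[OF tb] by (auto simp: W_def b_def)
    ultimately show ?thesis by simp
  qed
  let ?W = "W (points (total B))"
  have oW: "openin (mtop ?X) ?W" by (rule W) simp
  have WX: "?W \<subseteq> points ?X" using oW by (rule openin_subset)
  have UY: "U \<subseteq> points (total B)" by (rule top_chartD(5)[OF tt])
  have WU: "W O' \<subseteq> proj B ` U" for O' by (auto simp: W_def)
  have sW: "s p \<in> U" "?T (s p) = b p" if "p \<in> ?W" for p
  proof -
    have "b p \<in> ?T ` U" using that by (auto simp: W_def)
    then show "s p \<in> U" "?T (s p) = b p" unfolding s_def by (auto intro: inv_into_into f_inv_into_f)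
  qed
  have ps: "proj B (s p) = p" if p: "p \<in> ?W" for p
  proof -
    have pU: "p \<in> proj B ` U" using p WU by blast
    have "\<phi> (proj B (s p)) i = \<phi> p i" if "i \<in> ?I" for i
      using fun_cong[OF sW(2)[OF p], of "Inl i"] that by (simp add: b_def a_def InlI)
    then have "(\<lambda>i\<in>?I. \<phi> (proj B (s p)) i) = (\<lambda>i\<in>?I. \<phi> p i)" by (rule restrict_ext)
    then have "\<phi> (proj B (s p)) = \<phi> p" using bcoord_ext[OF B fc pU] bcoord_ext[OF B fc, of "proj B (s p)"] sW(1)[OF p] by simp
    then show ?thesis using inj_onD[OF top_chartD(3)[OF tb]] pU sW(1)[OF p] by blast
  qed
  have pre: "{p \<in> ?W. s p \<in> O'} = W O'" if "O' \<subseteq> points (total B)" for O'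
  proof safe
    fix p assume p: "p \<in> ?W" "s p \<in> O'"
    then show "p \<in> W O'" using sW[OF p(1)] WU by (auto simp: W_def intro!: image_eqI[of _ _ "s p"])
  next
    fix p assume p: "p \<in> W O'"
    then show p': "p \<in> ?W" using that by (auto simp: W_def)
    obtain q where q: "q \<in> U" "q \<in> O'" "b p = ?T q" using p by (auto simp: W_def)
    then show "s p \<in> O'" using chart_inv[OF tt q(1)] by (simp add: s_def)
  qed
  have bx: "b x = ?T y"
  proof -
    have "b x = (\<lambda>m\<in>tidx B. ?T y m)" unfolding b_def
      by (rule restrict_ext) (auto simp: a_def x_def[symmetric] P0 split: sum.split)
    then show ?thesis using tcoord_ext[OF B fc y(1)] by simp
  qed
  then have xW: "x \<in> ?W" using xU y(1) UY by (auto simp: W_def)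
  have sx: "s x = y" using chart_inv[OF tt y(1)] by (simp add: s_def bx)
  have sm: "smooth_map (open_submanifold ?X ?W) (total B) s"
    unfolding smooth_map_open_submanifold_iff[OF base_mfd[OF B] total_mfd[OF B] oW]
  proof (intro conjI ballI, goal_cases)
    case 1
    have ts: "topspace (subtopology (mtop ?X) ?W) = ?W" using WX by auto
    show ?case unfolding continuous_map_def ts
    proof (intro conjI allI impI)
      show "s \<in> ?W \<rightarrow> points (total B)" using sW(1) UY by blast
      fix O' assume O': "openin (mtop (total B)) O'"
      show "openin (subtopology (mtop ?X) ?W) {p \<in> ?W. s p \<in> O'}"
        unfolding pre[OF openin_subset[OF O']] openin_open_subtopology[OF oW]
        using W[OF O'] openin_subset[OF O'] by (auto simp: W_def)
    qed
  next
    case (2 c)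
    show ?case
    proof (cases c)
      case (Pair C \<gamma>)
      then have c: "(C, \<gamma>) \<in> matlas (total B)" using 2 by simp
      note tC = atlas_chart[OF total_mfd[OF B] c]
      note oC = top_chartD(1)[OF tC]
      have e: "{p \<in> ?W. s p \<in> C} = W C" by (rule pre[OF openin_subset[OF oC]])
      have "smooth_fn ?X (W C) (\<lambda>p. \<gamma> (s p) j)" if j: "j \<in> midx (total B)" for j
      proof (rule smooth_fn_change_target[OF base_mfd[OF B] W[OF oC] fin_tidx[OF B] tt tC
            is_chart_transition[OF total_mfd[OF B] fc_total[OF B fc] atlas_is_chart[OF total_mfd[OF B] c] midx_finite[OF total_mfd[OF B]]] _ _ j])
        show "s p \<in> U \<inter> C" if "p \<in> W C" for p using that sW(1) unfolding e[symmetric] by blast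
        fix m assume m: "m \<in> tidx B"
        have o: "openin (powertop_real ?I) (\<phi> ` W C)" by (rule chart_image_open_subset[OF tb W[OF oC] WU])
        have "smooth_fn ?X (W C) (\<lambda>p. a m (\<phi> p))"
        proof (rule smooth_fn_of_chart[OF base_mfd[OF B] fc_base[OF B fc] fin_bidx[OF B] W[OF oC] WU])
          have "a m (\<phi> (inv_into (proj B ` U) \<phi> z)) = a m z" if "z \<in> \<phi> ` W C" for z
            using that WU by (metis f_inv_into_f image_mono subsetD)
          then show "smooth_on ?I (\<phi> ` W C) (\<lambda>z. a m (\<phi> (inv_into (proj B ` U) \<phi> z)))"
            using smooth_on_cong[OF o, of "\<lambda>z. a m (\<phi> (inv_into (proj B ` U) \<phi> z))" "a m"] sa[OF o m] by simp
        qed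
        moreover have "a m (\<phi> p) = ?T (s p) m" if "p \<in> W C" for p
        proof -
          have "p \<in> ?W" using that unfolding e[symmetric] by blast
          then show ?thesis using sW(2) m by (simp add: b_def)
        qed
        ultimately show "smooth_fn ?X (W C) (\<lambda>p. ?T (s p) m)"
          using smooth_fn_cong[OF base_mfd[OF B] W[OF oC], of "\<lambda>p. a m (\<phi> p)" "\<lambda>p. ?T (s p) m"] by simp
      qed
      then show ?thesis unfolding Pair prod.case e by blast
    qed
  qed
  have ls: "local_section B x s" unfolding local_section_def using oW xW sm ps by blast
  have oW': "openin (powertop_real ?I) (\<phi> ` ?W)" by (rule chart_image_open_subset[OF tb oW WU])
  have sc: "section_coord B U \<phi> \<eta> s k z = P k z" if z: "z \<in> \<phi> ` ?W" and k: "k \<in> fidx B" for z k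
  proof -
    obtain p where p: "p \<in> ?W" "z = \<phi> p" using z by blast
    then have "p \<in> proj B ` U" using WU by blast
    then show ?thesis
      using section_coord_at[OF B fc] p k fun_cong[OF sW(2)[OF p(1)], of "Inr k"] by (simp add: b_def a_def InrI)
  qed
  have "jet_coords B r U \<phi> \<eta> x s m = w m" for m
  proof (cases "m \<in> jidx B r")
    case True
    then consider i where "m = Inl i" "i \<in> ?I" | k \<Lambda> where "m = Inr (k, \<Lambda>)" "(k, \<Lambda>) \<in> jet_fiber_idx B r" by auto
    then show ?thesis
    proof cases
      case 1
      then show ?thesis using fun_cong[OF z0, of i] by (simp add: jet_coords_def)
    next
      case (2 k \<Lambda>)
      obtain js where js: "mset js = \<Lambda>" using ex_mset by blast
      have k: "k \<in> fidx B" "set js \<subseteq> ?I" "length js \<le> r"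
        using 2 js by (auto simp: jet_fiber_idx_iff mindices_def)
      have "jet_coords B r U \<phi> \<eta> x s (Inr (k, \<Lambda>)) = iter_pderiv js (section_coord B U \<phi> \<eta> s k) (\<phi> x)"
        using jet_coords_list[OF ls _ k] sx y(1) js by simp
      also have "\<dots> = iter_pderiv js (P k) (\<phi> x)"
        by (rule iter_pderiv_cong[OF oW' sc _ k(2)]) (use xW k in auto)
      also have "\<dots> = w (Inr (k, \<Lambda>))" using iter_pderiv_poly_section[OF k, of w] js by (simp add: P_def z0)
      finally show ?thesis using 2 by simp
    qed
  next
    case False
    then show ?thesis using jet_coords_space[OF xU, of r s] w by (simp add: PiE_iff extensional_def)
  qed
  then have "jet_coords B r U \<phi> \<eta> x s = w" by (rule ext)
  with xX ls sx show thesis by (rule that)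
qed

lemma jet_chart_image:
  assumes "V \<subseteq> U"
  shows "(\<lambda>j. jet_coords B r U \<phi> \<eta> (fst j) (jet_rep j)) ` jet_dom B r V = jet_img B \<phi> \<eta> r V"
proof safe
  fix j assume "j \<in> jet_dom B r V"
  then obtain x s where xs: "x \<in> points (base B)" "local_section B x s" "j = jet_of B r x s" "s x \<in> V" by (rule jet_dom_cases)
  then have sU: "s x \<in> U" using assms by blast
  show "jet_coords B r U \<phi> \<eta> (fst j) (jet_rep j) \<in> jet_img B \<phi> \<eta> r V"
    unfolding xs(3) jet_chart_jet[OF xs(2) sU] jet_img_def
    using jet_coords_space[OF section_base_point(2)[OF xs(2) sU]] order0_jet_coords[OF xs(2) sU] xs(4) by auto
next
  fix w assume "w \<in> jet_img B \<phi> \<eta> r V"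
  then obtain y where w: "w \<in> coord_space (jidx B r)" "y \<in> V" "order0 B w = tcoord B \<phi> \<eta> y" by (auto simp: jet_img_def)
  obtain x s where xs: "x \<in> points (base B)" "local_section B x s" "s x = y" "jet_coords B r U \<phi> \<eta> x s = w"
    by (rule jet_realize[OF w(1) _ w(3)]) (use w assms in \<open>auto intro: that\<close>)
  have "jet_coords B r U \<phi> \<eta> (fst (jet_of B r x s)) (jet_rep (jet_of B r x s)) = w"
    using jet_chart_jet[OF xs(2)] xs w assms by auto
  moreover have "jet_of B r x s \<in> jet_dom B r V" using jet_of_dom_iff[OF xs(1,2)] xs w by simp
  ultimately show "w \<in> (\<lambda>j. jet_coords B r U \<phi> \<eta> (fst j) (jet_rep j)) ` jet_dom B r V" by force
qed

lemma jet_img_open: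
  assumes "openin (mtop (total B)) V" shows "openin (powertop_real (jidx B r)) (jet_img B \<phi> \<eta> r (U \<inter> V))"
proof -
  have "openin (powertop_real (jidx B r)) {w \<in> coord_space (jidx B r).
      (\<lambda>m\<in>tidx B. (case m of Inl i \<Rightarrow> (\<lambda>w. w (Inl i)) | Inr k \<Rightarrow> (\<lambda>w. w (Inr (k, {#})))) w) \<in> tcoord B \<phi> \<eta> ` (U \<inter> V)}"
  proof (rule smooth_preimage_open[OF coord_space_open chart_image_open[OF fc_total_top[OF B fc] assms]])
    show "continuous_on (coord_space (jidx B r)) (case m of Inl i \<Rightarrow> (\<lambda>w. w (Inl i)) | Inr k \<Rightarrow> (\<lambda>w. w (Inr (k, {#}))))" for m :: "'i + 'k"
      by (cases m) (auto intro!: continuous_on_subset[OF continuous_on_product_coordinates])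
  qed
  moreover have "(case m of Inl i \<Rightarrow> (\<lambda>w. w (Inl i)) | Inr k \<Rightarrow> (\<lambda>w. w (Inr (k, {#})))) w =
      (case m of Inl i \<Rightarrow> w (Inl i) | Inr k \<Rightarrow> w (Inr (k, {#})))" for m :: "'i + 'k" and w :: "'i + 'k \<times> 'i multiset \<Rightarrow> real"
    by (cases m) auto
  ultimately show ?thesis by (simp only: jet_img_def order0_def)
qed

text \<open>
  Equal coordinates force the same base point, hence the same point of the total space, and
  equal derivatives in one chart.
\<close>

lemma jet_coords_eq_imp:
  assumes s: "local_section B x s" "s x \<in> U" and s': "local_section B x' s'" "s' x' \<in> U"
    and eq: "jet_coords B r U \<phi> \<eta> x s = jet_coords B r U \<phi> \<eta> x' s'"
  shows "x = x'" "same_jet B r x s s'"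
proof -
  have "tcoord B \<phi> \<eta> (s x) = tcoord B \<phi> \<eta> (s' x')"
    using order0_jet_coords[OF s, of r] order0_jet_coords[OF s', of r] eq by simp
  then have y: "s x = s' x'" using inj_onD[OF top_chartD(3)[OF fc_total_top[OF B fc]]] s(2) s'(2) by blast
  then show x: "x = x'" using section_base_point(1)[OF s] section_base_point(1)[OF s'] by simp
  show "same_jet B r x s s'"
  proof (rule same_jetI[OF B fc s(1)])
    show "jet_eq (bidx B) r (\<phi> x) (section_coord B U \<phi> \<eta> s k) (section_coord B U \<phi> \<eta> s' k)" if "k \<in> fidx B" for k
      unfolding jet_eq_def
    proof (intro allI impI)
      fix js assume "set js \<subseteq> bidx B \<and> length js \<le> r"
      then have js: "set js \<subseteq> bidx B" "length js \<le> r" by auto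
      show "iter_pderiv js (section_coord B U \<phi> \<eta> s k) (\<phi> x) = iter_pderiv js (section_coord B U \<phi> \<eta> s' k) (\<phi> x)"
        using jet_coords_list[OF s that js] jet_coords_list[OF s' that js] eq x by simp
    qed
  qed (use s s' x y in auto)
qed

lemma jet_chart_inj: "inj_on (\<lambda>j. jet_coords B r U \<phi> \<eta> (fst j) (jet_rep j)) (jet_dom B r U)"
proof (rule inj_onI)
  fix j j' assume "j \<in> jet_dom B r U" "j' \<in> jet_dom B r U"
    and eq: "jet_coords B r U \<phi> \<eta> (fst j) (jet_rep j) = jet_coords B r U \<phi> \<eta> (fst j') (jet_rep j')"
  then obtain x s x' s' where xs: "local_section B x s" "j = jet_of B r x s" "s x \<in> U"
      "local_section B x' s'" "j' = jet_of B r x' s'" "s' x' \<in> U"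
    by (metis jet_dom_cases)
  have "jet_coords B r U \<phi> \<eta> x s = jet_coords B r U \<phi> \<eta> x' s'"
    using eq unfolding xs(2,5) jet_chart_jet[OF xs(1,3)] jet_chart_jet[OF xs(4,6)] .
  from jet_coords_eq_imp[OF xs(1,3,4,6) this] show "j = j'"
    unfolding xs(2,5) jet_of_eq[OF B xs(1,4)] by simp
qed

end

end

context
  fixes B :: "('x, 'i, 'y, 'j, 'v, 'k) fbundle"
  assumes B: "smooth_fiber_bundle B"
begin

subsection \<open>Smoothness of the coordinate changes\<close>

lemma Inl_family: "u \<in> coord_space (I <+> J) \<Longrightarrow> (\<lambda>i. u (Inl i)) = (\<lambda>i\<in>I. u (Inl i))"
  by (auto simp: PiE_iff extensional_def restrict_def fun_eq_iff)

context
  fixes U \<phi> \<eta> U' \<phi>' \<eta>'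
  assumes c: "fibered_chart B U \<phi> \<eta>" and c': "fibered_chart B U' \<phi>' \<eta>'"
begin

text \<open>
  Transforming the polynomial section with coefficients \<open>w\<close> to other coordinates and evaluating
  it at \<open>z\<close> is smooth in the pair \<open>(z, w)\<close> on an open set \<open>E\<close> of pairs for which the
  transformation is defined. Derivatives in \<open>z\<close> are then smooth in \<open>w\<close>.
\<close>

lemma poly_section_change_smooth:
  fixes r defines "N \<equiv> bidx B <+> jidx B r"
  assumes k': "k' \<in> fidx B"
  obtains E where "openin (powertop_real N) E"
    "smooth_on N E (\<lambda>u. section_change B U \<phi> \<eta> U' \<phi>' \<eta>' (poly_section B r (\<lambda>n. u (Inr n))) k' (\<lambda>i. u (Inl i)))"
    "\<And>z w. z \<in> \<phi>' ` (proj B ` U' \<inter> proj B ` U) \<Longrightarrow> w \<in> coord_space (jidx B r) \<Longrightarrow>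
       (\<lambda>m\<in>tidx B. case m of Inl i \<Rightarrow> \<phi> (inv_into (proj B ` U') \<phi>' z) i
          | Inr k \<Rightarrow> poly_section B r w k (\<lambda>i\<in>bidx B. \<phi> (inv_into (proj B ` U') \<phi>' z) i)) \<in> tcoord B \<phi> \<eta> ` (U \<inter> U') \<Longrightarrow> case_sum z w \<in> E"
proof -
  \<comment> \<open>The total coordinates of the polynomial section at the point with second base coordinates
    \<open>z\<close>, as functions of \<open>u = (z, w)\<close>.\<close>
  define A :: "'i + 'k \<Rightarrow> ('i + ('i + 'k \<times> 'i multiset) \<Rightarrow> real) \<Rightarrow> real" where "A m u = (case m of Inl i \<Rightarrow> \<phi> (inv_into (proj B ` U') \<phi>' (\<lambda>i. u (Inl i))) i
      | Inr k \<Rightarrow> poly_section B r (\<lambda>n. u (Inr n)) k (\<lambda>i\<in>bidx B. \<phi> (inv_into (proj B ` U') \<phi>' (\<lambda>i. u (Inl i))) i))" for m u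
  define O1 where "O1 = {u \<in> coord_space N. (\<lambda>i\<in>bidx B. u (Inl i)) \<in> \<phi>' ` (proj B ` U' \<inter> proj B ` U)}"
  have oN: "openin (powertop_real N) (coord_space N)" by (simp add: powertop_real_eq)
  have O1: "openin (powertop_real N) O1" unfolding O1_def
    by (rule smooth_preimage_open[OF oN overlap_base[OF B c c']])
       (rule smooth_on_continuous[OF subset_refl smooth_on_coord[OF oN]])
  have z: "(\<lambda>i. u (Inl i)) \<in> \<phi>' ` (proj B ` U' \<inter> proj B ` U)" if "u \<in> O1" for u
    using that Inl_family[of u "bidx B" "jidx B r"] by (simp add: O1_def N_def)
  note th = theta_compose[OF B c c' _ smooth_on_coord]
  have sp: "smooth_on N E (\<lambda>u. poly_section B r (\<lambda>n. u (Inr n)) k (\<lambda>i\<in>bidx B. \<phi> (inv_into (proj B ` U') \<phi>' (\<lambda>i. u (Inl i))) i))"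
    if E: "openin (powertop_real N) E" "E \<subseteq> O1" and k: "k \<in> fidx B" for k E
  proof (rule smooth_on_poly_section[OF B _ E(1) _ smooth_on_coord[OF E(1)] k])
    show "smooth_on N E (\<lambda>u. (\<lambda>i\<in>bidx B. \<phi> (inv_into (proj B ` U') \<phi>' (\<lambda>i. u (Inl i))) i) i)" if i: "i \<in> bidx B" for i
      using theta_compose[OF B c c' E(1), of "\<lambda>u i. u (Inl i)", OF smooth_on_coord[OF E(1)] z i] E(2) i by auto
  qed (rule c)
  have sA: "smooth_on N O1 (A m)" if "m \<in> tidx B" for m
  proof (cases m)
    case (Inl i)
    then have i: "i \<in> bidx B" using that by auto
    show ?thesis unfolding A_def[abs_def] Inl sum.case
      by (rule theta_compose[OF B c c' O1 smooth_on_coord[OF O1] z i])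
  next
    case (Inr k)
    then have k: "k \<in> fidx B" using that by auto
    show ?thesis unfolding A_def[abs_def] Inr sum.case by (rule sp[OF O1 subset_refl k])
  qed
  define E where "E = {u \<in> O1. (\<lambda>m\<in>tidx B. A m u) \<in> tcoord B \<phi> \<eta> ` (U \<inter> U')}"
  have E: "openin (powertop_real N) E" unfolding E_def
    by (rule smooth_preimage_open[OF O1 overlap_total[OF B c c']])
       (rule smooth_on_continuous[OF coord_openin_subset[OF O1] sA])
  have EO: "E \<subseteq> O1" by (auto simp: E_def)
  have finN: "finite N" unfolding N_def using fin_bidx[OF B] fin_jidx[OF B] by simp
  show thesis
  proof (rule that[OF E])
    show "smooth_on N E (\<lambda>u. section_change B U \<phi> \<eta> U' \<phi>' \<eta>' (poly_section B r (\<lambda>n. u (Inr n))) k' (\<lambda>i. u (Inl i)))"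
    proof (rule section_change_smooth[where z="\<lambda>u i. u (Inl i)" and q="\<lambda>u. poly_section B r (\<lambda>n. u (Inr n))",
          OF B c c' finN E smooth_on_coord[OF E] _ sp[OF E EO] _ k'])
      show "(\<lambda>i. u (Inl i)) \<in> \<phi>' ` (proj B ` U' \<inter> proj B ` U)" if "u \<in> E" for u using that EO z by blast
      show "(\<lambda>m\<in>tidx B. case m of Inl i \<Rightarrow> \<phi> (inv_into (proj B ` U') \<phi>' (\<lambda>i. u (Inl i))) i
        | Inr k \<Rightarrow> poly_section B r (\<lambda>n. u (Inr n)) k (\<lambda>i\<in>bidx B. \<phi> (inv_into (proj B ` U') \<phi>' (\<lambda>i. u (Inl i))) i)) \<in> tcoord B \<phi> \<eta> ` (U \<inter> U')"
        if "u \<in> E" for u using that unfolding E_def A_def by blast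
    qed
    fix z w assume zz: "z \<in> \<phi>' ` (proj B ` U' \<inter> proj B ` U)" and w: "w \<in> coord_space (jidx B r)"
      and T: "(\<lambda>m\<in>tidx B. case m of Inl i \<Rightarrow> \<phi> (inv_into (proj B ` U') \<phi>' z) i
          | Inr k \<Rightarrow> poly_section B r w k (\<lambda>i\<in>bidx B. \<phi> (inv_into (proj B ` U') \<phi>' z) i)) \<in> tcoord B \<phi> \<eta> ` (U \<inter> U')"
    have zc: "z \<in> coord_space (bidx B)" using zz coord_openin_subset[OF overlap_base[OF B c c']] by blast
    have "case_sum z w \<in> coord_space N" unfolding N_def using zc w
      by (auto simp: PiE_iff extensional_def split: sum.split)
    then have "case_sum z w \<in> O1" using zz coord_ext[OF zc] by (simp add: O1_def)
    then show "case_sum z w \<in> E" using T by (simp add: E_def A_def)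
  qed
qed

text \<open>
  A section and the polynomial with its jet coordinates have the same \<open>r\<close>-jet, and by
  \<open>section_change_jet_eq\<close> this is preserved by the change of coordinates.
\<close>

lemma jet_coords_change:
  assumes s: "local_section B x s" "s x \<in> U" "s x \<in> U'" and k': "k' \<in> fidx B" and js: "set js \<subseteq> bidx B" "length js \<le> r"
  defines "w \<equiv> jet_coords B r U \<phi> \<eta> x s"
  shows "jet_coords B r U' \<phi>' \<eta>' x s (Inr (k', mset js)) =
    iter_pderiv js (section_change B U \<phi> \<eta> U' \<phi>' \<eta>' (poly_section B r w) k') (\<phi>' x)"
    and "(\<lambda>m\<in>tidx B. case m of Inl i \<Rightarrow> \<phi> x i | Inr k \<Rightarrow> poly_section B r w k (\<phi> x)) \<in> tcoord B \<phi> \<eta> ` (U \<inter> U')"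
proof -
  let ?chg = "section_change B U \<phi> \<eta> U' \<phi>' \<eta>'" and ?q = "section_coord B U \<phi> \<eta> s"
  obtain D where D: "openin (mtop (base B)) D" "x \<in> D" "D \<subseteq> proj B ` U" "\<And>w. w \<in> D \<Longrightarrow> s w \<in> U \<and> proj B (s w) = w"
    "\<And>k. k \<in> fidx B \<Longrightarrow> smooth_on (bidx B) (\<phi> ` D) (?q k)"
    by (rule section_near[OF B c s(1,2)]) (rule that)
  obtain D' where D': "openin (mtop (base B)) D'" "x \<in> D'" "D' \<subseteq> proj B ` U'"
    by (rule section_near[OF B c' s(1,3)]) (rule that)
  have xU: "x \<in> proj B ` U" "x \<in> proj B ` U'" using D D' by auto
  note oD = chart_image_open_subset[OF fc_base_top[OF B c] D(1,3)]
  have oDD': "openin (powertop_real (bidx B)) (\<phi>' ` (D \<inter> D'))"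
    by (rule chart_image_open_subset[OF fc_base_top[OF B c']]) (use D D' in auto)
  \<comment> \<open>The polynomial section is centred at \<open>\<phi>(x)\<close>.\<close>
  have w0: "(\<lambda>i\<in>bidx B. w (Inl i)) = \<phi> x"
    using bcoord_ext[OF B c xU(1)] by (simp add: w_def jet_coords_def)
  have je: "jet_eq (bidx B) r (\<phi> x) (?q k) (poly_section B r w k)" if k: "k \<in> fidx B" for k
    unfolding jet_eq_def
  proof (intro allI impI)
    fix "is" assume "set is \<subseteq> bidx B \<and> length is \<le> r"
    then have i: "set is \<subseteq> bidx B" "length is \<le> r" by auto
    show "iter_pderiv is (?q k) (\<phi> x) = iter_pderiv is (poly_section B r w k) (\<phi> x)"
      using jet_coords_list[OF B c s(1,2) k i] iter_pderiv_poly_section[OF B c k i, of w] unfolding w0 by (simp add: w_def)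
  qed
  have T: "(\<lambda>m\<in>tidx B. case m of Inl i \<Rightarrow> \<phi> x i | Inr k \<Rightarrow> ?q k (\<phi> x)) \<in> tcoord B \<phi> \<eta> ` (U \<inter> U')"
  proof -
    have "(\<lambda>m\<in>tidx B. case m of Inl i \<Rightarrow> \<phi> x i | Inr k \<Rightarrow> ?q k (\<phi> x)) = (\<lambda>m\<in>tidx B. tcoord B \<phi> \<eta> (s x) m)"
      using D(4)[OF D(2)] by (intro restrict_ext) (auto simp: section_coord_at[OF B c xU(1)] split: sum.split)
    then show ?thesis using tcoord_ext[OF B c s(2)] s by auto
  qed
  have "(\<lambda>m\<in>tidx B. case m of Inl i \<Rightarrow> \<phi> x i | Inr k \<Rightarrow> ?q k (\<phi> x)) = (\<lambda>m\<in>tidx B. case m of Inl i \<Rightarrow> \<phi> x i | Inr k \<Rightarrow> poly_section B r w k (\<phi> x))"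
    by (rule restrict_ext) (use jet_eq_value[OF je] in \<open>auto split: sum.split\<close>)
  with T show "(\<lambda>m\<in>tidx B. case m of Inl i \<Rightarrow> \<phi> x i | Inr k \<Rightarrow> poly_section B r w k (\<phi> x)) \<in> tcoord B \<phi> \<eta> ` (U \<inter> U')" by simp
  have px: "\<phi> x \<in> \<phi> ` D" using D(2) by blast
  have sp: "smooth_on (bidx B) (\<phi> ` D) (poly_section B r w k)" if "k \<in> fidx B" for k
    using smooth_on_poly_section[OF B c oD, of "\<lambda>z. z" r "\<lambda>z. w", OF smooth_on_coord[OF oD] smooth_on_const[OF oD] that] .
  have "jet_eq (bidx B) r (\<phi>' x) (?chg ?q k') (?chg (poly_section B r w) k')"
    by (rule section_change_jet_eq[OF B c c' xU oD px D(5) sp je T k'])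
  moreover have "iter_pderiv js (section_coord B U' \<phi>' \<eta>' s k') (\<phi>' x) = iter_pderiv js (?chg ?q k') (\<phi>' x)"
  proof (rule iter_pderiv_cong[OF oDD' _ _ js(1)])
    show "\<phi>' x \<in> \<phi>' ` (D \<inter> D')" using D D' by blast
    fix z assume "z \<in> \<phi>' ` (D \<inter> D')"
    then obtain p where p: "p \<in> D" "p \<in> D'" "z = \<phi>' p" by blast
    show "section_coord B U' \<phi>' \<eta>' s k' z = ?chg ?q k' z"
      unfolding p(3) by (rule section_change_section[OF B c c']) (use p D(4) D'(3) in auto)
  qed
  ultimately show "jet_coords B r U' \<phi>' \<eta>' x s (Inr (k', mset js)) = iter_pderiv js (?chg (poly_section B r w) k') (\<phi>' x)"
    using jet_coords_list[OF B c' s(1,3) k' js] js by (simp add: jet_eq_def)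
qed

lemma jet_dom_Int: "jet_dom B r U \<inter> jet_dom B r V = jet_dom B r (U \<inter> V)"
  by (auto simp: jet_dom_def)

lemma jet_chart_overlap: "(\<lambda>j. jet_coords B r U \<phi> \<eta> (fst j) (jet_rep j)) ` (jet_dom B r U \<inter> jet_dom B r U') = jet_img B \<phi> \<eta> r (U \<inter> U')"
  unfolding jet_dom_Int by (rule jet_chart_image[OF B c]) auto

text \<open>
  By \<open>jet_coords_change\<close> the components of the transition are derivatives in \<open>z\<close> of the function
  from \<open>poly_section_change_smooth\<close>, evaluated at \<open>z = \<phi>'(x)\<close>, where the base point \<open>x\<close> is a
  smooth function of \<open>w\<close>.
\<close>

lemma jet_transition_smooth: "smooth_transition (jidx B r) (jidx B r) (jet_chart B r U \<phi> \<eta>) (jet_chart B r U' \<phi>' \<eta>')"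
  unfolding smooth_transition_def jet_chart_eq[OF B c] jet_chart_eq[OF B c'] prod.case jet_chart_overlap
proof
  fix m assume m: "m \<in> jidx B r"
  let ?E = "jet_img B \<phi> \<eta> r (U \<inter> U')" and ?\<psi> = "\<lambda>j. jet_coords B r U \<phi> \<eta> (fst j) (jet_rep j)"
    and ?\<psi>' = "\<lambda>j. jet_coords B r U' \<phi>' \<eta>' (fst j) (jet_rep j)"
  note U'o = top_chartD(1)[OF fc_total_top[OF B c']]
  have oE: "openin (powertop_real (jidx B r)) ?E" by (rule jet_img_open[OF B c U'o])
  \<comment> \<open>The base point of the jet with coordinates \<open>w\<close>.\<close>
  define X where "X w = inv_into (proj B ` U) \<phi> (\<lambda>i\<in>bidx B. w (Inl i))" for w :: "'i + 'k \<times> 'i multiset \<Rightarrow> real"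
  have rep: "\<exists>x s. local_section B x s \<and> s x \<in> U \<and> s x \<in> U' \<and> x \<in> proj B ` U \<inter> proj B ` U' \<and> w = jet_coords B r U \<phi> \<eta> x s \<and>
      ?\<psi>' (inv_into (jet_dom B r U) ?\<psi> w) = jet_coords B r U' \<phi>' \<eta>' x s \<and> X w = x \<and> (\<lambda>i\<in>bidx B. w (Inl i)) = \<phi> x"
    if w: "w \<in> ?E" for w
  proof -
    obtain j where j: "j \<in> jet_dom B r (U \<inter> U')" "w = ?\<psi> j"
      using w unfolding jet_chart_overlap[symmetric] jet_dom_Int by blast
    from j(1) obtain x s where xs: "x \<in> points (base B)" "local_section B x s" "j = jet_of B r x s" "s x \<in> U \<inter> U'"
      by (rule jet_dom_cases[OF B])
    have sU: "s x \<in> U" "s x \<in> U'" using xs by auto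
    have "j \<in> jet_dom B r U" using j(1) by (auto simp: jet_dom_def)
    then have inv: "inv_into (jet_dom B r U) ?\<psi> w = j" unfolding j(2) by (rule inv_into_f_f[OF jet_chart_inj[OF B c]])
    have w': "w = jet_coords B r U \<phi> \<eta> x s" unfolding j(2) xs(3) by (rule jet_chart_jet[OF B c xs(2) sU(1)])
    have "?\<psi>' j = jet_coords B r U' \<phi>' \<eta>' x s" unfolding xs(3) by (rule jet_chart_jet[OF B c' xs(2) sU(2)])
    moreover have xU: "x \<in> proj B ` U" "x \<in> proj B ` U'"
      using section_base_point(2)[OF B c xs(2) sU(1)] section_base_point(2)[OF B c' xs(2) sU(2)] by auto
    moreover have w0: "(\<lambda>i\<in>bidx B. w (Inl i)) = \<phi> x" using bcoord_ext[OF B c xU(1)] by (simp add: w' jet_coords_def)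
    moreover have "X w = x" unfolding X_def w0 by (rule chart_inv[OF fc_base_top[OF B c] xU(1)])
    ultimately show ?thesis using xs sU inv w' by auto
  qed
  have thX: "smooth_on (jidx B r) ?E (\<lambda>w. \<phi>' (X w) i)" if i: "i \<in> bidx B" for i
    unfolding X_def
  proof (rule theta_compose[OF B c' c oE])
    show "smooth_on (jidx B r) ?E (\<lambda>w. (\<lambda>i\<in>bidx B. w (Inl i)) i)" if "i \<in> bidx B" for i
      using smooth_on_coord[OF oE] that by simp
    show "(\<lambda>i\<in>bidx B. w (Inl i)) \<in> \<phi> ` (proj B ` U \<inter> proj B ` U')" if "w \<in> ?E" for w
      using rep[OF that] by auto
  qed (rule i)
  show "smooth_on (jidx B r) ?E (\<lambda>w. ?\<psi>' (inv_into (jet_dom B r U) ?\<psi> w) m)"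
  proof (cases m)
    case (Inl i)
    then have i: "i \<in> bidx B" using m by auto
    have "?\<psi>' (inv_into (jet_dom B r U) ?\<psi> w) m = \<phi>' (X w) i" if wE: "w \<in> ?E" for w
    proof -
      obtain x s where "?\<psi>' (inv_into (jet_dom B r U) ?\<psi> w) = jet_coords B r U' \<phi>' \<eta>' x s" "X w = x" using rep[OF wE] by blast
      moreover have "jet_coords B r U' \<phi>' \<eta>' x s (Inl i) = \<phi>' x i" by (simp add: jet_coords_def)
      ultimately show ?thesis by (simp only: Inl)
    qed
    then show ?thesis using smooth_on_cong[OF oE, of "\<lambda>w. ?\<psi>' (inv_into (jet_dom B r U) ?\<psi> w) m" "\<lambda>w. \<phi>' (X w) i"] thX[OF i] by simp
  next
    case (Inr p)
    obtain k' \<Lambda> where p: "p = (k', \<Lambda>)" by (cases p)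
    then have idx: "(k', \<Lambda>) \<in> jet_fiber_idx B r" using m Inr by auto
    obtain js where js: "mset js = \<Lambda>" using ex_mset by blast
    have k': "k' \<in> fidx B" and js': "set js \<subseteq> bidx B" "length js \<le> r" using idx js by (auto simp: jet_fiber_idx_iff mindices_def)
    let ?N = "bidx B <+> jidx B r"
    define G where "G = (\<lambda>u. section_change B U \<phi> \<eta> U' \<phi>' \<eta>' (poly_section B r (\<lambda>n. u (Inr n))) k' (\<lambda>i. u (Inl i)))"
    obtain V where V: "openin (powertop_real ?N) V"
      "smooth_on ?N V (\<lambda>u. section_change B U \<phi> \<eta> U' \<phi>' \<eta>' (poly_section B r (\<lambda>n. u (Inr n))) k' (\<lambda>i. u (Inl i)))"
      "\<And>z w. z \<in> \<phi>' ` (proj B ` U' \<inter> proj B ` U) \<Longrightarrow> w \<in> coord_space (jidx B r) \<Longrightarrow>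
       (\<lambda>m\<in>tidx B. case m of Inl i \<Rightarrow> \<phi> (inv_into (proj B ` U') \<phi>' z) i
          | Inr k \<Rightarrow> poly_section B r w k (\<lambda>i\<in>bidx B. \<phi> (inv_into (proj B ` U') \<phi>' z) i)) \<in> tcoord B \<phi> \<eta> ` (U \<inter> U') \<Longrightarrow> case_sum z w \<in> V"
      by (rule poly_section_change_smooth[OF k', of r]) (rule that)
    \<comment> \<open>The derivatives \<open>js\<close> in the variable \<open>z\<close>, the coefficients being parameters.\<close>
    define F where "F = iter_pderiv (map Inl js) G"
    have F: "smooth_on ?N V F" unfolding F_def
      by (rule smooth_on_iter_pderiv[OF coord_openin_subset[OF V(1)] V(2)[folded G_def]]) (use js' in auto)
    \<comment> \<open>The substitution of \<open>(\<phi>'(X w), w)\<close> for \<open>(z, w)\<close>.\<close>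
    define a where "a n w = (case n of Inl i \<Rightarrow> \<phi>' (X w) i | Inr m \<Rightarrow> w m)" for n and w :: "'i + 'k \<times> 'i multiset \<Rightarrow> real"
    have av: "(\<lambda>n\<in>?N. a n w) \<in> V \<and> F (\<lambda>n\<in>?N. a n w) = ?\<psi>' (inv_into (jet_dom B r U) ?\<psi> w) m" if w: "w \<in> ?E" for w
    proof -
      obtain x s where xs: "local_section B x s" "s x \<in> U" "s x \<in> U'" "x \<in> proj B ` U" "x \<in> proj B ` U'" "w = jet_coords B r U \<phi> \<eta> x s"
        "?\<psi>' (inv_into (jet_dom B r U) ?\<psi> w) = jet_coords B r U' \<phi>' \<eta>' x s" "X w = x"
        using rep[OF w] by blast
      have wc: "w \<in> coord_space (jidx B r)" using w by (auto simp: jet_img_def)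
      have xc: "\<phi>' x \<in> coord_space (bidx B)" by (rule chart_coord[OF fc_base_top[OF B c'] xs(5)])
      have "case_sum (\<phi>' x) w \<in> coord_space ?N"
        using xc wc by (auto simp: PiE_iff extensional_def split: sum.split)
      moreover have "a n w = case_sum (\<phi>' x) w n" for n by (auto simp: a_def xs(8) split: sum.split)
      ultimately have eq: "(\<lambda>n\<in>?N. a n w) = case_sum (\<phi>' x) w" using coord_ext by simp
      note jc = jet_coords_change[OF xs(1,2,3) k' js', folded xs(6)]
      have "case_sum (\<phi>' x) w \<in> V"
      proof (rule V(3)[OF _ wc])
        show "\<phi>' x \<in> \<phi>' ` (proj B ` U' \<inter> proj B ` U)" using xs by blast
        show "(\<lambda>m\<in>tidx B. case m of Inl i \<Rightarrow> \<phi> (inv_into (proj B ` U') \<phi>' (\<phi>' x)) i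
          | Inr k \<Rightarrow> poly_section B r w k (\<lambda>i\<in>bidx B. \<phi> (inv_into (proj B ` U') \<phi>' (\<phi>' x)) i)) \<in> tcoord B \<phi> \<eta> ` (U \<inter> U')"
          unfolding chart_inv[OF fc_base_top[OF B c'] xs(5)] bcoord_ext[OF B c xs(4)] by (rule jc(2))
      qed
      moreover have "F (case_sum (\<phi>' x) w) = iter_pderiv js (section_change B U \<phi> \<eta> U' \<phi>' \<eta>' (poly_section B r w) k') (\<phi>' x)"
        unfolding F_def iter_pderiv_map_Inl by (simp add: G_def)
      ultimately show ?thesis unfolding eq xs(7) Inr p using jc(1) js by simp
    qed
    have "smooth_on (jidx B r) ?E (\<lambda>w. F (\<lambda>n\<in>?N. a n w))"
    proof (rule smooth_on_compose[OF oE _ V(1) _ F])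
      show "finite ?N" using fin_bidx[OF B] fin_jidx[OF B] by simp
      show "(\<lambda>n\<in>?N. a n w) \<in> V" if "w \<in> ?E" for w using av[OF that] by blast
      show "smooth_on (jidx B r) ?E (a n)" if "n \<in> ?N" for n
        using that thX smooth_on_coord[OF oE] by (cases n) (auto simp: a_def[abs_def])
    qed
    then show ?thesis
      using smooth_on_cong[OF oE, of "\<lambda>w. ?\<psi>' (inv_into (jet_dom B r U) ?\<psi> w) m" "\<lambda>w. F (\<lambda>n\<in>?N. a n w)"] av by simp
  qed
qed

end

end

text \<open>
  Representatives of the points of the infinite order jet space. The carrier of the jet manifold
  is the union of the domains of the jet charts, hence the condition on fibered charts.
\<close>

definition jet_germs :: "('x, 'i, 'y, 'j, 'v, 'k) fbundle \<Rightarrow> ('x \<times> ('x \<Rightarrow> 'y)) set" where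
  "jet_germs B = {(x, s). x \<in> points (base B) \<and> local_section B x s \<and> (\<exists>U \<phi> \<eta>. fibered_chart B U \<phi> \<eta> \<and> s x \<in> U)}"

definition jet_at :: "('x, 'i, 'y, 'j, 'v, 'k) fbundle \<Rightarrow> nat \<Rightarrow> 'x \<times> ('x \<Rightarrow> 'y) \<Rightarrow> ('x, 'y) jet" where
  "jet_at B r \<sigma> = jet_of B r (fst \<sigma>) (snd \<sigma>)"

context
  fixes B :: "('x, 'i, 'y, 'j, 'v, 'k) fbundle"
  assumes B: "smooth_fiber_bundle B"
begin

subsection \<open>The manifold structure\<close>

lemma jet_atlas_cases:
  assumes "c \<in> jet_atlas B r"
  obtains U \<phi> \<eta> where "fibered_chart B U \<phi> \<eta>" "c = (jet_dom B r U, \<lambda>j. jet_coords B r U \<phi> \<eta> (fst j) (jet_rep j))"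
  using assms jet_chart_eq[OF B] by (auto simp: jet_atlas_def)

lemma jet_atlas_pair:
  assumes "(V, \<psi>) \<in> jet_atlas B r"
  shows "\<exists>U \<phi> \<eta>. fibered_chart B U \<phi> \<eta> \<and> V = jet_dom B r U \<and> \<psi> = (\<lambda>j. jet_coords B r U \<phi> \<eta> (fst j) (jet_rep j))"
proof -
  from assms obtain U \<phi> \<eta> where "fibered_chart B U \<phi> \<eta>" "(V, \<psi>) = (jet_dom B r U, \<lambda>j. jet_coords B r U \<phi> \<eta> (fst j) (jet_rep j))"
    by (rule jet_atlas_cases)
  then show ?thesis by blast
qed

lemma jet_atlasI:
  "fibered_chart B U \<phi> \<eta> \<Longrightarrow> (jet_dom B r U, \<lambda>j. jet_coords B r U \<phi> \<eta> (fst j) (jet_rep j)) \<in> jet_atlas B r"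
proof -
  assume fc: "fibered_chart B U \<phi> \<eta>"
  show ?thesis unfolding jet_chart_eq[OF B fc, symmetric] jet_atlas_def using fc by blast
qed

lemma jet_manifold_sel:
  "mtop (jet_manifold B r) = topology_generated_by
     {{j \<in> U. \<phi> j \<in> S} | U \<phi> S. (U, \<phi>) \<in> jet_atlas B r \<and> openin (powertop_real (jidx B r)) S}"
  "midx (jet_manifold B r) = jidx B r" "matlas (jet_manifold B r) = jet_atlas B r"
  by (simp_all add: jet_manifold_def Let_def)

lemma jet_atlas_inj: "(V, \<psi>) \<in> jet_atlas B r \<Longrightarrow> inj_on \<psi> V"
proof (drule jet_atlas_pair, elim exE conjE)
  fix U \<phi> \<eta> assume "fibered_chart B U \<phi> \<eta>" "V = jet_dom B r U" "\<psi> = (\<lambda>j. jet_coords B r U \<phi> \<eta> (fst j) (jet_rep j))"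
  then show "inj_on \<psi> V" using jet_chart_inj[OF B] by simp
qed

lemma jet_atlas_img: "(V, \<psi>) \<in> jet_atlas B r \<Longrightarrow> openin (powertop_real (jidx B r)) (\<psi> ` V)"
proof (erule jet_atlas_cases)
  fix U \<phi> \<eta> assume fc: "fibered_chart B U \<phi> \<eta>" and e: "(V, \<psi>) = (jet_dom B r U, \<lambda>j. jet_coords B r U \<phi> \<eta> (fst j) (jet_rep j))"
  show "openin (powertop_real (jidx B r)) (\<psi> ` V)"
    using jet_chart_image[OF B fc subset_refl, of r] jet_img_open[OF B fc top_chartD(1)[OF fc_total_top[OF B fc]], of r] e by simp
qed

lemma jet_atlas_overlap:
  "(V, \<psi>) \<in> jet_atlas B r \<Longrightarrow> (V', \<psi>') \<in> jet_atlas B r \<Longrightarrow> openin (powertop_real (jidx B r)) (\<psi> ` (V \<inter> V'))"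
proof (erule jet_atlas_cases, erule jet_atlas_cases)
  fix U \<phi> \<eta> U' \<phi>' \<eta>'
  assume fc: "fibered_chart B U \<phi> \<eta>" and e: "(V, \<psi>) = (jet_dom B r U, \<lambda>j. jet_coords B r U \<phi> \<eta> (fst j) (jet_rep j))"
    and fc': "fibered_chart B U' \<phi>' \<eta>'" and e': "(V', \<psi>') = (jet_dom B r U', \<lambda>j. jet_coords B r U' \<phi>' \<eta>' (fst j) (jet_rep j))"
  show "openin (powertop_real (jidx B r)) (\<psi> ` (V \<inter> V'))"
    using jet_chart_overlap[OF B fc fc', of r] jet_img_open[OF B fc top_chartD(1)[OF fc_total_top[OF B fc']], of r] e e' by simp
qed

lemma jet_atlas_trans: "c \<in> jet_atlas B r \<Longrightarrow> c' \<in> jet_atlas B r \<Longrightarrow> smooth_transition (jidx B r) (jidx B r) c c'"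
  unfolding jet_atlas_def using jet_transition_smooth[OF B] by blast

lemmas jet_gen = jet_atlas_inj jet_atlas_img jet_atlas_overlap jet_atlas_trans

lemma jet_top_chart: "(V, \<psi>) \<in> jet_atlas B r \<Longrightarrow> top_chart (mtop (jet_manifold B r)) (jidx B r) (V, \<psi>)"
  unfolding jet_manifold_sel by (rule gen_top_chart[OF fin_jidx[OF B] jet_gen])

lemma jet_points: "points (jet_manifold B r) = {j. \<exists>U \<phi> \<eta>. fibered_chart B U \<phi> \<eta> \<and> j \<in> jet_dom B r U}"
proof -
  have "points (jet_manifold B r) = (\<Union>c\<in>jet_atlas B r. fst c)"
    unfolding jet_manifold_sel by (rule gen_topspace[OF fin_jidx[OF B] jet_gen])
  also have "\<dots> = {j. \<exists>U \<phi> \<eta>. fibered_chart B U \<phi> \<eta> \<and> j \<in> jet_dom B r U}"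
  proof safe
    fix x s V \<psi> assume "(V, \<psi>) \<in> jet_atlas B r" "(x, s) \<in> fst (V, \<psi>)"
    then show "\<exists>U \<phi> \<eta>. fibered_chart B U \<phi> \<eta> \<and> (x, s) \<in> jet_dom B r U" using jet_atlas_pair[of V \<psi> r] by auto
  next
    fix x s U \<phi> \<eta> assume "fibered_chart B U \<phi> \<eta>" "(x, s) \<in> jet_dom B r U"
    then show "(x, s) \<in> (\<Union>c\<in>jet_atlas B r. fst c)" by (intro UN_I[OF jet_atlasI]) auto
  qed
  finally show ?thesis .
qed

lemma jet_points_cases:
  assumes "j \<in> points (jet_manifold B r)"
  obtains \<sigma> where "\<sigma> \<in> jet_germs B" "j = jet_at B r \<sigma>"
proof -
  from assms obtain U \<phi> \<eta> where U: "fibered_chart B U \<phi> \<eta>" "j \<in> jet_dom B r U" unfolding jet_points by blast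
  from U(2) obtain x s where "x \<in> points (base B)" "local_section B x s" "j = jet_of B r x s" "s x \<in> U" by (rule jet_dom_cases[OF B])
  with U show thesis by (intro that[of "(x, s)"]) (auto simp: jet_germs_def jet_at_def)
qed

lemma jet_at_dom: "\<sigma> \<in> jet_germs B \<Longrightarrow> jet_at B r \<sigma> \<in> jet_dom B r U \<longleftrightarrow> snd \<sigma> (fst \<sigma>) \<in> U"
  using jet_of_dom_iff[OF B] by (auto simp: jet_germs_def jet_at_def)

lemma jet_at_points: "\<sigma> \<in> jet_germs B \<Longrightarrow> jet_at B r \<sigma> \<in> points (jet_manifold B r)"
proof -
  assume s: "\<sigma> \<in> jet_germs B"
  then obtain U \<phi> \<eta> where "fibered_chart B U \<phi> \<eta>" "snd \<sigma> (fst \<sigma>) \<in> U" by (auto simp: jet_germs_def)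
  then show ?thesis unfolding jet_points using jet_at_dom[OF s] by blast
qed

lemma jet_dom_open:
  assumes fc: "fibered_chart B U \<phi> \<eta>" and V: "openin (mtop (total B)) V"
  shows "openin (mtop (jet_manifold B r)) (jet_dom B r (U \<inter> V))"
proof -
  let ?\<psi> = "\<lambda>j. jet_coords B r U \<phi> \<eta> (fst j) (jet_rep j)"
  have "openin (mtop (jet_manifold B r)) {j \<in> jet_dom B r U. ?\<psi> j \<in> jet_img B \<phi> \<eta> r (U \<inter> V)}"
    by (rule chart_preimage_open[OF jet_top_chart[OF jet_atlasI[OF fc]] jet_img_open[OF B fc V]])
  moreover have "{j \<in> jet_dom B r U. ?\<psi> j \<in> jet_img B \<phi> \<eta> r (U \<inter> V)} = jet_dom B r (U \<inter> V)"
  proof -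
    have sub: "jet_dom B r (U \<inter> V) \<subseteq> jet_dom B r U" by (auto simp: jet_dom_def)
    have im: "jet_img B \<phi> \<eta> r (U \<inter> V) = ?\<psi> ` jet_dom B r (U \<inter> V)" by (rule jet_chart_image[OF B fc, symmetric]) auto
    show ?thesis unfolding im using sub inj_on_image_mem_iff[OF jet_chart_inj[OF B fc] _ sub] by blast
  qed
  ultimately show ?thesis by simp
qed

text \<open>Continuity of the projection to the total space.\<close>

lemma jet_base_open:
  assumes V: "openin (mtop (total B)) V"
  shows "openin (mtop (jet_manifold B r)) {j \<in> points (jet_manifold B r). jet_rep j (fst j) \<in> V}"
proof -
  have "{j \<in> points (jet_manifold B r). jet_rep j (fst j) \<in> V} = \<Union>{jet_dom B r (U \<inter> V) | U \<phi> \<eta>. fibered_chart B U \<phi> \<eta>}"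
    unfolding jet_points by (auto simp: jet_dom_def)
  then show ?thesis using jet_dom_open[OF _ V] by auto
qed

text \<open>
  Jets over different points of the total space are separated there; jets over the same point
  lie in a common jet chart.
\<close>

lemma jet_Hausdorff: "Hausdorff_space (mtop (jet_manifold B r))"
  unfolding Hausdorff_space_def
proof (intro allI impI)
  let ?T = "mtop (jet_manifold B r)"
  fix j j' assume a: "j \<in> points (jet_manifold B r) \<and> j' \<in> points (jet_manifold B r) \<and> j \<noteq> j'"
  obtain U \<phi> \<eta> where U: "fibered_chart B U \<phi> \<eta>" "j \<in> jet_dom B r U" using a unfolding jet_points by blast
  obtain U' \<phi>' \<eta>' where U': "fibered_chart B U' \<phi>' \<eta>'" "j' \<in> jet_dom B r U'" using a unfolding jet_points by blast
  let ?b = "\<lambda>j. jet_rep j (fst j)"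
  have bY: "?b j \<in> points (total B)" "?b j' \<in> points (total B)"
    using U(2) U'(2) top_chartD(5)[OF fc_total_top[OF B U(1)]] top_chartD(5)[OF fc_total_top[OF B U'(1)]] by (auto simp: jet_dom_def)
  show "\<exists>V V'. openin ?T V \<and> openin ?T V' \<and> j \<in> V \<and> j' \<in> V' \<and> disjnt V V'"
  proof (cases "?b j = ?b j'")
    case False
    have "Hausdorff_space (mtop (total B))" using total_mfd[OF B] by (simp add: smooth_manifold_def)
    then obtain V V' where V: "openin (mtop (total B)) V" "openin (mtop (total B)) V'" "?b j \<in> V" "?b j' \<in> V'" "disjnt V V'"
      using bY False unfolding Hausdorff_space_def by meson
    show ?thesis
      using jet_base_open[OF V(1), of r] jet_base_open[OF V(2), of r] a V(3-5)
      by (intro exI[of _ "{j \<in> points (jet_manifold B r). ?b j \<in> V}"] exI[of _ "{j \<in> points (jet_manifold B r). ?b j \<in> V'}"])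
         (auto simp: disjnt_def)
  next
    case True
    then have j': "j' \<in> jet_dom B r U" using U(2) U'(2) by (auto simp: jet_dom_def)
    let ?\<psi> = "\<lambda>j. jet_coords B r U \<phi> \<eta> (fst j) (jet_rep j)"
    note tc = jet_top_chart[OF jet_atlasI[OF U(1)], of r]
    have ne: "?\<psi> j \<noteq> ?\<psi> j'" using inj_onD[OF jet_chart_inj[OF B U(1)]] U(2) j' a by blast
    have "Hausdorff_space (powertop_real (jidx B r))" by (simp add: Hausdorff_space_product_topology)
    moreover have "?\<psi> j \<in> topspace (powertop_real (jidx B r))" "?\<psi> j' \<in> topspace (powertop_real (jidx B r))"
      using chart_coord[OF tc U(2)] chart_coord[OF tc j'] by auto
    ultimately obtain S S' where S: "openin (powertop_real (jidx B r)) S" "openin (powertop_real (jidx B r)) S'" "?\<psi> j \<in> S" "?\<psi> j' \<in> S'" "disjnt S S'"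
      using ne unfolding Hausdorff_space_def by meson
    show ?thesis
      using chart_preimage_open[OF tc S(1)] chart_preimage_open[OF tc S(2)] U(2) j' S(3-5)
      by (intro exI[of _ "{j \<in> jet_dom B r U. ?\<psi> j \<in> S}"] exI[of _ "{j \<in> jet_dom B r U. ?\<psi> j \<in> S'}"])
         (auto simp: disjnt_def)
  qed
qed

text \<open>The union of all fibered charts is second countable and so has the Lindelof property.\<close>

lemma countable_fibered_cover:
  obtains \<U> where "countable \<U>" "\<And>U. U \<in> \<U> \<Longrightarrow> \<exists>\<phi> \<eta>. fibered_chart B U \<phi> \<eta>"
    "\<Union>\<U> = \<Union>{U. \<exists>\<phi> \<eta>. fibered_chart B U \<phi> \<eta>}"
proof -
  let ?\<F> = "{U. \<exists>\<phi> \<eta>. fibered_chart B U \<phi> \<eta>}"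
  let ?X = "subtopology (mtop (total B)) (\<Union>?\<F>)"
  have o: "openin (mtop (total B)) U" if "U \<in> ?\<F>" for U
    using that top_chartD(1)[OF fc_total_top[OF B]] by blast
  have oU: "openin (mtop (total B)) (\<Union>?\<F>)" using o by (rule openin_Union)
  have "second_countable (mtop (total B))" using total_mfd[OF B] by (simp add: smooth_manifold_def second_countable_top_eq)
  then have "Lindelof_space ?X" by (intro second_countable_imp_Lindelof_space second_countable_subtopology)
  note L = this
  have oX: "openin ?X U" if "U \<in> ?\<F>" for U
    unfolding openin_open_subtopology[OF oU] using o[OF that] that by blast
  have top: "\<Union>?\<F> = topspace ?X" using openin_subset[OF oU] by auto
  have "\<exists>\<U>. countable \<U> \<and> \<U> \<subseteq> ?\<F> \<and> \<Union>\<U> = topspace ?X"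
    by (rule L[unfolded Lindelof_space_def, THEN spec, THEN mp], intro conjI ballI, rule oX, assumption, rule top)
  then obtain \<U> where "countable \<U> \<and> \<U> \<subseteq> ?\<F> \<and> \<Union>\<U> = topspace ?X" ..
  note U = this[THEN conjunct1] this[THEN conjunct2, THEN conjunct1] this[THEN conjunct2, THEN conjunct2]
  show thesis
  proof (rule that[OF U(1)])
    show "\<exists>\<phi> \<eta>. fibered_chart B U \<phi> \<eta>" if "U \<in> \<U>" for U
      using subsetD[OF U(2) that] by (rule CollectD)
    show "\<Union>\<U> = \<Union>?\<F>" by (rule trans[OF U(3) top[symmetric]])
  qed
qed

lemma jet_second_countable: "second_countable (mtop (jet_manifold B r))"
proof -
  obtain \<U> where \<U>: "countable \<U>" "\<And>U. U \<in> \<U> \<Longrightarrow> \<exists>\<phi> \<eta>. fibered_chart B U \<phi> \<eta>"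
    "\<Union>\<U> = \<Union>{U. \<exists>\<phi> \<eta>. fibered_chart B U \<phi> \<eta>}"
    by (rule countable_fibered_cover) (rule that)
  from \<U>(2) obtain f g where fg: "\<And>U. U \<in> \<U> \<Longrightarrow> fibered_chart B U (f U) (g U)" by metis
  define \<C> where "\<C> = (\<lambda>U. (jet_dom B r U, \<lambda>j. jet_coords B r U (f U) (g U) (fst j) (jet_rep j))) ` \<U>"
  have C: "countable \<C>" "\<C> \<subseteq> jet_atlas B r" unfolding \<C>_def using \<U>(1) fg jet_atlasI by auto
  have U: "(\<Union>c\<in>\<C>. fst c) = points (jet_manifold B r)"
  proof -
    have "(\<Union>c\<in>\<C>. fst c) = {j \<in> jets B r. jet_rep j (fst j) \<in> \<Union>\<U>}" by (auto simp: \<C>_def jet_dom_def)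
    also have "\<dots> = points (jet_manifold B r)" unfolding \<U>(3) jet_points by (auto simp: jet_dom_def)
    finally show ?thesis .
  qed
  show ?thesis unfolding jet_manifold_sel(1)
  proof (rule gen_second_countable[OF fin_jidx[OF B] jet_gen C])
    show "(\<Union>c\<in>\<C>. fst c) = topspace (topology_generated_by
      {{j \<in> U. \<phi> j \<in> S} | U \<phi> S. (U, \<phi>) \<in> jet_atlas B r \<and> openin (powertop_real (jidx B r)) S})"
      using U unfolding jet_manifold_sel(1) .
  qed
qed

lemma jet_manifold_smooth: "smooth_manifold (jet_manifold B r)"
  unfolding smooth_manifold_def
proof (intro conjI ballI)
  show "Hausdorff_space (mtop (jet_manifold B r))" by (rule jet_Hausdorff)
  show "second_countable_top (mtop (jet_manifold B r))" unfolding second_countable_top_eq by (rule jet_second_countable)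
  show "finite (midx (jet_manifold B r))" unfolding jet_manifold_sel(2) by (rule fin_jidx[OF B])
  show "top_chart (mtop (jet_manifold B r)) (midx (jet_manifold B r)) c" if "c \<in> matlas (jet_manifold B r)" for c
    using jet_top_chart[of "fst c" "snd c"] that unfolding jet_manifold_sel(2,3) by simp
  show "(\<Union>c\<in>matlas (jet_manifold B r). fst c) = points (jet_manifold B r)"
    unfolding jet_manifold_sel by (rule gen_topspace[OF fin_jidx[OF B] jet_gen, symmetric])
  show "smooth_transition (midx (jet_manifold B r)) (midx (jet_manifold B r)) c c'"
    if "c \<in> matlas (jet_manifold B r)" "c' \<in> matlas (jet_manifold B r)" for c c'
    using jet_atlas_trans that unfolding jet_manifold_sel(2,3) by blast
qed

subsection \<open>The projections\<close>

lemma jet_proj_at: "\<sigma> \<in> jet_germs B \<Longrightarrow> r \<le> t \<Longrightarrow> jet_proj B t r (jet_at B t \<sigma>) = jet_at B r \<sigma>"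
proof -
  assume s: "\<sigma> \<in> jet_germs B" and rt: "r \<le> t"
  have ls: "local_section B (fst \<sigma>) (snd \<sigma>)" using s by (auto simp: jet_germs_def)
  note p = jet_rep_props[OF B ls, of t]
  have "jet_of B r (fst \<sigma>) (snd \<sigma>) = jet_of B r (fst \<sigma>) (jet_rep (jet_at B t \<sigma>))"
    unfolding jet_of_eq[OF B ls p(1)[folded jet_at_def]] using same_jet_mono[OF B p(2) rt] by (simp add: jet_at_def)
  then show ?thesis using p(3) by (simp add: jet_proj_def jet_at_def)
qed

lemma jidx_mono: "r \<le> t \<Longrightarrow> jidx B r \<subseteq> jidx B t"
  by (auto simp: jet_fiber_idx_def)

lemma jet_coords_restrict:
  assumes "r \<le> t" "fibered_chart B U \<phi> \<eta>" "x \<in> proj B ` U"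
  shows "jet_coords B r U \<phi> \<eta> x s = (\<lambda>m\<in>jidx B r. jet_coords B t U \<phi> \<eta> x s m)"
proof -
  have "jet_coords B r U \<phi> \<eta> x s m = jet_coords B t U \<phi> \<eta> x s m" if "m \<in> jidx B r" for m
    using that jidx_mono[OF assms(1)] by (cases m) (auto simp: jet_coords_def)
  then have "(\<lambda>m\<in>jidx B r. jet_coords B r U \<phi> \<eta> x s m) = (\<lambda>m\<in>jidx B r. jet_coords B t U \<phi> \<eta> x s m)" by (rule restrict_ext)
  then show ?thesis using coord_ext[OF jet_coords_space[OF B assms(2,3)]] by simp
qed

text \<open>In jet charts the projection forgets the components of order greater than \<open>r\<close>.\<close>

lemma jet_proj_chart:
  assumes rt: "r \<le> t" and fc: "fibered_chart B U \<phi> \<eta>" and j: "j \<in> jet_dom B t U"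
  shows "jet_proj B t r j \<in> jet_dom B r U"
    "jet_coords B r U \<phi> \<eta> (fst (jet_proj B t r j)) (jet_rep (jet_proj B t r j)) =
      (\<lambda>m\<in>jidx B r. jet_coords B t U \<phi> \<eta> (fst j) (jet_rep j) m)"
proof -
  obtain x s where xs: "x \<in> points (base B)" "local_section B x s" "j = jet_of B t x s" "s x \<in> U"
    using j by (rule jet_dom_cases[OF B])
  have g: "(x, s) \<in> jet_germs B" using xs fc by (auto simp: jet_germs_def)
  have e: "jet_proj B t r j = jet_of B r x s" using jet_proj_at[OF g rt] xs(3) by (simp add: jet_at_def)
  show "jet_proj B t r j \<in> jet_dom B r U" unfolding e using jet_of_dom_iff[OF B xs(1,2)] xs(4) by simp
  show "jet_coords B r U \<phi> \<eta> (fst (jet_proj B t r j)) (jet_rep (jet_proj B t r j)) =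
      (\<lambda>m\<in>jidx B r. jet_coords B t U \<phi> \<eta> (fst j) (jet_rep j) m)"
  proof -
    have b: "jet_coords B t U \<phi> \<eta> (fst j) (jet_rep j) = jet_coords B t U \<phi> \<eta> x s"
      unfolding xs(3) by (rule jet_chart_jet[OF B fc xs(2,4)])
    show ?thesis unfolding e b jet_chart_jet[OF B fc xs(2,4)]
      by (rule jet_coords_restrict[OF rt fc section_base_point(2)[OF B fc xs(2,4)]])
  qed
qed

lemma jet_proj_continuous:
  assumes rt: "r \<le> t"
  shows "continuous_map (mtop (jet_manifold B t)) (mtop (jet_manifold B r)) (jet_proj B t r)"
proof -
  have pts: "jet_proj B t r j \<in> points (jet_manifold B r)" if "j \<in> points (jet_manifold B t)" for j
    using that jet_proj_chart(1)[OF rt] unfolding jet_points by blast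
  show ?thesis
    unfolding jet_manifold_sel(1)[of r] continuous_on_generated_topo_iff
  proof (intro conjI allI impI)
    show "jet_proj B t r ` points (jet_manifold B t) \<subseteq>
      \<Union>{{j \<in> U. \<phi> j \<in> S} | U \<phi> S. (U, \<phi>) \<in> jet_atlas B r \<and> openin (powertop_real (jidx B r)) S}"
      using pts unfolding jet_manifold_sel(1)[of r] topology_generated_by_topspace by blast
    fix A assume "A \<in> {{j \<in> U. \<phi> j \<in> S} | U \<phi> S. (U, \<phi>) \<in> jet_atlas B r \<and> openin (powertop_real (jidx B r)) S}"
    then obtain V \<psi> S where A: "A = {j \<in> V. \<psi> j \<in> S}" "(V, \<psi>) \<in> jet_atlas B r" "openin (powertop_real (jidx B r)) S" by blast
    from jet_atlas_pair[OF A(2)] obtain U \<phi> \<eta> where fc: "fibered_chart B U \<phi> \<eta>"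
      and e: "V = jet_dom B r U" "\<psi> = (\<lambda>j. jet_coords B r U \<phi> \<eta> (fst j) (jet_rep j))"
      by blast
    let ?\<psi> = "\<lambda>j. jet_coords B t U \<phi> \<eta> (fst j) (jet_rep j)"
    let ?S = "{w \<in> coord_space (jidx B t). (\<lambda>m\<in>jidx B r. w m) \<in> S}"
    have oC: "openin (powertop_real (jidx B t)) (coord_space (jidx B t))" by (simp add: powertop_real_eq)
    note tc = jet_top_chart[OF jet_atlasI[OF fc], of t]
    have S: "openin (powertop_real (jidx B t)) ?S"
      by (rule smooth_preimage_open[OF oC A(3)]) (rule smooth_on_continuous[OF subset_refl smooth_on_coord[OF oC]])
    have dom: "j \<in> jet_dom B t U" if jp: "j \<in> points (jet_manifold B t)" "jet_proj B t r j \<in> jet_dom B r U" for j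
    proof -
      from jp(1) obtain \<sigma> where s: "\<sigma> \<in> jet_germs B" "j = jet_at B t \<sigma>" by (rule jet_points_cases)
      show ?thesis using jp(2) unfolding s(2) jet_proj_at[OF s(1) rt] jet_at_dom[OF s(1)] .
    qed
    have "jet_proj B t r -` A \<inter> points (jet_manifold B t) = {j \<in> jet_dom B t U. ?\<psi> j \<in> ?S}"
    proof (intro subset_antisym subsetI)
      fix j assume j: "j \<in> jet_proj B t r -` A \<inter> points (jet_manifold B t)"
      then have jd: "j \<in> jet_dom B t U" using dom A(1) e(1) by simp
      then show "j \<in> {j \<in> jet_dom B t U. ?\<psi> j \<in> ?S}"
        using j jet_proj_chart(2)[OF rt fc jd] chart_coord[OF tc jd] by (simp add: A(1) e)
    next
      fix j assume j: "j \<in> {j \<in> jet_dom B t U. ?\<psi> j \<in> ?S}"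
      then have jd: "j \<in> jet_dom B t U" by simp
      then show "j \<in> jet_proj B t r -` A \<inter> points (jet_manifold B t)"
        using j jet_proj_chart[OF rt fc jd] fc unfolding jet_points by (auto simp: A(1) e)
    qed
    then show "openin (mtop (jet_manifold B t)) (jet_proj B t r -` A \<inter> points (jet_manifold B t))"
      using chart_preimage_open[OF tc S] by simp
  qed
qed

lemma jet_proj_pullback:
  assumes rt: "r \<le> t" and f: "f \<in> jet_funs B r"
  shows "fun_pull B r t f \<in> jet_funs B t"
  unfolding fun_pull_def pullback_fun_def
proof (rule smooth_functionsI[OF jet_manifold_smooth])
  show "smooth_fn (jet_manifold B t) (points (jet_manifold B t)) (\<lambda>j. f (jet_proj B t r j))"
    unfolding smooth_fn_def jet_manifold_sel(2,3)
  proof safe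
    fix V \<psi> assume at: "(V, \<psi>) \<in> jet_atlas B t"
    from jet_atlas_pair[OF at] obtain U \<phi> \<eta> where fc: "fibered_chart B U \<phi> \<eta>"
      and e: "V = jet_dom B t U" "\<psi> = (\<lambda>j. jet_coords B t U \<phi> \<eta> (fst j) (jet_rep j))"
      by blast
    let ?\<psi> = "\<lambda>j. jet_coords B r U \<phi> \<eta> (fst j) (jet_rep j)"
    note tc = jet_top_chart[OF jet_atlasI[OF fc], of t, folded e] and tr = jet_top_chart[OF jet_atlasI[OF fc], of r]
    have VV: "V \<inter> points (jet_manifold B t) = V" using top_chartD(5)[OF tc] by blast
    note oV = top_chartD(2)[OF tc] and oW = top_chartD(2)[OF tr]
    have "smooth_on (jidx B r) (?\<psi> ` (jet_dom B r U \<inter> points (jet_manifold B r))) (\<lambda>z. f (inv_into (jet_dom B r U) ?\<psi> z))"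
      using smooth_fnD[OF smooth_functionsD[OF jet_manifold_smooth f subset_refl]] jet_atlasI[OF fc] unfolding jet_manifold_sel(2,3) by blast
    moreover have "jet_dom B r U \<inter> points (jet_manifold B r) = jet_dom B r U" using top_chartD(5)[OF tr] by blast
    ultimately have sf: "smooth_on (jidx B r) (?\<psi> ` jet_dom B r U) (\<lambda>z. f (inv_into (jet_dom B r U) ?\<psi> z))" by simp
    have v: "(\<lambda>m\<in>jidx B r. z m) = ?\<psi> (jet_proj B t r (inv_into V \<psi> z)) \<and> jet_proj B t r (inv_into V \<psi> z) \<in> jet_dom B r U"
      if z: "z \<in> \<psi> ` V" for z
    proof -
      have i: "inv_into V \<psi> z \<in> V" "\<psi> (inv_into V \<psi> z) = z" using z by (auto intro: inv_into_into f_inv_into_f)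
      then show ?thesis using jet_proj_chart[OF rt fc, of "inv_into V \<psi> z"] unfolding e by simp
    qed
    have "smooth_on (jidx B t) (\<psi> ` V) (\<lambda>z. (\<lambda>z. f (inv_into (jet_dom B r U) ?\<psi> z)) (\<lambda>m\<in>jidx B r. z m))"
      by (rule smooth_on_compose[OF oV fin_jidx[OF B] oW _ sf smooth_on_coord[OF oV]]) (use v in auto)
    moreover have "(\<lambda>z. f (inv_into (jet_dom B r U) ?\<psi> z)) (\<lambda>m\<in>jidx B r. z m) = f (jet_proj B t r (inv_into V \<psi> z))" if z: "z \<in> \<psi> ` V" for z
      using v[OF z] inv_into_f_f[OF jet_chart_inj[OF B fc], of "jet_proj B t r (inv_into V \<psi> z)" r] by simp
    ultimately show "smooth_on (jidx B t) (\<psi> ` (V \<inter> points (jet_manifold B t))) (\<lambda>z. f (jet_proj B t r (inv_into V \<psi> z)))"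
      unfolding VV using smooth_on_cong[OF oV, of "\<lambda>z. (\<lambda>z. f (inv_into (jet_dom B r U) ?\<psi> z)) (\<lambda>m\<in>jidx B r. z m)" "\<lambda>z. f (jet_proj B t r (inv_into V \<psi> z))"]
      by simp
  qed
qed

end

section \<open>Direct limits\<close>

definition direct_system :: "(nat \<Rightarrow> 'a set) \<Rightarrow> (nat \<Rightarrow> nat \<Rightarrow> 'a \<Rightarrow> 'a) \<Rightarrow> bool" where
  "direct_system A \<iota> \<longleftrightarrow> (\<forall>r t a. r \<le> t \<longrightarrow> a \<in> A r \<longrightarrow> \<iota> r t a \<in> A t) \<and> (\<forall>r. \<forall>a\<in>A r. \<iota> r r a = a) \<and>
     (\<forall>r t u. r \<le> t \<longrightarrow> t \<le> u \<longrightarrow> (\<forall>a\<in>A r. \<iota> t u (\<iota> r t a) = \<iota> r u a))"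

context
  fixes A :: "nat \<Rightarrow> 'a set" and \<iota>
  assumes sys: "direct_system A \<iota>"
begin

lemma dl_maps: "r \<le> t \<Longrightarrow> a \<in> A r \<Longrightarrow> \<iota> r t a \<in> A t" "a \<in> A r \<Longrightarrow> \<iota> r r a = a"
  "r \<le> t \<Longrightarrow> t \<le> u \<Longrightarrow> a \<in> A r \<Longrightarrow> \<iota> t u (\<iota> r t a) = \<iota> r u a"
  using sys by (auto simp: direct_system_def)

lemma dl_class_self: "a \<in> A r \<Longrightarrow> (r, a) \<in> dl_class A \<iota> r a"
  by (auto simp: dl_class_def)

lemma dl_class_mem: "(s, b) \<in> dl_class A \<iota> r a \<longleftrightarrow> b \<in> A s \<and> (\<exists>t. r \<le> t \<and> s \<le> t \<and> \<iota> r t a = \<iota> s t b)"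
  by (simp add: dl_class_def)

text \<open>
  Two representatives that agree at one stage are identified; the classes are compared at a
  stage beyond all stages involved.
\<close>

lemma dl_class_eqI:
  assumes a: "a \<in> A r" and b: "b \<in> A s" and t: "r \<le> t" "s \<le> t" "\<iota> r t a = \<iota> s t b"
  shows "dl_class A \<iota> r a = dl_class A \<iota> s b"
proof -
  have "dl_class A \<iota> r a \<subseteq> dl_class A \<iota> s b"
    if a: "a \<in> A r" and b: "b \<in> A s" and t: "r \<le> t" "s \<le> t" "\<iota> r t a = \<iota> s t b" for r s a b
  proof (clarsimp simp: dl_class_mem)
    fix q c u assume c: "c \<in> A q" "r \<le> u" "q \<le> u" "\<iota> r u a = \<iota> q u c"
    let ?m = "max t u"
    have "\<iota> s ?m b = \<iota> t ?m (\<iota> s t b)" using dl_maps(3)[of s t ?m b] b t by simp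
    also have "\<dots> = \<iota> r ?m a" using dl_maps(3)[of r t ?m a] a t(1) unfolding t(3)[symmetric] by simp
    also have "\<dots> = \<iota> u ?m (\<iota> r u a)" using dl_maps(3)[of r u ?m a] a c by simp
    also have "\<dots> = \<iota> q ?m c" using dl_maps(3)[of q u ?m c] c by simp
    finally show "\<exists>t\<ge>s. q \<le> t \<and> \<iota> s t b = \<iota> q t c" using t c by (intro exI[of _ ?m]) auto
  qed
  from this[OF a b t] this[OF b a t(2,1) t(3)[symmetric]] show ?thesis by (rule subset_antisym)
qed

lemma dl_class_up: "a \<in> A r \<Longrightarrow> r \<le> t \<Longrightarrow> dl_class A \<iota> t (\<iota> r t a) = dl_class A \<iota> r a"
  using dl_class_eqI[of "\<iota> r t a" t a r t] dl_maps(1)[of r t a] dl_maps(2)[of "\<iota> r t a" t] by simp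

lemma dl_carrier_cases:
  assumes "P \<in> dl_carrier A \<iota>" obtains r a where "a \<in> A r" "P = dl_class A \<iota> r a"
  using assms by (auto simp: dl_carrier_def)

lemma dl_carrierI: "a \<in> A r \<Longrightarrow> dl_class A \<iota> r a \<in> dl_carrier A \<iota>"
  by (auto simp: dl_carrier_def)

lemma dl_carrier_above:
  assumes "P \<in> dl_carrier A \<iota>"
  shows "\<exists>r. \<forall>t\<ge>r. \<exists>a. a \<in> A t \<and> P = dl_class A \<iota> t a"
proof -
  obtain r a where a: "a \<in> A r" "P = dl_class A \<iota> r a" using assms by (rule dl_carrier_cases)
  then show ?thesis using dl_class_up[OF a(1)] dl_maps(1)[OF _ a(1)] by metis
qed

end

lemma dl_common:
  assumes A: "direct_system A \<iota>" and C: "direct_system C \<kappa>"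
    and P: "P \<in> dl_carrier A \<iota>" and Q: "Q \<in> dl_carrier C \<kappa>"
  obtains t a b where "a \<in> A t" "P = dl_class A \<iota> t a" "b \<in> C t" "Q = dl_class C \<kappa> t b"
proof -
  obtain r s where "\<forall>t\<ge>r. \<exists>a. a \<in> A t \<and> P = dl_class A \<iota> t a" "\<forall>t\<ge>s. \<exists>b. b \<in> C t \<and> Q = dl_class C \<kappa> t b"
    using dl_carrier_above[OF A P] dl_carrier_above[OF C Q] by blast
  then show thesis using that by (metis max.cobounded1 max.cobounded2)
qed

text \<open>
  \<open>dl_op\<close> is a union over all pairs of representatives. By compatibility with the transition
  maps all of them give the same class.
\<close>

lemma dl_op_class:
  assumes A: "direct_system A \<iota>" and C: "direct_system C \<kappa>"
    and f: "\<And>t a b. a \<in> A t \<Longrightarrow> b \<in> C t \<Longrightarrow> f t a b \<in> C t"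
    and compat: "\<And>r t a b. r \<le> t \<Longrightarrow> a \<in> A r \<Longrightarrow> b \<in> C r \<Longrightarrow> \<kappa> r t (f r a b) = f t (\<iota> r t a) (\<kappa> r t b)"
    and a: "a \<in> A t" and b: "b \<in> C t"
  shows "dl_op \<iota> C \<kappa> f (dl_class A \<iota> t a) (dl_class C \<kappa> t b) = dl_class C \<kappa> t (f t a b)"
proof -
  have *: "dl_class C \<kappa> (max r s) (f (max r s) (\<iota> r (max r s) a') (\<kappa> s (max r s) b')) = dl_class C \<kappa> t (f t a b)"
    if a': "(r, a') \<in> dl_class A \<iota> t a" and b': "(s, b') \<in> dl_class C \<kappa> t b" for r a' s b'
  proof -
    let ?m = "max r s"
    obtain u where u: "t \<le> u" "r \<le> u" "\<iota> t u a = \<iota> r u a'" and aA: "a' \<in> A r" using a' unfolding dl_class_mem[OF A] by blast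
    obtain v where v: "t \<le> v" "s \<le> v" "\<kappa> t v b = \<kappa> s v b'" and bC: "b' \<in> C s" using b' unfolding dl_class_mem[OF C] by blast
    let ?n = "max u v"
    have i: "\<iota> r ?m a' \<in> A ?m" "\<kappa> s ?m b' \<in> C ?m" using dl_maps(1)[OF A] dl_maps(1)[OF C] aA bC by auto
    have le: "r \<le> ?m" "s \<le> ?m" "?m \<le> ?n" using u v by auto
    have "\<kappa> ?m ?n (f ?m (\<iota> r ?m a') (\<kappa> s ?m b')) = f ?n (\<iota> r ?n a') (\<kappa> s ?n b')"
      using compat[OF le(3) i] dl_maps(3)[OF A le(1,3) aA] dl_maps(3)[OF C le(2,3) bC] by simp
    also have "\<iota> r ?n a' = \<iota> t ?n a"
      using dl_maps(3)[OF A, of r u ?n a'] dl_maps(3)[OF A, of t u ?n a] u a aA by simp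
    also have "\<kappa> s ?n b' = \<kappa> t ?n b"
      using dl_maps(3)[OF C, of s v ?n b'] dl_maps(3)[OF C, of t v ?n b] v b bC by simp
    also have "f ?n (\<iota> t ?n a) (\<kappa> t ?n b) = \<kappa> t ?n (f t a b)" using compat[OF _ a b, of ?n] u by simp
    finally show ?thesis
      by (intro dl_class_eqI[OF C f[OF i] f[OF a b], of ?n]) (use u v in auto)
  qed
  have "dl_op \<iota> C \<kappa> f (dl_class A \<iota> t a) (dl_class C \<kappa> t b) =
      (\<Union>(r, a')\<in>dl_class A \<iota> t a. \<Union>(s, b')\<in>dl_class C \<kappa> t b. dl_class C \<kappa> t (f t a b))"
    unfolding dl_op_def Let_def using * by (intro SUP_cong refl) (auto intro!: SUP_cong)
  also have "\<dots> = dl_class C \<kappa> t (f t a b)"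
    using dl_class_self[OF A a] dl_class_self[OF C b] by auto
  finally show ?thesis .
qed

section \<open>Modules of derivations and dual modules\<close>

lemma derivation_moduleD:
  assumes "D \<in> carrier (derivation_module R c)"
  shows "D \<in> extensional (carrier R)" "\<And>f. f \<in> carrier R \<Longrightarrow> D f \<in> carrier R"
    "\<And>f g. f \<in> carrier R \<Longrightarrow> g \<in> carrier R \<Longrightarrow> D (f \<oplus>\<^bsub>R\<^esub> g) = D f \<oplus>\<^bsub>R\<^esub> D g"
    "\<And>f g. f \<in> carrier R \<Longrightarrow> g \<in> carrier R \<Longrightarrow> D (f \<otimes>\<^bsub>R\<^esub> g) = (D f \<otimes>\<^bsub>R\<^esub> g) \<oplus>\<^bsub>R\<^esub> (f \<otimes>\<^bsub>R\<^esub> D g)"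
    "\<And>a f. f \<in> carrier R \<Longrightarrow> D (c a \<otimes>\<^bsub>R\<^esub> f) = c a \<otimes>\<^bsub>R\<^esub> D f"
  using assms by (auto simp: derivation_module_def PiE_iff)

lemma derivation_moduleI:
  assumes "D \<in> extensional (carrier R)" "\<And>f. f \<in> carrier R \<Longrightarrow> D f \<in> carrier R"
    "\<And>f g. f \<in> carrier R \<Longrightarrow> g \<in> carrier R \<Longrightarrow> D (f \<oplus>\<^bsub>R\<^esub> g) = D f \<oplus>\<^bsub>R\<^esub> D g"
    "\<And>f g. f \<in> carrier R \<Longrightarrow> g \<in> carrier R \<Longrightarrow> D (f \<otimes>\<^bsub>R\<^esub> g) = (D f \<otimes>\<^bsub>R\<^esub> g) \<oplus>\<^bsub>R\<^esub> (f \<otimes>\<^bsub>R\<^esub> D g)"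
    "\<And>a f. f \<in> carrier R \<Longrightarrow> D (c a \<otimes>\<^bsub>R\<^esub> f) = c a \<otimes>\<^bsub>R\<^esub> D f"
  shows "D \<in> carrier (derivation_module R c)"
  using assms by (auto simp: derivation_module_def PiE_def)

lemma dual_moduleD:
  assumes "\<phi> \<in> carrier (dual_module R M)"
  shows "\<phi> \<in> extensional (carrier M)" "\<And>u. u \<in> carrier M \<Longrightarrow> \<phi> u \<in> carrier R"
    "\<And>u v. u \<in> carrier M \<Longrightarrow> v \<in> carrier M \<Longrightarrow> \<phi> (u \<oplus>\<^bsub>M\<^esub> v) = \<phi> u \<oplus>\<^bsub>R\<^esub> \<phi> v"
    "\<And>h u. h \<in> carrier R \<Longrightarrow> u \<in> carrier M \<Longrightarrow> \<phi> (h \<odot>\<^bsub>M\<^esub> u) = h \<otimes>\<^bsub>R\<^esub> \<phi> u"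
  using assms by (auto simp: dual_module_def PiE_iff)

lemma dual_moduleI:
  assumes "\<phi> \<in> extensional (carrier M)" "\<And>u. u \<in> carrier M \<Longrightarrow> \<phi> u \<in> carrier R"
    "\<And>u v. u \<in> carrier M \<Longrightarrow> v \<in> carrier M \<Longrightarrow> \<phi> (u \<oplus>\<^bsub>M\<^esub> v) = \<phi> u \<oplus>\<^bsub>R\<^esub> \<phi> v"
    "\<And>h u. h \<in> carrier R \<Longrightarrow> u \<in> carrier M \<Longrightarrow> \<phi> (h \<odot>\<^bsub>M\<^esub> u) = h \<otimes>\<^bsub>R\<^esub> \<phi> u"
  shows "\<phi> \<in> carrier (dual_module R M)"
  using assms by (auto simp: dual_module_def PiE_def)

text \<open>
  Modules of functions with values in the ring and pointwise operations: the module laws are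
  inherited, so only closure remains to be checked for derivations and for linear forms.
\<close>

lemma function_module:
  fixes R (structure)
  assumes R: "cring R" and C: "carrier N \<subseteq> X \<rightarrow>\<^sub>E carrier R"
    and ops: "zero N = (\<lambda>x\<in>X. \<zero>\<^bsub>R\<^esub>)" "add N = (\<lambda>D E. \<lambda>x\<in>X. D x \<oplus>\<^bsub>R\<^esub> E x)" "smult N = (\<lambda>h D. \<lambda>x\<in>X. h \<otimes>\<^bsub>R\<^esub> D x)"
    and closed: "zero N \<in> carrier N" "\<And>D E. D \<in> carrier N \<Longrightarrow> E \<in> carrier N \<Longrightarrow> add N D E \<in> carrier N"
      "\<And>h D. h \<in> carrier R \<Longrightarrow> D \<in> carrier N \<Longrightarrow> smult N h D \<in> carrier N"
  shows "Module.module R N"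
proof -
  interpret cring R by (rule R)
  have v: "D x \<in> carrier R" if "D \<in> carrier N" "x \<in> X" for D x using C that by auto
  have e: "(\<lambda>x\<in>X. D x) = D" if "D \<in> carrier N" for D using C that by (auto simp: PiE_iff extensional_restrict)
  have ext: "D = E" if "D \<in> extensional X" "E \<in> extensional X" "\<And>x. x \<in> X \<Longrightarrow> D x = E x" for D E
    using that by (rule extensionalityI)
  have CE: "D \<in> extensional X" if "D \<in> carrier N" for D using C that by (auto simp: PiE_iff)
  have m: "(\<ominus> \<one>) \<in> carrier R" by simp
  have ab: "abelian_group N"
  proof (rule abelian_groupI)
    show "\<exists>y\<in>carrier N. y \<oplus>\<^bsub>N\<^esub> x = \<zero>\<^bsub>N\<^esub>" if x: "x \<in> carrier N" for x
    proof (rule bexI[OF _ closed(3)[OF m x]])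
      show "((\<ominus> \<one>) \<odot>\<^bsub>N\<^esub> x) \<oplus>\<^bsub>N\<^esub> x = \<zero>\<^bsub>N\<^esub>" unfolding ops
        by (rule restrict_ext) (use v[OF x] in \<open>simp add: l_minus l_neg\<close>)
    qed
  qed (use closed in \<open>auto simp: ops v a_ac e intro!: ext CE\<close>)
  show ?thesis
    by (rule moduleI[OF R ab]) (use closed in \<open>auto simp: ops v l_distr r_distr m_assoc e intro!: ext CE\<close>)
qed

text \<open>A multiple \<open>h D\<close> satisfies the Leibniz rule because the ring is commutative.\<close>

lemma derivation_module_module:
  fixes R (structure)
  assumes R: "cring R" and c: "\<And>a. c a \<in> carrier R"
  shows "Module.module R (derivation_module R c)"
proof -
  interpret cring R by (rule R)
  let ?N = "derivation_module R c"
  have sel: "zero ?N = (\<lambda>f\<in>carrier R. \<zero>\<^bsub>R\<^esub>)" "add ?N = (\<lambda>D E. \<lambda>f\<in>carrier R. D f \<oplus>\<^bsub>R\<^esub> E f)"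
    "smult ?N = (\<lambda>h D. \<lambda>f\<in>carrier R. h \<otimes>\<^bsub>R\<^esub> D f)"
    by (simp_all add: derivation_module_def)
  note d = derivation_moduleD[where R=R and c=c]
  show ?thesis
  proof (rule function_module[OF R _ sel])
    show "carrier ?N \<subseteq> carrier R \<rightarrow>\<^sub>E carrier R" by (auto simp: derivation_module_def)
    show "zero ?N \<in> carrier ?N" unfolding sel by (rule derivation_moduleI) (auto simp: c)
    show "add ?N D E \<in> carrier ?N" if D: "D \<in> carrier ?N" and E: "E \<in> carrier ?N" for D E
      unfolding sel
    proof (rule derivation_moduleI)
      fix f g a assume f: "f \<in> carrier R" and g: "g \<in> carrier R"
      note cl = f g d(2)[OF D f] d(2)[OF D g] d(2)[OF E f] d(2)[OF E g] c[of a]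
      show "(\<lambda>f\<in>carrier R. D f \<oplus> E f) (f \<oplus> g) = (\<lambda>f\<in>carrier R. D f \<oplus> E f) f \<oplus> (\<lambda>f\<in>carrier R. D f \<oplus> E f) g"
        using cl by (simp add: d(3)[OF D] d(3)[OF E] a_ac)
      show "(\<lambda>f\<in>carrier R. D f \<oplus> E f) (f \<otimes> g) =
          (\<lambda>f\<in>carrier R. D f \<oplus> E f) f \<otimes> g \<oplus> f \<otimes> (\<lambda>f\<in>carrier R. D f \<oplus> E f) g"
        using cl by (simp add: d(4)[OF D] d(4)[OF E] a_ac l_distr r_distr)
    next
      fix f a assume f: "f \<in> carrier R"
      note cl = f d(2)[OF D f] d(2)[OF E f] c[of a]
      show "(\<lambda>f\<in>carrier R. D f \<oplus> E f) f \<in> carrier R" using cl by simp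
      show "(\<lambda>f\<in>carrier R. D f \<oplus> E f) (c a \<otimes> f) = c a \<otimes> (\<lambda>f\<in>carrier R. D f \<oplus> E f) f"
        using cl by (simp add: d(5)[OF D] d(5)[OF E] r_distr)
    qed simp
    show "smult ?N h D \<in> carrier ?N" if h: "h \<in> carrier R" and D: "D \<in> carrier ?N" for h D
      unfolding sel
    proof (rule derivation_moduleI)
      fix f g a assume f: "f \<in> carrier R" and g: "g \<in> carrier R"
      note cl = h f g d(2)[OF D f] d(2)[OF D g] c[of a]
      show "(\<lambda>f\<in>carrier R. h \<otimes> D f) (f \<oplus> g) = (\<lambda>f\<in>carrier R. h \<otimes> D f) f \<oplus> (\<lambda>f\<in>carrier R. h \<otimes> D f) g"
        using cl by (simp add: d(3)[OF D] r_distr)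
      show "(\<lambda>f\<in>carrier R. h \<otimes> D f) (f \<otimes> g) = (\<lambda>f\<in>carrier R. h \<otimes> D f) f \<otimes> g \<oplus> f \<otimes> (\<lambda>f\<in>carrier R. h \<otimes> D f) g"
        using cl by (simp add: d(4)[OF D] r_distr m_ac)
    next
      fix f a assume f: "f \<in> carrier R"
      note cl = h f d(2)[OF D f] c[of a]
      show "(\<lambda>f\<in>carrier R. h \<otimes> D f) f \<in> carrier R" using cl by simp
      show "(\<lambda>f\<in>carrier R. h \<otimes> D f) (c a \<otimes> f) = c a \<otimes> (\<lambda>f\<in>carrier R. h \<otimes> D f) f"
      proof -
        have "(\<lambda>f\<in>carrier R. h \<otimes> D f) (c a \<otimes> f) = h \<otimes> (c a \<otimes> D f)" using cl d(5)[OF D f] by simp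
        also have "\<dots> = c a \<otimes> (h \<otimes> D f)" using cl by (simp add: m_lcomm)
        finally show ?thesis using f by simp
      qed
    qed simp
  qed
qed

lemma dual_module_module:
  fixes R (structure)
  assumes R: "cring R" and add: "\<And>u v. u \<in> carrier M \<Longrightarrow> v \<in> carrier M \<Longrightarrow> u \<oplus>\<^bsub>M\<^esub> v \<in> carrier M"
    and smult: "\<And>h u. h \<in> carrier R \<Longrightarrow> u \<in> carrier M \<Longrightarrow> h \<odot>\<^bsub>M\<^esub> u \<in> carrier M"
  shows "Module.module R (dual_module R M)"
proof -
  interpret cring R by (rule R)
  let ?N = "dual_module R M"
  have sel: "zero ?N = (\<lambda>f\<in>carrier M. \<zero>\<^bsub>R\<^esub>)" "Ring.ring.add ?N = (\<lambda>D E. \<lambda>f\<in>carrier M. D f \<oplus>\<^bsub>R\<^esub> E f)"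
    "Module.module.smult ?N = (\<lambda>h D. \<lambda>f\<in>carrier M. h \<otimes>\<^bsub>R\<^esub> D f)"
    by (simp_all add: dual_module_def)
  note d = dual_moduleD[where R=R and M=M]
  show ?thesis
  proof (rule function_module[OF R _ sel])
    show "carrier ?N \<subseteq> carrier M \<rightarrow>\<^sub>E carrier R" by (auto simp: dual_module_def)
    show "zero ?N \<in> carrier ?N" unfolding sel by (rule dual_moduleI) (auto simp: add smult)
    show "Ring.ring.add ?N D E \<in> carrier ?N" if D: "D \<in> carrier ?N" and E: "E \<in> carrier ?N" for D E
      unfolding sel
    proof (rule dual_moduleI)
      fix f g assume f: "f \<in> carrier M" and g: "g \<in> carrier M"
      note cl = f g d(2)[OF D f] d(2)[OF D g] d(2)[OF E f] d(2)[OF E g] add[OF f g]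
      show "(\<lambda>f\<in>carrier M. D f \<oplus> E f) (f \<oplus>\<^bsub>M\<^esub> g) = (\<lambda>f\<in>carrier M. D f \<oplus> E f) f \<oplus> (\<lambda>f\<in>carrier M. D f \<oplus> E f) g"
        using cl by (simp add: d(3)[OF D] d(3)[OF E] a_ac)
    next
      fix h f assume h: "h \<in> carrier R" and f: "f \<in> carrier M"
      note cl = f d(2)[OF D f] d(2)[OF E f] h smult[OF h f]
      show "(\<lambda>f\<in>carrier M. D f \<oplus> E f) (h \<odot>\<^bsub>M\<^esub> f) = h \<otimes> (\<lambda>f\<in>carrier M. D f \<oplus> E f) f"
        using cl by (simp add: d(4)[OF D] d(4)[OF E] r_distr)
    next
      fix f assume f: "f \<in> carrier M"
      then show "(\<lambda>f\<in>carrier M. D f \<oplus> E f) f \<in> carrier R" using d(2)[OF D f] d(2)[OF E f] by simp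
    qed simp
    show "Module.module.smult ?N h D \<in> carrier ?N" if h: "h \<in> carrier R" and D: "D \<in> carrier ?N" for h D
      unfolding sel
    proof (rule dual_moduleI)
      fix f g assume f: "f \<in> carrier M" and g: "g \<in> carrier M"
      note cl = h f g d(2)[OF D f] d(2)[OF D g] add[OF f g]
      show "(\<lambda>f\<in>carrier M. h \<otimes> D f) (f \<oplus>\<^bsub>M\<^esub> g) = (\<lambda>f\<in>carrier M. h \<otimes> D f) f \<oplus> (\<lambda>f\<in>carrier M. h \<otimes> D f) g"
        using cl by (simp add: d(3)[OF D] r_distr)
    next
      fix h' f assume h': "h' \<in> carrier R" and f: "f \<in> carrier M"
      note cl = h f d(2)[OF D f] h' smult[OF h' f]
      show "(\<lambda>f\<in>carrier M. h \<otimes> D f) (h' \<odot>\<^bsub>M\<^esub> f) = h' \<otimes> (\<lambda>f\<in>carrier M. h \<otimes> D f) f"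
        using cl by (simp add: d(4)[OF D] m_ac)
    next
      fix f assume f: "f \<in> carrier M"
      then show "(\<lambda>f\<in>carrier M. h \<otimes> D f) f \<in> carrier R" using h d(2)[OF D f] by simp
    qed simp
  qed
qed

section \<open>Functions and forms of finite jet order\<close>

text \<open>
  The differential of a function. With tangent vectors as derivations it is evaluation at the
  function.
\<close>

definition d_form :: "('a, 'i) manifold \<Rightarrow> ('a \<Rightarrow> real) \<Rightarrow> 'a \<Rightarrow> (('a \<Rightarrow> real) \<Rightarrow> real) \<Rightarrow> real" where
  "d_form M f = (\<lambda>p\<in>points M. \<lambda>v\<in>tangent_space M p. v f)"

lemma d_form_one_form:
  assumes M: "smooth_manifold M" and f: "f \<in> smooth_functions M"
  shows "d_form M f \<in> one_forms M"
proof -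
  have "sum_form M {()} (\<lambda>_. \<lambda>p\<in>points M. 1) (\<lambda>_. f) = d_form M f"
    unfolding sum_form_def[OF M] d_form_def by (intro restrict_ext) simp
  then show ?thesis using sum_form_one_form[OF M, of "{()}" "\<lambda>_. \<lambda>p\<in>points M. 1" "\<lambda>_. f"] sf_const[OF M] f by simp
qed

context
  fixes B :: "('x, 'i, 'y, 'j, 'v, 'k) fbundle"
  assumes B: "smooth_fiber_bundle B"
begin

lemmas JM = jet_manifold_smooth[OF B]

lemma jet_proj_points: "r \<le> t \<Longrightarrow> j \<in> points (jet_manifold B t) \<Longrightarrow> jet_proj B t r j \<in> points (jet_manifold B r)"
  using jet_proj_continuous[OF B, of r t] by (auto simp: continuous_map_def)

lemma jet_proj_comp: "r \<le> t \<Longrightarrow> t \<le> u \<Longrightarrow> j \<in> points (jet_manifold B u) \<Longrightarrow> jet_proj B t r (jet_proj B u t j) = jet_proj B u r j"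
proof -
  assume rt: "r \<le> t" "t \<le> u" and j: "j \<in> points (jet_manifold B u)"
  obtain \<sigma> where s: "\<sigma> \<in> jet_germs B" "j = jet_at B u \<sigma>" using j by (rule jet_points_cases[OF B])
  show ?thesis unfolding s(2) using rt by (simp add: jet_proj_at[OF B s(1)])
qed

lemma jet_proj_id: "j \<in> points (jet_manifold B r) \<Longrightarrow> jet_proj B r r j = j"
proof -
  assume j: "j \<in> points (jet_manifold B r)"
  obtain \<sigma> where s: "\<sigma> \<in> jet_germs B" "j = jet_at B r \<sigma>" using j by (rule jet_points_cases[OF B])
  show ?thesis unfolding s(2) by (simp add: jet_proj_at[OF B s(1)])
qed

lemma fun_pull_at: "\<sigma> \<in> jet_germs B \<Longrightarrow> r \<le> t \<Longrightarrow> fun_pull B r t f (jet_at B t \<sigma>) = f (jet_at B r \<sigma>)"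
  using jet_at_points[OF B] jet_proj_at[OF B] by (simp add: fun_pull_def pullback_fun_def)

text \<open>Every point of a jet manifold is the jet of a germ.\<close>

lemma jet_fun_ext:
  assumes "f \<in> jet_funs B r" "g \<in> jet_funs B r" "\<And>\<sigma>. \<sigma> \<in> jet_germs B \<Longrightarrow> f (jet_at B r \<sigma>) = g (jet_at B r \<sigma>)"
  shows "f = g"
proof (rule extensionalityI[of _ "points (jet_manifold B r)"])
  show "f \<in> extensional (points (jet_manifold B r))" "g \<in> extensional (points (jet_manifold B r))"
    using assms(1,2) by (auto simp: smooth_functions_def)
  fix j assume "j \<in> points (jet_manifold B r)"
  then obtain \<sigma> where "\<sigma> \<in> jet_germs B" "j = jet_at B r \<sigma>" by (rule jet_points_cases[OF B])
  then show "f j = g j" using assms(3) by simp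
qed

lemma fun_system: "direct_system (jet_funs B) (fun_pull B)"
  unfolding direct_system_def
proof (intro conjI allI impI ballI)
  fix r t u :: nat and f
  show 1: "fun_pull B r t f \<in> jet_funs B t" if "r \<le> t" "f \<in> jet_funs B r" for r t f
    by (rule jet_proj_pullback[OF B that])
  show "fun_pull B r r f = f" if "f \<in> jet_funs B r"
    by (rule jet_fun_ext[OF 1[OF order.refl that] that]) (simp add: fun_pull_at)
  show "fun_pull B t u (fun_pull B r t f) = fun_pull B r u f" if "r \<le> t" "t \<le> u" "f \<in> jet_funs B r"
    by (rule jet_fun_ext[of _ u]) (use that 1 in \<open>auto simp: fun_pull_at\<close>)
qed

lemma jet_push_tangent:
  assumes "r \<le> t" "j \<in> points (jet_manifold B t)" "v \<in> tangent_space (jet_manifold B t) j"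
  shows "pushforward (jet_manifold B t) (jet_manifold B r) (jet_proj B t r) v \<in> tangent_space (jet_manifold B r) (jet_proj B t r j)"
  using pushforward_tangent[OF JM JM jet_proj_continuous[OF B assms(1)] _ assms(2,3)] jet_proj_pullback[OF B assms(1)]
  by (simp add: fun_pull_def)

lemma form_pull_forms:
  assumes "r \<le> t" "\<omega> \<in> jet_forms B r" shows "form_pull B r t \<omega> \<in> jet_forms B t"
  using pullback_one_form[OF JM JM jet_proj_continuous[OF B assms(1)] _ assms(2)] jet_proj_pullback[OF B assms(1)]
  by (simp add: fun_pull_def form_pull_def)

lemma form_pull_app:
  "j \<in> points (jet_manifold B t) \<Longrightarrow> v \<in> tangent_space (jet_manifold B t) j \<Longrightarrow>
   form_pull B r t \<omega> j v = \<omega> (jet_proj B t r j) (pushforward (jet_manifold B t) (jet_manifold B r) (jet_proj B t r) v)"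
  by (simp add: form_pull_def pullback_form_def)

lemma pushforward_comp:
  assumes "r \<le> t" "t \<le> u"
  shows "pushforward (jet_manifold B t) (jet_manifold B r) (jet_proj B t r)
     (pushforward (jet_manifold B u) (jet_manifold B t) (jet_proj B u t) v) =
     pushforward (jet_manifold B u) (jet_manifold B r) (jet_proj B u r) v"
  unfolding pushforward_def
proof (rule restrict_ext)
  fix g assume g: "g \<in> jet_funs B r"
  have "pullback_fun (jet_manifold B t) (jet_proj B t r) g \<in> jet_funs B t"
    using dl_maps(1)[OF fun_system assms(1) g] by (simp add: fun_pull_def)
  moreover have "pullback_fun (jet_manifold B u) (jet_proj B u t) (pullback_fun (jet_manifold B t) (jet_proj B t r) g) =
      pullback_fun (jet_manifold B u) (jet_proj B u r) g"
    using dl_maps(3)[OF fun_system assms g] by (simp add: fun_pull_def)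
  ultimately show "(\<lambda>g\<in>jet_funs B t. v (pullback_fun (jet_manifold B u) (jet_proj B u t) g)) (pullback_fun (jet_manifold B t) (jet_proj B t r) g) =
      v (pullback_fun (jet_manifold B u) (jet_proj B u r) g)" by simp
qed

lemma pushforward_id:
  assumes "j \<in> points (jet_manifold B r)" "v \<in> tangent_space (jet_manifold B r) j"
  shows "pushforward (jet_manifold B r) (jet_manifold B r) (jet_proj B r r) v = v"
proof (rule extensionalityI[of _ "jet_funs B r"])
  show "v \<in> extensional (jet_funs B r)" using assms(2) by (simp add: tangent_space_def)
  show "pushforward (jet_manifold B r) (jet_manifold B r) (jet_proj B r r) v f = v f" if "f \<in> jet_funs B r" for f
    using that dl_maps(2)[OF fun_system that] by (simp add: pushforward_def fun_pull_def)
qed (simp add: pushforward_def)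

lemma form_system: "direct_system (jet_forms B) (form_pull B)"
  unfolding direct_system_def
proof (intro conjI allI impI ballI)
  fix r t u :: nat and \<omega>
  show 1: "form_pull B r t \<omega> \<in> jet_forms B t" if "r \<le> t" "\<omega> \<in> jet_forms B r" for r t \<omega>
    by (rule form_pull_forms[OF that])
  show "form_pull B r r \<omega> = \<omega>" if "\<omega> \<in> jet_forms B r"
    by (rule one_form_ext[OF JM 1[OF order.refl that] that]) (simp add: form_pull_app pushforward_id jet_proj_id)
  show "form_pull B t u (form_pull B r t \<omega>) = form_pull B r u \<omega>" if a: "r \<le> t" "t \<le> u" "\<omega> \<in> jet_forms B r"
  proof (rule one_form_ext[OF JM])
    show "form_pull B t u (form_pull B r t \<omega>) \<in> jet_forms B u" "form_pull B r u \<omega> \<in> jet_forms B u" using a 1 by auto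
    fix j v assume j: "j \<in> points (jet_manifold B u)" and v: "v \<in> tangent_space (jet_manifold B u) j"
    show "form_pull B t u (form_pull B r t \<omega>) j v = form_pull B r u \<omega> j v"
      using form_pull_app[OF jet_proj_points[OF a(2) j] jet_push_tangent[OF a(2) j v]] a
      by (simp add: form_pull_app[OF j v] pushforward_comp jet_proj_comp j)
  qed
qed

end

abbreviation fcl where "fcl B \<equiv> dl_class (jet_funs B) (fun_pull B)"
abbreviation ocl where "ocl B \<equiv> dl_class (jet_forms B) (form_pull B)"

definition form_add :: "('a, 'i) manifold \<Rightarrow> _ \<Rightarrow> _ \<Rightarrow> 'a \<Rightarrow> (('a \<Rightarrow> real) \<Rightarrow> real) \<Rightarrow> real" where
  "form_add M \<omega> \<sigma> = (\<lambda>p\<in>points M. \<lambda>v\<in>tangent_space M p. \<omega> p v + \<sigma> p v)"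

definition form_smult :: "('a, 'i) manifold \<Rightarrow> ('a \<Rightarrow> real) \<Rightarrow> _ \<Rightarrow> 'a \<Rightarrow> (('a \<Rightarrow> real) \<Rightarrow> real) \<Rightarrow> real" where
  "form_smult M f \<omega> = (\<lambda>p\<in>points M. \<lambda>v\<in>tangent_space M p. f p * \<omega> p v)"

text \<open>
  The value of a function of finite jet order at a germ. The representative in the direct limit
  is arbitrary, by \<open>germ_value_class\<close>.
\<close>

definition germ_value :: "('x, 'i, 'y, 'j, 'v, 'k) fbundle \<Rightarrow> (nat \<times> ('x, 'y) jet_fun) set \<Rightarrow> 'x \<times> ('x \<Rightarrow> 'y) \<Rightarrow> real" where
  "germ_value B P \<sigma> = (let z = (SOME z. z \<in> P) in snd z (jet_at B (fst z) \<sigma>))"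

text \<open>The tangent vector of the jet manifold of order \<open>r\<close> at the jet of \<open>\<sigma>\<close> that \<open>D\<close> induces.\<close>

definition der_vec ::
  "('x, 'i, 'y, 'j, 'v, 'k) fbundle \<Rightarrow> ((nat \<times> ('x, 'y) jet_fun) set \<Rightarrow> (nat \<times> ('x, 'y) jet_fun) set) \<Rightarrow> nat \<Rightarrow>
    'x \<times> ('x \<Rightarrow> 'y) \<Rightarrow> ('x, 'y) jet_fun \<Rightarrow> real" where
  "der_vec B D r \<sigma> = (\<lambda>f\<in>jet_funs B r. germ_value B (D (fcl B r f)) \<sigma>)"

text \<open>The value at \<open>\<sigma>\<close> of the contraction of the form \<open>u\<close> with \<open>D\<close>.\<close>

definition form_value where
  "form_value B D u \<sigma> = (let z = (SOME z. z \<in> u) in snd z (jet_at B (fst z) \<sigma>) (der_vec B D (fst z) \<sigma>))"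

context
  fixes B :: "('x, 'i, 'y, 'j, 'v, 'k) fbundle"
  assumes B: "smooth_fiber_bundle B"
begin

lemmas FS = fun_system[OF B] and OS = form_system[OF B] and JM' = jet_manifold_smooth[OF B]

subsection \<open>The ring of functions\<close>

lemma O0_sel: "carrier (O0 B) = dl_carrier (jet_funs B) (fun_pull B)"
  "f \<in> jet_funs B t \<Longrightarrow> g \<in> jet_funs B t \<Longrightarrow> fcl B t f \<oplus>\<^bsub>O0 B\<^esub> fcl B t g = fcl B t (\<lambda>p\<in>points (jet_manifold B t). f p + g p)"
  "f \<in> jet_funs B t \<Longrightarrow> g \<in> jet_funs B t \<Longrightarrow> fcl B t f \<otimes>\<^bsub>O0 B\<^esub> fcl B t g = fcl B t (\<lambda>p\<in>points (jet_manifold B t). f p * g p)"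
  "\<one>\<^bsub>O0 B\<^esub> = O0_const B 1" "\<zero>\<^bsub>O0 B\<^esub> = O0_const B 0"
proof -
  have pull: "fun_pull B r t (\<lambda>p\<in>points (jet_manifold B r). h (a p) (b p)) =
      (\<lambda>p\<in>points (jet_manifold B t). h (fun_pull B r t a p) (fun_pull B r t b p))" if "r \<le> t" for h :: "real \<Rightarrow> real \<Rightarrow> real" and r t a b
    unfolding fun_pull_def pullback_fun_def by (rule restrict_ext) (simp add: jet_proj_points[OF B that])
  show "fcl B t f \<oplus>\<^bsub>O0 B\<^esub> fcl B t g = fcl B t (\<lambda>p\<in>points (jet_manifold B t). f p + g p)"
    if "f \<in> jet_funs B t" "g \<in> jet_funs B t"
    unfolding O0_def ring.select_convs
    by (rule dl_op_class[OF FS FS sf_add[OF JM'] pull that])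
  show "fcl B t f \<otimes>\<^bsub>O0 B\<^esub> fcl B t g = fcl B t (\<lambda>p\<in>points (jet_manifold B t). f p * g p)"
    if "f \<in> jet_funs B t" "g \<in> jet_funs B t"
    unfolding O0_def monoid.select_convs
    by (rule dl_op_class[OF FS FS sf_mult[OF JM'] pull that])
qed (simp_all add: O0_def)

lemma O0_const_class: "O0_const B c = fcl B t (\<lambda>p\<in>points (jet_manifold B t). c)"
proof -
  have "fun_pull B 0 t (\<lambda>p\<in>points (jet_manifold B 0). c) = (\<lambda>p\<in>points (jet_manifold B t). c)"
    unfolding fun_pull_def pullback_fun_def by (rule restrict_ext) (simp add: jet_proj_points[OF B])
  then show ?thesis unfolding O0_const_def using dl_class_up[OF FS sf_const[OF JM'], of 0 t c] by simp
qed

lemma fcl_carrier: "f \<in> jet_funs B r \<Longrightarrow> fcl B r f \<in> carrier (O0 B)"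
  unfolding O0_sel by (rule dl_carrierI[OF FS])

lemma O0_const_carrier: "O0_const B c \<in> carrier (O0 B)"
  unfolding O0_const_class[where c=c and t=0] by (rule fcl_carrier[OF sf_const[OF JM']])

lemma O0_cases:
  assumes "P \<in> carrier (O0 B)" obtains r f where "f \<in> jet_funs B r" "P = fcl B r f"
  using assms unfolding O0_sel by (rule dl_carrier_cases[OF FS])

lemma O0_common:
  assumes "P \<in> carrier (O0 B)" "Q \<in> carrier (O0 B)"
  obtains t f g where "f \<in> jet_funs B t" "P = fcl B t f" "g \<in> jet_funs B t" "Q = fcl B t g"
  using assms unfolding O0_sel by (rule dl_common[OF FS FS])

text \<open>
  Two representatives agree after pull-back to a common order, and pull-back does not change the
  value at a germ.
\<close>

lemma germ_value_class:
  assumes f: "f \<in> jet_funs B r" and s: "\<sigma> \<in> jet_germs B"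
  shows "germ_value B (fcl B r f) \<sigma> = f (jet_at B r \<sigma>)"
proof -
  define z where "z = (SOME z. z \<in> fcl B r f)"
  have "z \<in> fcl B r f" unfolding z_def by (rule someI[of "\<lambda>z. z \<in> fcl B r f", OF dl_class_self[OF FS f]])
  then have "(fst z, snd z) \<in> fcl B r f" by simp
  then obtain t where t: "r \<le> t" "fst z \<le> t" "fun_pull B r t f = fun_pull B (fst z) t (snd z)"
    unfolding dl_class_mem[OF FS] by blast
  have "snd z (jet_at B (fst z) \<sigma>) = f (jet_at B r \<sigma>)"
    using fun_cong[OF t(3), of "jet_at B t \<sigma>"] fun_pull_at[OF B s t(1)] fun_pull_at[OF B s t(2)] by simp
  then show ?thesis by (simp add: germ_value_def z_def[symmetric] Let_def)
qed

text \<open>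
  Two classes have representatives of the same order, and these are functions on the set of jets
  of germs.
\<close>

lemma O0_eqI:
  assumes P: "P \<in> carrier (O0 B)" and Q: "Q \<in> carrier (O0 B)"
    and eq: "\<And>\<sigma>. \<sigma> \<in> jet_germs B \<Longrightarrow> germ_value B P \<sigma> = germ_value B Q \<sigma>"
  shows "P = Q"
proof -
  obtain t f g where c: "f \<in> jet_funs B t" "P = fcl B t f" "g \<in> jet_funs B t" "Q = fcl B t g"
    using P Q by (rule O0_common)
  have "f = g" by (rule jet_fun_ext[OF B c(1,3)]) (use eq germ_value_class c in auto)
  then show ?thesis using c by simp
qed

lemma germ_value_ops:
  assumes P: "P \<in> carrier (O0 B)" and Q: "Q \<in> carrier (O0 B)"
  shows "P \<oplus>\<^bsub>O0 B\<^esub> Q \<in> carrier (O0 B)" "P \<otimes>\<^bsub>O0 B\<^esub> Q \<in> carrier (O0 B)"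
    "\<sigma> \<in> jet_germs B \<Longrightarrow> germ_value B (P \<oplus>\<^bsub>O0 B\<^esub> Q) \<sigma> = germ_value B P \<sigma> + germ_value B Q \<sigma>"
    "\<sigma> \<in> jet_germs B \<Longrightarrow> germ_value B (P \<otimes>\<^bsub>O0 B\<^esub> Q) \<sigma> = germ_value B P \<sigma> * germ_value B Q \<sigma>"
proof -
  obtain t f g where c: "f \<in> jet_funs B t" "P = fcl B t f" "g \<in> jet_funs B t" "Q = fcl B t g"
    using P Q by (rule O0_common)
  note a = sf_add[OF JM' c(1,3)] and m = sf_mult[OF JM' c(1,3)]
  show "P \<oplus>\<^bsub>O0 B\<^esub> Q \<in> carrier (O0 B)" "P \<otimes>\<^bsub>O0 B\<^esub> Q \<in> carrier (O0 B)"
    unfolding c(2,4) O0_sel(2,3)[OF c(1,3)] by (rule fcl_carrier[OF a], rule fcl_carrier[OF m])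
  assume s: "\<sigma> \<in> jet_germs B"
  note p = jet_at_points[OF B s, of t]
  show "germ_value B (P \<oplus>\<^bsub>O0 B\<^esub> Q) \<sigma> = germ_value B P \<sigma> + germ_value B Q \<sigma>"
    "germ_value B (P \<otimes>\<^bsub>O0 B\<^esub> Q) \<sigma> = germ_value B P \<sigma> * germ_value B Q \<sigma>"
    unfolding c(2,4) O0_sel(2,3)[OF c(1,3)] germ_value_class[OF c(1) s] germ_value_class[OF c(3) s]
      germ_value_class[OF a s] germ_value_class[OF m s] using p by simp_all
qed

lemma germ_value_const: "\<sigma> \<in> jet_germs B \<Longrightarrow> germ_value B (O0_const B c) \<sigma> = c"
  unfolding O0_const_class[where c=c and t=0]
  by (subst germ_value_class[OF sf_const[OF JM']]) (simp_all add: jet_at_points[OF B])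

text \<open>By \<open>O0_eqI\<close> the ring laws reduce to those of the real numbers.\<close>

lemma O0_cring: "cring (O0 B)"
proof -
  note cl = germ_value_ops(1,2) O0_const_carrier
  note ev = germ_value_ops(3,4) germ_value_const
  have "abelian_group (O0 B)"
  proof (rule abelian_groupI)
    show "\<exists>Q\<in>carrier (O0 B). Q \<oplus>\<^bsub>O0 B\<^esub> P = \<zero>\<^bsub>O0 B\<^esub>" if P: "P \<in> carrier (O0 B)" for P
    proof (rule bexI[of _ "O0_const B (-1) \<otimes>\<^bsub>O0 B\<^esub> P"])
      show "(O0_const B (-1) \<otimes>\<^bsub>O0 B\<^esub> P) \<oplus>\<^bsub>O0 B\<^esub> P = \<zero>\<^bsub>O0 B\<^esub>"
        by (rule O0_eqI) (use P in \<open>auto simp: cl ev O0_sel(4,5)\<close>)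
    qed (use P cl in auto)
    show "P \<oplus>\<^bsub>O0 B\<^esub> Q \<oplus>\<^bsub>O0 B\<^esub> S = P \<oplus>\<^bsub>O0 B\<^esub> (Q \<oplus>\<^bsub>O0 B\<^esub> S)" if "P \<in> carrier (O0 B)" "Q \<in> carrier (O0 B)" "S \<in> carrier (O0 B)" for P Q S
      by (rule O0_eqI) (use that in \<open>auto simp: cl ev\<close>)
    show "P \<oplus>\<^bsub>O0 B\<^esub> Q = Q \<oplus>\<^bsub>O0 B\<^esub> P" if "P \<in> carrier (O0 B)" "Q \<in> carrier (O0 B)" for P Q
      by (rule O0_eqI) (use that in \<open>auto simp: cl ev\<close>)
    show "\<zero>\<^bsub>O0 B\<^esub> \<oplus>\<^bsub>O0 B\<^esub> P = P" if "P \<in> carrier (O0 B)" for P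
      by (rule O0_eqI) (use that in \<open>auto simp: cl ev O0_sel(4,5)\<close>)
  qed (auto simp: cl O0_sel(4,5))
  moreover have "comm_monoid (O0 B)"
  proof (rule comm_monoidI)
    show "P \<otimes>\<^bsub>O0 B\<^esub> Q \<otimes>\<^bsub>O0 B\<^esub> S = P \<otimes>\<^bsub>O0 B\<^esub> (Q \<otimes>\<^bsub>O0 B\<^esub> S)" if "P \<in> carrier (O0 B)" "Q \<in> carrier (O0 B)" "S \<in> carrier (O0 B)" for P Q S
      by (rule O0_eqI) (use that in \<open>auto simp: cl ev\<close>)
    show "P \<otimes>\<^bsub>O0 B\<^esub> Q = Q \<otimes>\<^bsub>O0 B\<^esub> P" if "P \<in> carrier (O0 B)" "Q \<in> carrier (O0 B)" for P Q
      by (rule O0_eqI) (use that in \<open>auto simp: cl ev\<close>)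
    show "\<one>\<^bsub>O0 B\<^esub> \<otimes>\<^bsub>O0 B\<^esub> P = P" if "P \<in> carrier (O0 B)" for P
      by (rule O0_eqI) (use that in \<open>auto simp: cl ev O0_sel(4,5)\<close>)
  qed (auto simp: cl O0_sel(4,5))
  moreover have "(P \<oplus>\<^bsub>O0 B\<^esub> Q) \<otimes>\<^bsub>O0 B\<^esub> S = P \<otimes>\<^bsub>O0 B\<^esub> S \<oplus>\<^bsub>O0 B\<^esub> Q \<otimes>\<^bsub>O0 B\<^esub> S"
    if "P \<in> carrier (O0 B)" "Q \<in> carrier (O0 B)" "S \<in> carrier (O0 B)" for P Q S
    by (rule O0_eqI) (use that in \<open>auto simp: cl ev algebra_simps\<close>)
  ultimately show ?thesis by (rule cringI)
qed

subsection \<open>The module of one-forms\<close>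

lemma form_add_form: "\<omega> \<in> jet_forms B r \<Longrightarrow> \<theta> \<in> jet_forms B r \<Longrightarrow> form_add (jet_manifold B r) \<omega> \<theta> \<in> jet_forms B r"
  unfolding form_add_def by (rule one_form_add[OF JM'])

lemma form_smult_form: "f \<in> jet_funs B r \<Longrightarrow> \<omega> \<in> jet_forms B r \<Longrightarrow> form_smult (jet_manifold B r) f \<omega> \<in> jet_forms B r"
  unfolding form_smult_def by (rule one_form_smult[OF JM'])

lemma O1_sel: "carrier (O1 B) = dl_carrier (jet_forms B) (form_pull B)"
  "\<omega> \<in> jet_forms B t \<Longrightarrow> \<theta> \<in> jet_forms B t \<Longrightarrow> ocl B t \<omega> \<oplus>\<^bsub>O1 B\<^esub> ocl B t \<theta> = ocl B t (form_add (jet_manifold B t) \<omega> \<theta>)"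
  "f \<in> jet_funs B t \<Longrightarrow> \<omega> \<in> jet_forms B t \<Longrightarrow> fcl B t f \<odot>\<^bsub>O1 B\<^esub> ocl B t \<omega> = ocl B t (form_smult (jet_manifold B t) f \<omega>)"
proof -
  show "carrier (O1 B) = dl_carrier (jet_forms B) (form_pull B)" by (simp add: O1_def)
  have e: "add (O1 B) = dl_op (form_pull B) (jet_forms B) (form_pull B) (\<lambda>t. form_add (jet_manifold B t))"
    "smult (O1 B) = dl_op (fun_pull B) (jet_forms B) (form_pull B) (\<lambda>t. form_smult (jet_manifold B t))"
    by (simp_all add: O1_def form_add_def[abs_def] form_smult_def[abs_def])
  have pa: "form_pull B r t (form_add (jet_manifold B r) a b) = form_add (jet_manifold B t) (form_pull B r t a) (form_pull B r t b)"
    if rt: "r \<le> t" and ab: "a \<in> jet_forms B r" "b \<in> jet_forms B r" for r t a b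
    by (rule one_form_ext[OF JM' form_pull_forms[OF B rt form_add_form[OF ab]] form_add_form[OF form_pull_forms[OF B rt ab(1)] form_pull_forms[OF B rt ab(2)]]])
       (simp add: form_pull_app[OF B] form_add_def jet_proj_points[OF B rt] jet_push_tangent[OF B rt])
  have ps: "form_pull B r t (form_smult (jet_manifold B r) a b) = form_smult (jet_manifold B t) (fun_pull B r t a) (form_pull B r t b)"
    if rt: "r \<le> t" and ab: "a \<in> jet_funs B r" "b \<in> jet_forms B r" for r t a b
    by (rule one_form_ext[OF JM' form_pull_forms[OF B rt form_smult_form[OF ab]] form_smult_form[OF jet_proj_pullback[OF B rt ab(1)] form_pull_forms[OF B rt ab(2)]]])
       (simp add: form_pull_app[OF B] form_smult_def jet_proj_points[OF B rt] jet_push_tangent[OF B rt] fun_pull_def pullback_fun_def)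
  show "ocl B t \<omega> \<oplus>\<^bsub>O1 B\<^esub> ocl B t \<theta> = ocl B t (form_add (jet_manifold B t) \<omega> \<theta>)" if "\<omega> \<in> jet_forms B t" "\<theta> \<in> jet_forms B t"
    unfolding e by (rule dl_op_class[where f="\<lambda>t. form_add (jet_manifold B t)", OF OS OS _ _ that]) (assumption | rule form_add_form pa)+
  show "fcl B t f \<odot>\<^bsub>O1 B\<^esub> ocl B t \<omega> = ocl B t (form_smult (jet_manifold B t) f \<omega>)" if "f \<in> jet_funs B t" "\<omega> \<in> jet_forms B t"
    unfolding e by (rule dl_op_class[where f="\<lambda>t. form_smult (jet_manifold B t)", OF FS OS _ _ that]) (assumption | rule form_smult_form ps)+
qed

lemma ocl_carrier: "\<omega> \<in> jet_forms B r \<Longrightarrow> ocl B r \<omega> \<in> carrier (O1 B)"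
  unfolding O1_sel by (rule dl_carrierI[OF OS])

lemma O1_cases:
  assumes "u \<in> carrier (O1 B)" obtains r \<omega> where "\<omega> \<in> jet_forms B r" "u = ocl B r \<omega>"
  using assms unfolding O1_sel by (rule dl_carrier_cases[OF OS])

lemma O1_common:
  assumes "u \<in> carrier (O1 B)" "v \<in> carrier (O1 B)"
  obtains t \<omega> \<theta> where "\<omega> \<in> jet_forms B t" "u = ocl B t \<omega>" "\<theta> \<in> jet_forms B t" "v = ocl B t \<theta>"
  using assms unfolding O1_sel by (rule dl_common[OF OS OS])

lemma O01_common:
  assumes "P \<in> carrier (O0 B)" "u \<in> carrier (O1 B)"
  obtains t f \<omega> where "f \<in> jet_funs B t" "P = fcl B t f" "\<omega> \<in> jet_forms B t" "u = ocl B t \<omega>"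
  using assms unfolding O0_sel O1_sel by (rule dl_common[OF FS OS])

lemma O1_closed:
  "u \<in> carrier (O1 B) \<Longrightarrow> v \<in> carrier (O1 B) \<Longrightarrow> u \<oplus>\<^bsub>O1 B\<^esub> v \<in> carrier (O1 B)"
  "P \<in> carrier (O0 B) \<Longrightarrow> u \<in> carrier (O1 B) \<Longrightarrow> P \<odot>\<^bsub>O1 B\<^esub> u \<in> carrier (O1 B)"
proof -
  show "u \<oplus>\<^bsub>O1 B\<^esub> v \<in> carrier (O1 B)" if uv: "u \<in> carrier (O1 B)" "v \<in> carrier (O1 B)"
  proof -
    obtain t \<omega> \<theta> where c: "\<omega> \<in> jet_forms B t" "u = ocl B t \<omega>" "\<theta> \<in> jet_forms B t" "v = ocl B t \<theta>" using uv by (rule O1_common)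
    show ?thesis unfolding c(2,4) O1_sel(2)[OF c(1,3)] by (rule ocl_carrier[OF form_add_form[OF c(1,3)]])
  qed
  show "P \<odot>\<^bsub>O1 B\<^esub> u \<in> carrier (O1 B)" if Pu: "P \<in> carrier (O0 B)" "u \<in> carrier (O1 B)"
  proof -
    obtain t f \<omega> where c: "f \<in> jet_funs B t" "P = fcl B t f" "\<omega> \<in> jet_forms B t" "u = ocl B t \<omega>" using Pu by (rule O01_common)
    show ?thesis unfolding c(2,4) O1_sel(3)[OF c(1,3)] by (rule ocl_carrier[OF form_smult_form[OF c(1,3)]])
  qed
qed

subsection \<open>The tangent vectors of a derivation\<close>

context
  fixes D assumes D: "D \<in> carrier (derivation_module (O0 B) (O0_const B))"
begin

lemmas derD = derivation_moduleD[OF D]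

lemma der_vec_app: "f \<in> jet_funs B r \<Longrightarrow> der_vec B D r \<sigma> f = germ_value B (D (fcl B r f)) \<sigma>"
  by (simp add: der_vec_def)

lemma der_vec_tangent:
  assumes s: "\<sigma> \<in> jet_germs B"
  shows "der_vec B D r \<sigma> \<in> tangent_space (jet_manifold B r) (jet_at B r \<sigma>)"
  unfolding tangent_space_def mem_Collect_eq
proof (intro conjI ballI allI)
  let ?M = "jet_manifold B r"
  show "der_vec B D r \<sigma> \<in> extensional (jet_funs B r)" by (simp add: der_vec_def)
  fix f g assume f: "f \<in> jet_funs B r" and g: "g \<in> jet_funs B r"
  note cf = fcl_carrier[OF f] and cg = fcl_carrier[OF g]
  show "der_vec B D r \<sigma> (\<lambda>q\<in>points ?M. f q + g q) = der_vec B D r \<sigma> f + der_vec B D r \<sigma> g"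
    unfolding der_vec_app[OF f] der_vec_app[OF g] der_vec_app[OF sf_add[OF JM' f g]] O0_sel(2)[OF f g, symmetric]
    using derD(3)[OF cf cg] germ_value_ops(3)[OF derD(2)[OF cf] derD(2)[OF cg] s] by simp
  show "der_vec B D r \<sigma> (\<lambda>q\<in>points ?M. f q * g q) = f (jet_at B r \<sigma>) * der_vec B D r \<sigma> g + g (jet_at B r \<sigma>) * der_vec B D r \<sigma> f"
    unfolding der_vec_app[OF f] der_vec_app[OF g] der_vec_app[OF sf_mult[OF JM' f g]] O0_sel(3)[OF f g, symmetric]
    using derD(4)[OF cf cg] germ_value_ops(3)[OF germ_value_ops(2)[OF derD(2)[OF cf] cg] germ_value_ops(2)[OF cf derD(2)[OF cg]] s]
      germ_value_ops(4)[OF derD(2)[OF cf] cg s] germ_value_ops(4)[OF cf derD(2)[OF cg] s] germ_value_class[OF f s] germ_value_class[OF g s]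
    by simp
next
  let ?M = "jet_manifold B r"
  fix c f assume f: "f \<in> jet_funs B r"
  note cf = fcl_carrier[OF f]
  have "(\<lambda>q\<in>points ?M. c * f q) = (\<lambda>q\<in>points ?M. (\<lambda>q\<in>points ?M. c) q * f q)" by (rule restrict_ext) simp
  then have e: "fcl B r (\<lambda>q\<in>points ?M. c * f q) = O0_const B c \<otimes>\<^bsub>O0 B\<^esub> fcl B r f"
    unfolding O0_const_class[where c=c and t=r] O0_sel(3)[OF sf_const[OF JM'] f] by simp
  show "der_vec B D r \<sigma> (\<lambda>q\<in>points ?M. c * f q) = c * der_vec B D r \<sigma> f"
    unfolding der_vec_app[OF f] der_vec_app[OF sf_scale[OF JM' f]] e
    using derD(5)[OF cf, of c] germ_value_ops(4)[OF O0_const_carrier derD(2)[OF cf] s] germ_value_const[OF s] by simp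
qed

text \<open>
  A function and its pull-back are the same element of the direct limit. Hence the values of a
  form and of its pull-back coincide, which makes \<open>form_value\<close> independent of the
  representative.
\<close>

lemma der_vec_push:
  assumes "r \<le> t"
  shows "pushforward (jet_manifold B t) (jet_manifold B r) (jet_proj B t r) (der_vec B D t \<sigma>) = der_vec B D r \<sigma>"
  unfolding pushforward_def der_vec_def[of B D r]
proof (rule restrict_ext)
  fix f assume f: "f \<in> jet_funs B r"
  show "der_vec B D t \<sigma> (pullback_fun (jet_manifold B t) (jet_proj B t r) f) = germ_value B (D (fcl B r f)) \<sigma>"
    using der_vec_app[OF dl_maps(1)[OF FS assms f]] dl_class_up[OF FS f assms] by (simp add: fun_pull_def)
qed

lemma form_value_class:
  assumes \<omega>: "\<omega> \<in> jet_forms B r" and s: "\<sigma> \<in> jet_germs B"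
  shows "form_value B D (ocl B r \<omega>) \<sigma> = \<omega> (jet_at B r \<sigma>) (der_vec B D r \<sigma>)"
proof -
  have pull: "form_pull B r t \<omega> (jet_at B t \<sigma>) (der_vec B D t \<sigma>) = \<omega> (jet_at B r \<sigma>) (der_vec B D r \<sigma>)" if "r \<le> t" for r t \<omega>
    using form_pull_app[OF B jet_at_points[OF B s] der_vec_tangent[OF s]] jet_proj_at[OF B s that] der_vec_push[OF that] by simp
  define z where "z = (SOME z. z \<in> ocl B r \<omega>)"
  have "z \<in> ocl B r \<omega>" unfolding z_def by (rule someI[of "\<lambda>z. z \<in> ocl B r \<omega>", OF dl_class_self[OF OS \<omega>]])
  then have "(fst z, snd z) \<in> ocl B r \<omega>" by simp
  then obtain t where t: "r \<le> t" "fst z \<le> t" "form_pull B r t \<omega> = form_pull B (fst z) t (snd z)"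
    unfolding dl_class_mem[OF OS] by blast
  have "snd z (jet_at B (fst z) \<sigma>) (der_vec B D (fst z) \<sigma>) = \<omega> (jet_at B r \<sigma>) (der_vec B D r \<sigma>)"
    using pull[OF t(1), of \<omega>] pull[OF t(2), of "snd z"] t(3) by simp
  then show ?thesis by (simp add: form_value_def z_def[symmetric] Let_def)
qed

text \<open>Near \<open>p\<close>, the function \<open>D f\<close> is a smooth function of the jets of order \<open>r + n\<close>.\<close>

definition has_order :: "nat \<Rightarrow> nat \<Rightarrow> ('x, 'y) jet \<Rightarrow> ('x, 'y) jet_fun \<Rightarrow> bool" where
  "has_order r n p f \<longleftrightarrow> (\<exists>W h. openin (mtop (jet_manifold B r)) W \<and> p \<in> W \<and> h \<in> jet_funs B (r + n) \<and>
     (\<forall>\<sigma>\<in>jet_germs B. jet_at B r \<sigma> \<in> W \<longrightarrow> der_vec B D r \<sigma> f = h (jet_at B (r + n) \<sigma>)))"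

lemma has_order_mono:
  assumes "m \<le> n" "has_order r m p f" shows "has_order r n p f"
proof -
  obtain W h where W: "openin (mtop (jet_manifold B r)) W" "p \<in> W" and h: "h \<in> jet_funs B (r + m)"
    and eq: "\<And>\<sigma>. \<sigma> \<in> jet_germs B \<Longrightarrow> jet_at B r \<sigma> \<in> W \<Longrightarrow> der_vec B D r \<sigma> f = h (jet_at B (r + m) \<sigma>)"
    using assms(2) unfolding has_order_def by blast
  have le: "r + m \<le> r + n" using assms(1) by simp
  show ?thesis unfolding has_order_def
  proof (intro exI conjI ballI impI)
    show "fun_pull B (r + m) (r + n) h \<in> jet_funs B (r + n)" by (rule dl_maps(1)[OF FS le h])
    show "der_vec B D r \<sigma> f = fun_pull B (r + m) (r + n) h (jet_at B (r + n) \<sigma>)" if "\<sigma> \<in> jet_germs B" "jet_at B r \<sigma> \<in> W" for \<sigma>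
      using eq[OF that] fun_pull_at[OF B that(1) le] by simp
  qed (rule W)+
qed

text \<open>\<open>D f\<close> is an element of the direct limit, so it is represented at some order.\<close>

lemma has_order_function:
  assumes f: "f \<in> jet_funs B r" shows "\<exists>n. \<forall>p\<in>points (jet_manifold B r). has_order r n p f"
proof -
  obtain s h where h: "h \<in> jet_funs B s" "D (fcl B r f) = fcl B s h" using derD(2)[OF fcl_carrier[OF f]] by (rule O0_cases)
  have le: "s \<le> r + s" by simp
  have "has_order r s p f" if p: "p \<in> points (jet_manifold B r)" for p
    unfolding has_order_def
  proof (intro exI conjI ballI impI)
    show "openin (mtop (jet_manifold B r)) (points (jet_manifold B r))" by simp
    show "fun_pull B s (r + s) h \<in> jet_funs B (r + s)" by (rule dl_maps(1)[OF FS le h(1)])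
    show "der_vec B D r \<sigma> f = fun_pull B s (r + s) h (jet_at B (r + s) \<sigma>)" if "\<sigma> \<in> jet_germs B" for \<sigma>
      using fun_pull_at[OF B that le] der_vec_app[OF f] germ_value_class[OF h(1) that] h(2) by simp
  qed (rule p)
  then show ?thesis by blast
qed

lemma combination_smooth:
  assumes rt: "r \<le> t" and a: "\<And>i. i \<in> S \<Longrightarrow> a i \<in> jet_funs B r" and h: "\<And>i. i \<in> S \<Longrightarrow> h i \<in> jet_funs B t"
  defines "g \<equiv> (\<lambda>q\<in>points (jet_manifold B t). \<Sum>i\<in>S. (\<lambda>q\<in>points (jet_manifold B t). fun_pull B r t (a i) q * h i q) q)"
  shows "g \<in> jet_funs B t"
    and "\<sigma> \<in> jet_germs B \<Longrightarrow> g (jet_at B t \<sigma>) = (\<Sum>i\<in>S. a i (jet_at B r \<sigma>) * h i (jet_at B t \<sigma>))"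
proof -
  show "g \<in> jet_funs B t" unfolding g_def
    by (rule sf_sum[OF JM'], rule sf_mult[OF JM' dl_maps(1)[OF FS rt a] h])
  show "g (jet_at B t \<sigma>) = (\<Sum>i\<in>S. a i (jet_at B r \<sigma>) * h i (jet_at B t \<sigma>))" if s: "\<sigma> \<in> jet_germs B"
    unfolding g_def using jet_at_points[OF B s, of t] by (simp add: fun_pull_at[OF B s rt])
qed

text \<open>
  Near \<open>p\<close> the differential of any \<open>f\<close> is a combination of the \<open>dx\<^sub>i\<close> of \<open>coframe\<close>, so \<open>D f\<close> is
  a combination of the finitely many \<open>D x\<^sub>i\<close>.
\<close>

lemma has_order_local:
  assumes p: "p \<in> points (jet_manifold B r)"
  shows "\<exists>n W. openin (mtop (jet_manifold B r)) W \<and> p \<in> W \<and> (\<forall>q\<in>W. \<forall>f\<in>jet_funs B r. has_order r n q f)"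
proof -
  let ?M = "jet_manifold B r"
  obtain N x where N: "openin (mtop ?M) N" "p \<in> N" "\<And>i. i \<in> midx ?M \<Longrightarrow> x i \<in> jet_funs B r"
    "\<And>\<omega>. \<omega> \<in> jet_forms B r \<Longrightarrow> \<exists>a. (\<forall>i\<in>midx ?M. a i \<in> jet_funs B r) \<and>
      (\<forall>q\<in>N. \<forall>v\<in>tangent_space ?M q. \<omega> q v = (\<Sum>i\<in>midx ?M. a i q * v (x i)))"
    by (rule coframe[OF JM' p]) (rule that)
  have "\<forall>i\<in>midx ?M. \<exists>s h. h \<in> jet_funs B s \<and> D (fcl B r (x i)) = fcl B s h"
    using O0_cases[OF derD(2)[OF fcl_carrier[OF N(3)]]] by metis
  then obtain s h where h: "\<And>i. i \<in> midx ?M \<Longrightarrow> h i \<in> jet_funs B (s i)" "\<And>i. i \<in> midx ?M \<Longrightarrow> D (fcl B r (x i)) = fcl B (s i) (h i)"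
    by metis
  \<comment> \<open>The sum is a common bound for the orders of the \<open>D x\<^sub>i\<close>.\<close>
  define n where "n = (\<Sum>i\<in>midx ?M. s i)"
  have le: "s i \<le> r + n" if "i \<in> midx ?M" for i
    using member_le_sum[OF that, of s] midx_finite[OF JM', of r] unfolding n_def by (simp add: trans_le_add2)
  have vx: "der_vec B D r \<sigma> (x i) = fun_pull B (s i) (r + n) (h i) (jet_at B (r + n) \<sigma>)" if i: "i \<in> midx ?M" and s: "\<sigma> \<in> jet_germs B" for i \<sigma>
    using fun_pull_at[OF B s le[OF i]] der_vec_app[OF N(3)[OF i]] germ_value_class[OF h(1)[OF i] s] h(2)[OF i] by simp
  have "has_order r n q f" if q: "q \<in> N" and f: "f \<in> jet_funs B r" for q f
  proof -
    obtain a where a: "\<And>i. i \<in> midx ?M \<Longrightarrow> a i \<in> jet_funs B r"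
      "\<And>q v. q \<in> N \<Longrightarrow> v \<in> tangent_space ?M q \<Longrightarrow> d_form ?M f q v = (\<Sum>i\<in>midx ?M. a i q * v (x i))"
      using N(4)[OF d_form_one_form[OF JM' f]] by blast
    note c = combination_smooth[of r "r + n" "midx ?M" a "\<lambda>i. fun_pull B (s i) (r + n) (h i)", OF _ a(1) dl_maps(1)[OF FS le h(1)]]
    show ?thesis unfolding has_order_def
    proof (intro exI conjI ballI impI)
      show "(\<lambda>q\<in>points (jet_manifold B (r + n)). \<Sum>i\<in>midx ?M. (\<lambda>q\<in>points (jet_manifold B (r + n)).
          fun_pull B r (r + n) (a i) q * fun_pull B (s i) (r + n) (h i) q) q) \<in> jet_funs B (r + n)" by (rule c(1)) auto
      fix \<sigma> assume s: "\<sigma> \<in> jet_germs B" "jet_at B r \<sigma> \<in> N"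
      have "der_vec B D r \<sigma> f = d_form ?M f (jet_at B r \<sigma>) (der_vec B D r \<sigma>)"
        using jet_at_points[OF B s(1)] der_vec_tangent[OF s(1)] by (simp add: d_form_def)
      also have "\<dots> = (\<Sum>i\<in>midx ?M. a i (jet_at B r \<sigma>) * der_vec B D r \<sigma> (x i))"
        by (rule a(2)[OF s(2) der_vec_tangent[OF s(1)]])
      also have "\<dots> = (\<Sum>i\<in>midx ?M. a i (jet_at B r \<sigma>) * fun_pull B (s i) (r + n) (h i) (jet_at B (r + n) \<sigma>))"
        by (rule sum.cong[OF refl]) (simp add: vx[OF _ s(1)])
      also have "\<dots> = (\<lambda>q\<in>points (jet_manifold B (r + n)). \<Sum>i\<in>midx ?M. (\<lambda>q\<in>points (jet_manifold B (r + n)).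
          fun_pull B r (r + n) (a i) q * fun_pull B (s i) (r + n) (h i) q) q) (jet_at B (r + n) \<sigma>)" by (rule c(2)[symmetric]) (use s in auto)
      finally show "der_vec B D r \<sigma> f = (\<lambda>q\<in>points (jet_manifold B (r + n)). \<Sum>i\<in>midx ?M. (\<lambda>q\<in>points (jet_manifold B (r + n)).
          fun_pull B r (r + n) (a i) q * fun_pull B (s i) (r + n) (h i) q) q) (jet_at B (r + n) \<sigma>)" .
    qed (rule N q)+
  qed
  then show ?thesis using N(1,2) by blast
qed

text \<open>\<open>D f\<close> near \<open>p\<close> depends on the germ of \<open>f\<close> only, so \<open>locally_bounded_imp_bounded\<close> applies.\<close>

lemma has_order_uniform: "\<exists>n. \<forall>p\<in>points (jet_manifold B r). \<forall>f\<in>jet_funs B r. has_order r n p f"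
proof (rule locally_bounded_imp_bounded[OF JM'])
  fix n p f g N
  assume f: "f \<in> jet_funs B r" and g: "g \<in> jet_funs B r" and N: "openin (mtop (jet_manifold B r)) N" "p \<in> N"
    and eq: "\<And>q. q \<in> N \<Longrightarrow> f q = g q" and Q: "has_order r n p f"
  obtain W h where W: "openin (mtop (jet_manifold B r)) W" "p \<in> W" and h: "h \<in> jet_funs B (r + n)"
    and e: "\<And>\<sigma>. \<sigma> \<in> jet_germs B \<Longrightarrow> jet_at B r \<sigma> \<in> W \<Longrightarrow> der_vec B D r \<sigma> f = h (jet_at B (r + n) \<sigma>)"
    using Q unfolding has_order_def by blast
  show "has_order r n p g" unfolding has_order_def
  proof (intro exI conjI ballI impI)
    show "openin (mtop (jet_manifold B r)) (W \<inter> N)" "p \<in> W \<inter> N" using W N by auto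
    fix \<sigma> assume s: "\<sigma> \<in> jet_germs B" "jet_at B r \<sigma> \<in> W \<inter> N"
    then have w: "jet_at B r \<sigma> \<in> W" and n: "jet_at B r \<sigma> \<in> N" by auto
    have "der_vec B D r \<sigma> f = der_vec B D r \<sigma> g" by (rule tv_local[OF JM' der_vec_tangent[OF s(1)] f g N(1) n eq])
    then show "der_vec B D r \<sigma> g = h (jet_at B (r + n) \<sigma>)" using e[OF s(1) w] by simp
  qed (rule h)
qed (use has_order_mono has_order_local has_order_function in auto)

text \<open>
  With a bound \<open>n\<close> for all functions of order \<open>r\<close>, the contraction is near each point a
  combination of functions of order \<open>r + n\<close>; these local expressions are smooth functions on the
  same jet manifold and so fit together.
\<close>

lemma form_value_function:
  assumes u: "u \<in> carrier (O1 B)"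
  shows "\<exists>P\<in>carrier (O0 B). \<forall>\<sigma>\<in>jet_germs B. germ_value B P \<sigma> = form_value B D u \<sigma>"
proof -
  obtain r \<omega> where \<omega>: "\<omega> \<in> jet_forms B r" "u = ocl B r \<omega>" using u by (rule O1_cases)
  let ?M = "jet_manifold B r"
  obtain n where n: "\<And>p f. p \<in> points ?M \<Longrightarrow> f \<in> jet_funs B r \<Longrightarrow> has_order r n p f" using has_order_uniform by blast
  define t where "t = r + n"
  have rt: "r \<le> t" by (simp add: t_def)
  let ?J = "jet_manifold B t"
  define val where "val \<sigma> = \<omega> (jet_at B r \<sigma>) (der_vec B D r \<sigma>)" for \<sigma>
  have loc: "\<exists>V g. openin (mtop ?J) V \<and> jet_at B t \<sigma>0 \<in> V \<and> g \<in> jet_funs B t \<and>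
      (\<forall>\<sigma>\<in>jet_germs B. jet_at B t \<sigma> \<in> V \<longrightarrow> val \<sigma> = g (jet_at B t \<sigma>))" if s0: "\<sigma>0 \<in> jet_germs B" for \<sigma>0
  proof -
    note p = jet_at_points[OF B s0, of r]
    obtain N x where N: "openin (mtop ?M) N" "jet_at B r \<sigma>0 \<in> N" "\<And>i. i \<in> midx ?M \<Longrightarrow> x i \<in> jet_funs B r"
      "\<And>\<omega>. \<omega> \<in> jet_forms B r \<Longrightarrow> \<exists>a. (\<forall>i\<in>midx ?M. a i \<in> jet_funs B r) \<and>
        (\<forall>q\<in>N. \<forall>v\<in>tangent_space ?M q. \<omega> q v = (\<Sum>i\<in>midx ?M. a i q * v (x i)))"
      by (rule coframe[OF JM' p]) (rule that)
    obtain a where a: "\<And>i. i \<in> midx ?M \<Longrightarrow> a i \<in> jet_funs B r"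
      "\<And>q v. q \<in> N \<Longrightarrow> v \<in> tangent_space ?M q \<Longrightarrow> \<omega> q v = (\<Sum>i\<in>midx ?M. a i q * v (x i))"
      using N(4)[OF \<omega>(1)] by blast
    have "\<forall>i\<in>midx ?M. \<exists>W h. openin (mtop ?M) W \<and> jet_at B r \<sigma>0 \<in> W \<and> h \<in> jet_funs B t \<and>
       (\<forall>\<sigma>\<in>jet_germs B. jet_at B r \<sigma> \<in> W \<longrightarrow> der_vec B D r \<sigma> (x i) = h (jet_at B t \<sigma>))"
      using n[OF p N(3)] unfolding has_order_def t_def by blast
    then obtain W h where W: "\<And>i. i \<in> midx ?M \<Longrightarrow> openin (mtop ?M) (W i)" "\<And>i. i \<in> midx ?M \<Longrightarrow> jet_at B r \<sigma>0 \<in> W i"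
      and h: "\<And>i. i \<in> midx ?M \<Longrightarrow> h i \<in> jet_funs B t"
      and e: "\<And>i \<sigma>. i \<in> midx ?M \<Longrightarrow> \<sigma> \<in> jet_germs B \<Longrightarrow> jet_at B r \<sigma> \<in> W i \<Longrightarrow> der_vec B D r \<sigma> (x i) = h i (jet_at B t \<sigma>)"
      by metis
    define W' where "W' = \<Inter>(insert N (W ` midx ?M))"
    have W': "openin (mtop ?M) W'" unfolding W'_def
      by (rule openin_Inter) (use N(1) W(1) midx_finite[OF JM'] in auto)
    have p': "jet_at B r \<sigma>0 \<in> W'" using N(2) W(2) by (auto simp: W'_def)
    note c = combination_smooth[of r t "midx ?M" a h, OF rt a(1) h]
    show ?thesis
    proof (intro exI conjI ballI impI)
      show "openin (mtop ?J) {j \<in> points ?J. jet_proj B t r j \<in> W'}"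
        by (rule openin_continuous_map_preimage[OF jet_proj_continuous[OF B rt] W'])
      show "jet_at B t \<sigma>0 \<in> {j \<in> points ?J. jet_proj B t r j \<in> W'}"
        using jet_at_points[OF B s0] jet_proj_at[OF B s0 rt] p' by simp
      show "(\<lambda>q\<in>points ?J. \<Sum>i\<in>midx ?M. (\<lambda>q\<in>points ?J. fun_pull B r t (a i) q * h i q) q) \<in> jet_funs B t" by (rule c(1))
      fix \<sigma> assume s: "\<sigma> \<in> jet_germs B" "jet_at B t \<sigma> \<in> {j \<in> points ?J. jet_proj B t r j \<in> W'}"
      then have w: "jet_at B r \<sigma> \<in> W'" using jet_proj_at[OF B s(1) rt] by simp
      then have wN: "jet_at B r \<sigma> \<in> N" and wW: "\<And>i. i \<in> midx ?M \<Longrightarrow> jet_at B r \<sigma> \<in> W i" by (auto simp: W'_def)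
      have "val \<sigma> = (\<Sum>i\<in>midx ?M. a i (jet_at B r \<sigma>) * der_vec B D r \<sigma> (x i))"
        unfolding val_def by (rule a(2)[OF wN der_vec_tangent[OF s(1)]])
      also have "\<dots> = (\<Sum>i\<in>midx ?M. a i (jet_at B r \<sigma>) * h i (jet_at B t \<sigma>))"
        by (rule sum.cong[OF refl]) (simp add: e[OF _ s(1) wW])
      also have "\<dots> = (\<lambda>q\<in>points ?J. \<Sum>i\<in>midx ?M. (\<lambda>q\<in>points ?J. fun_pull B r t (a i) q * h i q) q) (jet_at B t \<sigma>)"
        by (rule c(2)[OF _ _ s(1), symmetric]) auto
      finally show "val \<sigma> = (\<lambda>q\<in>points ?J. \<Sum>i\<in>midx ?M. (\<lambda>q\<in>points ?J. fun_pull B r t (a i) q * h i q) q) (jet_at B t \<sigma>)" .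
    qed
  qed
  \<comment> \<open>The value does not depend on the germ that represents the jet of order \<open>t\<close>, because near
    each jet it is given by a function of that jet.\<close>
  define H where "H = (\<lambda>q\<in>points ?J. val (SOME \<sigma>. \<sigma> \<in> jet_germs B \<and> q = jet_at B t \<sigma>))"
  have some: "(SOME \<sigma>. \<sigma> \<in> jet_germs B \<and> q = jet_at B t \<sigma>) \<in> jet_germs B \<and> q = jet_at B t (SOME \<sigma>. \<sigma> \<in> jet_germs B \<and> q = jet_at B t \<sigma>)"
    if q: "q \<in> points ?J" for q
  proof (rule someI_ex)
    obtain \<sigma> where "\<sigma> \<in> jet_germs B" "q = jet_at B t \<sigma>" using q by (rule jet_points_cases[OF B])
    then show "\<exists>\<sigma>. \<sigma> \<in> jet_germs B \<and> q = jet_at B t \<sigma>" by blast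
  qed
  have HV: "H q = g q" if q: "q \<in> points ?J" "q \<in> V"
    and g: "\<forall>\<sigma>\<in>jet_germs B. jet_at B t \<sigma> \<in> V \<longrightarrow> val \<sigma> = g (jet_at B t \<sigma>)" for q V g
    using some[OF q(1)] q g by (simp add: H_def)
  have Hval: "H (jet_at B t \<sigma>) = val \<sigma>" if s: "\<sigma> \<in> jet_germs B" for \<sigma>
  proof -
    obtain V g where "jet_at B t \<sigma> \<in> V" and g: "\<forall>\<sigma>\<in>jet_germs B. jet_at B t \<sigma> \<in> V \<longrightarrow> val \<sigma> = g (jet_at B t \<sigma>)" using loc[OF s] by blast
    then show ?thesis using HV[OF jet_at_points[OF B s] _ g] s by simp
  qed
  have "smooth_fn ?J (points ?J) H"
  proof (rule smooth_fn_local[OF JM' subset_refl])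
    fix q assume q: "q \<in> points ?J"
    obtain \<sigma> where s: "\<sigma> \<in> jet_germs B" "q = jet_at B t \<sigma>" using q by (rule jet_points_cases[OF B])
    obtain V g where V: "openin (mtop ?J) V" "jet_at B t \<sigma> \<in> V" "g \<in> jet_funs B t"
      and g: "\<forall>\<sigma>\<in>jet_germs B. jet_at B t \<sigma> \<in> V \<longrightarrow> val \<sigma> = g (jet_at B t \<sigma>)" using loc[OF s(1)] by blast
    note VJ = openin_subset[OF V(1)]
    have Hg: "H p = g p" if "p \<in> V" for p using HV[OF subsetD[OF VJ that] that g] .
    have "smooth_fn ?J V H"
      using smooth_fn_cong[OF JM' V(1), of H g, OF Hg] smooth_functionsD[OF JM' V(3) VJ] by simp
    moreover have "points ?J \<inter> V = V" using VJ by blast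
    ultimately show "\<exists>V. openin (mtop ?J) V \<and> q \<in> V \<and> smooth_fn ?J (points ?J \<inter> V) H"
      using V(1,2) s(2) by (intro exI[of _ V]) simp
  qed
  then have H: "H \<in> jet_funs B t" unfolding smooth_functions_iff[OF JM'] by (simp add: H_def)
  show ?thesis
  proof (intro bexI ballI)
    show "fcl B t H \<in> carrier (O0 B)" by (rule fcl_carrier[OF H])
    show "germ_value B (fcl B t H) \<sigma> = form_value B D u \<sigma>" if "\<sigma> \<in> jet_germs B" for \<sigma>
      using germ_value_class[OF H that] Hval[OF that] form_value_class[OF \<omega>(1) that] \<omega>(2) by (simp add: val_def)
  qed
qed

end

end

section \<open>The isomorphism\<close>

text \<open>
  An element of the ring is determined by its values at germs, so the choice is unique; it
  exists by \<open>form_value_function\<close>.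
\<close>

definition contraction where
  "contraction B D = (\<lambda>u\<in>carrier (O1 B). SOME P. P \<in> carrier (O0 B) \<and> (\<forall>\<sigma>\<in>jet_germs B. germ_value B P \<sigma> = form_value B D u \<sigma>))"

definition exterior_d :: "('x, 'i, 'y, 'j, 'v, 'k) fbundle \<Rightarrow> (nat \<times> ('x, 'y) jet_fun) set \<Rightarrow> (nat \<times> ('x, 'y) jet_form) set" where
  "exterior_d B P = (let z = (SOME z. z \<in> P) in ocl B (fst z) (d_form (jet_manifold B (fst z)) (snd z)))"

context
  fixes B :: "('x, 'i, 'y, 'j, 'v, 'k) fbundle"
  assumes B: "smooth_fiber_bundle B"
begin

abbreviation (input) "Der \<equiv> derivation_module (O0 B) (O0_const B)"
abbreviation (input) "Dual \<equiv> dual_module (O0 B) (O1 B)"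

lemmas FS' = fun_system[OF B] and OS' = form_system[OF B] and MJ = jet_manifold_smooth[OF B]
lemmas gv = germ_value_ops[OF B]

subsection \<open>From derivations to linear forms\<close>

lemma contraction_value:
  assumes D: "D \<in> carrier Der" and u: "u \<in> carrier (O1 B)"
  shows "contraction B D u \<in> carrier (O0 B)"
    "\<sigma> \<in> jet_germs B \<Longrightarrow> germ_value B (contraction B D u) \<sigma> = form_value B D u \<sigma>"
proof -
  have "\<exists>P. P \<in> carrier (O0 B) \<and> (\<forall>\<sigma>\<in>jet_germs B. germ_value B P \<sigma> = form_value B D u \<sigma>)"
    using form_value_function[OF B D u] by blast
  from someI_ex[OF this]
  show "contraction B D u \<in> carrier (O0 B)" "\<sigma> \<in> jet_germs B \<Longrightarrow> germ_value B (contraction B D u) \<sigma> = form_value B D u \<sigma>"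
    using u by (simp_all add: contraction_def)
qed

lemma form_value_ops:
  assumes D: "D \<in> carrier Der" and s: "\<sigma> \<in> jet_germs B"
  shows "u \<in> carrier (O1 B) \<Longrightarrow> v \<in> carrier (O1 B) \<Longrightarrow> form_value B D (u \<oplus>\<^bsub>O1 B\<^esub> v) \<sigma> = form_value B D u \<sigma> + form_value B D v \<sigma>"
    "P \<in> carrier (O0 B) \<Longrightarrow> u \<in> carrier (O1 B) \<Longrightarrow> form_value B D (P \<odot>\<^bsub>O1 B\<^esub> u) \<sigma> = germ_value B P \<sigma> * form_value B D u \<sigma>"
proof -
  note t = der_vec_tangent[OF B D s] and p = jet_at_points[OF B s]
  show "form_value B D (u \<oplus>\<^bsub>O1 B\<^esub> v) \<sigma> = form_value B D u \<sigma> + form_value B D v \<sigma>" if uv: "u \<in> carrier (O1 B)" "v \<in> carrier (O1 B)"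
  proof -
    obtain r \<omega> \<theta> where c: "\<omega> \<in> jet_forms B r" "u = ocl B r \<omega>" "\<theta> \<in> jet_forms B r" "v = ocl B r \<theta>" using uv by (rule O1_common[OF B])
    show ?thesis
      unfolding c(2,4) O1_sel(2)[OF B c(1,3)] form_value_class[OF B D c(1) s] form_value_class[OF B D c(3) s]
        form_value_class[OF B D form_add_form[OF B c(1,3)] s] using t[of r] p[of r] by (simp add: form_add_def)
  qed
  show "form_value B D (P \<odot>\<^bsub>O1 B\<^esub> u) \<sigma> = germ_value B P \<sigma> * form_value B D u \<sigma>" if Pu: "P \<in> carrier (O0 B)" "u \<in> carrier (O1 B)"
  proof -
    obtain r f \<omega> where c: "f \<in> jet_funs B r" "P = fcl B r f" "\<omega> \<in> jet_forms B r" "u = ocl B r \<omega>" using Pu by (rule O01_common[OF B])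
    show ?thesis
      unfolding c(2,4) O1_sel(3)[OF B c(1,3)] form_value_class[OF B D c(3) s] germ_value_class[OF B c(1) s]
        form_value_class[OF B D form_smult_form[OF B c(1,3)] s] using t[of r] p[of r] by (simp add: form_smult_def)
  qed
qed

lemma contraction_dual:
  assumes D: "D \<in> carrier Der" shows "contraction B D \<in> carrier Dual"
proof (rule dual_moduleI)
  note cv = contraction_value[OF D]
  show "contraction B D \<in> extensional (carrier (O1 B))" by (simp add: contraction_def)
  show "contraction B D u \<in> carrier (O0 B)" if "u \<in> carrier (O1 B)" for u by (rule cv(1)[OF that])
  show "contraction B D (u \<oplus>\<^bsub>O1 B\<^esub> v) = contraction B D u \<oplus>\<^bsub>O0 B\<^esub> contraction B D v" if u: "u \<in> carrier (O1 B)" and v: "v \<in> carrier (O1 B)" for u v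
    by (rule O0_eqI[OF B cv(1)[OF O1_closed(1)[OF B u v]] gv(1)[OF cv(1)[OF u] cv(1)[OF v]]])
       (simp add: cv(2)[OF O1_closed(1)[OF B u v]] gv(3)[OF cv(1)[OF u] cv(1)[OF v]] cv(2)[OF u] cv(2)[OF v] form_value_ops(1)[OF D _ u v])
  show "contraction B D (P \<odot>\<^bsub>O1 B\<^esub> u) = P \<otimes>\<^bsub>O0 B\<^esub> contraction B D u" if P: "P \<in> carrier (O0 B)" and u: "u \<in> carrier (O1 B)" for P u
    by (rule O0_eqI[OF B cv(1)[OF O1_closed(2)[OF B P u]] gv(2)[OF P cv(1)[OF u]]])
       (simp add: cv(2)[OF O1_closed(2)[OF B P u]] gv(4)[OF P cv(1)[OF u]] cv(2)[OF u] form_value_ops(2)[OF D _ P u])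
qed

lemma contraction_linear:
  assumes D: "D \<in> carrier Der" and E: "E \<in> carrier Der" and P: "P \<in> carrier (O0 B)"
  assumes DE: "D \<oplus>\<^bsub>Der\<^esub> E \<in> carrier Der" and PD: "P \<odot>\<^bsub>Der\<^esub> D \<in> carrier Der"
  shows "contraction B (D \<oplus>\<^bsub>Der\<^esub> E) = contraction B D \<oplus>\<^bsub>Dual\<^esub> contraction B E"
    "contraction B (P \<odot>\<^bsub>Der\<^esub> D) = P \<odot>\<^bsub>Dual\<^esub> contraction B D"
proof -
  note dD = derivation_moduleD[OF D] and dE = derivation_moduleD[OF E]
  have sel: "D \<oplus>\<^bsub>Der\<^esub> E = (\<lambda>f\<in>carrier (O0 B). D f \<oplus>\<^bsub>O0 B\<^esub> E f)" "P \<odot>\<^bsub>Der\<^esub> D = (\<lambda>f\<in>carrier (O0 B). P \<otimes>\<^bsub>O0 B\<^esub> D f)"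
    by (simp_all add: derivation_module_def)
  have va: "der_vec B (D \<oplus>\<^bsub>Der\<^esub> E) r \<sigma> = (\<lambda>f\<in>jet_funs B r. der_vec B D r \<sigma> f + der_vec B E r \<sigma> f)" if s: "\<sigma> \<in> jet_germs B" for r \<sigma>
    by (rule trans[OF der_vec_def], rule restrict_ext) (simp add: sel fcl_carrier[OF B] der_vec_def gv(3)[OF dD(2) dE(2) s])
  have vs: "der_vec B (P \<odot>\<^bsub>Der\<^esub> D) r \<sigma> = (\<lambda>f\<in>jet_funs B r. germ_value B P \<sigma> * der_vec B D r \<sigma> f)" if s: "\<sigma> \<in> jet_germs B" for r \<sigma>
    by (rule trans[OF der_vec_def], rule restrict_ext) (simp add: sel fcl_carrier[OF B] der_vec_def gv(4)[OF P dD(2) s])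
  have fa: "form_value B (D \<oplus>\<^bsub>Der\<^esub> E) u \<sigma> = form_value B D u \<sigma> + form_value B E u \<sigma>"
    and fs: "form_value B (P \<odot>\<^bsub>Der\<^esub> D) u \<sigma> = germ_value B P \<sigma> * form_value B D u \<sigma>"
    if s: "\<sigma> \<in> jet_germs B" and u: "u \<in> carrier (O1 B)" for u \<sigma>
  proof -
    obtain r \<omega> where c: "\<omega> \<in> jet_forms B r" "u = ocl B r \<omega>" using u by (rule O1_cases[OF B])
    note cot = cotD[OF MJ one_form_cot[OF MJ c(1) jet_at_points[OF B s]]]
    show "form_value B (D \<oplus>\<^bsub>Der\<^esub> E) u \<sigma> = form_value B D u \<sigma> + form_value B E u \<sigma>"
      unfolding c(2) form_value_class[OF B D c(1) s] form_value_class[OF B E c(1) s] form_value_class[OF B DE c(1) s] va[OF s]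
      by (rule cot(1)[OF der_vec_tangent[OF B D s] der_vec_tangent[OF B E s]])
    show "form_value B (P \<odot>\<^bsub>Der\<^esub> D) u \<sigma> = germ_value B P \<sigma> * form_value B D u \<sigma>"
      unfolding c(2) form_value_class[OF B D c(1) s] form_value_class[OF B PD c(1) s] vs[OF s]
      by (rule cot(2)[OF der_vec_tangent[OF B D s] der_vec_tangent[OF B D s]])
  qed
  note cD = contraction_value[OF D] and cE = contraction_value[OF E] and cDE = contraction_value[OF DE] and cPD = contraction_value[OF PD]
  have sel': "contraction B D \<oplus>\<^bsub>Dual\<^esub> contraction B E = (\<lambda>u\<in>carrier (O1 B). contraction B D u \<oplus>\<^bsub>O0 B\<^esub> contraction B E u)"
    "P \<odot>\<^bsub>Dual\<^esub> contraction B D = (\<lambda>u\<in>carrier (O1 B). P \<otimes>\<^bsub>O0 B\<^esub> contraction B D u)"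
    by (simp_all add: dual_module_def)
  show "contraction B (D \<oplus>\<^bsub>Der\<^esub> E) = contraction B D \<oplus>\<^bsub>Dual\<^esub> contraction B E"
    unfolding sel'
  proof (rule extensionalityI[of _ "carrier (O1 B)"])
    fix u assume u: "u \<in> carrier (O1 B)"
    have "contraction B (D \<oplus>\<^bsub>Der\<^esub> E) u = contraction B D u \<oplus>\<^bsub>O0 B\<^esub> contraction B E u"
      by (rule O0_eqI[OF B cDE(1)[OF u] gv(1)[OF cD(1)[OF u] cE(1)[OF u]]])
         (simp add: cDE(2)[OF u] gv(3)[OF cD(1)[OF u] cE(1)[OF u]] cD(2)[OF u] cE(2)[OF u] fa[OF _ u])
    then show "contraction B (D \<oplus>\<^bsub>Der\<^esub> E) u = (\<lambda>u\<in>carrier (O1 B). contraction B D u \<oplus>\<^bsub>O0 B\<^esub> contraction B E u) u"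
      using u by simp
  qed (simp_all add: contraction_def)
  show "contraction B (P \<odot>\<^bsub>Der\<^esub> D) = P \<odot>\<^bsub>Dual\<^esub> contraction B D"
    unfolding sel'
  proof (rule extensionalityI[of _ "carrier (O1 B)"])
    fix u assume u: "u \<in> carrier (O1 B)"
    have "contraction B (P \<odot>\<^bsub>Der\<^esub> D) u = P \<otimes>\<^bsub>O0 B\<^esub> contraction B D u"
      by (rule O0_eqI[OF B cPD(1)[OF u] gv(2)[OF P cD(1)[OF u]]])
         (simp add: cPD(2)[OF u] gv(4)[OF P cD(1)[OF u]] cD(2)[OF u] fs[OF _ u])
    then show "contraction B (P \<odot>\<^bsub>Der\<^esub> D) u = (\<lambda>u\<in>carrier (O1 B). P \<otimes>\<^bsub>O0 B\<^esub> contraction B D u) u"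
      using u by simp
  qed (simp_all add: contraction_def)
qed

subsection \<open>From linear forms to derivations\<close>

text \<open>Pull-back commutes with the differential, so the latter passes to the direct limit.\<close>

lemma d_form_pull:
  assumes rt: "r \<le> t" and f: "f \<in> jet_funs B r"
  shows "form_pull B r t (d_form (jet_manifold B r) f) = d_form (jet_manifold B t) (fun_pull B r t f)"
proof (rule one_form_ext[OF MJ])
  show "form_pull B r t (d_form (jet_manifold B r) f) \<in> jet_forms B t"
    by (rule form_pull_forms[OF B rt d_form_one_form[OF MJ f]])
  show "d_form (jet_manifold B t) (fun_pull B r t f) \<in> jet_forms B t"
    by (rule d_form_one_form[OF MJ dl_maps(1)[OF FS' rt f]])
  fix j v assume j: "j \<in> points (jet_manifold B t)" and v: "v \<in> tangent_space (jet_manifold B t) j"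
  show "form_pull B r t (d_form (jet_manifold B r) f) j v = d_form (jet_manifold B t) (fun_pull B r t f) j v"
    using jet_proj_points[OF B rt j] jet_push_tangent[OF B rt j v] f
    by (simp add: form_pull_app[OF B j v] d_form_def j v) (simp add: pushforward_def fun_pull_def)
qed

lemma exterior_d_class:
  assumes f: "f \<in> jet_funs B r" shows "exterior_d B (fcl B r f) = ocl B r (d_form (jet_manifold B r) f)"
proof -
  define z where "z = (SOME z. z \<in> fcl B r f)"
  have "z \<in> fcl B r f" unfolding z_def by (rule someI[of "\<lambda>z. z \<in> fcl B r f", OF dl_class_self[OF FS' f]])
  then have "(fst z, snd z) \<in> fcl B r f" by simp
  then obtain t where zf: "snd z \<in> jet_funs B (fst z)" and t: "r \<le> t" "fst z \<le> t" "fun_pull B r t f = fun_pull B (fst z) t (snd z)"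
    unfolding dl_class_mem[OF FS'] by blast
  have "ocl B (fst z) (d_form (jet_manifold B (fst z)) (snd z)) = ocl B r (d_form (jet_manifold B r) f)"
    by (rule dl_class_eqI[OF OS' d_form_one_form[OF MJ zf] d_form_one_form[OF MJ f] t(2,1)])
       (simp add: d_form_pull[OF t(1) f] d_form_pull[OF t(2) zf] t(3))
  then show ?thesis by (simp add: exterior_d_def z_def[symmetric] Let_def)
qed

lemma exterior_d_carrier: "P \<in> carrier (O0 B) \<Longrightarrow> exterior_d B P \<in> carrier (O1 B)"
  by (erule O0_cases[OF B]) (simp add: exterior_d_class ocl_carrier[OF B d_form_one_form[OF MJ]])

lemma exterior_d_rules:
  assumes P: "P \<in> carrier (O0 B)" and Q: "Q \<in> carrier (O0 B)"
  shows "exterior_d B (P \<oplus>\<^bsub>O0 B\<^esub> Q) = exterior_d B P \<oplus>\<^bsub>O1 B\<^esub> exterior_d B Q"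
    "exterior_d B (P \<otimes>\<^bsub>O0 B\<^esub> Q) = (P \<odot>\<^bsub>O1 B\<^esub> exterior_d B Q) \<oplus>\<^bsub>O1 B\<^esub> (Q \<odot>\<^bsub>O1 B\<^esub> exterior_d B P)"
    "exterior_d B (O0_const B c \<otimes>\<^bsub>O0 B\<^esub> P) = O0_const B c \<odot>\<^bsub>O1 B\<^esub> exterior_d B P"
proof -
  obtain t f g where fg: "f \<in> jet_funs B t" "P = fcl B t f" "g \<in> jet_funs B t" "Q = fcl B t g" using P Q by (rule O0_common[OF B])
  let ?M = "jet_manifold B t"
  note a = sf_add[OF MJ fg(1,3)] and m = sf_mult[OF MJ fg(1,3)]
  note df = d_form_one_form[OF MJ fg(1)] and dg = d_form_one_form[OF MJ fg(3)]
  have 1: "d_form ?M (\<lambda>q\<in>points ?M. f q + g q) = form_add ?M (d_form ?M f) (d_form ?M g)"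
    unfolding d_form_def form_add_def by (intro restrict_ext) (simp add: tvD(1)[OF MJ _ fg(1,3)])
  have 2: "d_form ?M (\<lambda>q\<in>points ?M. f q * g q) = form_add ?M (form_smult ?M f (d_form ?M g)) (form_smult ?M g (d_form ?M f))"
    unfolding d_form_def form_add_def form_smult_def by (intro restrict_ext) (simp add: tvD(2)[OF MJ _ fg(1,3)])
  show "exterior_d B (P \<oplus>\<^bsub>O0 B\<^esub> Q) = exterior_d B P \<oplus>\<^bsub>O1 B\<^esub> exterior_d B Q"
    unfolding fg(2,4) O0_sel(2)[OF B fg(1,3)] exterior_d_class[OF a] exterior_d_class[OF fg(1)] exterior_d_class[OF fg(3)] 1
      O1_sel(2)[OF B df dg] ..
  show "exterior_d B (P \<otimes>\<^bsub>O0 B\<^esub> Q) = (P \<odot>\<^bsub>O1 B\<^esub> exterior_d B Q) \<oplus>\<^bsub>O1 B\<^esub> (Q \<odot>\<^bsub>O1 B\<^esub> exterior_d B P)"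
    unfolding fg(2,4) O0_sel(3)[OF B fg(1,3)] exterior_d_class[OF m] exterior_d_class[OF fg(1)] exterior_d_class[OF fg(3)] 2
      O1_sel(3)[OF B fg(1) dg] O1_sel(3)[OF B fg(3) df] O1_sel(2)[OF B form_smult_form[OF B fg(1) dg] form_smult_form[OF B fg(3) df]] ..
  let ?c = "\<lambda>q\<in>points ?M. c"
  have kc: "?c \<in> jet_funs B t" by (rule sf_const[OF MJ])
  have 3: "d_form ?M (\<lambda>q\<in>points ?M. ?c q * f q) = form_smult ?M ?c (d_form ?M f)"
  proof -
    have "(\<lambda>q\<in>points ?M. ?c q * f q) = (\<lambda>q\<in>points ?M. c * f q)" by (rule restrict_ext) simp
    then show ?thesis unfolding d_form_def form_smult_def by (intro restrict_ext) (simp add: tv_scale[OF MJ _ fg(1)])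
  qed
  show "exterior_d B (O0_const B c \<otimes>\<^bsub>O0 B\<^esub> P) = O0_const B c \<odot>\<^bsub>O1 B\<^esub> exterior_d B P"
    unfolding fg(2) O0_const_class[OF B, where c=c and t=t] O0_sel(3)[OF B kc fg(1)] exterior_d_class[OF sf_mult[OF MJ kc fg(1)]]
      exterior_d_class[OF fg(1)] 3 O1_sel(3)[OF B kc df] ..
qed

definition restrict_d where "restrict_d \<phi> = (\<lambda>P\<in>carrier (O0 B). \<phi> (exterior_d B P))"

lemma restrict_d_derivation:
  assumes \<phi>: "\<phi> \<in> carrier Dual" shows "restrict_d \<phi> \<in> carrier Der"
proof (rule derivation_moduleI)
  interpret cring "O0 B" by (rule O0_cring[OF B])
  note d = dual_moduleD[OF \<phi>] and e = exterior_d_carrier and r = exterior_d_rules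
  show "restrict_d \<phi> \<in> extensional (carrier (O0 B))" by (simp add: restrict_d_def)
  have cl: "\<phi> (exterior_d B P) \<in> carrier (O0 B)" if "P \<in> carrier (O0 B)" for P by (rule d(2)[OF e[OF that]])
  show "restrict_d \<phi> P \<in> carrier (O0 B)" if "P \<in> carrier (O0 B)" for P using cl[OF that] that by (simp add: restrict_d_def)
  show "restrict_d \<phi> (P \<oplus>\<^bsub>O0 B\<^esub> Q) = restrict_d \<phi> P \<oplus>\<^bsub>O0 B\<^esub> restrict_d \<phi> Q" if P: "P \<in> carrier (O0 B)" and Q: "Q \<in> carrier (O0 B)" for P Q
    using P Q by (simp add: restrict_d_def r(1)[OF P Q] d(3)[OF e[OF P] e[OF Q]])
  show "restrict_d \<phi> (P \<otimes>\<^bsub>O0 B\<^esub> Q) = restrict_d \<phi> P \<otimes>\<^bsub>O0 B\<^esub> Q \<oplus>\<^bsub>O0 B\<^esub> P \<otimes>\<^bsub>O0 B\<^esub> restrict_d \<phi> Q"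
    if P: "P \<in> carrier (O0 B)" and Q: "Q \<in> carrier (O0 B)" for P Q
  proof -
    have "restrict_d \<phi> (P \<otimes>\<^bsub>O0 B\<^esub> Q) = P \<otimes>\<^bsub>O0 B\<^esub> \<phi> (exterior_d B Q) \<oplus>\<^bsub>O0 B\<^esub> Q \<otimes>\<^bsub>O0 B\<^esub> \<phi> (exterior_d B P)"
      using P Q by (simp add: restrict_d_def r(2)[OF P Q] d(3)[OF O1_closed(2)[OF B P e[OF Q]] O1_closed(2)[OF B Q e[OF P]]]
          d(4)[OF P e[OF Q]] d(4)[OF Q e[OF P]])
    also have "\<dots> = \<phi> (exterior_d B P) \<otimes>\<^bsub>O0 B\<^esub> Q \<oplus>\<^bsub>O0 B\<^esub> P \<otimes>\<^bsub>O0 B\<^esub> \<phi> (exterior_d B Q)"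
      using P Q cl[OF P] cl[OF Q] by (simp add: a_comm m_comm)
    finally show ?thesis using P Q by (simp add: restrict_d_def)
  qed
  show "restrict_d \<phi> (O0_const B c \<otimes>\<^bsub>O0 B\<^esub> P) = O0_const B c \<otimes>\<^bsub>O0 B\<^esub> restrict_d \<phi> P" if P: "P \<in> carrier (O0 B)" for c P
    using P O0_const_carrier[OF B, of c] by (simp add: restrict_d_def r(3)[OF P P] d(4)[OF O0_const_carrier[OF B] e[OF P]])
qed

subsection \<open>The two maps are inverse to each other\<close>

lemma restrict_d_contraction:
  assumes D: "D \<in> carrier Der" shows "restrict_d (contraction B D) = D"
proof (rule extensionalityI[of _ "carrier (O0 B)"])
  note dD = derivation_moduleD[OF D]
  show "D \<in> extensional (carrier (O0 B))" by (rule dD(1))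
  fix P assume P: "P \<in> carrier (O0 B)"
  obtain r f where f: "f \<in> jet_funs B r" "P = fcl B r f" using P by (rule O0_cases[OF B])
  note e = exterior_d_carrier[OF P]
  have "contraction B D (exterior_d B P) = D P"
  proof (rule O0_eqI[OF B contraction_value(1)[OF D e] dD(2)[OF P]])
    fix \<sigma> assume s: "\<sigma> \<in> jet_germs B"
    have "form_value B D (exterior_d B P) \<sigma> = germ_value B (D P) \<sigma>"
      unfolding f(2) exterior_d_class[OF f(1)] form_value_class[OF B D d_form_one_form[OF MJ f(1)] s]
      using jet_at_points[OF B s] der_vec_tangent[OF B D s] f(1) by (simp add: d_form_def der_vec_def)
    then show "germ_value B (contraction B D (exterior_d B P)) \<sigma> = germ_value B (D P) \<sigma>"
      using contraction_value(2)[OF D e s] by simp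
  qed
  then show "restrict_d (contraction B D) P = D P" using P by (simp add: restrict_d_def)
qed (simp add: restrict_d_def)

text \<open>Linearity of \<open>\<phi>\<close> over the ring, evaluated at a germ.\<close>

lemma dual_sum_form:
  assumes \<phi>: "\<phi> \<in> carrier Dual" and s: "\<sigma> \<in> jet_germs B" and S: "finite S"
    and b: "\<And>i. i \<in> S \<Longrightarrow> b i \<in> jet_funs B r" and x: "\<And>i. i \<in> S \<Longrightarrow> x i \<in> jet_funs B r"
  shows "germ_value B (\<phi> (ocl B r (sum_form (jet_manifold B r) S b x))) \<sigma> =
    (\<Sum>i\<in>S. b i (jet_at B r \<sigma>) * germ_value B (\<phi> (ocl B r (d_form (jet_manifold B r) (x i)))) \<sigma>)"
  using S b x
proof (induction S)
  case empty
  let ?M = "jet_manifold B r"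
  let ?z = "\<lambda>q\<in>points ?M. 0::real" and ?s = "sum_form ?M {} b x"
  have z: "?z \<in> jet_funs B r" by (rule sf_const[OF MJ])
  have sf: "?s \<in> jet_forms B r" by (rule sum_form_one_form[OF MJ]) auto
  \<comment> \<open>The empty sum is the product of \<open>0\<close> with itself, so linearity makes its image vanish.\<close>
  have "form_smult ?M ?z ?s = ?s"
    unfolding form_smult_def sum_form_def[OF MJ] by (intro restrict_ext) simp
  then have "ocl B r ?s = fcl B r ?z \<odot>\<^bsub>O1 B\<^esub> ocl B r ?s" using O1_sel(3)[OF B z sf] by simp
  then have "\<phi> (ocl B r ?s) = fcl B r ?z \<otimes>\<^bsub>O0 B\<^esub> \<phi> (ocl B r ?s)"
    using dual_moduleD(4)[OF \<phi> fcl_carrier[OF B z] ocl_carrier[OF B sf]] by simp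
  then have "germ_value B (\<phi> (ocl B r ?s)) \<sigma> = 0 * germ_value B (\<phi> (ocl B r ?s)) \<sigma>"
    using gv(4)[OF fcl_carrier[OF B z] dual_moduleD(2)[OF \<phi> ocl_carrier[OF B sf]] s] germ_value_class[OF B z s] jet_at_points[OF B s, of r] by simp
  then show ?case by simp
next
  case (insert k S)
  let ?M = "jet_manifold B r"
  let ?d = "d_form ?M (x k)" and ?s = "sum_form ?M S b x"
  have bk: "b k \<in> jet_funs B r" and xk: "x k \<in> jet_funs B r" using insert.prems by auto
  have d: "?d \<in> jet_forms B r" by (rule d_form_one_form[OF MJ xk])
  have sf: "?s \<in> jet_forms B r" by (rule sum_form_one_form[OF MJ]) (use insert.prems in auto)
  have bd: "form_smult ?M (b k) ?d \<in> jet_forms B r" by (rule form_smult_form[OF B bk d])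
  have "sum_form ?M (insert k S) b x = form_add ?M (form_smult ?M (b k) ?d) ?s"
    unfolding form_add_def form_smult_def sum_form_def[OF MJ] d_form_def by (intro restrict_ext) (simp add: insert.hyps)
  then have "ocl B r (sum_form ?M (insert k S) b x) = (fcl B r (b k) \<odot>\<^bsub>O1 B\<^esub> ocl B r ?d) \<oplus>\<^bsub>O1 B\<^esub> ocl B r ?s"
    by (simp add: O1_sel(3)[OF B bk d] O1_sel(2)[OF B bd sf])
  then have e: "\<phi> (ocl B r (sum_form ?M (insert k S) b x)) = (fcl B r (b k) \<otimes>\<^bsub>O0 B\<^esub> \<phi> (ocl B r ?d)) \<oplus>\<^bsub>O0 B\<^esub> \<phi> (ocl B r ?s)"
    by (simp add: dual_moduleD(3)[OF \<phi> O1_closed(2)[OF B fcl_carrier[OF B bk] ocl_carrier[OF B d]] ocl_carrier[OF B sf]]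
        dual_moduleD(4)[OF \<phi> fcl_carrier[OF B bk] ocl_carrier[OF B d]])
  note c1 = dual_moduleD(2)[OF \<phi> ocl_carrier[OF B d]] and c2 = dual_moduleD(2)[OF \<phi> ocl_carrier[OF B sf]] and c3 = fcl_carrier[OF B bk]
  have IH: "germ_value B (\<phi> (ocl B r ?s)) \<sigma> = (\<Sum>i\<in>S. b i (jet_at B r \<sigma>) * germ_value B (\<phi> (ocl B r (d_form ?M (x i)))) \<sigma>)"
    by (rule insert.IH) (use insert.prems in auto)
  show ?case unfolding e gv(3)[OF gv(2)[OF c3 c1] c2 s] gv(4)[OF c3 c1 s] germ_value_class[OF B bk s] IH
    by (simp add: insert.hyps)
qed

text \<open>
  A linear form over the ring is local: multiplying the form \<open>\<omega>\<close> by a bump function at the jet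
  \<open>p\<close> of \<open>\<sigma>\<close> does not change the value of \<open>\<phi>\<close> at \<open>\<sigma>\<close>, and makes the local coframe expression of
  \<open>\<omega>\<close> a global identity.
\<close>

lemma contraction_restrict_d:
  assumes \<phi>: "\<phi> \<in> carrier Dual" shows "contraction B (restrict_d \<phi>) = \<phi>"
proof (rule extensionalityI[of _ "carrier (O1 B)"])
  let ?D = "restrict_d \<phi>"
  have D: "?D \<in> carrier Der" by (rule restrict_d_derivation[OF \<phi>])
  show "\<phi> \<in> extensional (carrier (O1 B))" by (rule dual_moduleD(1)[OF \<phi>])
  fix u assume u: "u \<in> carrier (O1 B)"
  obtain r \<omega> where \<omega>: "\<omega> \<in> jet_forms B r" "u = ocl B r \<omega>" using u by (rule O1_cases[OF B])
  let ?M = "jet_manifold B r"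
  show "contraction B ?D u = \<phi> u"
  proof (rule O0_eqI[OF B contraction_value(1)[OF D u] dual_moduleD(2)[OF \<phi> u]])
    fix \<sigma> assume s: "\<sigma> \<in> jet_germs B"
    define p where "p = jet_at B r \<sigma>"
    have p: "p \<in> points ?M" unfolding p_def by (rule jet_at_points[OF B s])
    obtain N x where N: "openin (mtop ?M) N" "p \<in> N" "\<And>i. i \<in> midx ?M \<Longrightarrow> x i \<in> jet_funs B r"
      "\<And>\<omega>. \<omega> \<in> jet_forms B r \<Longrightarrow> \<exists>a. (\<forall>i\<in>midx ?M. a i \<in> jet_funs B r) \<and>
        (\<forall>q\<in>N. \<forall>v\<in>tangent_space ?M q. \<omega> q v = (\<Sum>i\<in>midx ?M. a i q * v (x i)))"
      by (rule coframe[OF MJ p]) (rule that)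
    obtain a where a: "\<And>i. i \<in> midx ?M \<Longrightarrow> a i \<in> jet_funs B r"
      "\<And>q v. q \<in> N \<Longrightarrow> v \<in> tangent_space ?M q \<Longrightarrow> \<omega> q v = (\<Sum>i\<in>midx ?M. a i q * v (x i))"
      using N(4)[OF \<omega>(1)] by blast
    obtain U \<psi> where c: "(U, \<psi>) \<in> matlas ?M" "p \<in> U" using atlas_cover[OF MJ p] by blast
    obtain \<rho> N' K where \<rho>: "\<rho> \<in> jet_funs B r" "openin (mtop ?M) N'" "p \<in> N'" "N' \<subseteq> K" "K \<subseteq> U \<inter> N"
      "closedin (mtop ?M) K" "compactin (mtop ?M) K" "\<And>q. q \<in> N' \<Longrightarrow> \<rho> q = 1" "\<And>q. q \<in> points ?M - K \<Longrightarrow> \<rho> q = 0"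
      by (rule chart_bump[OF MJ c N(1,2)]) (rule that)
    \<comment> \<open>Outside of \<open>N\<close> both sides of the identity \<open>\<rho> \<omega> = \<Sum>\<^sub>i b\<^sub>i dx\<^sub>i\<close> vanish.\<close>
    define b where "b i = (\<lambda>q\<in>points ?M. \<rho> q * a i q)" for i
    have b: "b i \<in> jet_funs B r" if "i \<in> midx ?M" for i unfolding b_def by (rule sf_mult[OF MJ \<rho>(1) a(1)[OF that]])
    have bp: "b i p = a i p" for i using p \<rho>(3,8) by (simp add: b_def)
    have "form_smult ?M \<rho> \<omega> = sum_form ?M (midx ?M) b x"
      unfolding form_smult_def sum_form_def[OF MJ]
    proof (intro restrict_ext)
      fix q v assume q: "q \<in> points ?M" and v: "v \<in> tangent_space ?M q"
      show "\<rho> q * \<omega> q v = (\<Sum>i\<in>midx ?M. b i q * v (x i))"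
      proof (cases "q \<in> N")
        case True
        then show ?thesis using a(2)[OF True v] q by (simp add: b_def sum_distrib_left mult.assoc)
      next
        case False
        then have "\<rho> q = 0" using \<rho>(5,9) q by blast
        then show ?thesis using q by (simp add: b_def)
      qed
    qed
    then have e: "fcl B r \<rho> \<odot>\<^bsub>O1 B\<^esub> u = ocl B r (sum_form ?M (midx ?M) b x)" using O1_sel(3)[OF B \<rho>(1) \<omega>(1)] \<omega>(2) by simp
    have "germ_value B (\<phi> (fcl B r \<rho> \<odot>\<^bsub>O1 B\<^esub> u)) \<sigma> = germ_value B (\<phi> u) \<sigma>"
      using dual_moduleD(4)[OF \<phi> fcl_carrier[OF B \<rho>(1)] u] gv(4)[OF fcl_carrier[OF B \<rho>(1)] dual_moduleD(2)[OF \<phi> u] s]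
        germ_value_class[OF B \<rho>(1) s] \<rho>(8)[OF \<rho>(3)] by (simp add: p_def)
    then have "germ_value B (\<phi> u) \<sigma> = (\<Sum>i\<in>midx ?M. b i p * germ_value B (\<phi> (ocl B r (d_form ?M (x i)))) \<sigma>)"
      using dual_sum_form[OF \<phi> s midx_finite[OF MJ] b N(3)] unfolding e p_def by simp
    also have "\<dots> = (\<Sum>i\<in>midx ?M. a i p * der_vec B ?D r \<sigma> (x i))"
      by (rule sum.cong[OF refl])
         (simp add: bp der_vec_def N(3) restrict_d_def fcl_carrier[OF B] exterior_d_class)
    also have "\<dots> = \<omega> p (der_vec B ?D r \<sigma>)"
      using a(2)[OF N(2)] der_vec_tangent[OF B D s] by (simp add: p_def)
    also have "\<dots> = form_value B ?D u \<sigma>" using form_value_class[OF B D \<omega>(1) s] \<omega>(2) by (simp add: p_def)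
    finally show "germ_value B (contraction B ?D u) \<sigma> = germ_value B (\<phi> u) \<sigma>"
      using contraction_value(2)[OF D u s] by simp
  qed
qed (simp add: contraction_def)

lemma derivations_isomorphic_dual: "module_isomorphic (O0 B) Der Dual"
  unfolding module_isomorphic_def
proof (intro conjI exI ballI)
  show Dm: "Module.module (O0 B) Der" by (rule derivation_module_module[OF O0_cring[OF B] O0_const_carrier[OF B]])
  show "Module.module (O0 B) Dual" by (rule dual_module_module[OF O0_cring[OF B] O1_closed[OF B]])
  show "bij_betw (contraction B) (carrier Der) (carrier Dual)"
    by (rule bij_betw_byWitness[where f'=restrict_d])
       (use restrict_d_contraction contraction_restrict_d contraction_dual restrict_d_derivation in auto)
  interpret Dm: Module.module "O0 B" Der by (rule Dm)
  fix D assume D: "D \<in> carrier Der"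
  show "contraction B (D \<oplus>\<^bsub>Der\<^esub> E) = contraction B D \<oplus>\<^bsub>Dual\<^esub> contraction B E" if E: "E \<in> carrier Der" for E
    by (rule contraction_linear(1)[OF D E _ Dm.M.a_closed[OF D E] Dm.smult_closed[OF _ D]]) (rule Dm.R.one_closed)+
next
  have Dm: "Module.module (O0 B) Der" by (rule derivation_module_module[OF O0_cring[OF B] O0_const_carrier[OF B]])
  interpret Dm: Module.module "O0 B" Der by (rule Dm)
  fix P D assume P: "P \<in> carrier (O0 B)" and D: "D \<in> carrier Der"
  show "contraction B (P \<odot>\<^bsub>Der\<^esub> D) = P \<odot>\<^bsub>Dual\<^esub> contraction B D"
    by (rule contraction_linear(2)[OF D D P Dm.M.a_closed[OF D D] Dm.smult_closed[OF P D]])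
qed

end

theorem proposition3p1:
  fixes B :: "('x, 'i, 'y, 'j, 'v, 'k) fbundle"
  assumes "smooth_fiber_bundle B"
  shows "module_isomorphic (O0 B) (derivation_module (O0 B) (O0_const B)) (dual_module (O0 B) (O1 B))"
  using assms by (rule derivations_isomorphic_dual)

end
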